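(* Consider the system $$\frac{dx}{dt}=f(x)+\gamma g(x,\beta t,\alpha t),\qquad x\in\mathbb{R}^n, \qquad (\ast)$$ under the setting described in the context, and suppose that $$\frac{1}{2\pi}\int_0^{2\pi}g(x,\psi,\varphi)\,d\varphi=0\quad\mbox{for all }x\in\mathbb{R}^n,\ \psi\in\mathbb{R}$$ and that all critical points of $G_2$ are non-degenerate. For any $\epsilon>0$ and $\epsilon_1>0$ there exist positive $\alpha_1,c_1,c_2$ and $\delta$ such that for all parameters $(\alpha,\beta,\gamma)$ satisfying $$\alpha\ge\alpha_1,\quad \frac{c_1}{\alpha}\le\gamma\le c_2\sqrt\alpha,\quad \frac{\gamma^2}{\alpha}G_2^-<\beta-\beta_0<\frac{\gamma^2}{\alpha}G_2^+,\quad \mathrm{dist}\left(\frac{\alpha}{\gamma^2}(\beta-\beta_0),S_2\right)\ge\epsilon$$ and for any solution $x(t)$ of system $(\ast)$ such that $\mathrm{dist}(x(t_0),\mathcal{T}_2)<\delta$ for a certain $t_0\in\mathbb{R}$, there exist $\sigma,T\in\mathbb{R}$ such that $$\inf_{\phi}\|x(t)-e^{A\phi}x_0(\beta t+\sigma)\|<\epsilon_1\quad\mbox{for all } t>T.$$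
   Context: Setting. $f:\mathbb{R}^n\to\mathbb{R}^n$ and $g:\mathbb{R}^n\times\mathbb{R}^2\to\mathbb{R}^n$ are $C^l$-smooth with $l>3$; $\alpha>0$, $\beta>0$, $\gamma\ge0$ are real parameters. $A$ is a non-zero real $n\times n$ matrix with $A^T=-A$ and $e^{2\pi A}=I$. For all $x\in\mathbb{R}^n$, $\xi,\psi,\varphi\in\mathbb{R}$: $f(e^{A\xi}x)=e^{A\xi}f(x)$; $g(x,\psi+2\pi,\varphi)=g(x,\psi,\varphi)=g(x,\psi,\varphi+2\pi)$; $g(e^{A\xi}x,\psi,\varphi+\xi)=e^{A\xi}g(x,\psi,\varphi)$. The unperturbed system $dx/dt=f(x)$ has an exponentially orbitally stable quasiperiodic solution $x(t)=e^{A\alpha_0t}x_0(\beta_0t)$, where $x_0:\mathbb{R}\to\mathbb{R}^n$ is $2\pi$-periodic and $\alpha_0>0$, $\beta_0>0$. The vectors $Ax_0(\psi)$ and $\frac{dx_0}{d\psi}(\psi)$ are linearly independent. The set $\mathcal{T}_2:=\{e^{A\varphi}x_0(\psi):\varphi,\psi\in\mathbb{R}\}\subset\mathbb{R}^n$ is a two-dimensional torus invariant under the unperturbed flow. The linear system $\beta_0\frac{dy}{d\psi}=(f'(x_0(\psi))-\alpha_0A)y$ has the two linearly independent $2\pi$-periodic solutions $q_1=\frac{dx_0}{d\psi}$, $q_2=Ax_0$. Exponential orbital stability means that the Floquet multiplier $1$ of this system has multiplicity two and all other multipliers have absolute value less than one. Let $p_1,p_2$ be the $2\pi$-periodic solutions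 of the adjoint system $\beta_0\frac{dz}{d\psi}=-(f'(x_0(\psi))^T+\alpha_0A)z$ with $p_j^T(\psi)q_k(\psi)=\delta_{jk}$ for $j,k=1,2$ and all $\psi$. Let $u_1(x,\psi,\varphi)$ be the antiderivative of $g(x,\psi,\varphi)$ with respect to $\varphi$ (so $\partial u_1/\partial\varphi=g$) satisfying $\int_0^{2\pi}u_1(x,\psi,\varphi)\,d\varphi=0$. Define $$g_2(x,\psi):=-\frac1{2\pi}\int_0^{2\pi}\frac{\partial u_1}{\partial x}(x,\psi,\varphi)\,g(x,\psi,\varphi)\,d\varphi,\qquad G_2(\psi):=\frac1{2\pi}\int_0^{2\pi}p_1^T(\psi+\theta)g_2(x_0(\psi+\theta),\theta)\,d\theta,$$ $G_2^+:=\max_{[0,2\pi]}G_2$, $G_2^-:=\min_{[0,2\pi]}G_2$. Non-degeneracy of the critical points of $G_2$ means $G_2''(\psi)\ne0$ whenever $G_2'(\psi)=0$. $S_2:=\{G_2(\psi):\psi\in[0,2\pi),\ G_2'(\psi)=0\}$ is the (finite) set of singular values of $G_2$. *)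

theory Defs
  imports "HOL-Analysis.Analysis" "HOL-Computational_Algebra.Polynomial"
begin

(* Smoothness of class C^k on the whole space. In finite dimensions, continuity of all iterated
   directional derivatives is continuity of the iterated Frechet derivatives. *)
primrec C_k :: "nat \<Rightarrow> ('a::euclidean_space \<Rightarrow> 'b::euclidean_space) \<Rightarrow> bool" where
  "C_k 0 f \<longleftrightarrow> continuous_on UNIV f"
| "C_k (Suc k) f \<longleftrightarrow>
     (\<forall>x. f differentiable (at x)) \<and> (\<forall>v. C_k k (\<lambda>x. frechet_derivative f (at x) v))"

(* The class instance times on real^'n^'n is entrywise, so neither the power operation nor exp
   of the library is the matrix one. *)
definition mat_exp :: "real^'n^'n \<Rightarrow> real^'n^'n" where
  "mat_exp M = (\<Sum>k. (1 / fact k) *\<^sub>R ((\<lambda>B. M ** B) ^^ k) (mat 1))"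

definition solves_ode_on ::
  "(real \<Rightarrow> 'a \<Rightarrow> 'a::real_normed_vector) \<Rightarrow> real set \<Rightarrow> (real \<Rightarrow> 'a) \<Rightarrow> bool" where
  "solves_ode_on F J x \<longleftrightarrow> (\<forall>t\<in>J. (x has_vector_derivative F t (x t)) (at t))"

(* J is the maximal open interval of existence; x is irrelevant outside J. *)
definition maximal_solution ::
  "(real \<Rightarrow> 'a \<Rightarrow> 'a::real_normed_vector) \<Rightarrow> real set \<Rightarrow> (real \<Rightarrow> 'a) \<Rightarrow> bool" where
  "maximal_solution F J x \<longleftrightarrow>
     open J \<and> is_interval J \<and> J \<noteq> {} \<and> solves_ode_on F J x \<and>
     (\<forall>K y. open K \<and> is_interval K \<and> J \<subseteq> K \<and> solves_ode_on F K y \<and> (\<forall>t\<in>J. y t = x t) \<longrightarrow> K = J)"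

definition cmplx_charpoly :: "real^'n^'n \<Rightarrow> complex poly" where
  "cmplx_charpoly M =
     det (\<chi> i j. (if i = j then [:0, 1:] else 0) - [:complex_of_real (M $ i $ j):])"

(* For the p-periodic linear system y' = C(s) y, with Y its fundamental matrix normalised by
   Y(0) = I, the Floquet multipliers are the eigenvalues of the monodromy matrix Y(p), counted
   with algebraic multiplicity. *)
definition multiplier_one_double_others_stable ::
  "(real \<Rightarrow> real^'n^'n) \<Rightarrow> real \<Rightarrow> bool" where
  "multiplier_one_double_others_stable C p \<longleftrightarrow>
     (\<exists>Y. Y 0 = mat 1 \<and> solves_ode_on (\<lambda>s Z. C s ** Z) UNIV Y \<and>
          order 1 (cmplx_charpoly (Y p)) = 2 \<and>
          (\<forall>\<mu>. poly (cmplx_charpoly (Y p)) \<mu> = 0 \<longrightarrow> \<mu> = 1 \<or> cmod \<mu> < 1))"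

definition torus_of :: "real^'n^'n \<Rightarrow> (real \<Rightarrow> real^'n) \<Rightarrow> (real^'n) set" where
  "torus_of A x\<^sub>0 = {mat_exp (\<phi> *\<^sub>R A) *v x\<^sub>0 \<psi> | \<phi> \<psi>. True}"

definition g2_of ::
  "(real^'n \<Rightarrow> real \<Rightarrow> real \<Rightarrow> real^'n) \<Rightarrow> (real^'n \<Rightarrow> real \<Rightarrow> real \<Rightarrow> real^'n) \<Rightarrow>
   real^'n \<Rightarrow> real \<Rightarrow> real^'n" where
  "g2_of u g x \<psi> =
     - ((1 / (2 * pi)) *\<^sub>R
        integral {0..2 * pi} (\<lambda>\<phi>. jacobian (\<lambda>y. u y \<psi> \<phi>) (at x) *v g x \<psi> \<phi>))"

definition G2_of ::
  "(real \<Rightarrow> real^'n) \<Rightarrow> (real \<Rightarrow> real^'n) \<Rightarrow> (real^'n \<Rightarrow> real \<Rightarrow> real^'n) \<Rightarrow> real \<Rightarrow> real" where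
  "G2_of p x\<^sub>0 h \<psi> =
     1 / (2 * pi) * integral {0..2 * pi} (\<lambda>\<theta>. p (\<psi> + \<theta>) \<bullet> h (x\<^sub>0 (\<psi> + \<theta>)) \<theta>)"

definition singular_values :: "(real \<Rightarrow> real) \<Rightarrow> real set" where
  "singular_values G = {G \<psi> | \<psi>. \<psi> \<in> {0..<2 * pi} \<and> deriv G \<psi> = 0}"

end

theory Submission
  imports Defs "HOL-Computational_Algebra.Fundamental_Theorem_Algebra"
begin

text \<open>
  In the frame rotating with frequency \<open>\<alpha>\<^sub>0\<close> the system reads \<open>y' = f(y) - \<alpha>\<^sub>0 A y + \<gamma> g(y, \<beta> t, \<omega> t)\<close> with
  \<open>\<omega> = \<alpha> - \<alpha>\<^sub>0\<close>, and \<open>h = y - (\<gamma> / \<omega>) u\<^sub>1(y) - x\<^sub>0\<close> feels the perturbation only through its averaged effect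
  \<open>\<rho> g\<^sub>2\<close>, \<open>\<rho> = \<gamma>\<^sup>2 / \<omega>\<close>, and terms that are smaller. The solution is sampled after a fixed number of unperturbed periods.
  At each sample both phases of the reference point on the torus are readjusted so that the components of \<open>h\<close> along
  the torus become quadratically small. The transversal part of \<open>h\<close> is halved by the linearized flow, hence
  eventually \<open>h = O(\<rho>)\<close>, while the slow phase \<open>\<sigma> = \<psi> - \<beta> t\<close> obeys
  \<open>\<sigma>\<^bsub>k+1\<^esub> = \<sigma>\<^bsub>k\<^esub> + \<rho> \<tau> (G\<^sub>2(\<sigma>\<^bsub>k\<^esub>) - \<kappa> + o(1))\<close> with \<open>\<kappa> = (\<beta> - \<beta>\<^sub>0) / \<rho>\<close>. As \<open>\<kappa>\<close> lies strictly between the extrema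
  of \<open>G\<^sub>2\<close>, this slow motion is bounded and gets trapped in an arbitrarily short interval.
\<close>

subsection \<open>Differential inequalities and continuation of solutions\<close>

text \<open>Two obstacles shape the estimates. Once h is of order \<rho>, a component of h along the
  torus would shift the phase by O(\<rho>) per sample, as much as the drift that is to be detected.
  The readjustment at the preceding sample makes p1 . h of order \<rho> squared, so that G2 -
  \<kappa> dominates. The transformation leaves a term of order a = \<gamma> / \<omega>, and a /
  \<rho> = 1 / \<gamma> may be large. This term has mean zero in the fast phase, so over a bounded
  time it contributes O(a / \<omega>), that is \<rho> times O(1 / (\<gamma> \<omega>)). The bound
  \<gamma> >= c1 / \<alpha> makes this small against \<rho>, while \<gamma> <= c2 sqrt \<alpha>
  makes \<rho> itself small; a second change of variables is avoided. A window of whole periods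
  returns the reference orbit to its initial phase, and taking many of them gives contraction in the
  Euclidean norm without an adapted norm. The extreme values of G2 are themselves singular values,
  hence the distance condition keeps \<kappa> at least \<epsilon> away from them. Non-degeneracy
  enters through the fact that G2 is constant on no interval.\<close>

lemma vector_derivative_imp_continuous_on:
  assumes "\<And>s. (z has_vector_derivative z' s) (at s)"
  shows "continuous_on T z"
  by (rule continuous_at_imp_continuous_on, rule ballI, rule has_vector_derivative_continuous[OF assms])

text \<open>The right-hand side I satisfies I' = L w <= L I, so I(s) exp(-L s) cannot
  increase.\<close>

lemma gronwall_integral:
  fixes w :: "real \<Rightarrow> real"
  assumes cont: "continuous_on {0..S} w" and L: "L \<ge> 0"
    and le: "\<And>s. s \<in> {0..S} \<Longrightarrow> w s \<le> a + L * integral {0..s} w"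
    and s: "s \<in> {0..S}"
  shows "w s \<le> a * exp (L * s)"
proof -
  define I where "I = (\<lambda>s. a + L * integral {0..s} w)"
  have dI: "(I has_vector_derivative L * w r) (at r within {0..S})" if "r \<in> {0..S}" for r
    unfolding I_def using integral_has_vector_derivative[OF cont that]
    by (auto intro!: derivative_eq_intros)
  define J where "J = (\<lambda>s. I s * exp (- L * s))"
  have contI: "continuous_on {0..S} I"
    unfolding continuous_on_eq_continuous_within
    using dI has_vector_derivative_continuous by blast
  have "J s \<le> J 0"
  proof (rule DERIV_nonpos_imp_decreasing_open[where f = J])
    show "0 \<le> s" using s by auto
    show "continuous_on {0..s} J" unfolding J_def
      using s by (intro continuous_intros continuous_on_subset[OF contI]) auto
    fix r assume r: "0 < r" "r < s"
    have "(I has_vector_derivative L * w r) (at r within {0<..<S})"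
      by (rule has_vector_derivative_within_subset[OF dI]) (use r s in auto)
    then have "(I has_vector_derivative L * w r) (at r)"
      using r s at_within_open[of r "{0<..<S}"] by auto
    then have "(I has_real_derivative L * w r) (at r)"
      by (simp add: has_real_derivative_iff_has_vector_derivative)
    then have "(J has_real_derivative (L * w r) * exp (- L * r) + I r * (exp (-L * r) * (- L))) (at r)"
      unfolding J_def by (auto intro!: derivative_eq_intros)
    moreover have "(L * w r) * exp (- L * r) + I r * (exp (-L * r) * (- L)) \<le> 0"
    proof -
      have "w r \<le> I r" unfolding I_def using le[of r] r s by auto
      then have "L * w r * exp (- L * r) \<le> L * I r * exp (- L * r)"
        using L by (intro mult_right_mono mult_left_mono) auto
      then show ?thesis by (simp add: algebra_simps)
    qed
    ultimately show "\<exists>y. DERIV J r :> y \<and> y \<le> 0" by blast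
  qed
  then have "I s * exp (- L * s) \<le> a" by (simp add: J_def I_def)
  then have "I s \<le> a * exp (L * s)" by (simp add: exp_minus field_simps)
  then show ?thesis using le[OF s] unfolding I_def by linarith
qed

text \<open>Integration of e' reduces this to the scalar inequality. The forcing \<open>b\<close> is
  charged over the whole window, which costs only a constant since the windows have bounded
  length.\<close>

lemma gronwall_norm:
  fixes e :: "real \<Rightarrow> 'a::euclidean_space"
  assumes der: "\<And>s. s \<in> {0..S} \<Longrightarrow> (e has_vector_derivative e' s) (at s within {0..S})"
    and le: "\<And>s. s \<in> {0..S} \<Longrightarrow> norm (e' s) \<le> L * norm (e s) + b"
    and L: "L \<ge> 0" and b: "b \<ge> 0" and s: "s \<in> {0..S}"
  shows "norm (e s) \<le> (norm (e 0) + b * S) * exp (L * s)"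
proof -
  have cont: "continuous_on {0..S} e"
    unfolding continuous_on_eq_continuous_within
    using der has_vector_derivative_continuous by blast
  show ?thesis
  proof (rule gronwall_integral[OF _ L _ s])
    show "continuous_on {0..S} (\<lambda>s. norm (e s))" using cont by (intro continuous_intros)
    fix r assume r: "r \<in> {0..S}"
    have hi: "(e' has_integral e r - e 0) {0..r}"
      by (rule fundamental_theorem_of_calculus)
        (use r in \<open>auto intro!: has_vector_derivative_within_subset[OF der]\<close>)
    have c': "continuous_on {0..r} (\<lambda>s. norm (e s))"
      using cont r by (intro continuous_intros continuous_on_subset[OF cont]) auto
    have "norm (e r - e 0) = norm (integral {0..r} e')" using hi by (simp add: integral_unique)
    also have "\<dots> \<le> integral {0..r} (\<lambda>s. L * norm (e s) + b)"
      using hi r le c' by (intro integral_norm_bound_integral has_integral_integrable[OF hi])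
        (auto intro!: integrable_continuous_real continuous_intros)
    also have "\<dots> = L * integral {0..r} (\<lambda>s. norm (e s)) + b * r"
      using r c' by (subst integral_add) (auto intro!: integrable_continuous_real continuous_intros)
    also have "\<dots> \<le> L * integral {0..r} (\<lambda>s. norm (e s)) + b * S"
      using r b by (auto intro: mult_left_mono)
    finally show "norm (e r) \<le> norm (e 0) + b * S + L * integral {0..r} (\<lambda>s. norm (e s))"
      using norm_triangle_sub[of "e r" "e 0"] by simp
  qed
qed

text \<open>Continuity argument: at the first time with d = B, \<open>step\<close> applies to the
  whole interval before it and gives d <= b < B. It turns the a priori assumption of the averaging
  estimates, distance at most 1 from the orbit, into a consequence, distance at most 1/2.\<close>

lemma bootstrap_bound:
  fixes d :: "real \<Rightarrow> real"
  assumes cont: "continuous_on {0..S} d"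
    and step: "\<And>s. s \<in> {0..S} \<Longrightarrow> (\<And>r. r \<in> {0..s} \<Longrightarrow> d r \<le> B) \<Longrightarrow> d s \<le> b"
    and bB: "b < B" and d0: "d 0 \<le> b" and s: "s \<in> {0..S}"
  shows "d s \<le> b"
proof -
  define Z where "Z = {s \<in> {0..S}. d s \<ge> B}"
  have "Z = {}"
  proof (rule ccontr)
    assume ne: "Z \<noteq> {}"
    have "closed Z" unfolding Z_def
      using continuous_closed_preimage[OF cont, of "{B..}"] by (auto simp: vimage_def Int_def)
    moreover have "bounded Z" unfolding Z_def by (rule bounded_subset[of "{0..S}"]) auto
    ultimately have "compact Z" by (simp add: compact_eq_bounded_closed)
    then obtain s0 where s0: "s0 \<in> Z" "\<And>r. r \<in> Z \<Longrightarrow> s0 \<le> r"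
      using compact_attains_inf[of Z] ne by auto
    have s0S: "s0 \<in> {0..S}" "d s0 \<ge> B" using s0 by (auto simp: Z_def)
    have "\<exists>x\<ge>0. x \<le> s0 \<and> d x = B"
      by (rule IVT') (use s0S d0 bB in \<open>auto intro: continuous_on_subset[OF cont]\<close>)
    then obtain r where r: "0 \<le> r" "r \<le> s0" "d r = B" by auto
    then have "r \<in> Z" using s0S by (auto simp: Z_def)
    then have "r = s0" using s0(2)[of r] r by auto
    then have "d t \<le> B" if "t \<in> {0..s0}" for t
      using s0(2)[of t] that s0S r by (cases "t = s0") (force simp: Z_def)+
    then have "d s0 \<le> b" using step[OF s0S(1)] by blast
    then show False using s0S bB by auto
  qed
  then have "d r \<le> B" if "r \<in> {0..S}" for r using that by (force simp: Z_def)
  then show ?thesis using step[OF s] s by auto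
qed

section \<open>Local existence and continuation of bounded solutions\<close>

lemma picard_local:
  fixes F :: "real \<Rightarrow> 'a::euclidean_space \<Rightarrow> 'a"
  assumes cont: "continuous_on UNIV (\<lambda>(t, y). F t y)"
    and lip: "\<And>t y z. t \<in> {b..b+1} \<Longrightarrow> y \<in> cball xb 1 \<Longrightarrow> z \<in> cball xb 1 \<Longrightarrow>
      norm (F t y - F t z) \<le> L * norm (y - z)"
  shows "\<exists>h>0. \<exists>y. y b = xb \<and>
    (\<forall>t\<in>{b..b+h}. (y has_vector_derivative F t (y t)) (at t within {b..b+h}))"
proof -
  \<comment> \<open>The Lipschitz bound holds only on the unit ball about \<open>xb\<close>.
    Composing the field with the nearest-point map and clamping time by \<open>c\<close> below gives
    a Picard map on all bounded continuous functions. Its fixed point turns out to stay in the ball,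
    where nothing has been changed.\<close>
  define p where "p = closest_point (cball xb 1)"
  have p_in: "p y \<in> cball xb 1" for y
    unfolding p_def by (rule closest_point_in_set) auto
  have p_id: "p y = y" if "y \<in> cball xb 1" for y
    unfolding p_def by (rule closest_point_self[OF that])
  have p_lip: "dist (p y) (p z) \<le> dist y z" for y z
    unfolding p_def by (rule closest_point_lipschitz) auto
  have p_cont: "continuous_on T p" for T
    unfolding p_def by (rule continuous_on_closest_point) auto
  have "compact ((\<lambda>(t, y). F t y) ` ({b..b+1} \<times> cball xb 1))"
    by (intro compact_continuous_image continuous_on_subset[OF cont] compact_Times) auto
  then have "bounded ((\<lambda>(t, y). F t y) ` ({b..b+1} \<times> cball xb 1))" by (rule compact_imp_bounded)
  then obtain M where "\<forall>z\<in>(\<lambda>(t, y). F t y) ` ({b..b+1} \<times> cball xb 1). norm z \<le> M"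
    unfolding bounded_iff by blast
  then have M: "norm (F t y) \<le> M" if "t \<in> {b..b+1}" "y \<in> cball xb 1" for t y
    using that by (auto simp: image_iff)
  have M0: "M \<ge> 0" using order_trans[OF norm_ge_zero M[of b xb]] by auto
  define L' where "L' = max L 0"
  have lip': "norm (F t (p y) - F t (p z)) \<le> L' * norm (y - z)" if "t \<in> {b..b+1}" for t y z
  proof -
    have "norm (F t (p y) - F t (p z)) \<le> L * norm (p y - p z)" by (rule lip[OF that p_in p_in])
    also have "\<dots> \<le> L' * norm (y - z)"
      using p_lip[of y z] by (intro mult_mono) (auto simp: L'_def dist_norm)
    finally show ?thesis .
  qed
  \<comment> \<open>\<open>h * L' \<le> 1/2\<close> makes the Picard map a contraction, and
    \<open>h * M \<le> 1\<close> keeps its fixed point in the unit ball.\<close>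
  define h where "h = 1 / (2 * (L' + M + 1))"
  have L0: "L' \<ge> 0" by (simp add: L'_def)
  have h0: "h > 0" using L0 M0 by (simp add: h_def)
  have h1: "h \<le> 1" "h * L' \<le> 1/2" "h * M \<le> 1" using L0 M0 by (simp_all add: h_def field_simps)
  define c where "c = (\<lambda>t::real. max b (min t (b + h)))"
  have c_in: "c t \<in> {b..b+h}" for t using h0 by (auto simp: c_def)
  have c_id: "c t = t" if "t \<in> {b..b+h}" for t using that by (auto simp: c_def)
  have c_cont: "continuous_on T c" for T unfolding c_def by (intro continuous_intros)
  have cF: "continuous_on {b..b+h} (\<lambda>s. F s (p (apply_bcontfun y s)))" for y
    by (rule continuous_on_compose2[OF cont, of _ "\<lambda>s. (s, p (apply_bcontfun y s))", simplified])
      (intro continuous_intros continuous_on_compose2[OF p_cont[of UNIV]]; simp)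
  define T where "T = (\<lambda>y t. xb + integral {b..c t} (\<lambda>s. F s (p (apply_bcontfun y s))))"
  have int: "(\<lambda>s. F s (p (apply_bcontfun y s))) integrable_on {b..c t}" for y t
    using c_in[of t] by (intro integrable_continuous_real continuous_on_subset[OF cF]) auto
  have Tb: "T y \<in> bcontfun" for y
  proof (rule bcontfun_normI)
    have "continuous_on {b..b+h} (\<lambda>t. integral {b..t} (\<lambda>s. F s (p (apply_bcontfun y s))))"
      by (intro indefinite_integral_continuous_1 integrable_continuous_real cF)
    then have "continuous_on UNIV (\<lambda>t. integral {b..c t} (\<lambda>s. F s (p (apply_bcontfun y s))))"
      by (rule continuous_on_compose2[OF _ c_cont]) (use c_in in auto)
    then show "continuous_on UNIV (T y)" unfolding T_def by (intro continuous_intros)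
    fix t
    have "norm (integral {b..c t} (\<lambda>s. F s (p (apply_bcontfun y s)))) \<le> M * (c t - b)"
      using c_in[of t] h1 p_in by (intro integral_bound continuous_on_subset[OF cF] M) auto
    also have "\<dots> \<le> M * h" using c_in[of t] M0 by (intro mult_left_mono) auto
    finally show "norm (T y t) \<le> norm xb + M * h"
      unfolding T_def by (intro norm_triangle_le) linarith
  qed
  have "\<exists>!y. Bcontfun (T y) = y"
  proof (rule banach_fix_type[of "1/2"], simp, simp, intro allI)
    fix y z
    show "dist (Bcontfun (T y)) (Bcontfun (T z)) \<le> 1 / 2 * dist y z"
    proof (rule dist_bound)
      fix t
      have "norm (integral {b..c t} (\<lambda>s. F s (p (apply_bcontfun y s))) - integral {b..c t} (\<lambda>s. F s (p (apply_bcontfun z s))))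
        = norm (integral {b..c t} (\<lambda>s. F s (p (apply_bcontfun y s)) - F s (p (apply_bcontfun z s))))"
        by (subst integral_diff[OF int int]) simp
      also have "\<dots> \<le> (L' * dist y z) * (c t - b)"
      proof (rule integral_bound)
        show "b \<le> c t" using c_in[of t] by auto
        show "continuous_on {b..c t} (\<lambda>s. F s (p (apply_bcontfun y s)) - F s (p (apply_bcontfun z s)))"
          using c_in[of t] by (intro continuous_intros continuous_on_subset[OF cF]) auto
        fix s assume "s \<in> {b..c t}"
        then have "s \<in> {b..b+1}" using c_in[of t] h1 by auto
        then have "norm (F s (p (apply_bcontfun y s)) - F s (p (apply_bcontfun z s))) \<le> L' * norm (apply_bcontfun y s - apply_bcontfun z s)"
          by (rule lip')
        also have "\<dots> \<le> L' * dist y z"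
          using dist_bounded[of y s z] L0 by (intro mult_left_mono) (auto simp: dist_norm)
        finally show "norm (F s (p (apply_bcontfun y s)) - F s (p (apply_bcontfun z s))) \<le> L' * dist y z" .
      qed
      also have "\<dots> \<le> (L' * dist y z) * h" using c_in[of t] L0 by (intro mult_left_mono) auto
      also have "\<dots> = (h * L') * dist y z" by simp
      also have "\<dots> \<le> 1/2 * dist y z" by (rule mult_right_mono[OF h1(2)]) simp
      finally show "dist (apply_bcontfun (Bcontfun (T y)) t) (apply_bcontfun (Bcontfun (T z)) t) \<le> 1/2 * dist y z"
        unfolding Bcontfun_inverse[OF Tb] by (simp add: T_def dist_norm)
    qed
  qed
  then obtain y where "Bcontfun (T y) = y" by auto
  then have y: "apply_bcontfun y t = T y t" for t using Bcontfun_inverse[OF Tb[of y]] by metis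
  have pin: "apply_bcontfun y t \<in> cball xb 1" if "t \<in> {b..b+h}" for t
  proof -
    have "norm (integral {b..t} (\<lambda>s. F s (p (apply_bcontfun y s)))) \<le> M * (t - b)"
      using that h1 p_in by (intro integral_bound continuous_on_subset[OF cF] M) auto
    also have "\<dots> \<le> M * h" using that M0 by (intro mult_left_mono) auto
    also have "\<dots> \<le> 1" using h1 by (simp add: mult.commute)
    finally show ?thesis unfolding y[of t] T_def using c_id[OF that] by (simp add: dist_norm)
  qed
  have D1: "((\<lambda>t. xb + integral {b..t} (\<lambda>s. F s (p (apply_bcontfun y s)))) has_vector_derivative F t (apply_bcontfun y t)) (at t within {b..b+h})"
    if t: "t \<in> {b..b+h}" for t
    using integral_has_vector_derivative[OF cF t, of y] p_id[OF pin[OF t]]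
    by (auto intro!: derivative_eq_intros)
  have D2: "apply_bcontfun y t = xb + integral {b..t} (\<lambda>s. F s (p (apply_bcontfun y s)))"
    if "t \<in> {b..b+h}" for t
    by (subst y) (simp only: T_def c_id[OF that])
  have "(apply_bcontfun y has_vector_derivative F t (apply_bcontfun y t)) (at t within {b..b+h})"
    if t: "t \<in> {b..b+h}" for t
    by (rule has_vector_derivative_transform[OF t D2 D1[OF t]])
  moreover have "apply_bcontfun y b = xb"
    by (subst y) (use h0 in \<open>simp add: T_def c_def\<close>)
  ultimately show ?thesis using h0 by blast
qed

text \<open>If J ended at some b <= t1, the bound on x would bound x' near b, so x would be
  Lipschitz and have a limit at b. A local solution started there would continue x beyond b, against
  maximality.\<close>

lemma maximal_solution_continues:
  fixes F :: "real \<Rightarrow> 'a::euclidean_space \<Rightarrow> 'a"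
  assumes max: "maximal_solution F J x"
    and cont: "continuous_on UNIV (\<lambda>(t, y). F t y)"
    and lip: "\<And>r. \<exists>L. \<forall>t\<in>{-r..r}. \<forall>y\<in>cball 0 r. \<forall>z\<in>cball 0 r. norm (F t y - F t z) \<le> L * norm (y - z)"
    and t0: "t0 \<in> J" "t0 \<le> t1"
    and bd: "\<And>t. t \<in> J \<Longrightarrow> t0 \<le> t \<Longrightarrow> t \<le> t1 \<Longrightarrow> norm (x t) \<le> R"
  shows "t1 \<in> J"
proof (rule ccontr)
  assume t1: "t1 \<notin> J"
  have J: "open J" "is_interval J" and sol: "solves_ode_on F J x"
    using max by (simp_all only: maximal_solution_def)
  have mx: "\<forall>K y. open K \<and> is_interval K \<and> J \<subseteq> K \<and> solves_ode_on F K y \<and> (\<forall>t\<in>J. y t = x t) \<longrightarrow> K = J"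
    by (rule max[unfolded maximal_solution_def, THEN conjunct2, THEN conjunct2, THEN conjunct2, THEN conjunct2])
  have int: "s \<in> J" if "r \<in> J" "r' \<in> J" "r \<le> s" "s \<le> r'" for r r' s
    using J(2)[unfolded is_interval_1] that by blast
  have lt: "s < t1" if "s \<in> J" for s
    using int[OF t0(1) that, of t1] t0 t1 by force
  define b where "b = Sup J"
  have bdd: "bdd_above J" using lt by (auto intro!: bdd_aboveI less_imp_le)
  have up: "s \<le> b" if "s \<in> J" for s unfolding b_def by (rule cSup_upper[OF that bdd])
  have bJ: "b \<notin> J"
  proof
    assume "b \<in> J"
    then obtain e where "e > 0" "ball b e \<subseteq> J" using J(1) openE by blast
    then have "b + e/2 \<in> J" by (auto simp: dist_norm subset_iff)
    then show False using up \<open>e > 0\<close> by fastforce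
  qed
  have lt_b: "s < b" if "s \<in> J" for s using up[OF that] bJ that by (cases "s = b") auto
  have bt1: "b \<le> t1" unfolding b_def using t0(1) lt by (intro cSup_least) (auto intro: less_imp_le)
  have in_J: "s \<in> J" if "t0 \<le> s" "s < b" for s
  proof -
    obtain r where "r \<in> J" "s < r" using \<open>s < b\<close> less_cSup_iff[OF _ bdd] t0(1) unfolding b_def by blast
    then show ?thesis using int[OF t0(1)] that by (meson less_imp_le)
  qed
  have dx: "(x has_vector_derivative F s (x s)) (at s)" if "s \<in> J" for s
    using sol that by (auto simp: solves_ode_on_def)
  have xR: "norm (x s) \<le> R" if "t0 \<le> s" "s < b" for s
    using bd in_J[OF that] that bt1 by auto
  have "compact ((\<lambda>(t, y). F t y) ` ({t0..b} \<times> cball 0 R))"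
    by (intro compact_continuous_image continuous_on_subset[OF cont] compact_Times) auto
  then have "bounded ((\<lambda>(t, y). F t y) ` ({t0..b} \<times> cball 0 R))" by (rule compact_imp_bounded)
  then obtain M where "\<forall>z\<in>(\<lambda>(t, y). F t y) ` ({t0..b} \<times> cball 0 R). norm z \<le> M"
    unfolding bounded_iff by blast
  then have M: "norm (F t y) \<le> M" if "t \<in> {t0..b}" "norm y \<le> R" for t y
    using that by (auto simp: image_iff)
  have xlip: "norm (x s - x r) \<le> M * norm (s - r)" if "s \<in> {t0..<b}" "r \<in> {t0..<b}" for s r
  proof (rule differentiable_bound[of "{t0..<b}" x "\<lambda>s h. h *\<^sub>R F s (x s)"])
    show "convex {t0..<b}" by simp
    fix q assume q: "q \<in> {t0..<b}"
    then show "(x has_derivative (\<lambda>h. h *\<^sub>R F q (x q))) (at q within {t0..<b})"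
      using dx[OF in_J] by (auto simp: has_vector_derivative_def intro: has_derivative_at_withinI)
    have "norm (F q (x q)) \<le> M" using q xR[of q] by (intro M) auto
    then show "onorm (\<lambda>h. h *\<^sub>R F q (x q)) \<le> M"
      by (intro onorm_le) (simp add: mult.commute[of M] mult_left_mono)
  qed (use that in auto)
  have "uniformly_continuous_on {t0..<b} x"
  proof (rule lipschitz_on_uniformly_continuous)
    show "(max M 0)-lipschitz_on {t0..<b} x"
    proof (rule lipschitz_onI)
      fix s r assume "s \<in> {t0..<b}" "r \<in> {t0..<b}"
      then have "norm (x s - x r) \<le> M * norm (s - r)" by (rule xlip)
      also have "\<dots> \<le> max M 0 * norm (s - r)" by (intro mult_right_mono) auto
      finally show "dist (x s) (x r) \<le> max M 0 * dist s r" by (simp add: dist_norm)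
    qed simp
  qed
  then obtain g where g: "uniformly_continuous_on (closure {t0..<b}) g" "\<And>s. s \<in> {t0..<b} \<Longrightarrow> x s = g s"
    using uniformly_continuous_on_extension_on_closure by metis
  have t0b: "t0 < b" using lt_b[OF t0(1)] .
  then have gc: "continuous_on {t0..b} g"
    using uniformly_continuous_imp_continuous[OF g(1)] by simp
  define r where "r = \<bar>b\<bar> + norm (g b) + 1"
  obtain L where L: "\<forall>t\<in>{-r..r}. \<forall>y\<in>cball 0 r. \<forall>z\<in>cball 0 r. norm (F t y - F t z) \<le> L * norm (y - z)"
    using lip by blast
  have cb: "y \<in> cball 0 r" if "y \<in> cball (g b) 1" for y
    using that norm_triangle_sub[of y "g b"] by (auto simp: dist_norm r_def norm_minus_commute)
  have "\<exists>h>0. \<exists>y. y b = g b \<and> (\<forall>t\<in>{b..b+h}. (y has_vector_derivative F t (y t)) (at t within {b..b+h}))"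
    by (rule picard_local[OF cont, of _ _ L]) (rule L[rule_format, OF _ cb cb], use norm_ge_zero[of "g b"] in \<open>auto simp: r_def simp del: norm_ge_zero\<close>)
  then obtain h y where h: "h > 0" and y: "y b = g b"
    "\<And>t. t \<in> {b..b+h} \<Longrightarrow> (y has_vector_derivative F t (y t)) (at t within {b..b+h})" by blast
  \<comment> \<open>\<open>w\<close> is the continuation to be held against maximality, defined at
    all times of J. \<open>Z\<close> agrees with it from t0 on but takes its values up to b from the
    continuous extension \<open>g\<close>, which makes continuity across b immediate.\<close>
  define w where "w = (\<lambda>t. if t < b then x t else y t)"
  define Z where "Z = (\<lambda>t. if t \<le> b then g t else y t)"
  have wZ: "w t = Z t" if "t0 \<le> t" for t
    using that g(2)[of t] y(1) by (auto simp: w_def Z_def)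
  have yc: "continuous_on {b..b+h} y"
    unfolding continuous_on_eq_continuous_within
    using y(2) has_vector_derivative_continuous by blast
  have "continuous_on ({t0..b} \<union> {b..b+h}) Z" unfolding Z_def
    by (rule continuous_on_If) (use gc yc y in auto)
  moreover have "{t0..b} \<union> {b..b+h} = {t0..b+h}" using t0b h by auto
  ultimately have Zc: "continuous_on {t0..b+h} Z" by simp
  have dZ: "(Z has_vector_derivative F s (Z s)) (at s)" if "s \<in> {t0<..<b+h} - {b}" for s
  proof (cases "s < b")
    case True
    have "(Z has_vector_derivative F s (x s)) (at s within {t0<..<b})"
      by (rule has_vector_derivative_transform[OF _ _ has_vector_derivative_at_within[OF dx[OF in_J]]])
        (use True that g(2) in \<open>auto simp: Z_def\<close>)
    then show ?thesis using True that g(2)[of s] at_within_open[of s "{t0<..<b}"] by (auto simp: Z_def)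
  next
    case False
    have "(Z has_vector_derivative F s (y s)) (at s within {b<..<b+h})"
      by (rule has_vector_derivative_transform[OF _ _ has_vector_derivative_within_subset[OF y(2)]])
        (use False that in \<open>auto simp: Z_def\<close>)
    then show ?thesis using False that at_within_open[of s "{b<..<b+h}"] by (auto simp: Z_def)
  qed
  have FZ: "continuous_on {t0..b+h} (\<lambda>s. F s (Z s))"
    by (rule continuous_on_compose2[OF cont, of _ "\<lambda>s. (s, Z s)", simplified]) (intro continuous_intros Zc)
  \<comment> \<open>The two pieces say nothing about the derivative at the joint b. The integral
    equation tolerates one exceptional point, and differentiating it yields the differential
    equation at b as well.\<close>
  have hi: "((\<lambda>s. F s (Z s)) has_integral Z t - Z t0) {t0..t}" if "t \<in> {t0..b+h}" for t
    by (rule fundamental_theorem_of_calculus_interior_strong[of "{b}"])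
      (use that in \<open>auto intro!: dZ continuous_on_subset[OF Zc]\<close>)
  have dZ': "(Z has_vector_derivative F t (Z t)) (at t)" if "t \<in> {t0<..<b+h}" for t
  proof -
    have "((\<lambda>t. Z t0 + integral {t0..t} (\<lambda>s. F s (Z s))) has_vector_derivative F t (Z t)) (at t within {t0..b+h})"
      using integral_has_vector_derivative[OF FZ, of t] that by (auto intro!: derivative_eq_intros)
    then have "(Z has_vector_derivative F t (Z t)) (at t within {t0..b+h})"
      by (rule has_vector_derivative_transform[rotated 2])
        (use that integral_unique[OF hi] in auto)
    then have "(Z has_vector_derivative F t (Z t)) (at t within {t0<..<b+h})"
      by (rule has_vector_derivative_within_subset) auto
    then show ?thesis using that at_within_open[of t "{t0<..<b+h}"] by auto
  qed
  define K where "K = J \<union> {t0<..<b+h}"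
  have bK: "b \<in> K" using t0b h by (auto simp: K_def)
  have "is_interval K" unfolding is_interval_1 K_def
  proof (clarify)
    fix p q s assume "p \<in> J \<union> {t0<..<b+h}" "q \<in> J \<union> {t0<..<b+h}" "p \<le> s" "s \<le> q" "s \<notin> {t0<..<b+h}"
    moreover have "q < b + h" using calculation lt_b[of q] h by auto
    ultimately have "s \<le> t0" by auto
    then have "p \<in> J" using \<open>p \<in> J \<union> {t0<..<b+h}\<close> \<open>p \<le> s\<close> by auto
    then show "s \<in> J" using int[OF _ t0(1)] \<open>p \<le> s\<close> \<open>s \<le> t0\<close> by blast
  qed
  moreover have "solves_ode_on F K w" unfolding solves_ode_on_def
  proof
    fix t assume t: "t \<in> K"
    show "(w has_vector_derivative F t (w t)) (at t)"
    proof (cases "t0 < t")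
      case True
      then have t': "t \<in> {t0<..<b+h}" using t lt_b[of t] h by (auto simp: K_def)
      have "(w has_vector_derivative F t (Z t)) (at t within {t0<..<b+h})"
        by (rule has_vector_derivative_transform[OF t' _ has_vector_derivative_at_within[OF dZ'[OF t']]])
          (use wZ in auto)
      then show ?thesis using t' wZ[of t] at_within_open[of t "{t0<..<b+h}"] by auto
    next
      case False
      then have tJ: "t \<in> J" using t by (auto simp: K_def)
      have "(w has_vector_derivative F t (x t)) (at t within J)"
        by (rule has_vector_derivative_transform[OF tJ _ has_vector_derivative_at_within[OF dx[OF tJ]]])
          (use lt_b in \<open>auto simp: w_def\<close>)
      then show ?thesis using tJ lt_b[of t] at_within_open[OF tJ J(1)] by (auto simp: w_def)
    qed
  qed
  moreover have "\<forall>t\<in>J. w t = x t" using lt_b by (auto simp: w_def)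
  moreover have "open K" using J(1) by (auto simp: K_def)
  ultimately have "K = J" using mx[rule_format, of K w] by (auto simp: K_def)
  then show False using bK bJ by simp
qed

subsection \<open>Averages of periodic functions and slow drift\<close>

lemma periodic_add_of_int:
  fixes h :: "real \<Rightarrow> 'a"
  assumes "\<And>s. h (s + p) = h s"
  shows "h (s + of_int n * p) = h s"
proof (induction n rule: int_induct[where k = 0])
  case (step1 i) then show ?case using assms[of "s + of_int i * p"] by (simp add: algebra_simps)
next
  case (step2 i) then show ?case using assms[of "s + of_int (i - 1) * p"] by (simp add: algebra_simps)
qed simp

lemma integral_shift_periodic:
  fixes h :: "real \<Rightarrow> 'a::euclidean_space"
  assumes cont: "continuous_on UNIV h" and per: "\<And>s. h (s + p) = h s" and p: "p > 0"
  shows "integral {c..c+p} h = integral {0..p} h"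
proof -
  have int: "h integrable_on {a..b}" for a b
    by (intro integrable_continuous_real continuous_on_subset[OF cont]) auto
  have shift: "integral {a + d..b + d} h = integral {a..b} (\<lambda>s. h (s + d))" for a b d
    using integral_shift_Icc_real[of a b h d] by (simp add: o_def add.commute)
  have pern: "h (s + of_int n * p) = h s" for s n
    by (rule periodic_add_of_int[of h p, OF per])
  define n where "n = \<lfloor>c / p\<rfloor>"
  define d where "d = c - of_int n * p"
  have d: "0 \<le> d" "d \<le> p" using floor_divide_lower[OF p, of c] floor_divide_upper[OF p, of c]
    by (auto simp: d_def n_def algebra_simps)
  have "integral {c..c+p} h = integral {d + of_int n * p..(d + p) + of_int n * p} h"
    by (simp add: d_def algebra_simps)
  also have "\<dots> = integral {d..d+p} h" by (subst shift) (simp add: pern)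
  also have "\<dots> = integral {d..p} h + integral {0 + p..d + p} h"
    using Henstock_Kurzweil_Integration.integral_combine[of d p "d+p" h] d int by (simp add: add.commute)
  also have "integral {0 + p..d + p} h = integral {0..d} h" by (subst shift) (simp add: per)
  also have "integral {d..p} h + integral {0..d} h = integral {0..p} h"
    using Henstock_Kurzweil_Integration.integral_combine[of 0 d p h] d int by (simp add: add.commute)
  finally show ?thesis .
qed

lemma oscillatory_integral_bound:
  fixes a :: "real \<Rightarrow> real \<Rightarrow> 'a::euclidean_space"
  assumes cont: "continuous_on UNIV (\<lambda>(s, \<phi>). a s \<phi>)"
    and per: "\<And>s \<phi>. a s (\<phi> + 2 * pi) = a s \<phi>"
    and mean: "\<And>s. integral {0..2 * pi} (a s) = 0"
    and lip: "\<And>s r \<phi>. norm (a s \<phi> - a r \<phi>) \<le> \<Lambda> * \<bar>s - r\<bar>"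
    and bound: "\<And>s \<phi>. norm (a s \<phi>) \<le> B"
    and \<omega>: "\<omega> > 0" and S: "S \<ge> 0"
  shows "norm (integral {0..S} (\<lambda>s. a s (\<phi> + \<omega> * s))) \<le> 2 * pi * (\<Lambda> * S + B) / \<omega>"
proof -
  define T where "T = 2 * pi / \<omega>"
  define w where "w = (\<lambda>s. a s (\<phi> + \<omega> * s))"
  have T: "T > 0" using \<omega> by (simp add: T_def)
  have \<Lambda>: "\<Lambda> \<ge> 0" using order_trans[OF norm_ge_zero lip[of 1 _ 0]] by simp
  have ca: "continuous_on X (\<lambda>s. a (p s) (q s))" if "continuous_on X p" "continuous_on X q" for p q and X :: "real set"
    by (rule continuous_on_compose2[OF cont, of _ "\<lambda>s. (p s, q s)", simplified]) (intro continuous_intros that)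
  have cw: "continuous_on X w" for X unfolding w_def by (intro ca continuous_intros)
  have int: "w integrable_on {c..d}" for c d by (rule integrable_continuous_real[OF cw])
  have zero: "integral {c..c+T} (\<lambda>s. a c (\<phi> + \<omega> * s)) = 0" for c
  proof -
    have "integral {\<phi> + \<omega> * c..\<phi> + \<omega> * c + 2 * pi} (a c) = integral {0..2 * pi} (a c)"
      by (rule integral_shift_periodic) (use per in \<open>auto intro!: ca continuous_intros\<close>)
    then have "(a c has_integral 0) {\<phi> + \<omega> * c..\<phi> + \<omega> * c + 2 * pi}"
      using mean[of c] integrable_integral[OF integrable_continuous_real[OF ca[of _ "\<lambda>_. c" "\<lambda>x. x"]]]
      by (metis continuous_on_const continuous_on_id)
    then have "(a c has_integral 0) (cbox (\<phi> + \<omega> * c) (\<phi> + \<omega> * (c + T)))"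
      using \<omega> by (simp add: T_def algebra_simps)
    then have "((\<lambda>s. a c (\<omega> *\<^sub>R s + \<phi>)) has_integral 0) ((\<lambda>x. (1 / \<omega>) *\<^sub>R x + - ((1 / \<omega>) *\<^sub>R \<phi>)) ` cbox (\<phi> + \<omega> * c) (\<phi> + \<omega> * (c + T)))"
      using has_integral_affinity[of "a c" 0 _ _ \<omega> \<phi>] \<omega> by simp
    moreover have "(\<lambda>x. (1 / \<omega>) *\<^sub>R x + - ((1 / \<omega>) *\<^sub>R \<phi>)) ` cbox (\<phi> + \<omega> * c) (\<phi> + \<omega> * (c + T)) = {c..c+T}"
      using \<omega> T by (subst image_affinity_cbox) (auto simp: field_simps)
    ultimately show ?thesis by (simp add: integral_unique add.commute)
  qed
  have one: "norm (integral {c..c+T} w) \<le> \<Lambda> * T * T" for c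
  proof -
    have "integral {c..c+T} w = integral {c..c+T} (\<lambda>s. w s - a c (\<phi> + \<omega> * s))"
      using zero[of c] int by (subst integral_diff) (auto intro!: integrable_continuous_real ca continuous_intros)
    also have "norm \<dots> \<le> (\<Lambda> * T) * (c + T - c)"
    proof (rule integral_bound)
      fix s assume "s \<in> {c..c+T}"
      then have "\<Lambda> * \<bar>s - c\<bar> \<le> \<Lambda> * T" using \<Lambda> by (intro mult_left_mono) auto
      then show "norm (w s - a c (\<phi> + \<omega> * s)) \<le> \<Lambda> * T"
        using lip[of s "\<phi> + \<omega> * s" c] by (simp add: w_def)
    qed (use T in \<open>auto intro!: continuous_intros cw ca\<close>)
    finally show ?thesis by simp
  qed
  have many: "norm (integral {0..real n * T} w) \<le> real n * (\<Lambda> * T * T)" for n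
  proof (induction n)
    case (Suc n)
    have "integral {0..real (Suc n) * T} w = integral {0..real n * T} w + integral {real n * T..real n * T + T} w"
      using Henstock_Kurzweil_Integration.integral_combine[of 0 "real n * T" "real n * T + T" w] T int
      by (simp add: algebra_simps)
    then show ?case using Suc one[of "real n * T"] norm_triangle_ineq[of "integral {0..real n * T} w" "integral {real n * T..real n * T + T} w"]
      by (simp add: algebra_simps)
  qed simp
  define n where "n = nat \<lfloor>S / T\<rfloor>"
  have n: "real n * T \<le> S" "S \<le> real n * T + T"
    using floor_divide_lower[OF T, of S] floor_divide_upper[OF T, of S] S T
    by (auto simp: n_def algebra_simps of_nat_nat)
  have "norm (integral {real n * T..S} w) \<le> B * (S - real n * T)"
    by (rule integral_bound) (use n cw bound in \<open>auto simp: w_def\<close>)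
  also have "\<dots> \<le> B * T" using n order_trans[OF norm_ge_zero bound] by (intro mult_left_mono) auto
  finally have "norm (integral {0..S} w) \<le> real n * (\<Lambda> * T * T) + B * T"
    using many[of n] Henstock_Kurzweil_Integration.integral_combine[of 0 "real n * T" S w] n T int
      norm_triangle_ineq[of "integral {0..real n * T} w" "integral {real n * T..S} w"] by simp
  also have "real n * (\<Lambda> * T * T) = (real n * T) * (\<Lambda> * T)" by simp
  also have "\<dots> \<le> S * (\<Lambda> * T)" using n \<Lambda> T by (intro mult_right_mono) auto
  finally show ?thesis unfolding w_def by (simp add: T_def field_simps add_divide_distrib)
qed

text \<open>Every interval of length \<open>\<epsilon>'/4\<close> contains a point where \<open>|G - \<kappa>|\<close> exceeds \<open>2 * \<eta>\<close>. Since steps are short,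
  a slow orbit can cross such a point in one direction only; gates of both directions recur periodically,
  so the orbit ends up between two neighbouring gates.\<close>

lemma slow_drift_converges:
  fixes G :: "real \<Rightarrow> real"
  assumes cont: "continuous_on UNIV G" and per: "\<And>s. G (s + p) = G s" and p: "p > 0"
    and nonconst: "\<And>a b. a < b \<Longrightarrow> \<not> G constant_on {a..b}"
    and \<epsilon>: "\<epsilon> > 0" and \<epsilon>': "\<epsilon>' > 0"
  shows "\<exists>\<eta>>0. \<exists>\<zeta>>0. \<forall>\<kappa> \<mu> \<sigma>.
    (\<exists>b. G b \<ge> \<kappa> + \<epsilon>) \<and> (\<exists>b. G b \<le> \<kappa> - \<epsilon>) \<and> 0 < \<mu> \<and> \<mu> \<le> \<zeta> \<and>
    (\<forall>k\<ge>k0. \<bar>\<sigma> (Suc k) - \<sigma> k - \<mu> * (G (\<sigma> k) - \<kappa>)\<bar> \<le> \<mu> * \<eta>) \<longrightarrow>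
    (\<exists>c. \<exists>K::nat. \<forall>k\<ge>K. \<bar>\<sigma> k - c\<bar> \<le> \<epsilon>')"
proof -
  have pern: "G (s + of_int n * p) = G s" for s n by (rule periodic_add_of_int[of G p, OF per])
  have red: "\<exists>n::int. s + of_int n * p \<in> {0..p}" for s
    using floor_divide_lower[OF p, of s] floor_divide_upper[OF p, of s]
    by (intro exI[of _ "- \<lfloor>s / p\<rfloor>"]) (auto simp: algebra_simps)
  have cont': "continuous_on X G" for X by (rule continuous_on_subset[OF cont]) auto
  obtain B where B: "\<And>s. \<bar>G s\<bar> \<le> B"
  proof -
    have "bounded (G ` {0..p})" by (intro compact_imp_bounded compact_continuous_image cont') auto
    then obtain B where B: "\<And>s. s \<in> {0..p} \<Longrightarrow> \<bar>G s\<bar> \<le> B" unfolding bounded_iff by (metis imageI real_norm_def)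
    have "\<bar>G s\<bar> \<le> B" for s using red[of s] pern[of s] B by metis
    then show ?thesis by (rule that)
  qed
  have unif: "\<exists>d>0. \<forall>x y. \<bar>x - y\<bar> < d \<longrightarrow> \<bar>G x - G y\<bar> < e" if "e > 0" for e
  proof -
    have "uniformly_continuous_on {-p..2*p} G"
      by (intro compact_uniformly_continuous cont') auto
    then obtain d where d: "d > 0" "\<And>x y. x \<in> {-p..2*p} \<Longrightarrow> y \<in> {-p..2*p} \<Longrightarrow> \<bar>y - x\<bar> < d \<Longrightarrow> \<bar>G y - G x\<bar> < e"
      using \<open>e > 0\<close> unfolding uniformly_continuous_on_def dist_real_def by metis
    have "\<bar>G x - G y\<bar> < e" if xy: "\<bar>x - y\<bar> < min d p" for x y
    proof -
      obtain n :: int where n: "y + of_int n * p \<in> {0..p}" using red by blast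
      then have "\<bar>G (x + of_int n * p) - G (y + of_int n * p)\<bar> < e" using xy by (intro d(2)) auto
      then show ?thesis by (simp add: pern)
    qed
    then show ?thesis using d(1) p by (intro exI[of _ "min d p"]) auto
  qed
  \<comment> \<open>The oscillation of G has a lower bound uniform over all windows of length
    \<epsilon>'/4. Otherwise there are windows with oscillation tending to 0; modulo p their left
    ends accumulate, and G would be constant on the limit window.\<close>
  have osc: "\<exists>e>0. \<forall>a. \<exists>x\<in>{a..a+\<epsilon>'/4}. \<exists>y\<in>{a..a+\<epsilon>'/4}. \<bar>G x - G y\<bar> > e"
  proof (rule ccontr)
    assume "\<not> ?thesis"
    then have neg: "\<exists>a. \<forall>x\<in>{a..a+\<epsilon>'/4}. \<forall>y\<in>{a..a+\<epsilon>'/4}. \<bar>G x - G y\<bar> \<le> e" if "e > 0" for e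
      using that by (meson not_le)
    have "\<exists>a\<in>{0..p}. \<forall>x\<in>{0..\<epsilon>'/4}. \<forall>y\<in>{0..\<epsilon>'/4}. \<bar>G (a + x) - G (a + y)\<bar> \<le> 1 / real (Suc n)" for n
    proof -
      obtain a where a: "\<forall>x\<in>{a..a+\<epsilon>'/4}. \<forall>y\<in>{a..a+\<epsilon>'/4}. \<bar>G x - G y\<bar> \<le> 1 / real (Suc n)"
        using neg[of "1 / real (Suc n)"] by auto
      obtain m :: int where m: "a + of_int m * p \<in> {0..p}" using red by blast
      have "G (a + of_int m * p + x) = G (a + x)" for x
        using pern[of "a + x" m] by (simp add: algebra_simps)
      then show ?thesis using a m by (intro bexI[OF _ m]) auto
    qed
    then obtain A where A: "\<And>n. A n \<in> {0..p}"
      "\<And>n x y. x \<in> {0..\<epsilon>'/4} \<Longrightarrow> y \<in> {0..\<epsilon>'/4} \<Longrightarrow> \<bar>G (A n + x) - G (A n + y)\<bar> \<le> 1 / real (Suc n)"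
      by metis
    obtain a r where r: "strict_mono r" "(A \<circ> r) \<longlonglongrightarrow> a"
      using compact_Icc[of 0 p] A(1) unfolding compact_def by metis
    have lim: "(\<lambda>n. G (A (r n) + x)) \<longlonglongrightarrow> G (a + x)" for x
      using continuous_on_tendsto_compose[OF cont tendsto_add[OF r(2) tendsto_const[of x]]]
      by (simp add: o_def)
    have "G (a + x) = G (a + y)" if "x \<in> {0..\<epsilon>'/4}" "y \<in> {0..\<epsilon>'/4}" for x y
    proof -
      have "(\<lambda>n. G (A (r n) + x) - G (A (r n) + y)) \<longlonglongrightarrow> 0"
      proof (rule Lim_null_comparison)
        show "\<forall>\<^sub>F n in sequentially. norm (G (A (r n) + x) - G (A (r n) + y)) \<le> 1 / real (Suc n)"
        proof (rule always_eventually, rule allI)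
          fix n
          have "1 / real (Suc (r n)) \<le> 1 / real (Suc n)"
            using seq_suble[OF r(1), of n] by (intro divide_left_mono) auto
          then show "norm (G (A (r n) + x) - G (A (r n) + y)) \<le> 1 / real (Suc n)"
            using A(2)[OF that, of "r n"] by simp
        qed
        show "(\<lambda>n. 1 / real (Suc n)) \<longlonglongrightarrow> 0" using LIMSEQ_inverse_real_of_nat by (simp add: inverse_eq_divide)
      qed
      then show ?thesis using tendsto_diff[OF lim[of x] lim[of y]] LIMSEQ_unique by fastforce
    qed
    then have "G x = G a" if "x \<in> {a..a+\<epsilon>'/4}" for x
      using that \<epsilon>' by (metis (no_types, opaque_lifting) add.commute add.right_neutral atLeastAtMost_iff diff_add_cancel diff_ge_0_iff_ge diff_le_eq divide_nonneg_nonneg less_eq_real_def order_refl zero_le_numeral)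
    then have "G constant_on {a..a+\<epsilon>'/4}" unfolding constant_on_def by blast
    then show False using nonconst[of a "a + \<epsilon>'/4"] \<epsilon>' by simp
  qed
  then obtain e where e: "e > 0" "\<And>a. \<exists>x\<in>{a..a+\<epsilon>'/4}. \<exists>y\<in>{a..a+\<epsilon>'/4}. \<bar>G x - G y\<bar> > e" by blast
  \<comment> \<open>Two values of G more than e >= 5 \<eta> apart cannot both lie within 2 \<eta> of
    \<kappa>. By 3 \<eta> <= \<epsilon> the points b and b' supplied with \<kappa> are
    gates.\<close>
  define \<eta> where "\<eta> = min (e / 5) (\<epsilon> / 3)"
  have \<eta>: "\<eta> > 0" "5 * \<eta> \<le> e" "3 * \<eta> \<le> \<epsilon>" using e \<epsilon> by (auto simp: \<eta>_def)
  obtain d where d: "d > 0" "\<And>x y. \<bar>x - y\<bar> < d \<Longrightarrow> \<bar>G x - G y\<bar> < \<eta>" using unif[OF \<eta>(1)] by blast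
  have B0: "B \<ge> 0" using B[of 0] by linarith
  \<comment> \<open>Since |G - \<kappa>| <= 2 B, a step with \<mu> <= \<zeta> is shorter than d. An
    orbit about to cross a gate is then so near that G - \<kappa> still has the sign of the gate and
    modulus above \<eta>, and the error term cannot reverse the motion.\<close>
  define \<zeta> where "\<zeta> = d / (2 * B + \<eta> + 1)"
  have \<zeta>: "\<zeta> > 0" using d B0 \<eta> by (simp add: \<zeta>_def)
  show ?thesis
  proof (rule exI[of _ \<eta>], rule conjI[OF \<eta>(1)], rule exI[of _ \<zeta>], rule conjI[OF \<zeta>], intro allI impI, elim conjE exE)
    fix \<kappa> \<mu> :: real and \<sigma> :: "nat \<Rightarrow> real" and b b'
    assume b: "\<kappa> + \<epsilon> \<le> G b" and b': "G b' \<le> \<kappa> - \<epsilon>" and \<mu>: "0 < \<mu>" "\<mu> \<le> \<zeta>"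
      and "\<forall>k\<ge>k0. \<bar>\<sigma> (Suc k) - \<sigma> k - \<mu> * (G (\<sigma> k) - \<kappa>)\<bar> \<le> \<mu> * \<eta>"
    then have st: "\<bar>\<sigma> (Suc k) - \<sigma> k - \<mu> * (G (\<sigma> k) - \<kappa>)\<bar> \<le> \<mu> * \<eta>" if "k \<ge> k0" for k
      using that by blast
    have \<kappa>: "\<bar>\<kappa>\<bar> \<le> B" using b b' \<epsilon> B[of b] B[of b'] by linarith
    have small: "\<bar>\<sigma> (Suc k) - \<sigma> k\<bar> < d" if "k \<ge> k0" for k
    proof -
      have "\<bar>G (\<sigma> k) - \<kappa>\<bar> \<le> 2 * B" using B[of "\<sigma> k"] \<kappa> by linarith
      then have "\<bar>\<mu> * (G (\<sigma> k) - \<kappa>)\<bar> \<le> \<mu> * (2 * B)" using \<mu> by (simp add: abs_mult)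
      then have "\<bar>\<sigma> (Suc k) - \<sigma> k\<bar> \<le> \<mu> * (2 * B + \<eta>)" using st[OF that] by (simp add: algebra_simps)
      also have "\<dots> \<le> \<zeta> * (2 * B + \<eta>)" using \<mu> B0 \<eta> by (intro mult_right_mono) auto
      also have "\<dots> < d" using d(1) B0 \<eta> by (simp add: \<zeta>_def field_simps)
      finally show ?thesis .
    qed
    have up1: "\<sigma> (Suc k) \<ge> c" if "G c > \<kappa> + 2 * \<eta>" "k \<ge> k0" "\<sigma> k \<ge> c" for c k
    proof (rule ccontr)
      assume n: "\<not> ?thesis"
      then have "\<bar>\<sigma> k - c\<bar> < d" using small[OF that(2)] that(3) by linarith
      then have "G (\<sigma> k) - \<kappa> > \<eta>" using d(2)[of "\<sigma> k" c] that(1) by linarith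
      then have "\<mu> * (G (\<sigma> k) - \<kappa>) \<ge> \<mu> * \<eta>" using \<mu> by simp
      then show False using st[OF that(2)] n that(3) by linarith
    qed
    have dn1: "\<sigma> (Suc k) \<le> c" if "G c < \<kappa> - 2 * \<eta>" "k \<ge> k0" "\<sigma> k \<le> c" for c k
    proof (rule ccontr)
      assume n: "\<not> ?thesis"
      then have "\<bar>\<sigma> k - c\<bar> < d" using small[OF that(2)] that(3) by linarith
      then have "G (\<sigma> k) - \<kappa> < - \<eta>" using d(2)[of "\<sigma> k" c] that(1) by linarith
      then have "\<mu> * (G (\<sigma> k) - \<kappa>) \<le> \<mu> * (- \<eta>)" using \<mu> by (intro mult_left_mono) auto
      then show False using st[OF that(2)] n that(3) by simp
    qed
    have up: "\<sigma> j \<ge> c" if "G c > \<kappa> + 2 * \<eta>" "k \<ge> k0" "\<sigma> k \<ge> c" "j \<ge> k" for c k j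
      using that(4) by (induction j rule: dec_induct) (use up1 that in auto)
    have dn: "\<sigma> j \<le> c" if "G c < \<kappa> - 2 * \<eta>" "k \<ge> k0" "\<sigma> k \<le> c" "j \<ge> k" for c k j
      using that(4) by (induction j rule: dec_induct) (use dn1 that in auto)
    \<comment> \<open>The supremum of C is the lower limit of \<sigma>. Periodic copies of the gates
      b and b' enclose the orbit, which makes C nonempty and bounded above.\<close>
    define C where "C = {c. \<exists>K. \<forall>k\<ge>K. \<sigma> k \<ge> c}"
    obtain n1 :: int where n1: "of_int n1 \<ge> (b - \<sigma> k0) / p" using ex_le_of_int by blast
    have "b + of_int (- n1) * p \<le> \<sigma> k0" using n1 p by (simp add: field_simps)
    moreover have "G (b + of_int (- n1) * p) > \<kappa> + 2 * \<eta>" using b \<eta> by (subst pern) linarith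
    ultimately have "\<sigma> j \<ge> b + of_int (- n1) * p" if "j \<ge> k0" for j
      using up that by blast
    then have C1: "b + of_int (- n1) * p \<in> C" unfolding C_def by blast
    obtain n2 :: int where n2: "of_int n2 \<ge> (\<sigma> k0 - b') / p" using ex_le_of_int by blast
    have "\<sigma> k0 \<le> b' + of_int n2 * p" using n2 p by (simp add: field_simps)
    moreover have "G (b' + of_int n2 * p) < \<kappa> - 2 * \<eta>" using b' \<eta> by (subst pern) linarith
    ultimately have ub: "\<sigma> j \<le> b' + of_int n2 * p" if "j \<ge> k0" for j
      using dn that by blast
    have C2: "c \<le> b' + of_int n2 * p" if c: "c \<in> C" for c
    proof -
      obtain K where "\<forall>k\<ge>K. \<sigma> k \<ge> c" using c by (auto simp: C_def)
      then have "\<sigma> (max K k0) \<ge> c" by simp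
      then show ?thesis using ub[of "max K k0"] by simp
    qed
    have bdd: "bdd_above C" using C2 by (rule bdd_aboveI)
    define s where "s = Sup C"
    have low: "\<exists>K. \<forall>k\<ge>K. \<sigma> k \<ge> s - \<epsilon>'/2"
    proof -
      have "s - \<epsilon>'/2 < Sup C" using \<epsilon>' by (simp add: s_def)
      then obtain c where c: "c \<in> C" "s - \<epsilon>'/2 < c" using less_cSup_iff[OF _ bdd] C1 by blast
      then obtain K where "\<forall>k\<ge>K. \<sigma> k \<ge> c" by (auto simp: C_def)
      then show ?thesis using c(2) by (intro exI[of _ K]) force
    qed
    have "\<exists>c\<in>{s+\<epsilon>'/4..s+\<epsilon>'/4+\<epsilon>'/4}. \<bar>G c - \<kappa>\<bar> > 2 * \<eta>"
    proof -
      obtain x y where xy: "x \<in> {s+\<epsilon>'/4..s+\<epsilon>'/4+\<epsilon>'/4}" "y \<in> {s+\<epsilon>'/4..s+\<epsilon>'/4+\<epsilon>'/4}" "\<bar>G x - G y\<bar> > e"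
        using e(2) by blast
      then have "\<bar>G x - \<kappa>\<bar> > 2 * \<eta> \<or> \<bar>G y - \<kappa>\<bar> > 2 * \<eta>" using \<eta> by linarith
      then show ?thesis using xy by blast
    qed
    then obtain c where c: "s + \<epsilon>'/4 \<le> c" "c \<le> s + \<epsilon>'/2" "\<bar>G c - \<kappa>\<bar> > 2 * \<eta>" by auto
    have cC: "c \<notin> C" using cSup_upper[OF _ bdd, of c] c(1) \<epsilon>' by (auto simp: s_def)
    \<comment> \<open>\<open>c\<close> lies above the lower limit, so the orbit falls below it again
      and again. If \<open>c\<close> is an upward gate, the orbit can never have passed it, since
      there would be no return; if it is a downward gate, the first visit below is final.\<close>
    have high: "\<exists>K. \<forall>k\<ge>K. \<sigma> k \<le> c"
    proof (cases "G c > \<kappa> + 2 * \<eta>")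
      case True
      have "\<sigma> k \<le> c" if "k \<ge> k0" for k
        using up[OF True that] cC unfolding C_def by force
      then show ?thesis by blast
    next
      case False
      then have Gc: "G c < \<kappa> - 2 * \<eta>" using c(3) by linarith
      obtain k where "k \<ge> k0" "\<sigma> k < c" using cC unfolding C_def by force
      then have "\<sigma> j \<le> c" if "j \<ge> k" for j using dn[OF Gc _ _ that] by simp
      then show ?thesis by blast
    qed
    obtain K1 K2 where K: "\<forall>k\<ge>K1. \<sigma> k \<ge> s - \<epsilon>'/2" "\<forall>k\<ge>K2. \<sigma> k \<le> c" using low high by blast
    have "\<bar>\<sigma> k - s\<bar> \<le> \<epsilon>'" if "k \<ge> max K1 K2" for k
    proof -
      have "\<sigma> k \<ge> s - \<epsilon>'/2" "\<sigma> k \<le> c" using K that by auto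
      then show ?thesis using c(2) \<epsilon>' by linarith
    qed
    then show "\<exists>c K. \<forall>k\<ge>K. \<bar>\<sigma> k - c\<bar> \<le> \<epsilon>'" by blast
  qed
qed

subsection \<open>Functions of class $C^k$\<close>

lemma C_k_SucD: "C_k (Suc k) h \<Longrightarrow> C_k k h"
proof (induction k arbitrary: h)
  case 0
  then show ?case
    by (auto intro!: differentiable_imp_continuous_on simp: differentiable_on_def differentiable_at_withinI)
qed auto

lemma C_k_antimono: "C_k l h \<Longrightarrow> k \<le> l \<Longrightarrow> C_k k h"
  by (induction l rule: nat_induct) (auto simp: le_Suc_eq dest: C_k_SucD simp del: C_k.simps)

lemma C1_imp_continuous: "C_k (Suc 0) h \<Longrightarrow> continuous_on S h"
  using C_k_SucD[of 0 h] continuous_on_subset[of UNIV h S] by simp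

lemma C1_has_derivative: "C_k (Suc 0) h \<Longrightarrow> (h has_derivative frechet_derivative h (at x)) (at x)"
  by (simp add: frechet_derivative_works)

lemma C1_linear: "C_k (Suc 0) h \<Longrightarrow> linear (frechet_derivative h (at x))"
  using C1_has_derivative has_derivative_linear by blast

text \<open>\<open>C_k\<close> controls one direction at a time. Expansion in the basis gives joint
  continuity in point and direction and reduces bounds on the derivative to finitely many
  directions.\<close>

lemma C1_derivative_expand:
  fixes h :: "'a::euclidean_space \<Rightarrow> 'b::euclidean_space"
  assumes "C_k (Suc 0) h"
  shows "frechet_derivative h (at x) v = (\<Sum>i\<in>Basis. (v \<bullet> i) *\<^sub>R frechet_derivative h (at x) i)"
proof -
  interpret linear "frechet_derivative h (at x)" by (rule C1_linear[OF assms])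
  have "frechet_derivative h (at x) (\<Sum>i\<in>Basis. (v \<bullet> i) *\<^sub>R i) = (\<Sum>i\<in>Basis. (v \<bullet> i) *\<^sub>R frechet_derivative h (at x) i)"
    by (simp add: sum scale)
  then show ?thesis by (simp add: euclidean_representation)
qed

lemma continuous_on_C1_derivative [continuous_intros]:
  fixes h :: "'a::euclidean_space \<Rightarrow> 'b::euclidean_space"
  assumes h: "C_k (Suc 0) h" and "continuous_on S p" "continuous_on S q"
  shows "continuous_on S (\<lambda>s. frechet_derivative h (at (p s)) (q s))"
proof -
  have "continuous_on UNIV (\<lambda>x. frechet_derivative h (at x) i)" for i using h by simp
  then have "continuous_on S (\<lambda>s. frechet_derivative h (at (p s)) i)" for i
    by (rule continuous_on_compose2[OF _ assms(2)]) auto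
  then show ?thesis
    by (subst C1_derivative_expand[OF h]) (intro continuous_intros assms)
qed

text \<open>The derivative as an element of the normed space of bounded linear maps, the form in
  which differentiation under the integral asks for its continuity.\<close>

definition dblin :: "('a::euclidean_space \<Rightarrow> 'b::euclidean_space) \<Rightarrow> 'a \<Rightarrow> 'a \<Rightarrow>\<^sub>L 'b" where
  "dblin h x = Blinfun (frechet_derivative h (at x))"

lemma dblin_apply: "C_k (Suc 0) h \<Longrightarrow> blinfun_apply (dblin h x) = frechet_derivative h (at x)"
  unfolding dblin_def by (intro bounded_linear_Blinfun_apply linear_conv_bounded_linear[THEN iffD1] C1_linear)

lemma continuous_on_dblin: "C_k (Suc 0) h \<Longrightarrow> continuous_on S (dblin h)"
  by (rule continuous_on_blinfun_componentwise) (simp add: dblin_apply continuous_on_C1_derivative del: C_k.simps)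

lemma C_k_cong_derivative:
  assumes "\<And>x. (h has_derivative h' x) (at x)" "\<And>v. C_k k (\<lambda>x. h' x v)"
  shows "C_k (Suc k) h"
  using assms frechet_derivative_at[OF assms(1)] by (auto simp: differentiable_def)

lemma frechet_derivative_eq: "(h has_derivative h') (at x) \<Longrightarrow> frechet_derivative h (at x) = h'"
  using frechet_derivative_at by metis

section \<open>Weighted averages along a line segment\<close>

definition line_avg :: "(real \<Rightarrow> real) \<Rightarrow> 'a::euclidean_space \<Rightarrow> ('a \<Rightarrow> 'b::euclidean_space) \<Rightarrow> 'a \<Rightarrow> 'b" where
  "line_avg w e h z = integral {0..2 * pi} (\<lambda>s. w s *\<^sub>R h (z + s *\<^sub>R e))"

text \<open>Differentiation under the integral. With \<open>e\<close> the direction of the fast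
  phase, the weight s / (2 pi) produces the antiderivative of g and the weight 1 produces averages
  over the fast phase, so one smoothness argument serves both.\<close>

lemma line_avg_has_derivative:
  fixes h :: "'a::euclidean_space \<Rightarrow> 'b::euclidean_space"
  assumes h: "C_k (Suc 0) h" and w: "continuous_on UNIV w"
  shows "(line_avg w e h has_derivative (\<lambda>v. line_avg w e (\<lambda>x. frechet_derivative h (at x) v) z)) (at z)"
proof -
  have cw: "continuous_on S (\<lambda>x. w (p x))" if "continuous_on S p" for S and p :: "'c::topological_space \<Rightarrow> real"
    by (rule continuous_on_compose2[OF w that]) auto
  have ch: "continuous_on S (\<lambda>x. h (p x))" if "continuous_on S p" for S and p :: "'c::topological_space \<Rightarrow> 'a"
    by (rule continuous_on_compose2[OF C1_imp_continuous[OF h] that]) auto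
  have cd: "continuous_on S (\<lambda>x. dblin h (p x))" if "continuous_on S p" for S and p :: "'c::topological_space \<Rightarrow> 'a"
    by (rule continuous_on_compose2[OF continuous_on_dblin[OF h] that]) auto
  let ?fx = "\<lambda>z s. w s *\<^sub>R dblin h (z + s *\<^sub>R e)"
  have "((\<lambda>z. integral (cbox 0 (2 * pi)) (\<lambda>s. w s *\<^sub>R h (z + s *\<^sub>R e))) has_derivative
      blinfun_apply (integral (cbox 0 (2 * pi)) (?fx z))) (at z within UNIV)"
  proof (rule leibniz_rule)
    fix z s
    have "((\<lambda>x. h (x + s *\<^sub>R e)) has_derivative (\<lambda>v. frechet_derivative h (at (z + s *\<^sub>R e)) v)) (at z)"
      by (rule has_derivative_compose[OF _ C1_has_derivative[OF h], of "\<lambda>x. x + s *\<^sub>R e" "\<lambda>v. v", simplified])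
        (auto intro!: derivative_eq_intros)
    then show "((\<lambda>x. w s *\<^sub>R h (x + s *\<^sub>R e)) has_derivative blinfun_apply (?fx z s)) (at z within UNIV)"
      by (auto intro!: derivative_eq_intros simp: scaleR_blinfun.rep_eq dblin_apply[OF h])
  next
    show "continuous_on (UNIV \<times> cbox 0 (2 * pi)) (\<lambda>(z, s). ?fx z s)"
      unfolding split_beta by (intro continuous_intros cw cd)
  qed (auto intro!: integrable_continuous_real continuous_intros cw ch)
  moreover have "blinfun_apply (integral (cbox 0 (2 * pi)) (?fx z)) = (\<lambda>v. line_avg w e (\<lambda>x. frechet_derivative h (at x) v) z)"
  proof (rule ext)
    fix v
    show "blinfun_apply (integral (cbox 0 (2 * pi)) (?fx z)) v = line_avg w e (\<lambda>x. frechet_derivative h (at x) v) z"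
      unfolding line_avg_def
      by (subst blinfun_apply_integral)
        (auto intro!: integrable_continuous_real continuous_intros cw cd simp: scaleR_blinfun.rep_eq dblin_apply[OF h])
  qed
  ultimately have "((\<lambda>z. integral (cbox 0 (2 * pi)) (\<lambda>s. w s *\<^sub>R h (z + s *\<^sub>R e))) has_derivative
      (\<lambda>v. line_avg w e (\<lambda>x. frechet_derivative h (at x) v) z)) (at z)"
    by (simp only:)
  then show ?thesis by (simp add: line_avg_def[abs_def])
qed

lemma continuous_on_line_avg:
  fixes h :: "'a::euclidean_space \<Rightarrow> 'b::euclidean_space"
  assumes h: "continuous_on UNIV h" and w: "continuous_on UNIV w"
  shows "continuous_on UNIV (line_avg w e h)"
proof -
  have "continuous_on UNIV (\<lambda>z. integral (cbox 0 (2 * pi)) (\<lambda>s. w s *\<^sub>R h (z + s *\<^sub>R e)))"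
    unfolding split_beta
    by (rule integral_continuous_on_param)
      (auto simp: split_beta intro!: continuous_intros continuous_on_compose2[OF h] continuous_on_compose2[OF w])
  then show ?thesis by (simp add: line_avg_def[abs_def])
qed

text \<open>Directional derivatives commute with \<open>line_avg\<close>, so the induction, general
  in h, applies its hypothesis to the directional derivatives of h.\<close>

lemma C_k_line_avg:
  assumes "C_k k h" "continuous_on UNIV w"
  shows "C_k k (line_avg w e h)"
  using assms(1)
proof (induction k arbitrary: h)
  case (Suc k)
  have "C_k (Suc 0) h" using C_k_antimono[OF Suc.prems, of "Suc 0"] by simp
  then show ?case
    using Suc.prems by (intro C_k_cong_derivative[OF line_avg_has_derivative] assms Suc.IH) auto
qed (simp add: continuous_on_line_avg assms)

lemma C1_scaleR:
  fixes a :: "'a::euclidean_space \<Rightarrow> real" and h :: "'a \<Rightarrow> 'b::euclidean_space"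
  assumes "C_k (Suc 0) a" "C_k (Suc 0) h"
  shows "C_k (Suc 0) (\<lambda>x. a x *\<^sub>R h x)"
proof (rule C_k_cong_derivative)
  show "((\<lambda>x. a x *\<^sub>R h x) has_derivative
     (\<lambda>v. a x *\<^sub>R frechet_derivative h (at x) v + frechet_derivative a (at x) v *\<^sub>R h x)) (at x)" for x
    by (intro has_derivative_scaleR C1_has_derivative assms)
  show "C_k 0 (\<lambda>x. a x *\<^sub>R frechet_derivative h (at x) v + frechet_derivative a (at x) v *\<^sub>R h x)" for v
    unfolding C_k.simps(1)
    by (intro continuous_intros assms C1_imp_continuous[OF assms(1)] C1_imp_continuous[OF assms(2)])
qed

lemma C1_sum:
  fixes h :: "'i \<Rightarrow> 'a::euclidean_space \<Rightarrow> 'b::euclidean_space"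
  assumes "\<And>i. i \<in> I \<Longrightarrow> C_k (Suc 0) (h i)"
  shows "C_k (Suc 0) (\<lambda>x. \<Sum>i\<in>I. h i x)"
proof (rule C_k_cong_derivative)
  show "((\<lambda>x. \<Sum>i\<in>I. h i x) has_derivative (\<lambda>v. \<Sum>i\<in>I. frechet_derivative (h i) (at x) v)) (at x)" for x
    by (intro has_derivative_sum C1_has_derivative assms)
  show "C_k 0 (\<lambda>x. \<Sum>i\<in>I. frechet_derivative (h i) (at x) v)" for v
    using assms by (auto intro!: continuous_intros simp del: C_k.simps(2) simp: C_k.simps(1))
qed

lemma C1_inner_right:
  fixes h :: "'a::euclidean_space \<Rightarrow> 'b::euclidean_space"
  assumes "C_k (Suc 0) h"
  shows "C_k (Suc 0) (\<lambda>x. h x \<bullet> i)"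
proof (rule C_k_cong_derivative)
  show "((\<lambda>x. h x \<bullet> i) has_derivative (\<lambda>v. frechet_derivative h (at x) v \<bullet> i)) (at x)" for x
    by (intro has_derivative_inner_left C1_has_derivative assms)
  show "C_k 0 (\<lambda>x. frechet_derivative h (at x) v \<bullet> i)" for v
    using assms by (auto intro!: continuous_intros simp del: C_k.simps(2) simp: C_k.simps(1))
qed

lemma frechet_derivative_translate:
  assumes "\<And>w. h (w + c) = h w" and "h differentiable (at z)"
  shows "frechet_derivative h (at (z + c)) = frechet_derivative h (at z)"
proof -
  have "(h has_derivative frechet_derivative h (at z)) (at z)" using assms(2) by (simp add: frechet_derivative_works)
  then have "((\<lambda>x. h (x - c)) has_derivative frechet_derivative h (at z)) (at (z + c))"
    by (intro has_derivative_compose[of "\<lambda>x. x - c" "\<lambda>v. v" "z + c" UNIV h "frechet_derivative h (at z)"])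
      (auto intro!: derivative_eq_intros)
  moreover have "(\<lambda>x. h (x - c)) = h" using assms(1)[of "_ - c"] by auto
  ultimately show ?thesis by (simp add: frechet_derivative_eq)
qed

text \<open>\<open>K\<close> may be unbounded, such as a ball times two phase axes; translations by
  the periods in \<Gamma> fold it into the compact set \<open>K0\<close>.\<close>

lemma bounded_by_periodicity:
  fixes h :: "'a::euclidean_space \<Rightarrow> 'b::euclidean_space"
  assumes "continuous_on UNIV h" "compact K0"
    and "\<And>c w. c \<in> \<Gamma> \<Longrightarrow> h (w + c) = h w" and "\<And>z. z \<in> K \<Longrightarrow> \<exists>c\<in>\<Gamma>. z + c \<in> K0"
  shows "\<exists>B. \<forall>z\<in>K. norm (h z) \<le> B"
proof -
  have "bounded (h ` K0)"
    by (intro compact_imp_bounded compact_continuous_image continuous_on_subset[OF assms(1)] assms) auto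
  then obtain B where "\<And>z. z \<in> K0 \<Longrightarrow> norm (h z) \<le> B" unfolding bounded_iff by (metis imageI)
  then show ?thesis using assms(3,4) by metis
qed

lemma norm_derivative_le_basis:
  fixes h :: "'a::euclidean_space \<Rightarrow> 'b::euclidean_space"
  assumes "C_k (Suc 0) h" "\<And>i. i \<in> Basis \<Longrightarrow> norm (frechet_derivative h (at z) i) \<le> B i"
  shows "norm (frechet_derivative h (at z) v) \<le> (\<Sum>i\<in>Basis. B i) * norm v"
proof -
  have "norm (frechet_derivative h (at z) v) \<le> (\<Sum>i\<in>Basis. norm ((v \<bullet> i) *\<^sub>R frechet_derivative h (at z) i))"
    by (subst C1_derivative_expand[OF assms(1)]) (rule norm_sum)
  also have "\<dots> \<le> (\<Sum>i\<in>Basis. B i * norm v)"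
  proof (rule sum_mono)
    fix i :: 'a assume i: "i \<in> Basis"
    have "\<bar>v \<bullet> i\<bar> * norm (frechet_derivative h (at z) i) \<le> norm v * B i"
      using assms(2)[OF i] Basis_le_norm[OF i, of v] by (intro mult_mono) auto
    then show "norm ((v \<bullet> i) *\<^sub>R frechet_derivative h (at z) i) \<le> B i * norm v" by (simp add: mult.commute)
  qed
  finally show ?thesis by (simp add: sum_distrib_right)
qed

lemma C1_derivative_bounded:
  fixes h :: "'a::euclidean_space \<Rightarrow> 'b::euclidean_space"
  assumes h: "C_k (Suc 0) h" and K0: "compact K0"
    and per: "\<And>c w. c \<in> \<Gamma> \<Longrightarrow> h (w + c) = h w" and cov: "\<And>z. z \<in> K \<Longrightarrow> \<exists>c\<in>\<Gamma>. z + c \<in> K0"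
  shows "\<exists>B\<ge>0. \<forall>z\<in>K. \<forall>v. norm (frechet_derivative h (at z) v) \<le> B * norm v"
proof -
  have "\<exists>B. \<forall>z\<in>K. norm (frechet_derivative h (at z) i) \<le> B" for i
  proof (rule bounded_by_periodicity[OF _ K0 _ cov])
    show "continuous_on UNIV (\<lambda>z. frechet_derivative h (at z) i)" using h by simp
    show "frechet_derivative h (at (w + c)) i = frechet_derivative h (at w) i" if "c \<in> \<Gamma>" for c w
      using frechet_derivative_translate[of h c w] per[OF that] h by auto
  qed
  then obtain B where B: "\<And>i z. z \<in> K \<Longrightarrow> norm (frechet_derivative h (at z) i) \<le> B i" by metis
  then have *: "norm (frechet_derivative h (at z) v) \<le> (\<Sum>i\<in>Basis. B i) * norm v" if "z \<in> K" for z v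
    using that by (intro norm_derivative_le_basis h) auto
  show ?thesis
  proof (intro exI[of _ "max 0 (\<Sum>i\<in>Basis. B i)"] conjI ballI allI)
    fix z v assume "z \<in> K"
    then show "norm (frechet_derivative h (at z) v) \<le> max 0 (\<Sum>i\<in>Basis. B i) * norm v"
      using *[of z v] mult_right_mono[of "\<Sum>i\<in>Basis. B i" "max 0 (\<Sum>i\<in>Basis. B i)" "norm v"] by simp
  qed simp
qed

lemma C1_lipschitz:
  fixes h :: "'a::euclidean_space \<Rightarrow> 'b::euclidean_space"
  assumes h: "C_k (Suc 0) h" and K: "convex K"
    and B: "\<And>z v. z \<in> K \<Longrightarrow> norm (frechet_derivative h (at z) v) \<le> B * norm v"
    and xy: "x \<in> K" "y \<in> K"
  shows "norm (h x - h y) \<le> B * norm (x - y)"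
  by (rule differentiable_bound[OF K _ _ xy])
    (auto intro!: onorm_le B has_derivative_at_withinI[OF C1_has_derivative[OF h]])

text \<open>Periodicity bounds the first and second directional derivatives on a possibly noncompact
  K. Convexity of K lets the mean value inequality turn these bounds into Lipschitz and Taylor
  estimates.\<close>

lemma C2_bounds:
  fixes h :: "'a::euclidean_space \<Rightarrow> 'b::euclidean_space"
  assumes h: "C_k 2 h" and K0: "compact K0" and K: "convex K"
    and per: "\<And>c w. c \<in> \<Gamma> \<Longrightarrow> h (w + c) = h w" and cov: "\<And>z. z \<in> K \<Longrightarrow> \<exists>c\<in>\<Gamma>. z + c \<in> K0"
  shows "\<exists>C\<ge>0. (\<forall>z\<in>K. norm (h z) \<le> C) \<and>
    (\<forall>z\<in>K. \<forall>v. norm (frechet_derivative h (at z) v) \<le> C * norm v) \<and>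
    (\<forall>z\<in>K. \<forall>w\<in>K. norm (h z - h w) \<le> C * norm (z - w)) \<and>
    (\<forall>z\<in>K. \<forall>w\<in>K. \<forall>v. norm (frechet_derivative h (at z) v - frechet_derivative h (at w) v) \<le> C * norm (z - w) * norm v) \<and>
    (\<forall>z\<in>K. \<forall>w\<in>K. norm (h w - h z - frechet_derivative h (at z) (w - z)) \<le> C * (norm (w - z))\<^sup>2)"
proof -
  have h1: "C_k (Suc 0) h" by (rule C_k_antimono[OF h]) simp
  have h2: "C_k (Suc 0) (\<lambda>z. frechet_derivative h (at z) v)" for v
    using h by (simp add: numeral_2_eq_2)
  have dper: "frechet_derivative h (at (w + c)) v = frechet_derivative h (at w) v" if "c \<in> \<Gamma>" for c w v
    using frechet_derivative_translate[of h c w] per[OF that] h1 by auto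
  have "\<exists>B. \<forall>z\<in>K. norm (h z) \<le> B"
    by (rule bounded_by_periodicity[OF C1_imp_continuous[OF h1] K0 per cov])
  then obtain C0 where C0: "\<forall>z\<in>K. norm (h z) \<le> C0" ..
  have "\<exists>B\<ge>0. \<forall>z\<in>K. \<forall>v. norm (frechet_derivative h (at z) v) \<le> B * norm v"
    by (rule C1_derivative_bounded[OF h1 K0 per cov])
  then obtain C1 where C1: "C1 \<ge> 0" "\<And>z v. z \<in> K \<Longrightarrow> norm (frechet_derivative h (at z) v) \<le> C1 * norm v"
    by blast
  have "\<exists>B\<ge>0. \<forall>z\<in>K. \<forall>w. norm (frechet_derivative (\<lambda>z. frechet_derivative h (at z) v) (at z) w) \<le> B * norm w" for v
    by (rule C1_derivative_bounded[OF h2 K0 dper cov])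
  then obtain B where B: "\<And>v. B v \<ge> 0" "\<And>z v w. z \<in> K \<Longrightarrow> norm (frechet_derivative (\<lambda>z. frechet_derivative h (at z) v) (at z) w) \<le> B v * norm w"
    by metis
  define C2 where "C2 = (\<Sum>i\<in>(Basis::'a set). B i)"
  have C2: "C2 \<ge> 0" unfolding C2_def by (intro sum_nonneg B)
  have lip: "norm (h z - h w) \<le> C1 * norm (z - w)" if "z \<in> K" "w \<in> K" for z w
    by (rule C1_lipschitz[OF h1 K C1(2) that])
  have dlip: "norm (frechet_derivative h (at z) v - frechet_derivative h (at w) v) \<le> C2 * norm (z - w) * norm v"
    if "z \<in> K" "w \<in> K" for z w v
  proof -
    have "norm (frechet_derivative h (at z) v - frechet_derivative h (at w) v)
      = norm (\<Sum>i\<in>Basis. (v \<bullet> i) *\<^sub>R (frechet_derivative h (at z) i - frechet_derivative h (at w) i))"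
      by (subst (1 2) C1_derivative_expand[OF h1]) (simp add: sum_subtractf scaleR_diff_right)
    also have "\<dots> \<le> (\<Sum>i\<in>Basis. B i * norm (z - w) * norm v)"
    proof (intro sum_norm_le)
      fix i :: 'a assume i: "i \<in> Basis"
      have "norm (frechet_derivative h (at z) i - frechet_derivative h (at w) i) \<le> B i * norm (z - w)"
        by (rule C1_lipschitz[OF h2 K B(2) that])
      then have "\<bar>v \<bullet> i\<bar> * norm (frechet_derivative h (at z) i - frechet_derivative h (at w) i) \<le> norm v * (B i * norm (z - w))"
        using Basis_le_norm[OF i, of v] by (intro mult_mono) auto
      then show "norm ((v \<bullet> i) *\<^sub>R (frechet_derivative h (at z) i - frechet_derivative h (at w) i)) \<le> B i * norm (z - w) * norm v"
        by (simp add: mult.commute mult.left_commute)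
    qed
    finally show ?thesis by (simp add: C2_def sum_distrib_right)
  qed
  have taylor: "norm (h w - h z - frechet_derivative h (at z) (w - z)) \<le> C2 * (norm (w - z))\<^sup>2"
    if zw: "z \<in> K" "w \<in> K" for z w
  proof -
    let ?\<phi> = "\<lambda>x. h x - frechet_derivative h (at z) x"
    have seg: "closed_segment z w \<subseteq> K" using closed_segment_subset[OF zw K] .
    interpret L: linear "frechet_derivative h (at z)" by (rule C1_linear[OF h1])
    \<comment> \<open>Mean value inequality for h minus its linear part at z, whose derivative on
      the segment has norm at most C2 |w - z|. The factor 1/2 of the sharp Taylor bound is given
      away.\<close>
    have "norm (?\<phi> w - ?\<phi> z) \<le> (C2 * norm (w - z)) * norm (w - z)"
    proof (rule differentiable_bound[of "closed_segment z w"])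
      fix x assume x: "x \<in> closed_segment z w"
      show "(?\<phi> has_derivative (\<lambda>v. frechet_derivative h (at x) v - frechet_derivative h (at z) v)) (at x within closed_segment z w)"
        by (intro has_derivative_diff has_derivative_at_withinI[OF C1_has_derivative[OF h1]]
            bounded_linear.has_derivative[OF linear_conv_bounded_linear[THEN iffD1, OF C1_linear[OF h1]]] has_derivative_ident)
      have "norm (x - z) \<le> norm (w - z)" using segment_bound1[OF x] .
      then have "C2 * norm (x - z) \<le> C2 * norm (w - z)" using C2 by (rule mult_left_mono)
      then show "onorm (\<lambda>v. frechet_derivative h (at x) v - frechet_derivative h (at z) v) \<le> C2 * norm (w - z)"
        using dlip[of x z] x seg zw
        by (intro onorm_le) (meson mult_right_mono norm_ge_zero order_trans subsetD)
    qed auto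
    then show ?thesis by (simp add: L.diff power2_eq_square algebra_simps)
  qed
  let ?C = "max (max \<bar>C0\<bar> C1) C2"
  show ?thesis
  proof (intro exI[of _ ?C] conjI ballI allI)
    show "norm (h z) \<le> ?C" if "z \<in> K" for z using C0 that by fastforce
    show "norm (frechet_derivative h (at z) v) \<le> ?C * norm v" if "z \<in> K" for z v
      using C1(2)[OF that, of v] mult_right_mono[of C1 ?C "norm v"] by (simp add: le_max_iff_disj) 
    show "norm (h z - h w) \<le> ?C * norm (z - w)" if "z \<in> K" "w \<in> K" for z w
      by (rule order_trans[OF lip[OF that]]) (intro mult_right_mono, auto)
    show "norm (frechet_derivative h (at z) v - frechet_derivative h (at w) v) \<le> ?C * norm (z - w) * norm v"
      if "z \<in> K" "w \<in> K" for z w v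
      by (rule order_trans[OF dlip[OF that]]) (intro mult_right_mono, auto)
    show "norm (h w - h z - frechet_derivative h (at z) (w - z)) \<le> ?C * (norm (w - z))\<^sup>2" if "z \<in> K" "w \<in> K" for z w
      by (rule order_trans[OF taylor[OF that]]) (intro mult_right_mono, auto)
  qed (use C1 in auto)
qed

subsection \<open>Contraction by the deflated monodromy matrix\<close>

lemma contraction_sequence_tendsto_zero:
  fixes a b :: "nat \<Rightarrow> real"
  assumes a: "\<And>k. a k \<ge> 0" and r: "0 \<le> r" "r < 1"
    and step: "\<And>k. a (Suc k) \<le> r * a k + b k" and b: "b \<longlonglongrightarrow> 0"
  shows "a \<longlonglongrightarrow> 0"
proof (rule LIMSEQ_I)
  fix e :: real assume e: "e > 0"
  \<comment> \<open>With this d the map t -> r t + d has the fixed point e / 2.\<close>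
  define d where "d = e * (1 - r) / 2"
  have d: "d > 0" using e r by (simp add: d_def)
  obtain K where K: "\<And>k. k \<ge> K \<Longrightarrow> norm (b k - 0) < d" using LIMSEQ_D[OF b d] by blast
  have "a (K + j) \<le> r ^ j * a K + e / 2" for j
  proof (induction j)
    case (Suc j)
    have "a (K + Suc j) \<le> r * a (K + j) + b (K + j)" using step[of "K + j"] by simp
    also have "\<dots> \<le> r * (r ^ j * a K + e / 2) + d"
      using Suc K[of "K + j"] r by (intro add_mono mult_left_mono) auto
    also have "\<dots> = r ^ Suc j * a K + e / 2" by (simp add: d_def field_simps)
    finally show ?case .
  qed (use e in auto)
  moreover have "(\<lambda>j. r ^ j * a K) \<longlonglongrightarrow> 0"
    using LIMSEQ_realpow_zero[OF r] tendsto_mult_left_zero by blast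
  then obtain N where "\<And>j. j \<ge> N \<Longrightarrow> norm (r ^ j * a K - 0) < e / 2" using LIMSEQ_D e by (metis half_gt_zero)
  ultimately have "a (K + j) < e" if "j \<ge> N" for j
    using that by (smt (verit) field_sum_of_halves real_norm_def)
  then have "a k < e" if "k \<ge> K + N" for k
    using that by (metis add_le_cancel_left le_add1 le_add_diff_inverse le_trans)
  then show "\<exists>k0. \<forall>k\<ge>k0. norm (a k - 0) < e" using a by (intro exI[of _ "K + N"]) simp
qed

lemma norm_vector_smult: "norm (c *s (x::complex^'n)) = cmod c * norm x"
  by (simp add: norm_vec_def L2_set_def norm_mult power_mult_distrib sum_distrib_left[symmetric] real_sqrt_mult)

definition poly_apply :: "complex poly \<Rightarrow> complex^'n^'n \<Rightarrow> complex^'n \<Rightarrow> complex^'n" where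
  "poly_apply p M v = (\<Sum>i\<le>degree p. coeff p i *s (((*v) M) ^^ i) v)"

lemma poly_apply_bound:
  "degree p \<le> N \<Longrightarrow> poly_apply p M v = (\<Sum>i\<le>N. coeff p i *s (((*v) M) ^^ i) v)"
  unfolding poly_apply_def by (rule sum.mono_neutral_left) (auto simp: coeff_eq_0)

lemma funpow_matrix_diff:
  fixes M :: "'a::field^'n^'n"
  shows "(((*v) M) ^^ i) (v - w) = (((*v) M) ^^ i) v - (((*v) M) ^^ i) w"
  by (induction i) (auto simp: matrix_vector_mult_diff_distrib)

lemma funpow_matrix_smult:
  fixes M :: "'a::field^'n^'n"
  shows "(((*v) M) ^^ i) (c *s w) = c *s (((*v) M) ^^ i) w"
  by (induction i) (auto simp: vector_scalar_commute)

lemma poly_apply_linear_factor: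
  "poly_apply ([:-\<mu>, 1:] * q) M v = poly_apply q M (M *v v - \<mu> *s v)"
proof -
  define N where "N = degree q"
  have "degree ([:-\<mu>, 1:] * q) \<le> Suc N" unfolding N_def by (rule order_trans[OF degree_mult_le]) simp
  then have "poly_apply ([:-\<mu>, 1:] * q) M v = (\<Sum>i\<le>Suc N. coeff ([:-\<mu>, 1:] * q) i *s (((*v) M) ^^ i) v)"
    by (rule poly_apply_bound)
  also have "\<dots> = (\<Sum>i\<le>Suc N. (if i = 0 then 0 else coeff q (i - 1)) *s (((*v) M) ^^ i) v) -
      (\<Sum>i\<le>Suc N. (\<mu> * coeff q i) *s (((*v) M) ^^ i) v)"
    unfolding sum_subtractf[symmetric]
    by (rule sum.cong) (auto simp: coeff_pCons vector_sub_rdistrib algebra_simps vector_smult_lneg split: nat.split)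
  also have "(\<Sum>i\<le>Suc N. (if i = 0 then 0 else coeff q (i - 1)) *s (((*v) M) ^^ i) v) = (\<Sum>i\<le>N. coeff q i *s (((*v) M) ^^ i) (M *v v))"
    by (subst sum.atMost_Suc_shift) (simp add: funpow_swap1)
  also have "(\<Sum>i\<le>Suc N. (\<mu> * coeff q i) *s (((*v) M) ^^ i) v) = (\<Sum>i\<le>N. coeff q i *s (((*v) M) ^^ i) (\<mu> *s v))"
    by (simp add: coeff_eq_0 N_def funpow_matrix_smult vector_smult_assoc mult.commute)
  finally show ?thesis
    by (simp add: poly_apply_def N_def funpow_matrix_diff vector_ssub_ldistrib sum_subtractf)
qed

text \<open>With D the real dimension, the D + 1 iterates of v of order 0 to D are linearly
  dependent over the reals. Coinciding iterates are treated apart: as a set they may be independent,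
  while X^i - X^j annihilates v.\<close>

lemma exists_annihilating_poly:
  fixes M :: "complex^'n^'n"
  shows "\<exists>p. p \<noteq> 0 \<and> poly_apply p M v = 0"
proof -
  define D where "D = DIM(complex^'n)"
  define w where "w = (\<lambda>i. (((*v) M) ^^ i) v)"
  have "\<exists>c::nat \<Rightarrow> real. (\<exists>i\<le>D. c i \<noteq> 0) \<and> (\<Sum>i\<le>D. c i *\<^sub>R w i) = 0"
  proof (cases "inj_on w {..D}")
    case True
    then have "dependent (w ` {..D})" by (intro dependent_biggerset) (simp add: card_image D_def)
    then obtain u where u: "\<exists>v\<in>w ` {..D}. u v \<noteq> 0" "(\<Sum>v\<in>w ` {..D}. u v *\<^sub>R v) = 0"
      using dependent_finite[of "w ` {..D}"] by auto
    then have "(\<Sum>i\<le>D. u (w i) *\<^sub>R w i) = 0" using sum.reindex[OF True, of "\<lambda>v. u v *\<^sub>R v"] by simp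
    then show ?thesis using u(1) by (intro exI[of _ "\<lambda>i. u (w i)"]) auto
  next
    case False
    then obtain i j where ij: "i \<le> D" "j \<le> D" "i \<noteq> j" "w i = w j" unfolding inj_on_def by auto
    have "(\<Sum>k\<le>D. ((if k = i then 1 else 0) - (if k = j then 1 else 0)) *\<^sub>R w k) = 0"
      using ij by (simp add: scaleR_diff_left sum_subtractf if_distrib[of "\<lambda>c. c *\<^sub>R _"] cong: if_cong)
    then show ?thesis using ij by (intro exI[of _ "\<lambda>k. (if k = i then 1 else 0) - (if k = j then 1 else 0)"]) auto
  qed
  then obtain c where c: "\<exists>i\<le>D. c i \<noteq> 0" "(\<Sum>i\<le>D. c i *\<^sub>R w i) = 0" by blast
  define p where "p = (\<Sum>i\<le>D. monom (complex_of_real (c i)) i)"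
  have cf: "coeff p i = (if i \<le> D then complex_of_real (c i) else 0)" for i
    by (simp add: p_def coeff_sum)
  have "degree p \<le> D" by (rule degree_le) (simp add: cf)
  then have "poly_apply p M v = (\<Sum>i\<le>D. coeff p i *s w i)" by (simp add: poly_apply_bound w_def)
  also have "\<dots> = (\<Sum>i\<le>D. c i *\<^sub>R w i)"
  proof (rule sum.cong)
    fix i assume "i \<in> {..D}"
    then show "coeff p i *s w i = c i *\<^sub>R w i"
      by (simp add: cf vec_eq_iff) (simp add: complex_eq_iff)
  qed simp
  finally have "poly_apply p M v = 0" using c by simp
  moreover have "p \<noteq> 0" using c(1) cf by (metis coeff_0 of_real_eq_0_iff)
  ultimately show ?thesis by blast
qed

text \<open>Induction on the degree of a polynomial annihilating \<open>v\<close>: splitting off a root \<open>\<mu>\<close> leaves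
  a polynomial of lower degree annihilating \<open>w = (M - \<mu>) v\<close>. For \<open>|\<mu>| < 1\<close> the powers of \<open>M\<close> at \<open>v\<close> obey a contracting
  recursion driven by those at \<open>w\<close>; otherwise \<open>\<mu>\<close> is not an eigenvalue and \<open>M - \<mu>\<close> can be inverted.\<close>

lemma matrix_powers_tendsto_zero_complex:
  fixes M :: "complex^'n^'n"
  assumes ev: "\<And>\<mu> v. v \<noteq> 0 \<Longrightarrow> M *v v = \<mu> *s v \<Longrightarrow> cmod \<mu> < 1"
  shows "(\<lambda>k. (((*v) M) ^^ k) v) \<longlonglongrightarrow> 0"
proof -
  have "p \<noteq> 0 \<Longrightarrow> poly_apply p M v = 0 \<Longrightarrow> (\<lambda>k. (((*v) M) ^^ k) v) \<longlonglongrightarrow> 0" for p v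
  proof (induction "degree p" arbitrary: p v)
    case 0
    then obtain c where c: "p = [:c:]" "c \<noteq> 0" by (metis degree_eq_zeroE pCons_eq_0_iff)
    then have "c *s v = 0" using 0 by (simp add: poly_apply_def)
    then have "v = 0" using c(2) by (auto simp: vec_eq_iff)
    moreover have "(((*v) M) ^^ k) 0 = 0" for k by (induction k) auto
    ultimately show ?case by simp
  next
    case (Suc d)
    obtain \<mu> where "poly p \<mu> = 0" using fundamental_theorem_of_algebra[of p] constant_degree[of p] Suc(2) by auto
    then obtain q where q: "p = [:-\<mu>, 1:] * q" by (metis dvdE poly_eq_0_iff_dvd)
    have "q \<noteq> 0" using q Suc.prems by auto
    then have "degree ([:-\<mu>, 1:] * q) = degree [:-\<mu>, 1:] + degree q" by (intro degree_mult_eq) auto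
    then have dq: "d = degree q" using q Suc(2) by simp
    define w where "w = M *v v - \<mu> *s v"
    have "poly_apply q M w = 0" using Suc.prems(2) poly_apply_linear_factor[of \<mu> q M v] q by (simp add: w_def)
    then have w: "(\<lambda>k. (((*v) M) ^^ k) w) \<longlonglongrightarrow> 0" by (rule Suc(1)[OF dq \<open>q \<noteq> 0\<close>])
    have step: "(((*v) M) ^^ Suc k) v = \<mu> *s (((*v) M) ^^ k) v + (((*v) M) ^^ k) w" for k
      unfolding w_def funpow_matrix_diff funpow_matrix_smult by (simp add: funpow_swap1)
    show ?case
    proof (cases "cmod \<mu> < 1")
      case True
      have "(\<lambda>k. norm ((((*v) M) ^^ k) v)) \<longlonglongrightarrow> 0"
      proof (rule contraction_sequence_tendsto_zero[of _ "cmod \<mu>"])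
        fix k
        show "norm ((((*v) M) ^^ Suc k) v) \<le> cmod \<mu> * norm ((((*v) M) ^^ k) v) + norm ((((*v) M) ^^ k) w)"
          unfolding step by (rule order_trans[OF norm_triangle_ineq]) (simp add: norm_vector_smult)
      qed (use True w in \<open>auto intro: tendsto_norm_zero\<close>)
      then show ?thesis by (rule tendsto_norm_zero_cancel)
    next
      case False
      define N where "N = M - mat \<mu>"
      have N: "N *v x = M *v x - \<mu> *s x" for x
      proof -
        have "mat \<mu> *v x = \<mu> *s x"
          by (simp add: vec_eq_iff matrix_vector_mult_def mat_def if_distrib[of "\<lambda>c. c * _"] sum.delta cong: if_cong)
        then show ?thesis by (simp add: N_def matrix_vector_mult_diff_rdistrib)
      qed
      have "inj ((*v) N)"
      proof (rule injI)
        fix x y assume "N *v x = N *v y"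
        then have "M *v (x - y) = \<mu> *s (x - y)" unfolding N by (simp add: algebra_simps matrix_vector_mult_diff_distrib vector_ssub_ldistrib)
        then show "x = y" using ev[of "x - y" \<mu>] False by auto
      qed
      then obtain B where B: "B ** N = mat 1" using matrix_left_invertible_injective by blast
      have Nk: "N *v (((*v) M) ^^ k) v = (((*v) M) ^^ k) w" for k
        using step[of k] unfolding N by simp
      have eq: "(((*v) M) ^^ k) v = B *v ((((*v) M) ^^ k) w)" for k
        unfolding Nk[symmetric] using B by (simp add: matrix_vector_mul_assoc)
      have "continuous_on UNIV ((*v) B)" by (simp add: matrix_vector_mult_def continuous_on_vec_lambda continuous_intros)
      then have "(\<lambda>k. B *v ((((*v) M) ^^ k) w)) \<longlonglongrightarrow> B *v 0"
        by (rule continuous_on_tendsto_compose[OF _ w]) auto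
      then show ?thesis unfolding eq by simp
    qed
  qed
  then show ?thesis using exists_annihilating_poly by blast
qed

definition cvec :: "real^'n \<Rightarrow> complex^'n" where "cvec v = (\<chi> i. complex_of_real (v $ i))"
definition cmat :: "real^'n^'n \<Rightarrow> complex^'n^'n" where "cmat M = (\<chi> i j. complex_of_real (M $ i $ j))"

lemma cmat_mult_cvec: "cmat M *v cvec v = cvec (M *v v)"
  by (simp add: vec_eq_iff cmat_def cvec_def matrix_vector_mult_def)

lemma norm_cvec: "norm (cvec v) = norm v"
  by (simp add: norm_vec_def cvec_def)

text \<open>Convergence to 0 on each of the finitely many basis vectors controls the operator norm.
  The exponent is taken as a successor to make it positive.\<close>

lemma matrix_power_contracts:
  fixes M :: "real^'n^'n"
  assumes ev: "\<And>\<mu> v. v \<noteq> 0 \<Longrightarrow> cmat M *v v = \<mu> *s v \<Longrightarrow> cmod \<mu> < 1" and c: "c > 0"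
  shows "\<exists>N>0. \<forall>v. norm ((((*v) M) ^^ N) v) \<le> c * norm v"
proof -
  have cv: "(((*v) (cmat M)) ^^ k) (cvec v) = cvec ((((*v) M) ^^ k) v)" for k v
    by (induction k) (auto simp: cmat_mult_cvec)
  have lim: "(\<lambda>k. norm ((((*v) M) ^^ k) v)) \<longlonglongrightarrow> 0" for v
    using tendsto_norm_zero[OF matrix_powers_tendsto_zero_complex[of "cmat M" "cvec v", OF ev]]
    by (simp add: cv norm_cvec)
  have lin: "linear (((*v) M) ^^ k)" for k
  proof (induction k)
    case (Suc k)
    then show ?case using linear_compose[OF Suc matrix_vector_mul_linear[of M]] by (simp add: o_def)
  qed (simp add: linear_id[unfolded id_def] id_def)
  have "(\<lambda>k. \<Sum>i\<in>Basis. norm ((((*v) M) ^^ k) i)) \<longlonglongrightarrow> 0" by (intro tendsto_null_sum lim)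
  then obtain N where N: "\<And>k. k \<ge> N \<Longrightarrow> norm ((\<Sum>i\<in>Basis. norm ((((*v) M) ^^ k) i)) - 0) < c"
    using LIMSEQ_D c by blast
  have "norm ((((*v) M) ^^ Suc N) v) \<le> c * norm v" for v
  proof -
    let ?T = "((*v) M) ^^ Suc N"
    have "?T v = ?T (\<Sum>i\<in>Basis. (v \<bullet> i) *\<^sub>R i)" by (simp add: euclidean_representation)
    also have "\<dots> = (\<Sum>i\<in>Basis. (v \<bullet> i) *\<^sub>R ?T i)"
      using lin[of "Suc N"] by (simp only: linear_sum linear_cmul)
    also have "norm \<dots> \<le> (\<Sum>i\<in>Basis. norm v * norm (?T i))"
      by (intro sum_norm_le) (auto intro!: mult_right_mono Basis_le_norm simp del: funpow.simps)
    also have "\<dots> = norm v * (\<Sum>i\<in>Basis. norm (?T i))" by (simp only: sum_distrib_left)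
    also have "\<dots> \<le> norm v * c"
      using N[of "Suc N"] by (intro mult_left_mono) auto
    finally show ?thesis by (simp add: mult.commute)
  qed
  then show ?thesis by blast
qed

section \<open>Multiplicity of the eigenvalue one\<close>

lemma det_row_combination:
  fixes B :: "'a::comm_ring_1^'n^'n"
  shows "det (\<chi> i. if i = k then (\<Sum>j\<in>UNIV. r $ j *s B $ j) else B $ i) = r $ k * det B"
proof -
  \<comment> \<open>A copy of row j in position k repeats a row unless j = k, and a repeated row
    makes the determinant vanish.\<close>
  have z: "det (\<chi> i. if i = k then B $ j else B $ i) = (if j = k then det B else 0)" for j
  proof (cases "j = k")
    case True
    then have "(\<chi> i. if i = k then B $ j else B $ i) = B" by (simp add: vec_eq_iff)
    then show ?thesis using True by simp
  next
    case False
    then show ?thesis using det_identical_rows[OF False, of "\<chi> i. if i = k then B $ j else B $ i"]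
      by (simp add: row_def vec_eq_iff)
  qed
  have "det (\<chi> i. if i = k then (\<Sum>j\<in>UNIV. r $ j *s B $ j) else B $ i)
    = (\<Sum>j\<in>UNIV. det (\<chi> i. if i = k then r $ j *s B $ j else B $ i))"
    by (rule det_linear_row_sum) simp
  also have "\<dots> = (\<Sum>j\<in>UNIV. r $ j * det (\<chi> i. if i = k then B $ j else B $ i))"
    by (intro sum.cong refl det_row_mul)
  also have "\<dots> = r $ k * det B" by (simp add: z if_distrib cong: if_cong)
  finally show ?thesis .
qed

lemma poly_charpoly_eq_0_if_eigenvector:
  assumes "cmat M *v v = \<mu> *s v" "v \<noteq> 0"
  shows "poly (cmplx_charpoly M) \<mu> = 0"
proof -
  have pd: "poly (det A) x = det (\<chi> i j. poly (A $ i $ j) x)" for A :: "complex poly^'n^'n" and x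
    by (simp add: det_def poly_sum poly_prod)
  define N where "N = mat \<mu> - cmat M"
  have "(\<chi> i j. poly ((\<chi> i j. (if i = j then [:0, 1:] else 0) - [:complex_of_real (M $ i $ j):]) $ i $ j) \<mu>) = N"
    by (simp add: N_def vec_eq_iff mat_def cmat_def)
  then have "poly (cmplx_charpoly M) \<mu> = det N" unfolding cmplx_charpoly_def pd by simp
  moreover have "N *v v = 0"
  proof -
    have "mat \<mu> *v v = \<mu> *s v"
      by (simp add: vec_eq_iff matrix_vector_mult_def mat_def if_distrib[of "\<lambda>c. c * _"] sum.delta cong: if_cong)
    then show ?thesis using assms(1) by (simp add: N_def matrix_vector_mult_diff_rdistrib)
  qed
  then have "\<not> inj ((*v) N)" using assms(2) by (metis injD matrix_vector_mult_0_right)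
  then have "\<not> invertible N" using matrix_left_invertible_injective unfolding invertible_def by blast
  ultimately show ?thesis using invertible_det_nz by auto
qed

text \<open>If the rows of B combined with coefficients r are a multiple of X - 1, this combination
  may replace row k at the price of the constant \<open>r $ k\<close>, and X - 1 comes out of the
  determinant. The gain requires a position k with nonzero \<open>r $ k\<close>.\<close>

lemma charpoly_row_step:
  fixes B :: "complex poly^'n^'n"
  assumes "(\<Sum>j\<in>UNIV. [:complex_of_real (r $ j):] *s B $ j) = [:-1, 1:] *s R"
  shows "[:complex_of_real (r $ k):] * det B = [:-1, 1:] * det (\<chi> i. if i = k then R else B $ i)"
proof -
  have "[:complex_of_real (r $ k):] * det B = det (\<chi> i. if i = k then [:-1, 1:] *s R else B $ i)"
    using det_row_combination[of k "\<chi> j. [:complex_of_real (r $ j):]" B] unfolding vec_lambda_beta assms by (rule sym)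
  then show ?thesis by (simp only: det_row_mul)
qed

text \<open>Replacing three rows of the transposed characteristic matrix by combinations along \<open>a\<close>, \<open>b\<close>, \<open>c\<close>
  extracts three factors \<open>X - 1\<close> from its determinant.\<close>

lemma order_charpoly_ge_3:
  fixes M :: "real^'n^'n"
  assumes fixed: "M *v a = a" "M *v b = b" "M *v c = c"
    and indep: "\<And>x y z. x *\<^sub>R a + y *\<^sub>R b + z *\<^sub>R c = 0 \<Longrightarrow> x = 0 \<and> y = 0 \<and> z = 0"
    and nz: "cmplx_charpoly M \<noteq> 0"
  shows "order 1 (cmplx_charpoly M) \<ge> 3"
proof -
  let ?e = "\<lambda>r. \<chi> j. [:complex_of_real ((r::real^'n) $ j):]"
  define B where "B = transpose (\<chi> i j. (if i = j then [:0, 1:] else 0) - [:complex_of_real (M $ i $ j):])"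
  have detB: "det B = cmplx_charpoly M" unfolding B_def cmplx_charpoly_def by (rule det_transpose)
  \<comment> \<open>The rows of B are the columns of X I - M, so combining them with coefficients r
    gives (X I - M) r, which is (X - 1) r when M fixes r.\<close>
  have comb: "(\<Sum>j\<in>UNIV. [:complex_of_real (r $ j):] *s B $ j) = [:-1, 1:] *s ?e r" if "M *v r = r" for r
  proof -
    have "(\<Sum>j\<in>UNIV. complex_of_real (r $ j) * complex_of_real (M $ i $ j)) = complex_of_real (r $ i)" for i
    proof -
      have "(\<Sum>j\<in>UNIV. r $ j * M $ i $ j) = r $ i"
        using arg_cong[OF that, of "\<lambda>v. v $ i"] by (simp add: matrix_vector_mult_def mult.commute)
      then have "complex_of_real (\<Sum>j\<in>UNIV. r $ j * M $ i $ j) = complex_of_real (r $ i)" by simp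
      then show ?thesis by simp
    qed
    moreover have "(\<Sum>j\<in>UNIV. [:complex_of_real (r $ j):] * ((if i = j then [:0, 1:] else 0) - [:complex_of_real (M $ i $ j):]))
      = [:0, complex_of_real (r $ i):] - [:\<Sum>j\<in>UNIV. complex_of_real (r $ j) * complex_of_real (M $ i $ j):]" for i
    proof -
      have "(\<Sum>j\<in>UNIV. [:complex_of_real (r $ j):] * (if i = j then [:0, 1:] else 0)) = [:0, complex_of_real (r $ i):]"
        by (subst sum.remove[of _ i]) auto
      moreover have "(\<Sum>j\<in>UNIV. [:complex_of_real (r $ j) * complex_of_real (M $ i $ j):])
        = [:\<Sum>j\<in>UNIV. complex_of_real (r $ j) * complex_of_real (M $ i $ j):]"
        by (rule poly_eqI) (simp add: coeff_sum coeff_pCons split: nat.split)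
      moreover have "[:x:] * [:y:] = [:x * y:]" for x y :: complex by simp
      ultimately show ?thesis by (simp only: right_diff_distrib sum_subtractf)
    qed
    ultimately have eq: "(\<Sum>j\<in>UNIV. [:complex_of_real (r $ j):] * ((if i = j then [:0, 1:] else 0) - [:complex_of_real (M $ i $ j):]))
      = [:0, complex_of_real (r $ i):] - [:complex_of_real (r $ i):]" for i by (simp only:)
    show ?thesis
    proof (rule vec_eq_iff[THEN iffD2, rule_format])
      fix i
      have "(\<Sum>j\<in>UNIV. [:complex_of_real (r $ j):] *s B $ j) $ i
        = (\<Sum>j\<in>UNIV. [:complex_of_real (r $ j):] * ((if i = j then [:0, 1:] else 0) - [:complex_of_real (M $ i $ j):]))"
        by (simp only: sum_component vector_smult_component B_def transpose_def vec_lambda_beta)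
      also have "\<dots> = ([:-1, 1:] *s ?e r) $ i" unfolding eq by simp
      finally show "(\<Sum>j\<in>UNIV. [:complex_of_real (r $ j):] *s B $ j) $ i = ([:-1, 1:] *s ?e r) $ i" .
    qed
  qed
  have "a \<noteq> 0" using indep[of 1 0 0] by auto
  then obtain i1 where i1: "a $ i1 \<noteq> 0" by (auto simp: vec_eq_iff)
  \<comment> \<open>Elimination: \<open>b'\<close> vanishes at i1, and \<open>c'\<close> at i1 and
    i2. The rows replaced before then do not enter the later combinations, which can still be
    computed from B.\<close>
  define b' where "b' = b - (b $ i1 / a $ i1) *\<^sub>R a"
  have b'1: "b' $ i1 = 0" using i1 by (simp add: b'_def)
  have b'f: "M *v b' = b'" by (simp add: b'_def matrix_vector_mult_diff_distrib matrix_vector_mult_scaleR fixed)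
  have "b' \<noteq> 0" using indep[of "- (b $ i1 / a $ i1)" 1 0] by (auto simp: b'_def)
  then obtain i2 where i2: "b' $ i2 \<noteq> 0" by (auto simp: vec_eq_iff)
  have i12: "i2 \<noteq> i1" using i2 b'1 by auto
  define c1 where "c1 = c - (c $ i1 / a $ i1) *\<^sub>R a"
  define c' where "c' = c1 - (c1 $ i2 / b' $ i2) *\<^sub>R b'"
  have c'1: "c' $ i1 = 0" using i1 b'1 by (simp add: c'_def c1_def)
  have c'2: "c' $ i2 = 0" using i2 by (simp add: c'_def)
  have c'f: "M *v c' = c'" using b'f by (simp add: c'_def c1_def matrix_vector_mult_diff_distrib matrix_vector_mult_scaleR fixed)
  have "c' \<noteq> 0"
  proof
    assume "c' = 0"
    then have "(- (c $ i1 / a $ i1) + (c1 $ i2 / b' $ i2) * (b $ i1 / a $ i1)) *\<^sub>R a + (- (c1 $ i2 / b' $ i2)) *\<^sub>R b + 1 *\<^sub>R c = 0"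
      by (simp add: c'_def c1_def b'_def algebra_simps)
    then show False using indep by fastforce
  qed
  then obtain i3 where i3: "c' $ i3 \<noteq> 0" by (auto simp: vec_eq_iff)
  have i13: "i3 \<noteq> i1" "i3 \<noteq> i2" using i3 c'1 c'2 by auto
  define B1 where "B1 = (\<chi> i. if i = i1 then ?e a else B $ i)"
  define B2 where "B2 = (\<chi> i. if i = i2 then ?e b' else B1 $ i)"
  define B3 where "B3 = (\<chi> i. if i = i3 then ?e c' else B2 $ i)"
  have s1: "[:complex_of_real (a $ i1):] * det B = [:-1, 1:] * det B1"
    unfolding B1_def by (rule charpoly_row_step[OF comb[OF fixed(1)]])
  have s2: "[:complex_of_real (b' $ i2):] * det B1 = [:-1, 1:] * det B2"
    unfolding B2_def
  proof (rule charpoly_row_step)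
    have "(\<Sum>j\<in>UNIV. [:complex_of_real (b' $ j):] *s B1 $ j) = (\<Sum>j\<in>UNIV. [:complex_of_real (b' $ j):] *s B $ j)"
      by (rule sum.cong) (auto simp: B1_def b'1)
    then show "(\<Sum>j\<in>UNIV. [:complex_of_real (b' $ j):] *s B1 $ j) = [:-1, 1:] *s ?e b'" using comb[OF b'f] by simp
  qed
  have s3: "[:complex_of_real (c' $ i3):] * det B2 = [:-1, 1:] * det B3"
    unfolding B3_def
  proof (rule charpoly_row_step)
    have "(\<Sum>j\<in>UNIV. [:complex_of_real (c' $ j):] *s B2 $ j) = (\<Sum>j\<in>UNIV. [:complex_of_real (c' $ j):] *s B $ j)"
      by (rule sum.cong) (auto simp: B1_def B2_def c'1 c'2)
    then show "(\<Sum>j\<in>UNIV. [:complex_of_real (c' $ j):] *s B2 $ j) = [:-1, 1:] *s ?e c'" using comb[OF c'f] by simp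
  qed
  let ?k = "complex_of_real (a $ i1) * complex_of_real (b' $ i2) * complex_of_real (c' $ i3)"
  have chain: "c * (b * (a * D)) = X ^ 3 * D3" if "a * D = X * D1" "b * D1 = X * D2" "c * D2 = X * D3"
    for a b c D X D1 D2 D3 :: "complex poly"
  proof -
    have "c * (b * (a * D)) = X * (c * (b * D1))" unfolding that(1) by (simp only: ac_simps)
    also have "\<dots> = X * (X * (c * D2))" unfolding that(2) by (simp only: ac_simps)
    also have "\<dots> = X ^ 3 * D3" unfolding that(3) by (simp only: power3_eq_cube ac_simps)
    finally show ?thesis .
  qed
  have "[:?k:] * det B = [:complex_of_real (c' $ i3):] * ([:complex_of_real (b' $ i2):] * ([:complex_of_real (a $ i1):] * det B))"
    by (simp add: ac_simps)
  also have "\<dots> = [:-1, 1:] ^ 3 * det B3" by (rule chain[OF s1 s2 s3])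
  finally have "[:?k:] * det B = [:-1, 1:] ^ 3 * det B3" .
  then have "smult ?k (det B) = [:-1, 1:] ^ 3 * det B3" by simp
  then have "[:-1, 1:] ^ 3 dvd smult ?k (det B)" by (metis dvd_triv_left)
  moreover have "?k \<noteq> 0" using i1 i2 i3 by simp
  ultimately have "[:-1, 1:] ^ 3 dvd det B" by (rule dvd_smult_cancel)
  then have "cmplx_charpoly M = 0 \<or> 3 \<le> order 1 (cmplx_charpoly M)"
    unfolding detB order_divides .
  then show ?thesis using nz by blast
qed

definition deflate :: "real^'n \<Rightarrow> real^'n \<Rightarrow> real^'n \<Rightarrow> real^'n \<Rightarrow> real^'n \<Rightarrow> real^'n" where
  "deflate q1 q2 p1 p2 v = v - (p1 \<bullet> v) *\<^sub>R q1 - (p2 \<bullet> v) *\<^sub>R q2"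

text \<open>Subtracting the projection onto \<open>q1\<close>, \<open>q2\<close> turns the double multiplier 1 into 0. An eigenvector for 1
  left after that would yield three independent fixed vectors of \<open>Y\<close>.\<close>

lemma deflated_monodromy_contracts:
  fixes Y :: "real^'n^'n"
  assumes Yq: "Y *v q1 = q1" "Y *v q2 = q2"
    and pY: "\<And>v. p1 \<bullet> (Y *v v) = p1 \<bullet> v" "\<And>v. p2 \<bullet> (Y *v v) = p2 \<bullet> v"
    and pq: "p1 \<bullet> q1 = 1" "p1 \<bullet> q2 = 0" "p2 \<bullet> q1 = 0" "p2 \<bullet> q2 = 1"
    and order: "order 1 (cmplx_charpoly Y) = 2"
    and roots: "\<And>\<mu>. poly (cmplx_charpoly Y) \<mu> = 0 \<Longrightarrow> \<mu> = 1 \<or> cmod \<mu> < 1"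
    and c: "c > 0"
  shows "\<exists>N>0. \<forall>v. norm (deflate q1 q2 p1 p2 ((((*v) Y) ^^ N) v)) \<le> c * norm v"
proof -
  \<comment> \<open>Y followed by the projection along q1 and q2. The projection commutes with Y, so
    powers of M are deflated powers of Y, and it remains to place all eigenvalues of M inside the
    unit disc.\<close>
  define M where "M = (\<chi> i j. Y $ i $ j - q1 $ i * p1 $ j - q2 $ i * p2 $ j)"
  have M: "M *v v = deflate q1 q2 p1 p2 (Y *v v)" for v
  proof -
    have "(M *v v) $ i = (Y *v v) $ i - q1 $ i * (p1 \<bullet> v) - q2 $ i * (p2 \<bullet> v)" for i
      by (simp add: M_def matrix_vector_mult_def inner_vec_def left_diff_distrib sum_subtractf sum_distrib_left mult.assoc)
    then show ?thesis by (simp add: deflate_def vec_eq_iff pY mult.commute)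
  qed
  have ev: "cmod \<mu> < 1" if v: "v \<noteq> 0" "cmat M *v v = \<mu> *s v" for \<mu> v
  proof (cases "\<mu> = 0")
    case False
    let ?L = "\<lambda>p v. \<Sum>i\<in>UNIV. complex_of_real ((p::real^'n) $ i) * v $ i"
    have Mv: "(cmat M *v w) $ i = (cmat Y *v w) $ i - complex_of_real (q1 $ i) * ?L p1 w - complex_of_real (q2 $ i) * ?L p2 w" for w i
      by (simp add: M_def cmat_def matrix_vector_mult_def left_diff_distrib sum_subtractf sum_distrib_left mult.assoc)
    have LY: "?L p (cmat Y *v w) = ?L p w" if "\<And>v. p \<bullet> (Y *v v) = p \<bullet> v" for p w
    proof -
      have pY_col: "(\<Sum>i\<in>UNIV. complex_of_real (p $ i) * complex_of_real (Y $ i $ k)) = complex_of_real (p $ k)" for k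
      proof -
        have "(\<Sum>i\<in>UNIV. p $ i * Y $ i $ k) = p \<bullet> (Y *v axis k 1)"
          by (simp add: matrix_vector_mult_basis inner_vec_def column_def)
        also have "\<dots> = p $ k" by (simp add: that inner_axis)
        finally have "complex_of_real (\<Sum>i\<in>UNIV. p $ i * Y $ i $ k) = complex_of_real (p $ k)" by simp
        then show ?thesis by simp
      qed
      have "?L p (cmat Y *v w) = (\<Sum>i\<in>UNIV. \<Sum>k\<in>UNIV. complex_of_real (p $ i) * complex_of_real (Y $ i $ k) * w $ k)"
        by (simp add: cmat_def matrix_vector_mult_def sum_distrib_left mult.assoc)
      also have "\<dots> = (\<Sum>k\<in>UNIV. \<Sum>i\<in>UNIV. complex_of_real (p $ i) * complex_of_real (Y $ i $ k) * w $ k)"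
        by (rule sum.swap)
      also have "\<dots> = ?L p w" by (simp add: sum_distrib_right[symmetric] pY_col)
      finally show ?thesis .
    qed
    have Lq: "(\<Sum>i\<in>UNIV. complex_of_real (p $ i) * (complex_of_real (q $ i) * z)) = complex_of_real (p \<bullet> q) * z" for p q :: "real^'n" and z
      by (simp add: inner_vec_def sum_distrib_right mult.assoc)
    \<comment> \<open>p1 and p2 annihilate the range of M. An eigenvector for \<mu> other than 0
      lies in this range, so deflation does not affect it and it is an eigenvector of Y.\<close>
    have L0: "?L p1 (cmat M *v v) = 0" "?L p2 (cmat M *v v) = 0"
      by (simp_all add: Mv right_diff_distrib sum_subtractf Lq pq LY[OF pY(1)] LY[OF pY(2)])
    have "?L p (\<mu> *s v) = \<mu> * ?L p v" for p by (simp add: sum_distrib_left mult.left_commute)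
    then have L: "?L p1 v = 0" "?L p2 v = 0" using L0 False unfolding v(2) by auto
    then have Yv: "cmat Y *v v = \<mu> *s v" using v(2) Mv by (simp add: vec_eq_iff)
    then have "\<mu> = 1 \<or> cmod \<mu> < 1" using poly_charpoly_eq_0_if_eigenvector v(1) roots by blast
    moreover have "\<mu> \<noteq> 1"
    proof
      assume [simp]: "\<mu> = 1"
      have third: False if r: "r \<noteq> 0" "Y *v r = r" "p1 \<bullet> r = 0" "p2 \<bullet> r = 0" for r
      proof -
        have "cmplx_charpoly Y \<noteq> 0"
        proof
          assume "cmplx_charpoly Y = 0"
          \<comment> \<open>The zero polynomial would vanish at 5, which is neither 1 nor inside the
            unit disc.\<close>
          then show False using roots[of 5] by simp
        qed
        moreover have "x = 0 \<and> y = 0 \<and> z = 0" if eq: "x *\<^sub>R q1 + y *\<^sub>R q2 + z *\<^sub>R r = 0" for x y z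
        proof -
          have "p1 \<bullet> (x *\<^sub>R q1 + y *\<^sub>R q2 + z *\<^sub>R r) = x" "p2 \<bullet> (x *\<^sub>R q1 + y *\<^sub>R q2 + z *\<^sub>R r) = y"
            by (simp_all add: inner_add_right pq r)
          then have "x = 0" "y = 0" unfolding eq by simp_all
          then show ?thesis using eq r by simp
        qed
        ultimately show False using order_charpoly_ge_3[OF Yq r(2)] order by fastforce
      qed
      \<comment> \<open>The real and imaginary parts of v are real vectors fixed by Y and
        annihilated by p1 and p2; each would be a third independent fixed vector unless it is
        zero.\<close>
      define a where "a = (\<chi> i. Re (v $ i))"
      define b where "b = (\<chi> i. Im (v $ i))"
      have "(\<Sum>j\<in>UNIV. complex_of_real (Y $ i $ j) * v $ j) = v $ i" for i
        using Yv by (simp add: vec_eq_iff cmat_def matrix_vector_mult_def)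
      then have "Re (\<Sum>j\<in>UNIV. complex_of_real (Y $ i $ j) * v $ j) = Re (v $ i)"
        "Im (\<Sum>j\<in>UNIV. complex_of_real (Y $ i $ j) * v $ j) = Im (v $ i)" for i by simp_all
      then have Yab: "Y *v a = a" "Y *v b = b"
        by (simp_all add: a_def b_def vec_eq_iff matrix_vector_mult_def)
      have "Re (?L p1 v) = 0" "Im (?L p1 v) = 0" "Re (?L p2 v) = 0" "Im (?L p2 v) = 0"
        unfolding L by simp_all
      then have pab: "p1 \<bullet> a = 0" "p1 \<bullet> b = 0" "p2 \<bullet> a = 0" "p2 \<bullet> b = 0"
        by (simp_all add: a_def b_def inner_vec_def)
      have "a = 0" "b = 0" using third[OF _ Yab(1)] third[OF _ Yab(2)] pab by blast+
      then have "v = 0" by (simp add: a_def b_def vec_eq_iff complex_eq_iff)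
      then show False using v(1) by simp
    qed
    ultimately show ?thesis by blast
  qed simp
  have "\<exists>N>0. \<forall>v. norm ((((*v) M) ^^ N) v) \<le> c * norm v"
    by (rule matrix_power_contracts[OF ev c])
  then obtain N where N: "N > 0" "\<And>v. norm ((((*v) M) ^^ N) v) \<le> c * norm v" by auto
  have pw: "(((*v) M) ^^ Suc k) v = deflate q1 q2 p1 p2 ((((*v) Y) ^^ Suc k) v)" for k v
  proof (induction k)
    case 0 then show ?case by (simp add: M)
  next
    case (Suc k)
    have "(((*v) M) ^^ Suc (Suc k)) v = M *v ((((*v) M) ^^ Suc k) v)" by simp
    also have "\<dots> = deflate q1 q2 p1 p2 (Y *v deflate q1 q2 p1 p2 ((((*v) Y) ^^ Suc k) v))"
      by (simp only: Suc M)
    also have "\<dots> = deflate q1 q2 p1 p2 ((((*v) Y) ^^ Suc (Suc k)) v)"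
      by (simp add: deflate_def matrix_vector_mult_diff_distrib matrix_vector_mult_scaleR Yq inner_diff_right pq pY algebra_simps)
    finally show ?case .
  qed
  have "norm (deflate q1 q2 p1 p2 ((((*v) Y) ^^ N) v)) \<le> c * norm v" for v
    using N(2)[of v] pw[of "N - 1" v] N(1) by simp
  then show ?thesis using N(1) by blast
qed

subsection \<open>The one-parameter group of a skew matrix\<close>

lemma norm_matrix_le_entries:
  fixes M :: "real^'n^'m"
  assumes "\<And>i j. \<bar>M $ i $ j\<bar> \<le> b"
  shows "norm M \<le> real CARD('m) * (real CARD('n) * b)"
proof -
  have "norm M \<le> (\<Sum>i\<in>UNIV. norm (M $ i))" by (simp add: norm_vec_def L2_set_le_sum)
  also have "\<dots> \<le> (\<Sum>i\<in>(UNIV::'m set). real CARD('n) * b)"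
  proof (rule sum_mono)
    fix i
    have "norm (M $ i) \<le> (\<Sum>j\<in>UNIV. \<bar>M $ i $ j\<bar>)" by (rule norm_le_l1_cart)
    also have "\<dots> \<le> (\<Sum>j\<in>(UNIV::'n set). b)" by (rule sum_mono) (rule assms)
    finally show "norm (M $ i) \<le> real CARD('n) * b" by simp
  qed
  finally show ?thesis by simp
qed

definition mat_pow :: "real^'n^'n \<Rightarrow> nat \<Rightarrow> real^'n^'n" where
  "mat_pow A k = ((\<lambda>B. A ** B) ^^ k) (mat 1)"

lemma mat_pow_simps: "mat_pow A 0 = mat 1" "mat_pow A (Suc k) = A ** mat_pow A k"
  by (simp_all add: mat_pow_def)

lemma mat_pow_scaleR: "((\<lambda>B. (\<xi> *\<^sub>R A) ** B) ^^ k) (mat 1) = \<xi> ^ k *\<^sub>R mat_pow A k"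
  by (induction k)
    (simp_all add: mat_pow_simps vec_eq_iff matrix_matrix_mult_def sum_distrib_left algebra_simps)

lemma mat_pow_bound: "\<exists>K\<ge>0. \<forall>k i j. \<bar>mat_pow A k $ i $ j\<bar> \<le> K ^ k"
proof -
  define K where "K = (\<Sum>i\<in>UNIV. \<Sum>l\<in>UNIV. \<bar>A $ i $ l\<bar>)"
  have K: "K \<ge> 0" unfolding K_def by (intro sum_nonneg) auto
  have row: "(\<Sum>l\<in>UNIV. \<bar>A $ i $ l\<bar>) \<le> K" for i
    unfolding K_def by (rule member_le_sum[of i UNIV "\<lambda>i. \<Sum>l\<in>UNIV. \<bar>A $ i $ l\<bar>"]) (auto intro: sum_nonneg)
  have "\<bar>mat_pow A k $ i $ j\<bar> \<le> K ^ k" for k i j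
  proof (induction k arbitrary: i)
    case 0 then show ?case by (simp add: mat_pow_simps mat_def)
  next
    case (Suc k)
    have "\<bar>mat_pow A (Suc k) $ i $ j\<bar> \<le> (\<Sum>l\<in>UNIV. \<bar>A $ i $ l * mat_pow A k $ l $ j\<bar>)"
      by (simp add: mat_pow_simps matrix_matrix_mult_def sum_abs)
    also have "\<dots> \<le> (\<Sum>l\<in>UNIV. \<bar>A $ i $ l\<bar> * K ^ k)"
      by (rule sum_mono) (auto simp: abs_mult intro: mult_left_mono Suc)
    also have "\<dots> \<le> K * K ^ k" unfolding sum_distrib_right[symmetric] using row K by (intro mult_right_mono) auto
    finally show ?case by simp
  qed
  then show ?thesis using K by blast
qed

text \<open>Entrywise the matrix exponential is a scalar power series that converges everywhere by
  comparison with the exponential series, which opens the way to termwise differentiation.\<close>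

lemma mat_exp_entry:
  "mat_exp (\<xi> *\<^sub>R A) $ i $ j = (\<Sum>k. (mat_pow A k $ i $ j / fact k) * \<xi> ^ k)"
  and mat_exp_entry_summable: "summable (\<lambda>k. (mat_pow A k $ i $ j / fact k) * \<xi> ^ k)"
proof -
  let ?f = "\<lambda>k. (1 / fact k) *\<^sub>R (\<xi> ^ k *\<^sub>R mat_pow A k)"
  obtain K where K: "K \<ge> 0" "\<And>k i j. \<bar>mat_pow A k $ i $ j\<bar> \<le> K ^ k" using mat_pow_bound by blast
  let ?n = "real CARD('a)"
  have sm: "summable ?f"
  proof (rule summable_comparison_test)
    show "summable (\<lambda>k. ?n * (?n * ((\<bar>\<xi>\<bar> * K) ^ k /\<^sub>R fact k)))"
      by (intro summable_mult summable_exp_generic)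
    have "norm (mat_pow A k) \<le> ?n * (?n * K ^ k)" for k by (rule norm_matrix_le_entries[OF K(2)])
    then have "norm (?f k) \<le> (1 / fact k) * (\<bar>\<xi>\<bar> ^ k * (?n * (?n * K ^ k)))" for k
      by (simp add: power_abs divide_right_mono mult_left_mono)
    then show "\<exists>N. \<forall>k\<ge>N. norm (?f k) \<le> ?n * (?n * ((\<bar>\<xi>\<bar> * K) ^ k /\<^sub>R fact k))"
      by (auto simp: field_simps power_mult_distrib)
  qed
  have bl: "bounded_linear (\<lambda>M::real^'a^'a. M $ i $ j)"
    by (intro bounded_linear_compose[OF bounded_linear_vec_nth bounded_linear_vec_nth, unfolded o_def])
  have e: "?f k $ i $ j = (mat_pow A k $ i $ j / fact k) * \<xi> ^ k" for k by simp
  show "summable (\<lambda>k. (mat_pow A k $ i $ j / fact k) * \<xi> ^ k)"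
    using bounded_linear.summable[OF bl sm] unfolding e .
  show "mat_exp (\<xi> *\<^sub>R A) $ i $ j = (\<Sum>k. (mat_pow A k $ i $ j / fact k) * \<xi> ^ k)"
    using bounded_linear.suminf[OF bl sm] unfolding e mat_exp_def mat_pow_scaleR .
qed

lemma mat_exp_entry_derivative:
  "((\<lambda>\<xi>. mat_exp (\<xi> *\<^sub>R A) $ i $ j) has_real_derivative (A ** mat_exp (\<xi> *\<^sub>R A)) $ i $ j) (at \<xi>)"
proof -
  let ?c = "\<lambda>i k. mat_pow A k $ i $ j / fact k"
  have "((\<lambda>\<xi>. \<Sum>k. ?c i k * \<xi> ^ k) has_real_derivative (\<Sum>k. diffs (?c i) k * \<xi> ^ k)) (at \<xi>)"
    by (rule termdiffs_strong_converges_everywhere) (rule mat_exp_entry_summable)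
  \<comment> \<open>Differentiation shifts the coefficients by one, which multiplies
    \<open>mat_pow\<close> by A from the left.\<close>
  moreover have "diffs (?c i) k * \<xi> ^ k = (\<Sum>l\<in>UNIV. A $ i $ l * (?c l k * \<xi> ^ k))" for k
  proof -
    have "real (Suc k) * (y / fact (Suc k)) = y / fact k" for y :: real by (simp add: fact_Suc del: of_nat_Suc)
    then have "diffs (?c i) k = mat_pow A (Suc k) $ i $ j / fact k" unfolding diffs_def .
    then show ?thesis
      by (simp add: mat_pow_simps matrix_matrix_mult_def sum_divide_distrib sum_distrib_right mult.assoc)
  qed
  moreover have "(\<Sum>k. \<Sum>l\<in>UNIV. A $ i $ l * (?c l k * \<xi> ^ k)) = (A ** mat_exp (\<xi> *\<^sub>R A)) $ i $ j"
    by (subst suminf_sum)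
      (simp_all only: suminf_mult mat_exp_entry_summable summable_mult matrix_matrix_mult_def mat_exp_entry vec_lambda_beta)
  ultimately show ?thesis by (simp add: mat_exp_entry)
qed

lemma mat_exp_has_vector_derivative:
  "((\<lambda>\<xi>. mat_exp (\<xi> *\<^sub>R A) *v x) has_vector_derivative A *v (mat_exp (\<xi> *\<^sub>R A) *v x)) (at \<xi>)"
proof -
  have "((\<lambda>\<xi>. (mat_exp (\<xi> *\<^sub>R A) *v x) $ i) has_real_derivative ((A ** mat_exp (\<xi> *\<^sub>R A)) *v x) $ i) (at \<xi>)" for i
    unfolding matrix_vector_mult_def[of "mat_exp _"] matrix_vector_mult_def[of "_ ** _"] vec_lambda_beta
    by (intro DERIV_sum DERIV_cmult_right mat_exp_entry_derivative)
  then show ?thesis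
    unfolding has_real_derivative_iff_has_vector_derivative has_vector_derivative_def
      has_derivative_componentwise_within[of "\<lambda>\<xi>. mat_exp (\<xi> *\<^sub>R A) *v x"]
    by (auto simp: Basis_vec_def inner_axis matrix_vector_mul_assoc)
qed

lemma mat_exp_zero: "mat_exp (0 *\<^sub>R A) = mat 1"
proof -
  have "(\<Sum>k. (mat_pow A k $ i $ j / fact k) * 0 ^ k) = mat 1 $ i $ j" for i j
    using powser_zero[of "\<lambda>k. mat_pow A k $ i $ j / fact k"] by (simp add: mat_pow_simps)
  then show ?thesis by (simp only: vec_eq_iff mat_exp_entry) simp
qed

lemma skew_inner_zero:
  assumes "transpose A = - (A::real^'n^'n)"
  shows "(A *v x) \<bullet> x = 0"
proof -
  have "(A *v x) \<bullet> x = x \<bullet> (transpose A *v x)"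
    by (metis dot_lmul_matrix inner_commute transpose_matrix_vector)
  also have "\<dots> = - ((A *v x) \<bullet> x)"
    unfolding assms by (simp add: matrix_vector_mult_def inner_vec_def sum_negf mult.commute)
  finally show ?thesis by simp
qed

lemma skew_flow_norm_const:
  assumes A: "transpose A = - (A::real^'n^'n)"
    and z: "\<And>t. (z has_vector_derivative A *v z t) (at t)"
  shows "norm (z t) = norm (z 0)"
proof -
  have "((\<lambda>t. z t \<bullet> z t) has_real_derivative 0) (at t)" for t
  proof -
    have "((\<lambda>t. z t \<bullet> z t) has_vector_derivative (z t \<bullet> (A *v z t) + (A *v z t) \<bullet> z t)) (at t)"
      using has_derivative_inner[OF z[unfolded has_vector_derivative_def] z[unfolded has_vector_derivative_def], of t]
      by (simp add: has_vector_derivative_def algebra_simps)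
    then show ?thesis
      using skew_inner_zero[OF A] by (simp add: has_real_derivative_iff_has_vector_derivative inner_commute)
  qed
  then have "z t \<bullet> z t = z 0 \<bullet> z 0" by (rule DERIV_isconst_all[rule_format, of "\<lambda>t. z t \<bullet> z t"])
  then show ?thesis by (simp add: norm_eq_sqrt_inner)
qed

text \<open>The difference of two solutions has constant norm because A is skew.\<close>

lemma skew_flow_unique:
  assumes A: "transpose A = - (A::real^'n^'n)"
    and z: "\<And>t. (z has_vector_derivative A *v z t) (at t)"
    and w: "\<And>t. (w has_vector_derivative A *v w t) (at t)" and "z 0 = w 0"
  shows "z t = w t"
proof -
  have "norm (z t - w t) = norm (z 0 - w 0)"
    by (rule skew_flow_norm_const[OF A, of "\<lambda>t. z t - w t"])
      (use has_vector_derivative_diff[OF z w] in \<open>simp add: matrix_vector_mult_diff_distrib\<close>)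
  then show ?thesis using assms(4) by simp
qed

lemma mat_exp_norm: "transpose A = - (A::real^'n^'n) \<Longrightarrow> norm (mat_exp (\<xi> *\<^sub>R A) *v x) = norm x"
  using skew_flow_norm_const[of A "\<lambda>\<xi>. mat_exp (\<xi> *\<^sub>R A) *v x" \<xi>, OF _ mat_exp_has_vector_derivative] by (simp add: mat_exp_zero[of A, simplified])

text \<open>As functions of \<xi> both sides solve z' = A z with the same value at 0; this avoids
  multiplying exponential series.\<close>

lemma mat_exp_add:
  assumes A: "transpose A = - (A::real^'n^'n)"
  shows "mat_exp ((\<xi> + \<eta>) *\<^sub>R A) *v x = mat_exp (\<xi> *\<^sub>R A) *v (mat_exp (\<eta> *\<^sub>R A) *v x)"
proof (rule skew_flow_unique[OF A, of "\<lambda>\<xi>. mat_exp ((\<xi> + \<eta>) *\<^sub>R A) *v x" "\<lambda>\<xi>. mat_exp (\<xi> *\<^sub>R A) *v (mat_exp (\<eta> *\<^sub>R A) *v x)"])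
  fix t
  have "((\<lambda>t. t + \<eta>) has_vector_derivative 1) (at t)" by (auto intro!: derivative_eq_intros)
  from vector_diff_chain_at[OF this mat_exp_has_vector_derivative]
  show "((\<lambda>\<xi>. mat_exp ((\<xi> + \<eta>) *\<^sub>R A) *v x) has_vector_derivative A *v (mat_exp ((t + \<eta>) *\<^sub>R A) *v x)) (at t)"
    by (simp add: o_def)
qed (use mat_exp_zero[of A] mat_exp_has_vector_derivative in simp_all)

subsection \<open>Averaging over a bounded time\<close>

lemma norm_triple_le: "norm (x, s, 0::real) \<le> norm x + \<bar>s\<bar>" for s :: real
  using norm_Pair_le[of x "(s, 0::real)"] by (simp add: norm_Pair)

lemma norm_triple_diff: "norm ((y, s, r) - (x, s, r)) = norm (y - x)" for s r :: real
  by (simp add: norm_Pair)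

text \<open>The unperturbed system in the rotating frame, with one constant \<open>C\<close> bounding everything needed
  on the ball of radius \<open>R\<close>. The last argument of \<open>g\<close> and \<open>u\<close> is the fast phase.\<close>

locale averaging_step =
  fixes F :: "'a::euclidean_space \<Rightarrow> 'a" and DF :: "'a \<Rightarrow> 'a \<Rightarrow> 'a"
    and g u :: "'a \<times> real \<times> real \<Rightarrow> 'a" and Du :: "'a \<times> real \<times> real \<Rightarrow> 'a \<times> real \<times> real \<Rightarrow> 'a"
    and X :: "real \<Rightarrow> 'a" and \<beta>0 R C \<tau> :: real
  assumes C: "C \<ge> 1" and \<tau>: "\<tau> > 0" and \<beta>0: "\<beta>0 > 0"
    and X_bound: "\<And>\<psi>. norm (X \<psi>) + 1 \<le> R"
    and X_deriv: "\<And>\<psi>. (X has_vector_derivative (1 / \<beta>0) *\<^sub>R F (X \<psi>)) (at \<psi>)"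
    and F_bound: "\<And>x. norm x \<le> R \<Longrightarrow> norm (F x) \<le> C"
    and F_taylor: "\<And>x y. norm x \<le> R \<Longrightarrow> norm y \<le> R \<Longrightarrow> norm (F y - F x - DF x (y - x)) \<le> C * (norm (y - x))\<^sup>2"
    and F_lip: "\<And>x y. norm x \<le> R \<Longrightarrow> norm y \<le> R \<Longrightarrow> norm (F x - F y) \<le> C * norm (x - y)"
    and DF_linear: "\<And>x. linear (DF x)"
    and DF_bound: "\<And>x v. norm x \<le> R \<Longrightarrow> norm (DF x v) \<le> C * norm v"
    and DF_lip: "\<And>x y v. norm x \<le> R \<Longrightarrow> norm y \<le> R \<Longrightarrow> norm (DF x v - DF y v) \<le> C * norm (x - y) * norm v"
    and u_deriv: "\<And>z. (u has_derivative Du z) (at z)"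
    and u_bound: "\<And>z. norm (fst z) \<le> R \<Longrightarrow> norm (u z) \<le> C"
    and u_lip: "\<And>z w. norm (fst z) \<le> R \<Longrightarrow> norm (fst w) \<le> R \<Longrightarrow> norm (u z - u w) \<le> C * norm (z - w)"
    and Du_bound: "\<And>z v. norm (fst z) \<le> R \<Longrightarrow> norm (Du z v) \<le> C * norm v"
    and Du_lip: "\<And>z w v. norm (fst z) \<le> R \<Longrightarrow> norm (fst w) \<le> R \<Longrightarrow> norm (Du z v - Du w v) \<le> C * norm (z - w) * norm v"
    and g_bound: "\<And>z. norm (fst z) \<le> R \<Longrightarrow> norm (g z) \<le> C"
    and g_lip: "\<And>z w. norm (fst z) \<le> R \<Longrightarrow> norm (fst w) \<le> R \<Longrightarrow> norm (g z - g w) \<le> C * norm (z - w)"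
    and Du_fast: "\<And>z. Du z (0, 0, 1) = g z"
    and u_per: "\<And>x \<theta> \<phi>. u (x, \<theta>, \<phi> + 2 * pi) = u (x, \<theta>, \<phi>)"
    and Du_per: "\<And>x \<theta> \<phi>. Du (x, \<theta>, \<phi> + 2 * pi) = Du (x, \<theta>, \<phi>)"
    and u_mean: "\<And>x \<theta>. integral {0..2 * pi} (\<lambda>\<phi>. u (x, \<theta>, \<phi>)) = 0"
    and Du_mean: "\<And>x \<theta> v. integral {0..2 * pi} (\<lambda>\<phi>. Du (x, \<theta>, \<phi>) v) = 0"
    and F_cont: "continuous_on UNIV F" and g_cont: "continuous_on UNIV g"
    and DF_cont: "continuous_on UNIV (\<lambda>(x, v). DF x v)"
    and Du_cont: "continuous_on UNIV (\<lambda>(z, v). Du z v)"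
begin

lemma Du_linear: "linear (Du z)" using u_deriv has_derivative_linear by blast

lemma X_le_R: "norm (X \<psi>) \<le> R" using X_bound[of \<psi>] by linarith

lemma u_cont: "continuous_on UNIV u"
  by (rule differentiable_imp_continuous_on)
    (auto simp: differentiable_on_def intro: differentiableI[OF u_deriv])

lemma X_cont: "continuous_on UNIV X"
  by (rule vector_derivative_imp_continuous_on[OF X_deriv])

lemma cont_compose:
  assumes "continuous_on S p" "continuous_on S q"
  shows "continuous_on S (\<lambda>s. DF (p s) (q s))"
  using continuous_on_compose2[OF DF_cont continuous_on_Pair[OF assms]] by auto

lemma cont_compose_Du:
  assumes "continuous_on S p" "continuous_on S q"
  shows "continuous_on S (\<lambda>s. Du (p s) (q s))"
  using continuous_on_compose2[OF Du_cont continuous_on_Pair[OF assms]] by auto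

lemma cont_compose1:
  assumes "continuous_on S q"
  shows "continuous_on S (\<lambda>s. u (q s))" "continuous_on S (\<lambda>s. g (q s))"
  using continuous_on_compose2[OF u_cont assms] continuous_on_compose2[OF g_cont assms] by auto

lemma cont_compose2:
  assumes "continuous_on S p"
  shows "continuous_on S (\<lambda>s. F (p s))"
  using continuous_on_compose2[OF F_cont assms] by auto

lemma cont_compose3:
  assumes "continuous_on S r"
  shows "continuous_on S (\<lambda>s. X (r s))"
  using continuous_on_compose2[OF X_cont assms] by auto

lemmas conts = cont_compose cont_compose_Du cont_compose1 cont_compose2 cont_compose3

text \<open>Coefficients of the terms of order \<open>\<gamma> / \<omega>\<close> and \<open>\<gamma>\<^sup>2 / \<omega>\<close> that the transformation
  \<open>y \<mapsto> y - (\<gamma> / \<omega>) u(y)\<close> leaves on the unperturbed orbit; only the second has a nonzero mean.\<close>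

definition vdrift :: "real \<Rightarrow> real \<Rightarrow> real \<Rightarrow> real \<Rightarrow> 'a" where
  "vdrift \<beta> \<psi> \<theta> \<phi> = DF (X \<psi>) (u (X \<psi>, \<theta>, \<phi>)) - Du (X \<psi>, \<theta>, \<phi>) (F (X \<psi>), \<beta>, 0)"

definition mdrift :: "real \<Rightarrow> real \<Rightarrow> real \<Rightarrow> 'a" where
  "mdrift \<psi> \<theta> \<phi> = - Du (X \<psi>, \<theta>, \<phi>) (g (X \<psi>, \<theta>, \<phi>), 0, 0)"

text \<open>In the application this is \<open>g2_of\<close> at the torus point with phase
  \<psi>.\<close>

definition mmean :: "real \<Rightarrow> real \<Rightarrow> 'a" where
  "mmean \<psi> \<theta> = (1 / (2 * pi)) *\<^sub>R integral {0..2 * pi} (mdrift \<psi> \<theta>)"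

text \<open>Every group of terms vanishes at y = x: F deviates from its linear part quadratically,
  and the terms with prefactor a or \<rho> are Lipschitz in y. Expanding DF of the transformed
  deviation leaves a DF(u) at y, which is paired with the same term at x.\<close>

lemma remainder_bound:
  assumes x: "norm x \<le> R" and y: "norm y \<le> R" and a: "a \<ge> 0" and \<rho>: "\<rho> \<ge> 0" and \<beta>: "0 \<le> \<beta>" "\<beta> \<le> C"
  shows "norm (F y - F x - a *\<^sub>R Du (y, \<theta>, \<phi>) (F y, \<beta>, 0) - \<rho> *\<^sub>R Du (y, \<theta>, \<phi>) (g (y, \<theta>, \<phi>), 0, 0)
      - DF x (y - a *\<^sub>R u (y, \<theta>, \<phi>) - x)
      - a *\<^sub>R (DF x (u (x, \<theta>, \<phi>)) - Du (x, \<theta>, \<phi>) (F x, \<beta>, 0))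
      + \<rho> *\<^sub>R Du (x, \<theta>, \<phi>) (g (x, \<theta>, \<phi>), 0, 0))
    \<le> 4 * C\<^sup>2 * norm (y - x) * (norm (y - x) + a + \<rho>)"
proof -
  define z where "z = (y, \<theta>, \<phi>)"
  define w where "w = (x, \<theta>, \<phi>)"
  define D where "D = norm (y - x)"
  have zw: "norm (z - w) = D" unfolding z_def w_def D_def by (rule norm_triple_diff)
  have zR: "norm (fst z) \<le> R" "norm (fst w) \<le> R" using x y by (auto simp: z_def w_def)
  have D0: "D \<ge> 0" by (simp add: D_def)
  note ld = linear_diff[OF DF_linear] linear_cmul[OF DF_linear] linear_add[OF DF_linear]
  have t1: "norm (F y - F x - DF x (y - x)) \<le> C * D\<^sup>2" unfolding D_def by (rule F_taylor[OF x y])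
  have t2: "norm (DF x (u z - u w)) \<le> C * (C * D)"
    using DF_bound[OF x, of "u z - u w"] u_lip[OF zR] C unfolding zw
    by (meson mult_left_mono order_trans zero_le_one)
  have nb: "norm (F y, \<beta>, 0::real) \<le> 2 * C" using norm_triple_le[of "F y" \<beta>] F_bound[OF y] \<beta> by simp
  have t3: "norm (Du z (F y, \<beta>, 0) - Du w (F x, \<beta>, 0)) \<le> 3 * C\<^sup>2 * D"
  proof -
    have "Du z (F y, \<beta>, 0) - Du w (F x, \<beta>, 0) = (Du z (F y, \<beta>, 0) - Du w (F y, \<beta>, 0)) + Du w (F y - F x, 0, 0)"
      using linear_diff[OF Du_linear, of w "(F y, \<beta>, 0)" "(F x, \<beta>, 0)"] by (simp add: zero_prod_def)
    also have "norm \<dots> \<le> C * D * (2 * C) + C * (C * D)"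
    proof (rule norm_triangle_le, rule add_mono)
      show "norm (Du z (F y, \<beta>, 0) - Du w (F y, \<beta>, 0)) \<le> C * D * (2 * C)"
        using Du_lip[OF zR, of "(F y, \<beta>, 0)"] nb C D0 unfolding zw
        by (meson mult_left_mono mult_nonneg_nonneg order_trans zero_le_one)
      have "norm (F y - F x, 0::real, 0::real) \<le> C * D" using F_lip[OF y x] by (simp add: norm_Pair D_def)
      then show "norm (Du w (F y - F x, 0, 0)) \<le> C * (C * D)"
        using Du_bound[OF zR(2), of "(F y - F x, 0, 0)"] C by (meson mult_left_mono order_trans zero_le_one)
    qed
    finally show ?thesis by (simp add: power2_eq_square algebra_simps)
  qed
  have t4: "norm (Du z (g z, 0, 0) - Du w (g w, 0, 0)) \<le> 2 * C\<^sup>2 * D"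
  proof -
    have "Du z (g z, 0, 0) - Du w (g w, 0, 0) = (Du z (g z, 0, 0) - Du w (g z, 0, 0)) + Du w (g z - g w, 0, 0)"
      using linear_diff[OF Du_linear, of w "(g z, 0, 0)" "(g w, 0, 0)"] by (simp add: zero_prod_def)
    also have "norm \<dots> \<le> C * D * C + C * (C * D)"
    proof (rule norm_triangle_le, rule add_mono)
      have "norm (g z, 0::real, 0::real) \<le> C" using g_bound[OF zR(1)] by (simp add: norm_Pair)
      then show "norm (Du z (g z, 0, 0) - Du w (g z, 0, 0)) \<le> C * D * C"
        using Du_lip[OF zR, of "(g z, 0, 0)"] C D0 unfolding zw
        by (meson mult_left_mono mult_nonneg_nonneg order_trans zero_le_one)
      have "norm (g z - g w, 0::real, 0::real) \<le> C * D" using g_lip[OF zR] by (simp add: norm_Pair zw)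
      then show "norm (Du w (g z - g w, 0, 0)) \<le> C * (C * D)"
        using Du_bound[OF zR(2), of "(g z - g w, 0, 0)"] C by (meson mult_left_mono order_trans zero_le_one)
    qed
    finally show ?thesis by (simp add: power2_eq_square algebra_simps)
  qed
  have "F y - F x - a *\<^sub>R Du z (F y, \<beta>, 0) - \<rho> *\<^sub>R Du z (g z, 0, 0) - DF x (y - a *\<^sub>R u z - x)
      - a *\<^sub>R (DF x (u w) - Du w (F x, \<beta>, 0)) + \<rho> *\<^sub>R Du w (g w, 0, 0)
    = (F y - F x - DF x (y - x)) + a *\<^sub>R DF x (u z - u w)
      - a *\<^sub>R (Du z (F y, \<beta>, 0) - Du w (F x, \<beta>, 0)) - \<rho> *\<^sub>R (Du z (g z, 0, 0) - Du w (g w, 0, 0))"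
    by (simp add: ld algebra_simps)
  also have "norm \<dots> \<le> C * D\<^sup>2 + a * (C * (C * D)) + a * (3 * C\<^sup>2 * D) + \<rho> * (2 * C\<^sup>2 * D)"
  proof -
    have tri: "norm (P + Q - S - T) \<le> norm P + norm Q + norm S + norm T" for P Q S T :: 'a
      by (smt (verit) norm_triangle_ineq norm_triangle_ineq4)
    show ?thesis
      by (rule order_trans[OF tri]) (use t1 t2 t3 t4 a \<rho> in \<open>auto intro!: add_mono mult_left_mono\<close>)
  qed
  also have "\<dots> \<le> 4 * C\<^sup>2 * D * (D + a + \<rho>)"
  proof -
    have "C * 1 \<le> C * (4 * C)" using C by (intro mult_left_mono) auto
    then have "C * D\<^sup>2 \<le> (4 * C\<^sup>2) * D\<^sup>2" by (intro mult_right_mono) (simp_all add: power2_eq_square)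
    moreover have "\<rho> * (2 * C\<^sup>2 * D) \<le> \<rho> * (4 * C\<^sup>2 * D)" using \<rho> D0 by (intro mult_left_mono mult_right_mono) auto
    ultimately show ?thesis by (simp add: algebra_simps power2_eq_square)
  qed
  finally show ?thesis by (simp add: z_def w_def D_def)
qed

lemma X_lip: "norm (X (\<psi> + \<beta>0 * s) - X (\<psi> + \<beta>0 * r)) \<le> C * \<bar>s - r\<bar>"
proof -
  have "norm (X (\<psi> + \<beta>0 * s) - X (\<psi> + \<beta>0 * r)) \<le> (C / \<beta>0) * norm ((\<psi> + \<beta>0 * s) - (\<psi> + \<beta>0 * r))"
  proof (rule differentiable_bound[of UNIV X "\<lambda>s h. h *\<^sub>R ((1 / \<beta>0) *\<^sub>R F (X s))"])
    fix s
    show "(X has_derivative (\<lambda>h. h *\<^sub>R (1 / \<beta>0) *\<^sub>R F (X s))) (at s within UNIV)"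
      using X_deriv[of s] by (simp add: has_vector_derivative_def)
    have "norm (F (X s)) \<le> C" by (rule F_bound[OF X_le_R])
    then have "\<bar>h\<bar> * norm (F (X s)) / \<beta>0 \<le> C * \<bar>h\<bar> / \<beta>0" for h
      using \<beta>0 by (intro divide_right_mono) (simp_all add: mult.commute[of C] mult_left_mono)
    then show "onorm (\<lambda>h. h *\<^sub>R (1 / \<beta>0) *\<^sub>R F (X s)) \<le> C / \<beta>0"
      using \<beta>0 by (intro onorm_le) simp
  qed auto
  then show ?thesis using \<beta>0 by (simp add: abs_mult flip: right_diff_distrib)
qed

lemma z_lip:
  fixes \<phi> :: real
  assumes "0 \<le> \<beta>" "\<beta> \<le> C"
  shows "norm ((X (\<psi> + \<beta>0 * s), \<theta> + \<beta> * s, \<phi>) - (X (\<psi> + \<beta>0 * r), \<theta> + \<beta> * r, \<phi>)) \<le> 2 * C * \<bar>s - r\<bar>"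
proof -
  have "norm ((X (\<psi> + \<beta>0 * s), \<theta> + \<beta> * s, \<phi>) - (X (\<psi> + \<beta>0 * r), \<theta> + \<beta> * r, \<phi>))
    \<le> norm (X (\<psi> + \<beta>0 * s) - X (\<psi> + \<beta>0 * r)) + \<bar>\<beta> * (s - r)\<bar>"
    using norm_triple_le[of "X (\<psi> + \<beta>0 * s) - X (\<psi> + \<beta>0 * r)" "\<beta> * (s - r)"] by (simp add: algebra_simps)
  also have "\<dots> \<le> C * \<bar>s - r\<bar> + C * \<bar>s - r\<bar>"
    using X_lip assms by (intro add_mono) (auto simp: abs_mult mult_right_mono)
  finally show ?thesis by simp
qed

text \<open>Product rule for Lipschitz bounds, varying the linear map first and its argument
  second.\<close>

lemma linear_family_lip:
  assumes "norm (T1 v - T2 v) \<le> p * d * norm v" "\<And>w. norm (T2 w) \<le> q * norm w" "linear T2"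
    "norm v \<le> V" "norm (v - v') \<le> W * d" "p \<ge> 0" "q \<ge> 0" "d \<ge> 0"
  shows "norm (T1 v - T2 v') \<le> (p * V + q * W) * d"
proof -
  have "T1 v - T2 v' = (T1 v - T2 v) + T2 (v - v')" using linear_diff[OF assms(3)] by simp
  also have "norm \<dots> \<le> p * d * V + q * (W * d)"
  proof (rule norm_triangle_le, rule add_mono)
    show "norm (T1 v - T2 v) \<le> p * d * V" using assms by (meson mult_left_mono mult_nonneg_nonneg order_trans)
    show "norm (T2 (v - v')) \<le> q * (W * d)" using assms by (meson mult_left_mono order_trans)
  qed
  finally show ?thesis by (simp add: algebra_simps)
qed

lemma vdrift_bound: "0 \<le> \<beta> \<Longrightarrow> \<beta> \<le> C \<Longrightarrow> norm (vdrift \<beta> \<psi> \<theta> \<phi>) \<le> 3 * C\<^sup>2"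
proof -
  assume \<beta>: "0 \<le> \<beta>" "\<beta> \<le> C"
  have "norm (DF (X \<psi>) (u (X \<psi>, \<theta>, \<phi>))) \<le> C * C"
    using DF_bound[OF X_le_R, of \<psi> "u (X \<psi>, \<theta>, \<phi>)"] u_bound[of "(X \<psi>, \<theta>, \<phi>)"] X_le_R[of \<psi>] C
    by (smt (verit) fst_conv mult_left_mono)
  moreover have "norm (F (X \<psi>), \<beta>, 0::real) \<le> 2 * C"
    using norm_triple_le[of "F (X \<psi>)" \<beta>] F_bound[OF X_le_R, of \<psi>] \<beta> by simp
  then have "norm (Du (X \<psi>, \<theta>, \<phi>) (F (X \<psi>), \<beta>, 0)) \<le> C * (2 * C)"
    using Du_bound[of "(X \<psi>, \<theta>, \<phi>)" "(F (X \<psi>), \<beta>, 0)"] X_le_R[of \<psi>] C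
    by (smt (verit) fst_conv mult_left_mono)
  ultimately show ?thesis unfolding vdrift_def
    by (intro norm_triangle_le_diff) (simp add: power2_eq_square)
qed

lemma mdrift_bound: "norm (mdrift \<psi> \<theta> \<phi>) \<le> C\<^sup>2"
proof -
  have "norm (g (X \<psi>, \<theta>, \<phi>), 0::real, 0::real) \<le> C" using g_bound[of "(X \<psi>, \<theta>, \<phi>)"] X_le_R[of \<psi>] by (simp add: norm_Pair)
  then show ?thesis
    using Du_bound[of "(X \<psi>, \<theta>, \<phi>)" "(g (X \<psi>, \<theta>, \<phi>), 0, 0)"] X_le_R[of \<psi>] C
    unfolding mdrift_def by (smt (verit) fst_conv mult_left_mono norm_minus_cancel power2_eq_square)
qed

lemma vdrift_lip:
  assumes \<beta>: "0 \<le> \<beta>" "\<beta> \<le> C"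
  shows "norm (vdrift \<beta> (\<psi> + \<beta>0 * s) (\<theta> + \<beta> * s) \<phi> - vdrift \<beta> (\<psi> + \<beta>0 * r) (\<theta> + \<beta> * r) \<phi>) \<le> 8 * C ^ 3 * \<bar>s - r\<bar>"
proof -
  let ?d = "\<bar>s - r\<bar>"
  let ?x = "\<lambda>s. X (\<psi> + \<beta>0 * s)" and ?z = "\<lambda>s. (X (\<psi> + \<beta>0 * s), \<theta> + \<beta> * s, \<phi>)"
  have C0: "C \<ge> 0" using C by simp
  have zl: "norm (?z s - ?z r) \<le> 2 * C * ?d" by (rule z_lip[OF \<beta>])
  have zR: "norm (fst (?z s)) \<le> R" for s using X_le_R by simp
  have "norm (DF (?x s) (u (?z s)) - DF (?x r) (u (?z r))) \<le> (C\<^sup>2 * C + C * (2 * C\<^sup>2)) * ?d"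
  proof (rule linear_family_lip[where ?T1.0 = "DF (?x s)" and ?T2.0 = "DF (?x r)"])
    show "norm (DF (?x s) (u (?z s)) - DF (?x r) (u (?z s))) \<le> C\<^sup>2 * ?d * norm (u (?z s))"
    proof -
      have "norm (DF (?x s) (u (?z s)) - DF (?x r) (u (?z s))) \<le> C * norm (?x s - ?x r) * norm (u (?z s))"
        by (rule DF_lip[OF X_le_R X_le_R])
      also have "\<dots> \<le> C * (C * ?d) * norm (u (?z s))"
        using X_lip C0 by (intro mult_right_mono mult_left_mono) auto
      finally show ?thesis by (simp add: power2_eq_square mult.assoc)
    qed
    show "norm (u (?z s) - u (?z r)) \<le> 2 * C\<^sup>2 * ?d"
    proof -
      have "norm (u (?z s) - u (?z r)) \<le> C * norm (?z s - ?z r)" by (rule u_lip[OF zR zR])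
      also have "\<dots> \<le> C * (2 * C * ?d)" by (rule mult_left_mono[OF zl C0])
      finally show ?thesis by (simp add: power2_eq_square)
    qed
  qed (use C0 in \<open>auto intro: DF_bound X_le_R DF_linear u_bound[OF zR]\<close>)
  moreover have "norm (Du (?z s) (F (?x s), \<beta>, 0) - Du (?z r) (F (?x r), \<beta>, 0)) \<le> (2 * C\<^sup>2 * (2 * C) + C * C\<^sup>2) * ?d"
  proof (rule linear_family_lip[where ?T1.0 = "Du (?z s)" and ?T2.0 = "Du (?z r)"])
    show "norm (Du (?z s) (F (?x s), \<beta>, 0) - Du (?z r) (F (?x s), \<beta>, 0)) \<le> 2 * C\<^sup>2 * ?d * norm (F (?x s), \<beta>, 0::real)"
    proof -
      have "norm (Du (?z s) (F (?x s), \<beta>, 0) - Du (?z r) (F (?x s), \<beta>, 0)) \<le> C * norm (?z s - ?z r) * norm (F (?x s), \<beta>, 0::real)"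
        by (rule Du_lip[OF zR zR])
      also have "\<dots> \<le> C * (2 * C * ?d) * norm (F (?x s), \<beta>, 0::real)"
        using zl C0 by (intro mult_right_mono mult_left_mono) auto
      finally show ?thesis by (simp add: power2_eq_square mult.assoc)
    qed
    show "norm (F (?x s), \<beta>, 0::real) \<le> 2 * C"
      using norm_triple_le[of "F (?x s)" \<beta>] F_bound[OF X_le_R, of "\<psi> + \<beta>0 * s"] \<beta> by simp
    show "norm ((F (?x s), \<beta>, 0::real) - (F (?x r), \<beta>, 0)) \<le> C\<^sup>2 * ?d"
    proof -
      have "norm ((F (?x s), \<beta>, 0::real) - (F (?x r), \<beta>, 0)) = norm (F (?x s) - F (?x r))" by (rule norm_triple_diff)
      also have "\<dots> \<le> C * norm (?x s - ?x r)" by (rule F_lip[OF X_le_R X_le_R])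
      also have "\<dots> \<le> C * (C * ?d)" by (rule mult_left_mono[OF X_lip C0])
      finally show ?thesis by (simp add: power2_eq_square)
    qed
  qed (use C0 zR in \<open>auto intro: Du_bound Du_linear\<close>)
  ultimately show ?thesis unfolding vdrift_def
    using norm_triangle_ineq4[of "DF (?x s) (u (?z s)) - DF (?x r) (u (?z r))" "Du (?z s) (F (?x s), \<beta>, 0) - Du (?z r) (F (?x r), \<beta>, 0)"]
    by (simp add: power2_eq_square power3_eq_cube algebra_simps)
qed

lemma mdrift_lip:
  assumes \<beta>: "0 \<le> \<beta>" "\<beta> \<le> C"
  shows "norm (mdrift (\<psi> + \<beta>0 * s) (\<theta> + \<beta> * s) \<phi> - mdrift (\<psi> + \<beta>0 * r) (\<theta> + \<beta> * r) \<phi>) \<le> 4 * C ^ 3 * \<bar>s - r\<bar>"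
proof -
  let ?d = "\<bar>s - r\<bar>"
  let ?z = "\<lambda>s. (X (\<psi> + \<beta>0 * s), \<theta> + \<beta> * s, \<phi>)"
  have C0: "C \<ge> 0" using C by simp
  have zl: "norm (?z s - ?z r) \<le> 2 * C * ?d" by (rule z_lip[OF \<beta>])
  have zR: "norm (fst (?z s)) \<le> R" for s using X_le_R by simp
  have "norm (Du (?z s) (g (?z s), 0, 0) - Du (?z r) (g (?z r), 0, 0)) \<le> (2 * C\<^sup>2 * C + C * (2 * C\<^sup>2)) * ?d"
  proof (rule linear_family_lip[where ?T1.0 = "Du (?z s)" and ?T2.0 = "Du (?z r)"])
    show "norm (Du (?z s) (g (?z s), 0, 0) - Du (?z r) (g (?z s), 0, 0)) \<le> 2 * C\<^sup>2 * ?d * norm (g (?z s), 0::real, 0::real)"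
    proof -
      have "norm (Du (?z s) (g (?z s), 0, 0) - Du (?z r) (g (?z s), 0, 0)) \<le> C * norm (?z s - ?z r) * norm (g (?z s), 0::real, 0::real)"
        by (rule Du_lip[OF zR zR])
      also have "\<dots> \<le> C * (2 * C * ?d) * norm (g (?z s), 0::real, 0::real)"
        using zl C0 by (intro mult_right_mono mult_left_mono) auto
      finally show ?thesis by (simp add: power2_eq_square mult.assoc)
    qed
    show "norm (g (?z s), 0::real, 0::real) \<le> C" using g_bound[OF zR[of s]] by (simp add: norm_Pair)
    show "norm ((g (?z s), 0::real, 0::real) - (g (?z r), 0, 0)) \<le> 2 * C\<^sup>2 * ?d"
    proof -
      have "norm ((g (?z s), 0::real, 0::real) - (g (?z r), 0, 0)) = norm (g (?z s) - g (?z r))" by (rule norm_triple_diff)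
      also have "\<dots> \<le> C * norm (?z s - ?z r)" by (rule g_lip[OF zR zR])
      also have "\<dots> \<le> C * (2 * C * ?d)" by (rule mult_left_mono[OF zl C0])
      finally show ?thesis by (simp add: power2_eq_square)
    qed
  qed (use C0 zR in \<open>auto intro: Du_bound Du_linear\<close>)
  then show ?thesis unfolding mdrift_def
    by (simp add: norm_minus_commute power2_eq_square power3_eq_cube algebra_simps)
qed

lemma vdrift_per: "vdrift \<beta> \<psi> \<theta> (\<phi> + 2 * pi) = vdrift \<beta> \<psi> \<theta> \<phi>"
  by (simp add: vdrift_def u_per Du_per)

lemma mdrift_per: "mdrift \<psi> \<theta> (\<phi> + 2 * pi) = mdrift \<psi> \<theta> \<phi>"
  using Du_fast[of "(X \<psi>, \<theta>, \<phi> + 2 * pi)"] Du_fast[of "(X \<psi>, \<theta>, \<phi>)"] by (simp add: mdrift_def Du_per)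

lemma vdrift_cont:
  assumes "continuous_on T p" "continuous_on T q" "continuous_on T r"
  shows "continuous_on T (\<lambda>s. vdrift \<beta> (p s) (q s) (r s))"
  unfolding vdrift_def by (intro continuous_intros conts assms)

lemma mdrift_cont:
  assumes "continuous_on T p" "continuous_on T q" "continuous_on T r"
  shows "continuous_on T (\<lambda>s. mdrift (p s) (q s) (r s))"
  unfolding mdrift_def by (intro continuous_intros conts assms)

lemma mmean_cont:
  assumes "continuous_on T p" "continuous_on T q"
  shows "continuous_on T (\<lambda>s. mmean (p s) (q s))"
proof -
  have "continuous_on UNIV (\<lambda>z. integral (cbox 0 (2 * pi)) (mdrift (fst z) (snd z)))"
    by (rule integral_continuous_on_param) (auto simp: split_beta intro!: mdrift_cont continuous_intros)
  then have "continuous_on T (\<lambda>s. integral (cbox 0 (2 * pi)) (mdrift (fst (p s, q s)) (snd (p s, q s))))"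
    by (rule continuous_on_compose2) (auto intro!: continuous_intros assms)
  then show ?thesis unfolding mmean_def by (auto intro!: continuous_intros)
qed

lemma vdrift_mean: "integral {0..2 * pi} (vdrift \<beta> \<psi> \<theta>) = 0"
proof -
  have iu: "(\<lambda>\<phi>. u (X \<psi>, \<theta>, \<phi>)) integrable_on {0..2 * pi}"
    by (intro integrable_continuous_real conts continuous_intros)
  have "integral {0..2 * pi} (\<lambda>\<phi>. DF (X \<psi>) (u (X \<psi>, \<theta>, \<phi>))) = DF (X \<psi>) 0"
    using integral_linear[OF iu linear_conv_bounded_linear[THEN iffD1, OF DF_linear]] u_mean by (simp add: o_def)
  then have "integral {0..2 * pi} (\<lambda>\<phi>. DF (X \<psi>) (u (X \<psi>, \<theta>, \<phi>))) = 0"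
    by (simp add: linear_0[OF DF_linear])
  then show ?thesis unfolding vdrift_def
    by (subst integral_diff) (auto intro!: integrable_continuous_real conts continuous_intros simp: Du_mean)
qed

text \<open>Measures the cost of letting the slow phase in the averaged term run with frequency
  \<beta>0 instead of \<beta>.\<close>

lemma mdrift_theta_lip: "norm (mdrift \<psi> \<theta> \<phi> - mdrift \<psi> \<theta>' \<phi>) \<le> 2 * C\<^sup>2 * \<bar>\<theta> - \<theta>'\<bar>"
proof -
  let ?d = "\<bar>\<theta> - \<theta>'\<bar>"
  let ?z = "\<lambda>\<theta>. (X \<psi>, \<theta>, \<phi>)"
  have C0: "C \<ge> 0" using C by simp
  have zl: "norm (?z \<theta> - ?z \<theta>') = ?d" by (simp add: norm_Pair)
  have zR: "norm (fst (?z \<theta>)) \<le> R" for \<theta> using X_le_R by simp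
  have "norm (Du (?z \<theta>) (g (?z \<theta>), 0, 0) - Du (?z \<theta>') (g (?z \<theta>'), 0, 0)) \<le> (C * C + C * C) * ?d"
  proof (rule linear_family_lip[where ?T1.0 = "Du (?z \<theta>)" and ?T2.0 = "Du (?z \<theta>')"])
    show "norm (Du (?z \<theta>) (g (?z \<theta>), 0, 0) - Du (?z \<theta>') (g (?z \<theta>), 0, 0)) \<le> C * ?d * norm (g (?z \<theta>), 0::real, 0::real)"
      using Du_lip[OF zR[of \<theta>] zR[of \<theta>'], of "(g (?z \<theta>), 0, 0)"] unfolding zl .
    show "norm (g (?z \<theta>), 0::real, 0::real) \<le> C" using g_bound[OF zR[of \<theta>]] by (simp add: norm_Pair)
    show "norm ((g (?z \<theta>), 0::real, 0::real) - (g (?z \<theta>'), 0, 0)) \<le> C * ?d"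
      unfolding norm_triple_diff using g_lip[OF zR[of \<theta>] zR[of \<theta>']] unfolding zl .
  qed (use C0 in \<open>auto intro!: Du_bound[OF zR] Du_linear\<close>)
  then show ?thesis unfolding mdrift_def by (simp add: norm_minus_commute power2_eq_square algebra_simps)
qed

lemma mmean_diff_le:
  assumes "\<And>\<phi>. norm (mdrift \<psi> \<theta> \<phi> - mdrift \<psi>' \<theta>' \<phi>) \<le> b"
  shows "norm (mmean \<psi> \<theta> - mmean \<psi>' \<theta>') \<le> b"
proof -
  have "norm (integral {0..2 * pi} (\<lambda>\<phi>. mdrift \<psi> \<theta> \<phi> - mdrift \<psi>' \<theta>' \<phi>)) \<le> b * (2 * pi - 0)"
    by (rule integral_bound) (auto intro!: mdrift_cont continuous_intros assms)
  moreover have "integral {0..2 * pi} (\<lambda>\<phi>. mdrift \<psi> \<theta> \<phi> - mdrift \<psi>' \<theta>' \<phi>) = integral {0..2 * pi} (mdrift \<psi> \<theta>) - integral {0..2 * pi} (mdrift \<psi>' \<theta>')"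
    by (rule integral_diff) (auto intro!: integrable_continuous_real mdrift_cont continuous_intros)
  ultimately have "norm (integral {0..2 * pi} (mdrift \<psi> \<theta>) - integral {0..2 * pi} (mdrift \<psi>' \<theta>')) \<le> b * (2 * pi)"
    by simp
  moreover have "mmean \<psi> \<theta> - mmean \<psi>' \<theta>' = (1 / (2 * pi)) *\<^sub>R (integral {0..2 * pi} (mdrift \<psi> \<theta>) - integral {0..2 * pi} (mdrift \<psi>' \<theta>'))"
    by (simp only: mmean_def scaleR_diff_right)
  ultimately show ?thesis by (simp add: divide_le_eq)
qed

lemma mmean_bound: "norm (mmean \<psi> \<theta>) \<le> C\<^sup>2"
proof -
  have "norm (integral {0..2 * pi} (mdrift \<psi> \<theta>)) \<le> C\<^sup>2 * (2 * pi - 0)"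
    by (rule integral_bound) (auto intro!: mdrift_cont continuous_intros mdrift_bound)
  then show ?thesis unfolding mmean_def by (simp add: divide_le_eq)
qed

section \<open>Oscillatory integrals along the unperturbed orbit\<close>

definition osc_const :: real where "osc_const = 2 * pi * (14 * C ^ 4 * (\<tau> + 1))"

lemma osc_const_nonneg: "osc_const \<ge> 0" using \<tau> C by (simp add: osc_const_def)

text \<open>The constant 14 C^4 dominates the sizes and Lipschitz constants of all integrands to
  which this is applied: \<open>vdrift\<close>, and the products of p with \<open>vdrift\<close> and
  with the centred \<open>mdrift\<close>.\<close>

lemma osc_bound:
  fixes a :: "real \<Rightarrow> real \<Rightarrow> 'b::euclidean_space"
  assumes "continuous_on UNIV (\<lambda>(s, \<phi>). a s \<phi>)" "\<And>s \<phi>. a s (\<phi> + 2 * pi) = a s \<phi>"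
    "\<And>s. integral {0..2 * pi} (a s) = 0"
    "\<And>s r \<phi>. norm (a s \<phi> - a r \<phi>) \<le> 14 * C ^ 4 * \<bar>s - r\<bar>" "\<And>s \<phi>. norm (a s \<phi>) \<le> 14 * C ^ 4"
    "\<omega> > 0" "0 \<le> S" "S \<le> \<tau>"
  shows "norm (integral {0..S} (\<lambda>s. a s (\<chi>0 + \<omega> * s))) \<le> osc_const / \<omega>"
proof -
  have "norm (integral {0..S} (\<lambda>s. a s (\<chi>0 + \<omega> * s))) \<le> 2 * pi * (14 * C ^ 4 * S + 14 * C ^ 4) / \<omega>"
    by (rule oscillatory_integral_bound[OF assms(1-7)])
  also have "\<dots> \<le> osc_const / \<omega>"
  proof -
    have "14 * C ^ 4 * S + 14 * C ^ 4 \<le> 14 * C ^ 4 * (\<tau> + 1)"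
      using assms(8) C by (simp add: distrib_left)
    then show ?thesis unfolding osc_const_def using assms(6) by (intro divide_right_mono mult_left_mono) auto
  qed
  finally show ?thesis .
qed

lemma C_powers: "C \<le> C ^ 4" "C\<^sup>2 \<le> C ^ 4" "C ^ 3 \<le> C ^ 4" "1 \<le> C ^ 4"
  using C power_increasing[of 1 4 C] power_increasing[of 2 4 C] power_increasing[of 3 4 C] one_le_power[of C 4] by auto

lemma osc_vdrift:
  assumes "0 \<le> \<beta>" "\<beta> \<le> C" "\<omega> > 0" "0 \<le> S" "S \<le> \<tau>"
  shows "norm (integral {0..S} (\<lambda>s. vdrift \<beta> (\<psi> + \<beta>0 * s) (\<theta> + \<beta> * s) (\<chi>0 + \<omega> * s))) \<le> osc_const / \<omega>"
proof (rule osc_bound[OF _ _ _ _ _ assms(3-5)])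
  show "continuous_on UNIV (\<lambda>(s, \<phi>). vdrift \<beta> (\<psi> + \<beta>0 * s) (\<theta> + \<beta> * s) \<phi>)"
    unfolding split_beta by (intro vdrift_cont continuous_intros)
  show "norm (vdrift \<beta> (\<psi> + \<beta>0 * s) (\<theta> + \<beta> * s) \<phi> - vdrift \<beta> (\<psi> + \<beta>0 * r) (\<theta> + \<beta> * r) \<phi>) \<le> 14 * C ^ 4 * \<bar>s - r\<bar>" for s r \<phi>
    by (rule order_trans[OF vdrift_lip[OF assms(1,2)]]) (rule mult_right_mono, use C_powers in auto)
  show "norm (vdrift \<beta> (\<psi> + \<beta>0 * s) (\<theta> + \<beta> * s) \<phi>) \<le> 14 * C ^ 4" for s \<phi>
    by (rule order_trans[OF vdrift_bound[OF assms(1,2)]]) (use C_powers in auto)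
qed (simp_all add: vdrift_per vdrift_mean)

lemma inner_family_lip:
  fixes p v :: "real \<Rightarrow> 'a"
  assumes "norm (p s) \<le> C" "norm (p r) \<le> C" "norm (p s - p r) \<le> C * d" "norm (v s) \<le> V" "norm (v s - v r) \<le> W * d" "d \<ge> 0"
  shows "\<bar>p s \<bullet> v s - p r \<bullet> v r\<bar> \<le> (C * V + C * W) * d"
proof -
  have V0: "V \<ge> 0" using assms(4) norm_ge_zero order_trans by blast
  have "p s \<bullet> v s - p r \<bullet> v r = (p s - p r) \<bullet> v s + p r \<bullet> (v s - v r)" by (simp add: inner_diff_left inner_diff_right)
  also have "\<bar>\<dots>\<bar> \<le> norm (p s - p r) * norm (v s) + norm (p r) * norm (v s - v r)"
    by (rule order_trans[OF abs_triangle_ineq]) (intro add_mono Cauchy_Schwarz_ineq2)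
  also have "\<dots> \<le> (C * d) * V + C * (W * d)"
    using assms C by (intro add_mono mult_mono) auto
  finally show ?thesis by (simp add: algebra_simps)
qed

lemma osc_p_vdrift:
  fixes p :: "real \<Rightarrow> 'a"
  assumes "0 \<le> \<beta>" "\<beta> \<le> C" "\<omega> > 0" "0 \<le> S" "S \<le> \<tau>"
    and pc: "continuous_on UNIV p" and pb: "\<And>\<psi>. norm (p \<psi>) \<le> C" and pl: "\<And>s r. norm (p (\<psi> + \<beta>0 * s) - p (\<psi> + \<beta>0 * r)) \<le> C * \<bar>s - r\<bar>"
  shows "\<bar>integral {0..S} (\<lambda>s. p (\<psi> + \<beta>0 * s) \<bullet> vdrift \<beta> (\<psi> + \<beta>0 * s) (\<theta> + \<beta> * s) (\<chi>0 + \<omega> * s))\<bar> \<le> osc_const / \<omega>"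
  unfolding real_norm_def[symmetric]
proof (rule osc_bound[OF _ _ _ _ _ assms(3-5)])
  show "continuous_on UNIV (\<lambda>(s, \<phi>). p (\<psi> + \<beta>0 * s) \<bullet> vdrift \<beta> (\<psi> + \<beta>0 * s) (\<theta> + \<beta> * s) \<phi>)"
    unfolding split_beta by (intro vdrift_cont continuous_intros continuous_on_compose2[OF pc]) auto
  show "norm (p (\<psi> + \<beta>0 * s) \<bullet> vdrift \<beta> (\<psi> + \<beta>0 * s) (\<theta> + \<beta> * s) \<phi> - p (\<psi> + \<beta>0 * r) \<bullet> vdrift \<beta> (\<psi> + \<beta>0 * r) (\<theta> + \<beta> * r) \<phi>) \<le> 14 * C ^ 4 * \<bar>s - r\<bar>" for s r \<phi>
  proof -
    have "\<bar>p (\<psi> + \<beta>0 * s) \<bullet> vdrift \<beta> (\<psi> + \<beta>0 * s) (\<theta> + \<beta> * s) \<phi> - p (\<psi> + \<beta>0 * r) \<bullet> vdrift \<beta> (\<psi> + \<beta>0 * r) (\<theta> + \<beta> * r) \<phi>\<bar>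
      \<le> (C * (3 * C\<^sup>2) + C * (8 * C ^ 3)) * \<bar>s - r\<bar>"
      by (rule inner_family_lip[where p = "\<lambda>s. p (\<psi> + \<beta>0 * s)" and v = "\<lambda>s. vdrift \<beta> (\<psi> + \<beta>0 * s) (\<theta> + \<beta> * s) \<phi>"])
        (auto intro: pb pl vdrift_bound vdrift_lip assms)
    also have "\<dots> \<le> 14 * C ^ 4 * \<bar>s - r\<bar>"
      using C_powers by (intro mult_right_mono) (auto simp: power2_eq_square power3_eq_cube power4_eq_xxxx)
    finally show ?thesis by simp
  qed
  show "norm (p (\<psi> + \<beta>0 * s) \<bullet> vdrift \<beta> (\<psi> + \<beta>0 * s) (\<theta> + \<beta> * s) \<phi>) \<le> 14 * C ^ 4" for s \<phi>
  proof -
    have "norm (p (\<psi> + \<beta>0 * s) \<bullet> vdrift \<beta> (\<psi> + \<beta>0 * s) (\<theta> + \<beta> * s) \<phi>) \<le> C * (3 * C\<^sup>2)"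
      unfolding real_norm_def using C
      by (intro order_trans[OF Cauchy_Schwarz_ineq2] mult_mono pb vdrift_bound assms) auto
    also have "\<dots> \<le> 14 * C ^ 4" using C_powers by (auto simp: power2_eq_square power3_eq_cube)
    finally show ?thesis .
  qed
  show "integral {0..2 * pi} (\<lambda>\<phi>. p (\<psi> + \<beta>0 * s) \<bullet> vdrift \<beta> (\<psi> + \<beta>0 * s) (\<theta> + \<beta> * s) \<phi>) = 0" for s
    using integral_linear[OF integrable_continuous_real bounded_linear_inner_right, of 0 "2 * pi" "vdrift \<beta> (\<psi> + \<beta>0 * s) (\<theta> + \<beta> * s)" "p (\<psi> + \<beta>0 * s)"]
    by (simp add: o_def vdrift_mean vdrift_cont)
qed (simp_all add: vdrift_per)

text \<open>Unlike \<open>vdrift\<close>, \<open>mdrift\<close> has a mean, which must be subtracted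
  before oscillation helps; this mean is what drives the slow phase.\<close>

lemma osc_p_mdrift:
  fixes p :: "real \<Rightarrow> 'a"
  assumes "0 \<le> \<beta>" "\<beta> \<le> C" "\<omega> > 0" "0 \<le> S" "S \<le> \<tau>"
    and pc: "continuous_on UNIV p" and pb: "\<And>\<psi>. norm (p \<psi>) \<le> C" and pl: "\<And>s r. norm (p (\<psi> + \<beta>0 * s) - p (\<psi> + \<beta>0 * r)) \<le> C * \<bar>s - r\<bar>"
  shows "\<bar>integral {0..S} (\<lambda>s. p (\<psi> + \<beta>0 * s) \<bullet> (mdrift (\<psi> + \<beta>0 * s) (\<theta> + \<beta> * s) (\<chi>0 + \<omega> * s) - mmean (\<psi> + \<beta>0 * s) (\<theta> + \<beta> * s)))\<bar> \<le> osc_const / \<omega>"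
  unfolding real_norm_def[symmetric]
proof (rule osc_bound[OF _ _ _ _ _ assms(3-5)])
  let ?m = "\<lambda>s \<phi>. mdrift (\<psi> + \<beta>0 * s) (\<theta> + \<beta> * s) \<phi> - mmean (\<psi> + \<beta>0 * s) (\<theta> + \<beta> * s)"
  have mb: "norm (?m s \<phi>) \<le> 2 * C\<^sup>2" for s \<phi>
    using mdrift_bound[of "\<psi> + \<beta>0 * s" "\<theta> + \<beta> * s" \<phi>] mmean_bound[of "\<psi> + \<beta>0 * s" "\<theta> + \<beta> * s"]
    by (intro norm_triangle_le_diff) simp
  have ml: "norm (?m s \<phi> - ?m r \<phi>) \<le> 8 * C ^ 3 * \<bar>s - r\<bar>" for s r \<phi>
  proof -
    have "norm (mmean (\<psi> + \<beta>0 * s) (\<theta> + \<beta> * s) - mmean (\<psi> + \<beta>0 * r) (\<theta> + \<beta> * r)) \<le> 4 * C ^ 3 * \<bar>s - r\<bar>"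
      by (rule mmean_diff_le[OF mdrift_lip[OF assms(1,2)]])
    moreover have "?m s \<phi> - ?m r \<phi> = (mdrift (\<psi> + \<beta>0 * s) (\<theta> + \<beta> * s) \<phi> - mdrift (\<psi> + \<beta>0 * r) (\<theta> + \<beta> * r) \<phi>)
      - (mmean (\<psi> + \<beta>0 * s) (\<theta> + \<beta> * s) - mmean (\<psi> + \<beta>0 * r) (\<theta> + \<beta> * r))" by simp
    ultimately show ?thesis
      using mdrift_lip[OF assms(1,2), of \<psi> s \<theta> \<phi> r] by (simp only:, intro norm_triangle_le_diff) linarith
  qed
  show "continuous_on UNIV (\<lambda>(s, \<phi>). p (\<psi> + \<beta>0 * s) \<bullet> ?m s \<phi>)"
    unfolding split_beta by (intro mdrift_cont mmean_cont continuous_intros continuous_on_compose2[OF pc]) auto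
  show "norm (p (\<psi> + \<beta>0 * s) \<bullet> ?m s \<phi> - p (\<psi> + \<beta>0 * r) \<bullet> ?m r \<phi>) \<le> 14 * C ^ 4 * \<bar>s - r\<bar>" for s r \<phi>
  proof -
    have "\<bar>p (\<psi> + \<beta>0 * s) \<bullet> ?m s \<phi> - p (\<psi> + \<beta>0 * r) \<bullet> ?m r \<phi>\<bar>
      \<le> (C * (2 * C\<^sup>2) + C * (8 * C ^ 3)) * \<bar>s - r\<bar>"
      by (rule inner_family_lip[where p = "\<lambda>s. p (\<psi> + \<beta>0 * s)" and v = "\<lambda>s. ?m s \<phi>"])
        (rule pb pl mb ml abs_ge_zero)+
    also have "\<dots> \<le> 14 * C ^ 4 * \<bar>s - r\<bar>"
      using C_powers by (intro mult_right_mono) (auto simp: power2_eq_square power3_eq_cube power4_eq_xxxx)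
    finally show ?thesis by simp
  qed
  show "norm (p (\<psi> + \<beta>0 * s) \<bullet> ?m s \<phi>) \<le> 14 * C ^ 4" for s \<phi>
  proof -
    have "norm (p (\<psi> + \<beta>0 * s) \<bullet> ?m s \<phi>) \<le> C * (2 * C\<^sup>2)"
      unfolding real_norm_def using C
      by (intro order_trans[OF Cauchy_Schwarz_ineq2] mult_mono pb mb) auto
    also have "\<dots> \<le> 14 * C ^ 4" using C_powers by (auto simp: power2_eq_square power3_eq_cube)
    finally show ?thesis .
  qed
  have im: "mdrift (\<psi> + \<beta>0 * s) (\<theta> + \<beta> * s) integrable_on {0..2 * pi}" for s
    by (intro integrable_continuous_real mdrift_cont continuous_intros)
  have "integral {0..2 * pi} (?m s) = 0" for s
    by (subst integral_diff) (auto intro: im simp: mmean_def)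
  moreover have "?m s integrable_on {0..2 * pi}" for s by (intro integrable_diff im) auto
  ultimately show "integral {0..2 * pi} (\<lambda>\<phi>. p (\<psi> + \<beta>0 * s) \<bullet> ?m s \<phi>) = 0" for s
    using integral_linear[OF _ bounded_linear_inner_right, of "?m s" "{0..2 * pi}" "p (\<psi> + \<beta>0 * s)"]
    by (simp add: o_def)
qed (simp_all add: mdrift_per)

text \<open>Constants for one window of length at most \<tau>: \<open>drift_const\<close> for
  \<open>acc\<close> relative to \<rho>, \<open>rate_const\<close> for the Gronwall rate when the
  quadratic error is treated as linear, \<open>crude_const\<close> for the growth of the deviation,
  \<open>err_const\<close> for the remainder \<open>err\<close>, \<open>lin_const\<close> for the
  distance from the linearized flow, \<open>phase_const\<close> for the error of the phase
  equation.\<close>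

definition drift_const :: real where "drift_const = osc_const + C\<^sup>2 * \<tau>"
definition rate_const :: real where "rate_const = 41 * C ^ 5"
definition crude_const :: real where
  "crude_const = (1 + (rate_const * drift_const + 16 * C ^ 4) * \<tau>) * exp (rate_const * \<tau>) + drift_const + 1"
definition err_const :: real where "err_const = 24 * C ^ 4 * crude_const\<^sup>2"
definition lin_const :: real where "lin_const = (C * drift_const + err_const) * \<tau> * exp (C * \<tau>) + drift_const"
definition phase_const :: real where "phase_const = 2 * osc_const + 2 * C ^ 4 * \<tau>\<^sup>2 + C * err_const * \<tau>"

lemma drift_const_nonneg: "drift_const \<ge> 0" using osc_const_nonneg C \<tau> by (simp add: drift_const_def)
lemma rate_const_nonneg: "rate_const \<ge> 0" using C by (simp add: rate_const_def)
lemma crude_const_ge_1: "crude_const \<ge> 1"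
  using drift_const_nonneg rate_const_nonneg \<tau> C by (simp add: crude_const_def)
lemma err_const_nonneg: "err_const \<ge> 0" using C by (simp add: err_const_def)

end

section \<open>One run of the perturbed flow close to the unperturbed orbit\<close>

locale averaging_run = averaging_step +
  fixes \<nu> \<gamma> \<omega> \<beta> \<theta> \<chi>0 \<psi> S :: real and y :: "real \<Rightarrow> 'a"
  assumes \<nu>: "0 < \<nu>" "\<nu> \<le> 1" and \<omega>: "\<omega> > 0" and \<gamma>: "\<gamma> > 0"
    and small: "\<gamma> / \<omega> \<le> \<nu>" "\<gamma>\<^sup>2 / \<omega> \<le> \<nu>" "1 / \<omega> \<le> \<nu>" "1 / (\<gamma> * \<omega>) \<le> \<nu>"
    and \<beta>: "0 \<le> \<beta>" "\<beta> \<le> C" "\<bar>\<beta> - \<beta>0\<bar> \<le> C * (\<gamma>\<^sup>2 / \<omega>)"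
    and S: "0 \<le> S" "S \<le> \<tau>"
    and y_deriv: "\<And>s. s \<in> {0..S} \<Longrightarrow> (y has_vector_derivative
       F (y s) + \<gamma> *\<^sub>R g (y s, \<theta> + \<beta> * s, \<chi>0 + \<omega> * s)) (at s within {0..S})"
    and y_near: "\<And>s. s \<in> {0..S} \<Longrightarrow> norm (y s - X (\<psi> + \<beta>0 * s)) \<le> 1"
begin

definition a :: real where "a = \<gamma> / \<omega>"
definition \<rho> :: real where "\<rho> = \<gamma>\<^sup>2 / \<omega>"

text \<open>Deviation of the transformed solution from the unperturbed orbit; \<open>k'\<close> is its derivative and \<open>acc\<close>
  accumulates the rapidly oscillating part of it.\<close>

definition k :: "real \<Rightarrow> 'a" where
  "k s = y s - a *\<^sub>R u (y s, \<theta> + \<beta> * s, \<chi>0 + \<omega> * s) - X (\<psi> + \<beta>0 * s)"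

definition v :: "real \<Rightarrow> 'a" where "v s = vdrift \<beta> (\<psi> + \<beta>0 * s) (\<theta> + \<beta> * s) (\<chi>0 + \<omega> * s)"
definition m :: "real \<Rightarrow> 'a" where "m s = mdrift (\<psi> + \<beta>0 * s) (\<theta> + \<beta> * s) (\<chi>0 + \<omega> * s)"

definition k' :: "real \<Rightarrow> 'a" where
  "k' s = F (y s) - F (X (\<psi> + \<beta>0 * s)) - a *\<^sub>R Du (y s, \<theta> + \<beta> * s, \<chi>0 + \<omega> * s) (F (y s), \<beta>, 0)
     - \<rho> *\<^sub>R Du (y s, \<theta> + \<beta> * s, \<chi>0 + \<omega> * s) (g (y s, \<theta> + \<beta> * s, \<chi>0 + \<omega> * s), 0, 0)"

definition err :: "real \<Rightarrow> 'a" where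
  "err s = k' s - DF (X (\<psi> + \<beta>0 * s)) (k s) - a *\<^sub>R v s - \<rho> *\<^sub>R m s"

lemma a_pos: "a > 0" and \<rho>_pos: "\<rho> > 0" using \<gamma> \<omega> by (simp_all add: a_def \<rho>_def)

lemma a_small: "a \<le> \<nu>" and \<rho>_small: "\<rho> \<le> \<nu>" using small by (simp_all add: a_def \<rho>_def)

text \<open>Errors are measured against \<nu> \<rho>. From a = \<gamma> / \<omega> come a^2 = \<rho>
  / \<omega> and a / \<omega> = \<rho> / (\<gamma> \<omega>); the latter is where smallness of 1 /
  (\<gamma> \<omega>) is spent.\<close>

lemma a_sq: "a * a \<le> \<nu> * \<rho>" "a * \<rho> \<le> \<nu> * \<rho>" "a / \<omega> \<le> \<nu> * \<rho>" "\<rho> / \<omega> \<le> \<nu> * \<rho>"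
proof -
  have "a * a = \<rho> * (1 / \<omega>)" by (simp add: a_def \<rho>_def power2_eq_square)
  also have "\<dots> \<le> \<rho> * \<nu>" using \<rho>_pos small(3) by (intro mult_left_mono) auto
  finally show "a * a \<le> \<nu> * \<rho>" by (simp add: mult.commute)
  show "a * \<rho> \<le> \<nu> * \<rho>" using \<rho>_pos a_small by (intro mult_right_mono) auto
  have "a / \<omega> = \<rho> * (1 / (\<gamma> * \<omega>))" using \<gamma> by (simp add: a_def \<rho>_def power2_eq_square)
  also have "\<dots> \<le> \<rho> * \<nu>" using \<rho>_pos small(4) by (intro mult_left_mono) auto
  finally show "a / \<omega> \<le> \<nu> * \<rho>" by (simp add: mult.commute)
  have "\<rho> * (1 / \<omega>) \<le> \<rho> * \<nu>" using \<rho>_pos small(3) by (intro mult_left_mono) auto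
  then show "\<rho> / \<omega> \<le> \<nu> * \<rho>" by (simp add: mult.commute)
qed

text \<open>The a priori closeness \<open>y_near\<close> keeps the run in the ball where C is valid;
  \<open>one_step\<close> discharges it by bootstrapping.\<close>

lemma y_le_R: "s \<in> {0..S} \<Longrightarrow> norm (y s) \<le> R"
  using y_near[of s] X_bound[of "\<psi> + \<beta>0 * s"] norm_triangle_sub[of "y s" "X (\<psi> + \<beta>0 * s)"] by linarith

lemma X_flow: "((\<lambda>s. X (\<psi> + \<beta>0 * s)) has_vector_derivative F (X (\<psi> + \<beta>0 * s))) (at s within T)"
proof -
  have "((\<lambda>s. \<psi> + \<beta>0 * s) has_real_derivative \<beta>0) (at s within T)"
    by (auto intro!: derivative_eq_intros)
  moreover have "(X has_vector_derivative (1 / \<beta>0) *\<^sub>R F (X (\<psi> + \<beta>0 * s))) (at (\<psi> + \<beta>0 * s) within (\<lambda>s. \<psi> + \<beta>0 * s) ` T)"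
    by (rule has_vector_derivative_at_within[OF X_deriv])
  ultimately have "((X \<circ> (\<lambda>s. \<psi> + \<beta>0 * s)) has_vector_derivative \<beta>0 *\<^sub>R ((1 / \<beta>0) *\<^sub>R F (X (\<psi> + \<beta>0 * s)))) (at s within T)"
    unfolding has_real_derivative_iff_has_vector_derivative by (rule vector_diff_chain_within)
  then show ?thesis using \<beta>0 by (simp add: o_def)
qed

text \<open>The derivative of u in the fast phase is g, and a \<omega> = \<gamma>, so
  differentiating -a u cancels the perturbation \<gamma> g. What is left of it carries the
  prefactors a and a \<gamma> = \<rho>.\<close>

lemma k_deriv:
  assumes s: "s \<in> {0..S}"
  shows "(k has_vector_derivative k' s) (at s within {0..S})"
proof -
  let ?z = "\<lambda>s. (y s, \<theta> + \<beta> * s, \<chi>0 + \<omega> * s)"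
  let ?y' = "F (y s) + \<gamma> *\<^sub>R g (?z s)"
  have "(?z has_derivative (\<lambda>h. (h *\<^sub>R ?y', \<beta> * h, \<omega> * h))) (at s within {0..S})"
    using y_deriv[OF s] unfolding has_vector_derivative_def
    by (intro has_derivative_Pair) (auto intro!: derivative_eq_intros)
  then have "((\<lambda>s. u (?z s)) has_derivative (\<lambda>h. Du (?z s) (h *\<^sub>R ?y', \<beta> * h, \<omega> * h))) (at s within {0..S})"
    by (rule has_derivative_compose) (rule u_deriv)
  moreover have "Du (?z s) (h *\<^sub>R ?y', \<beta> * h, \<omega> * h) = h *\<^sub>R (Du (?z s) (F (y s), \<beta>, 0) + \<gamma> *\<^sub>R Du (?z s) (g (?z s), 0, 0) + \<omega> *\<^sub>R g (?z s))" for h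
  proof -
    have "(h *\<^sub>R ?y', \<beta> * h, \<omega> * h) = h *\<^sub>R ((F (y s), \<beta>, 0) + \<gamma> *\<^sub>R (g (?z s), 0, 0) + \<omega> *\<^sub>R (0, 0, 1))"
      by (simp add: mult.commute)
    then show ?thesis
      by (simp only: linear_cmul[OF Du_linear] linear_add[OF Du_linear] Du_fast)
  qed
  ultimately have du: "((\<lambda>s. u (?z s)) has_vector_derivative (Du (?z s) (F (y s), \<beta>, 0) + \<gamma> *\<^sub>R Du (?z s) (g (?z s), 0, 0) + \<omega> *\<^sub>R g (?z s))) (at s within {0..S})"
    unfolding has_vector_derivative_def by simp
  have "(k has_vector_derivative ?y' - a *\<^sub>R (Du (?z s) (F (y s), \<beta>, 0) + \<gamma> *\<^sub>R Du (?z s) (g (?z s), 0, 0) + \<omega> *\<^sub>R g (?z s))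
      - F (X (\<psi> + \<beta>0 * s))) (at s within {0..S})"
    unfolding k_def[abs_def]
    by (intro has_vector_derivative_diff y_deriv[OF s] X_flow bounded_linear.has_vector_derivative[OF bounded_linear_scaleR_right du])
  moreover have "a * \<gamma> = \<rho>" "a * \<omega> = \<gamma>" using \<omega> by (simp_all add: a_def \<rho>_def power2_eq_square)
  ultimately show ?thesis by (simp add: k'_def algebra_simps)
qed

lemma y_near_k: "norm (y s - X (\<psi> + \<beta>0 * s)) \<le> norm (k s) + a * C" if s: "s \<in> {0..S}"
proof -
  have "y s - X (\<psi> + \<beta>0 * s) = k s + a *\<^sub>R u (y s, \<theta> + \<beta> * s, \<chi>0 + \<omega> * s)" by (simp add: k_def)
  also have "norm \<dots> \<le> norm (k s) + a * C"
    using u_bound[of "(y s, \<theta> + \<beta> * s, \<chi>0 + \<omega> * s)"] y_le_R[OF s] a_pos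
    by (intro norm_triangle_le add_mono) auto
  finally show ?thesis .
qed

lemma k_le_2C: "norm (k s) \<le> 2 * C" if s: "s \<in> {0..S}"
proof -
  have "norm (k s) \<le> norm (y s - X (\<psi> + \<beta>0 * s)) + norm (a *\<^sub>R u (y s, \<theta> + \<beta> * s, \<chi>0 + \<omega> * s))"
    using norm_triangle_ineq4[of "y s - X (\<psi> + \<beta>0 * s)" "a *\<^sub>R u (y s, \<theta> + \<beta> * s, \<chi>0 + \<omega> * s)"]
    by (simp add: k_def algebra_simps)
  moreover have "a * norm (u (y s, \<theta> + \<beta> * s, \<chi>0 + \<omega> * s)) \<le> 1 * C"
    using u_bound[of "(y s, \<theta> + \<beta> * s, \<chi>0 + \<omega> * s)"] y_le_R[OF s] a_pos a_small \<nu> C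
    by (intro mult_mono) auto
  then have "norm (a *\<^sub>R u (y s, \<theta> + \<beta> * s, \<chi>0 + \<omega> * s)) \<le> C" using a_pos by simp
  ultimately show ?thesis using y_near[OF s] C by simp
qed

text \<open>Expresses the remainder through k instead of y by |y - X| <= |k| + a C; the products a^2
  and a \<rho> that appear are absorbed by \<nu> \<rho>.\<close>

lemma err_bound:
  assumes s: "s \<in> {0..S}"
  shows "norm (err s) \<le> 8 * C ^ 4 * (norm (k s) * (norm (k s) + 3 * \<nu>) + 2 * \<nu> * \<rho>)"
proof -
  let ?D = "norm (y s - X (\<psi> + \<beta>0 * s))" and ?n = "norm (k s)"
  have "norm (err s) \<le> 4 * C\<^sup>2 * ?D * (?D + a + \<rho>)"
    using remainder_bound[OF X_le_R y_le_R[OF s], of a \<rho> \<beta> "\<psi> + \<beta>0 * s" "\<theta> + \<beta> * s" "\<chi>0 + \<omega> * s"] a_pos \<rho>_pos \<beta>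
    by (simp add: err_def k'_def k_def v_def m_def vdrift_def mdrift_def algebra_simps)
  also have "\<dots> \<le> 4 * C\<^sup>2 * (C * (?n + a)) * (2 * C * (?n + a + \<rho>))"
  proof -
    have D: "?D \<le> ?n + a * C" by (rule y_near_k[OF s])
    have "?n * 1 \<le> ?n * C" "\<rho> * 1 \<le> \<rho> * (2 * C)" "?n * 1 \<le> ?n * (2 * C)" "a * 1 \<le> a * C"
      by (rule mult_left_mono; use C a_pos \<rho>_pos in simp)+
    then have "?D \<le> C * (?n + a)" "?D + a + \<rho> \<le> 2 * C * (?n + a + \<rho>)" using D by (auto simp: algebra_simps)
    then show ?thesis using C a_pos \<rho>_pos by (intro mult_mono) auto
  qed
  also have "\<dots> = 8 * C ^ 4 * ((?n + a) * (?n + a + \<rho>))" by (simp add: power2_eq_square power4_eq_xxxx)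
  also have "\<dots> \<le> 8 * C ^ 4 * (?n * (?n + 3 * \<nu>) + 2 * \<nu> * \<rho>)"
  proof (rule mult_left_mono)
    have "?n * (2 * a + \<rho>) \<le> ?n * (3 * \<nu>)" using a_small \<rho>_small by (intro mult_left_mono) auto
    then show "(?n + a) * (?n + a + \<rho>) \<le> ?n * (?n + 3 * \<nu>) + 2 * \<nu> * \<rho>"
      using a_sq by (simp add: algebra_simps)
  qed (use C in simp)
  finally show ?thesis .
qed

definition acc :: "real \<Rightarrow> 'a" where
  "acc s = a *\<^sub>R integral {0..s} v + \<rho> *\<^sub>R integral {0..s} m"

lemma v_cont: "continuous_on T v" unfolding v_def[abs_def] by (intro vdrift_cont continuous_intros)
lemma m_cont: "continuous_on T m" unfolding m_def[abs_def] by (intro mdrift_cont continuous_intros)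

lemma acc_deriv: "s \<in> {0..S} \<Longrightarrow> (acc has_vector_derivative a *\<^sub>R v s + \<rho> *\<^sub>R m s) (at s within {0..S})"
  unfolding acc_def[abs_def]
  by (intro has_vector_derivative_add bounded_linear.has_vector_derivative[OF bounded_linear_scaleR_right]
      integral_has_vector_derivative v_cont m_cont)

text \<open>The \<open>m\<close> part carries \<rho> and is bounded by its size times the elapsed
  time. The \<open>v\<close> part carries a, possibly much larger than \<rho>, and is saved by
  oscillation, since the integral of \<open>v\<close> is O(1 / \<omega>).\<close>

lemma acc_bound: "norm (acc s) \<le> drift_const * \<rho>" if s: "s \<in> {0..S}"
proof -
  have "norm (integral {0..s} v) \<le> osc_const / \<omega>"
    unfolding v_def[abs_def] by (rule osc_vdrift) (use s S \<beta> \<omega> in auto)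
  then have "norm (a *\<^sub>R integral {0..s} v) \<le> a * (osc_const / \<omega>)" using a_pos by (simp add: mult_left_mono del: times_divide_eq_right)
  also have "\<dots> = osc_const * (a / \<omega>)" by simp
  also have "\<dots> \<le> osc_const * \<rho>"
  proof (rule mult_left_mono[OF _ osc_const_nonneg])
    have "\<nu> * \<rho> \<le> 1 * \<rho>" using \<nu> \<rho>_pos by (intro mult_right_mono) auto
    then show "a / \<omega> \<le> \<rho>" using a_sq(3) by linarith
  qed
  finally have 1: "norm (a *\<^sub>R integral {0..s} v) \<le> osc_const * \<rho>" .
  have "norm (integral {0..s} m) \<le> C\<^sup>2 * (s - 0)"
    by (rule integral_bound) (use s m_cont in \<open>auto simp: m_def mdrift_bound\<close>)
  also have "\<dots> \<le> C\<^sup>2 * \<tau>" using s S by (intro mult_left_mono) auto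
  finally have "norm (\<rho> *\<^sub>R integral {0..s} m) \<le> \<rho> * (C\<^sup>2 * \<tau>)" using \<rho>_pos by (simp add: mult_left_mono)
  then show ?thesis unfolding acc_def using 1 by (intro norm_triangle_le) (simp add: drift_const_def algebra_simps)
qed

lemma acc_0: "acc 0 = 0" by (simp add: acc_def)

text \<open>Gronwall for k - acc, so that the term of order a never appears as a forcing. The
  quadratic part of \<open>err\<close> counts as linear because |k| is at most 2 C.\<close>

lemma crude_bound:
  assumes s: "s \<in> {0..S}"
  shows "norm (k s) \<le> crude_const * (norm (k 0) + \<rho>)"
proof -
  let ?e = "\<lambda>s. k s - acc s"
  let ?e' = "\<lambda>s. DF (X (\<psi> + \<beta>0 * s)) (k s) + err s"
  let ?H = drift_const and ?L = rate_const
  have der: "(?e has_vector_derivative ?e' r) (at r within {0..S})" if "r \<in> {0..S}" for r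
    using has_vector_derivative_diff[OF k_deriv[OF that] acc_deriv[OF that]] by (simp add: err_def algebra_simps)
  have bd: "norm (?e' r) \<le> ?L * norm (?e r) + (?L * ?H + 16 * C ^ 4) * \<rho>" if r: "r \<in> {0..S}" for r
  proof -
    let ?n = "norm (k r)"
    have "norm (DF (X (\<psi> + \<beta>0 * r)) (k r)) \<le> C * ?n" by (rule DF_bound[OF X_le_R])
    also have "\<dots> \<le> C ^ 5 * ?n" using C power_increasing[of 1 5 C] by (intro mult_right_mono) auto
    finally have 1: "norm (DF (X (\<psi> + \<beta>0 * r)) (k r)) \<le> C ^ 5 * ?n" .
    have "?n * (?n + 3 * \<nu>) \<le> ?n * (5 * C)" using k_le_2C[OF r] \<nu> C by (intro mult_left_mono) auto
    moreover have "2 * \<nu> * \<rho> \<le> 2 * 1 * \<rho>" using \<nu> \<rho>_pos by (intro mult_right_mono) auto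
    ultimately have "8 * C ^ 4 * (?n * (?n + 3 * \<nu>) + 2 * \<nu> * \<rho>) \<le> 8 * C ^ 4 * (?n * (5 * C) + 2 * \<rho>)"
      using C by (intro mult_left_mono) auto
    then have 2: "norm (err r) \<le> 40 * C ^ 5 * ?n + 16 * C ^ 4 * \<rho>"
      using err_bound[OF r] by (simp add: algebra_simps power_numeral_reduce)
    have "?n \<le> norm (?e r) + ?H * \<rho>"
      using norm_triangle_sub[of "k r" "acc r"] acc_bound[OF r] by linarith
    then have "?L * ?n \<le> ?L * (norm (?e r) + ?H * \<rho>)" using rate_const_nonneg by (rule mult_left_mono)
    then have "norm (?e' r) \<le> ?L * (norm (?e r) + ?H * \<rho>) + 16 * C ^ 4 * \<rho>"
      using 1 2 by (intro norm_triangle_le) (simp add: rate_const_def)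
    then show ?thesis by (simp add: algebra_simps)
  qed
  have c0: "(?L * ?H + 16 * C ^ 4) * \<rho> \<ge> 0" using rate_const_nonneg drift_const_nonneg \<rho>_pos C by simp
  have "norm (?e s) \<le> (norm (?e 0) + (?L * ?H + 16 * C ^ 4) * \<rho> * S) * exp (?L * s)"
    by (rule gronwall_norm[OF der bd rate_const_nonneg c0 s])
  also have "\<dots> \<le> (norm (k 0) + (?L * ?H + 16 * C ^ 4) * \<rho> * \<tau>) * exp (?L * \<tau>)"
    using s S c0 rate_const_nonneg
    by (intro mult_mono add_mono mult_left_mono) (auto simp: acc_0 intro!: mult_left_mono add_nonneg_nonneg mult_nonneg_nonneg)
  finally have "norm (k s) \<le> (norm (k 0) + (?L * ?H + 16 * C ^ 4) * \<rho> * \<tau>) * exp (?L * \<tau>) + ?H * \<rho>"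
    using norm_triangle_sub[of "k s" "acc s"] acc_bound[OF s] by linarith
  also have "\<dots> \<le> crude_const * (norm (k 0) + \<rho>)"
  proof -
    have "0 \<le> norm (k 0) * ((?L * ?H + 16 * C ^ 4) * \<tau> * exp (?L * \<tau>) + ?H + 1) + \<rho> * (exp (?L * \<tau>) + 1)"
      using rate_const_nonneg drift_const_nonneg \<rho>_pos C \<tau> by (intro add_nonneg_nonneg mult_nonneg_nonneg) auto
    then show ?thesis by (simp add: crude_const_def algebra_simps)
  qed
  finally show ?thesis .
qed

definition q :: real where "q = norm (k 0) + \<rho>"

lemma err_bound_q:
  assumes s: "s \<in> {0..S}"
  shows "norm (err s) \<le> err_const * (q * (q + \<nu>) + \<nu> * \<rho>)"
proof -
  let ?n = "norm (k s)" and ?G = crude_const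
  have G: "?G \<ge> 1" by (rule crude_const_ge_1)
  have q0: "q \<ge> 0" using \<rho>_pos by (simp add: q_def)
  have n: "?n \<le> ?G * q" using crude_bound[OF s] by (simp add: q_def)
  have G2: "?G\<^sup>2 \<ge> ?G" "?G\<^sup>2 \<ge> 1" using G by (auto simp: power2_eq_square intro: order_trans)
  have "?n * (?n + 3 * \<nu>) \<le> (?G * q) * (?G * q + 3 * \<nu>)" using n \<nu> q0 G by (intro mult_mono add_mono) auto
  also have "\<dots> = ?G\<^sup>2 * q * q + 3 * (?G * (q * \<nu>))" by (simp add: power2_eq_square algebra_simps)
  also have "\<dots> \<le> 3 * ?G\<^sup>2 * q * q + 3 * (?G\<^sup>2 * (q * \<nu>))"
    using G2 q0 \<nu> by (intro add_mono mult_left_mono mult_right_mono) auto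
  finally have "?n * (?n + 3 * \<nu>) \<le> 3 * ?G\<^sup>2 * (q * (q + \<nu>))" by (simp add: algebra_simps)
  moreover have "2 * \<nu> * \<rho> \<le> 3 * ?G\<^sup>2 * (\<nu> * \<rho>)"
  proof -
    have "2 * (\<nu> * \<rho>) \<le> 3 * ?G\<^sup>2 * (\<nu> * \<rho>)" using G2 \<nu> \<rho>_pos by (intro mult_right_mono) auto
    then show ?thesis by simp
  qed
  ultimately have "8 * C ^ 4 * (?n * (?n + 3 * \<nu>) + 2 * \<nu> * \<rho>) \<le> 8 * C ^ 4 * (3 * ?G\<^sup>2 * (q * (q + \<nu>)) + 3 * ?G\<^sup>2 * (\<nu> * \<rho>))"
    using C by (intro mult_left_mono add_mono) auto
  then show ?thesis using err_bound[OF s] by (simp add: err_const_def algebra_simps)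
qed

text \<open>Besides \<open>acc\<close>, the solution \<open>mh\<close> of the variational equation
  is subtracted. Only \<open>err\<close> and DF applied to \<open>acc\<close> drive the difference,
  so the decay of the linear flow carries over to k up to O(\<rho>) and terms that are small against
  q.\<close>

lemma linearization_bound:
  assumes mh: "\<And>s. s \<in> {0..S} \<Longrightarrow> (mh has_vector_derivative DF (X (\<psi> + \<beta>0 * s)) (mh s)) (at s within {0..S})"
    and mh0: "mh 0 = k 0"
  shows "norm (k S - mh S) \<le> lin_const * (\<rho> + q * (q + \<nu>))"
proof -
  let ?w = "\<lambda>s. k s - acc s - mh s"
  let ?w' = "\<lambda>s. DF (X (\<psi> + \<beta>0 * s)) (k s - mh s) + err s"
  let ?E = "C * drift_const * \<rho> + err_const * (q * (q + \<nu>) + \<nu> * \<rho>)"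
  have q0: "q \<ge> 0" using \<rho>_pos by (simp add: q_def)
  have der: "(?w has_vector_derivative ?w' r) (at r within {0..S})" if "r \<in> {0..S}" for r
    using has_vector_derivative_diff[OF has_vector_derivative_diff[OF k_deriv[OF that] acc_deriv[OF that]] mh[OF that]]
    by (simp add: err_def linear_diff[OF DF_linear] algebra_simps)
  have bd: "norm (?w' r) \<le> C * norm (?w r) + ?E" if r: "r \<in> {0..S}" for r
  proof -
    have "norm (k r - mh r) \<le> norm (?w r) + drift_const * \<rho>"
      using norm_triangle_sub[of "k r - mh r" "acc r"] acc_bound[OF r] by (simp add: algebra_simps)
    then have "C * norm (k r - mh r) \<le> C * (norm (?w r) + drift_const * \<rho>)" using C by (intro mult_left_mono) auto
    then show ?thesis
      using DF_bound[OF X_le_R, of "\<psi> + \<beta>0 * r" "k r - mh r"] err_bound_q[OF r]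
      by (intro norm_triangle_le) (simp add: algebra_simps)
  qed
  have E0: "?E \<ge> 0" using C drift_const_nonneg err_const_nonneg q0 \<nu> \<rho>_pos by simp
  have "norm (?w S) \<le> (norm (?w 0) + ?E * S) * exp (C * S)"
    by (rule gronwall_norm[OF der bd _ E0]) (use C S in auto)
  also have "\<dots> \<le> (?E * \<tau>) * exp (C * \<tau>)"
    using S C E0 \<tau> by (intro mult_mono) (auto simp: acc_0 mh0 intro!: mult_left_mono)
  also have "\<dots> \<le> ((C * drift_const + err_const) * (\<rho> + q * (q + \<nu>)) * \<tau>) * exp (C * \<tau>)"
  proof (intro mult_right_mono)
    have "\<nu> * \<rho> \<le> 1 * \<rho>" using \<nu> \<rho>_pos by (intro mult_right_mono) auto
    then have "err_const * (q * (q + \<nu>) + \<nu> * \<rho>) \<le> err_const * (q * (q + \<nu>) + \<rho>)"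
      using err_const_nonneg by (intro mult_left_mono) auto
    moreover have "C * drift_const * \<rho> \<le> C * drift_const * (\<rho> + q * (q + \<nu>))"
      using C drift_const_nonneg q0 \<nu> by (intro mult_left_mono) auto
    ultimately show "?E \<le> (C * drift_const + err_const) * (\<rho> + q * (q + \<nu>))" by (simp add: algebra_simps)
  qed (use \<tau> in auto)
  finally have "norm (?w S) \<le> (C * drift_const + err_const) * \<tau> * exp (C * \<tau>) * (\<rho> + q * (q + \<nu>))" by (simp add: algebra_simps)
  moreover have "norm (acc S) \<le> drift_const * (\<rho> + q * (q + \<nu>))"
  proof -
    have "drift_const * \<rho> \<le> drift_const * (\<rho> + q * (q + \<nu>))" using drift_const_nonneg q0 \<nu> by (intro mult_left_mono) auto
    then show ?thesis using acc_bound[of S] S by auto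
  qed
  moreover have "norm (k S - mh S) \<le> norm (?w S) + norm (acc S)"
    using norm_triangle_ineq[of "?w S" "acc S"] by simp
  ultimately show ?thesis by (simp add: lin_const_def algebra_simps)
qed

text \<open>Pairing with a solution of the adjoint equation cancels the linear part: (p . k)' = p .
  (a v + \<rho> m + err). The first term oscillates away, the second leaves its mean, and replacing
  \<beta> by \<beta>0 in this mean costs a multiple of \<rho> |\<beta> - \<beta>0|.\<close>

lemma phase_bound:
  assumes pc: "continuous_on UNIV p" and pb: "\<And>\<psi>. norm (p \<psi>) \<le> C" and pl: "\<And>s r. norm (p (\<psi> + \<beta>0 * s) - p (\<psi> + \<beta>0 * r)) \<le> C * \<bar>s - r\<bar>"
    and pd: "\<And>s. ((\<lambda>s. p (\<psi> + \<beta>0 * s)) has_vector_derivative p' s) (at s)"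
    and adj: "\<And>s w. p' s \<bullet> w = - (p (\<psi> + \<beta>0 * s) \<bullet> DF (X (\<psi> + \<beta>0 * s)) w)"
  shows "\<bar>p (\<psi> + \<beta>0 * S) \<bullet> k S - p \<psi> \<bullet> k 0 - \<rho> * integral {0..S} (\<lambda>s. p (\<psi> + \<beta>0 * s) \<bullet> mmean (\<psi> + \<beta>0 * s) (\<theta> + \<beta>0 * s))\<bar>
    \<le> phase_const * (\<nu> * \<rho> + q * (q + \<nu>))"
proof -
  let ?p = "\<lambda>s. p (\<psi> + \<beta>0 * s)"
  let ?mm = "\<lambda>\<beta> s. mmean (\<psi> + \<beta>0 * s) (\<theta> + \<beta> * s)"
  have pcont: "continuous_on T ?p" for T by (rule continuous_on_compose2[OF pc]) (auto intro!: continuous_intros)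
  have q0: "q \<ge> 0" using \<rho>_pos by (simp add: q_def)
  have der: "((\<lambda>s. ?p s \<bullet> k s) has_vector_derivative ?p s \<bullet> (a *\<^sub>R v s + \<rho> *\<^sub>R m s + err s)) (at s within {0..S})"
    if "s \<in> {0..S}" for s
  proof -
    have "((\<lambda>s. ?p s \<bullet> k s) has_vector_derivative ?p s \<bullet> k' s + p' s \<bullet> k s) (at s within {0..S})"
      using has_derivative_inner[OF has_vector_derivative_at_within[OF pd, unfolded has_vector_derivative_def] k_deriv[OF that, unfolded has_vector_derivative_def]]
      by (simp add: has_vector_derivative_def algebra_simps)
    moreover have "?p s \<bullet> k' s + p' s \<bullet> k s = ?p s \<bullet> (a *\<^sub>R v s + \<rho> *\<^sub>R m s + err s)"
      unfolding adj by (simp add: err_def inner_diff_right inner_add_right)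
    ultimately show ?thesis by simp
  qed
  have hi: "((\<lambda>s. ?p s \<bullet> (a *\<^sub>R v s + \<rho> *\<^sub>R m s + err s)) has_integral (?p S \<bullet> k S - ?p 0 \<bullet> k 0)) {0..S}"
    by (rule fundamental_theorem_of_calculus[OF S(1) der])
  have iv: "(\<lambda>s. ?p s \<bullet> v s) integrable_on {0..S}" and im: "(\<lambda>s. ?p s \<bullet> m s) integrable_on {0..S}"
    and imm: "(\<lambda>s. ?p s \<bullet> ?mm b s) integrable_on {0..S}" for b
    by (intro integrable_continuous_real continuous_intros pcont v_cont m_cont mmean_cont)+
  have iva: "(\<lambda>s. a * (?p s \<bullet> v s)) integrable_on {0..S}" and ima: "(\<lambda>s. \<rho> * (?p s \<bullet> m s)) integrable_on {0..S}"
    by (intro integrable_continuous_real continuous_intros pcont v_cont m_cont)+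
  \<comment> \<open>The whole integrand is integrable as a derivative, hence so is what remains
    after removing its continuous parts; the regularity of \<open>err\<close> is not examined
    directly.\<close>
  have ie: "(\<lambda>s. ?p s \<bullet> err s) integrable_on {0..S}"
  proof -
    have "(\<lambda>s. ?p s \<bullet> (a *\<^sub>R v s + \<rho> *\<^sub>R m s + err s) - a * (?p s \<bullet> v s) - \<rho> * (?p s \<bullet> m s)) integrable_on {0..S}"
      by (intro integrable_diff has_integral_integrable[OF hi] iva ima)
    then show ?thesis by (simp add: inner_add_right)
  qed
  have split: "?p S \<bullet> k S - ?p 0 \<bullet> k 0 - \<rho> * integral {0..S} (\<lambda>s. ?p s \<bullet> ?mm \<beta>0 s)
    = a * integral {0..S} (\<lambda>s. ?p s \<bullet> v s) + \<rho> * integral {0..S} (\<lambda>s. ?p s \<bullet> (m s - ?mm \<beta> s))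
      + \<rho> * integral {0..S} (\<lambda>s. ?p s \<bullet> (?mm \<beta> s - ?mm \<beta>0 s)) + integral {0..S} (\<lambda>s. ?p s \<bullet> err s)"
  proof -
    have "?p S \<bullet> k S - ?p 0 \<bullet> k 0 = integral {0..S} (\<lambda>s. a * (?p s \<bullet> v s) + \<rho> * (?p s \<bullet> m s) + ?p s \<bullet> err s)"
      using integral_unique[OF hi] by (simp add: inner_add_right)
    also have "\<dots> = a * integral {0..S} (\<lambda>s. ?p s \<bullet> v s) + \<rho> * integral {0..S} (\<lambda>s. ?p s \<bullet> m s) + integral {0..S} (\<lambda>s. ?p s \<bullet> err s)"
      by (simp only: integral_add[OF integrable_add[OF iva ima] ie] integral_add[OF iva ima] integral_mult_right)
    finally have 1: "?p S \<bullet> k S - ?p 0 \<bullet> k 0 = a * integral {0..S} (\<lambda>s. ?p s \<bullet> v s) + \<rho> * integral {0..S} (\<lambda>s. ?p s \<bullet> m s) + integral {0..S} (\<lambda>s. ?p s \<bullet> err s)" .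
    have "integral {0..S} (\<lambda>s. ?p s \<bullet> (m s - ?mm \<beta> s)) = integral {0..S} (\<lambda>s. ?p s \<bullet> m s) - integral {0..S} (\<lambda>s. ?p s \<bullet> ?mm \<beta> s)"
      "integral {0..S} (\<lambda>s. ?p s \<bullet> (?mm \<beta> s - ?mm \<beta>0 s)) = integral {0..S} (\<lambda>s. ?p s \<bullet> ?mm \<beta> s) - integral {0..S} (\<lambda>s. ?p s \<bullet> ?mm \<beta>0 s)"
      by (simp_all only: inner_diff_right integral_diff[OF im imm] integral_diff[OF imm imm])
    then show ?thesis using 1 by (simp only: right_diff_distrib)
  qed
  have b1: "\<bar>a * integral {0..S} (\<lambda>s. ?p s \<bullet> v s)\<bar> \<le> osc_const * (\<nu> * \<rho>)"
  proof -
    have "\<bar>integral {0..S} (\<lambda>s. ?p s \<bullet> v s)\<bar> \<le> osc_const / \<omega>"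
      unfolding v_def by (rule osc_p_vdrift[OF \<beta>(1,2) \<omega> S pc pb pl])
    then have "\<bar>a * integral {0..S} (\<lambda>s. ?p s \<bullet> v s)\<bar> \<le> a * (osc_const / \<omega>)"
      using a_pos by (simp add: abs_mult mult_left_mono del: times_divide_eq_right)
    also have "\<dots> = osc_const * (a / \<omega>)" by simp
    also have "\<dots> \<le> osc_const * (\<nu> * \<rho>)" by (rule mult_left_mono[OF a_sq(3) osc_const_nonneg])
    finally show ?thesis .
  qed
  have b2: "\<bar>\<rho> * integral {0..S} (\<lambda>s. ?p s \<bullet> (m s - ?mm \<beta> s))\<bar> \<le> osc_const * (\<nu> * \<rho>)"
  proof -
    have "\<bar>integral {0..S} (\<lambda>s. ?p s \<bullet> (m s - ?mm \<beta> s))\<bar> \<le> osc_const / \<omega>"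
      unfolding m_def by (rule osc_p_mdrift[OF \<beta>(1,2) \<omega> S pc pb pl])
    then have "\<bar>\<rho> * integral {0..S} (\<lambda>s. ?p s \<bullet> (m s - ?mm \<beta> s))\<bar> \<le> \<rho> * (osc_const / \<omega>)"
      using \<rho>_pos by (simp add: abs_mult mult_left_mono del: times_divide_eq_right)
    also have "\<dots> = osc_const * (\<rho> / \<omega>)" by simp
    also have "\<dots> \<le> osc_const * (\<nu> * \<rho>)" by (rule mult_left_mono[OF a_sq(4) osc_const_nonneg])
    finally show ?thesis .
  qed
  have b3: "\<bar>\<rho> * integral {0..S} (\<lambda>s. ?p s \<bullet> (?mm \<beta> s - ?mm \<beta>0 s))\<bar> \<le> (2 * C ^ 4 * \<tau>\<^sup>2) * (\<nu> * \<rho>)"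
  proof -
    have "norm (integral {0..S} (\<lambda>s. ?p s \<bullet> (?mm \<beta> s - ?mm \<beta>0 s))) \<le> (2 * C ^ 4 * \<nu> * \<tau>) * (S - 0)"
    proof (rule integral_bound[OF S(1)])
      show "continuous_on {0..S} (\<lambda>s. ?p s \<bullet> (?mm \<beta> s - ?mm \<beta>0 s))"
        by (intro continuous_intros pcont mmean_cont)
      fix s assume s: "s \<in> {0..S}"
      have "norm (?mm \<beta> s - ?mm \<beta>0 s) \<le> 2 * C\<^sup>2 * \<bar>(\<theta> + \<beta> * s) - (\<theta> + \<beta>0 * s)\<bar>"
        by (rule mmean_diff_le[OF mdrift_theta_lip])
      also have "\<dots> = 2 * C\<^sup>2 * (\<bar>\<beta> - \<beta>0\<bar> * s)" using s by (simp add: abs_mult flip: left_diff_distrib)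
      also have "\<dots> \<le> 2 * C\<^sup>2 * ((C * \<nu>) * \<tau>)"
      proof (intro mult_left_mono mult_mono)
        have "C * (\<gamma>\<^sup>2 / \<omega>) \<le> C * \<nu>" using C small(2) by (intro mult_left_mono) auto
        then show "\<bar>\<beta> - \<beta>0\<bar> \<le> C * \<nu>" using \<beta>(3) by linarith
      qed (use s S C \<nu> in auto)
      finally have "norm (?p s \<bullet> (?mm \<beta> s - ?mm \<beta>0 s)) \<le> C * (2 * C\<^sup>2 * ((C * \<nu>) * \<tau>))"
        unfolding real_norm_def using C pb by (intro order_trans[OF Cauchy_Schwarz_ineq2] mult_mono) auto
      then show "norm (?p s \<bullet> (?mm \<beta> s - ?mm \<beta>0 s)) \<le> 2 * C ^ 4 * \<nu> * \<tau>"
        by (simp add: power2_eq_square power4_eq_xxxx algebra_simps)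
    qed
    also have "\<dots> \<le> (2 * C ^ 4 * \<nu> * \<tau>) * \<tau>" using S C \<nu> \<tau> by (intro mult_left_mono) auto
    finally have "\<bar>\<rho> * integral {0..S} (\<lambda>s. ?p s \<bullet> (?mm \<beta> s - ?mm \<beta>0 s))\<bar> \<le> \<rho> * ((2 * C ^ 4 * \<nu> * \<tau>) * \<tau>)"
      using \<rho>_pos by (simp add: abs_mult mult_left_mono)
    then show ?thesis by (simp add: power2_eq_square algebra_simps)
  qed
  have b4: "\<bar>integral {0..S} (\<lambda>s. ?p s \<bullet> err s)\<bar> \<le> (C * err_const * \<tau>) * (q * (q + \<nu>) + \<nu> * \<rho>)"
  proof -
    let ?B = "C * (err_const * (q * (q + \<nu>) + \<nu> * \<rho>))"
    have "norm (integral {0..S} (\<lambda>s. ?p s \<bullet> err s)) \<le> integral {0..S} (\<lambda>_. ?B)"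
    proof (rule integral_norm_bound_integral[OF ie])
      fix s assume "s \<in> {0..S}"
      then show "norm (?p s \<bullet> err s) \<le> ?B"
        unfolding real_norm_def using C pb err_bound_q
        by (intro order_trans[OF Cauchy_Schwarz_ineq2] mult_mono) auto
    qed auto
    also have "\<dots> = ?B * S" using S by simp
    also have "\<dots> \<le> ?B * \<tau>" using S C err_const_nonneg q0 \<nu> \<rho>_pos by (intro mult_left_mono) auto
    finally show ?thesis by (simp add: algebra_simps)
  qed
  have "\<bar>?p S \<bullet> k S - ?p 0 \<bullet> k 0 - \<rho> * integral {0..S} (\<lambda>s. ?p s \<bullet> ?mm \<beta>0 s)\<bar>
    \<le> 2 * osc_const * (\<nu> * \<rho>) + (2 * C ^ 4 * \<tau>\<^sup>2) * (\<nu> * \<rho>) + (C * err_const * \<tau>) * (q * (q + \<nu>) + \<nu> * \<rho>)"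
    unfolding split using b1 b2 b3 b4 by linarith
  also have "\<dots> \<le> phase_const * (\<nu> * \<rho> + q * (q + \<nu>))"
  proof -
    have "0 \<le> (2 * osc_const + 2 * C ^ 4 * \<tau>\<^sup>2) * (q * (q + \<nu>))"
      using osc_const_nonneg C q0 \<nu> by simp
    then show ?thesis by (simp add: phase_const_def algebra_simps)
  qed
  finally show ?thesis by simp
qed

end

subsection \<open>Variation along the invariant torus\<close>

lemma mat_exp_product_derivative:
  assumes h: "(h has_real_derivative h') (at t within T)" and z: "(z has_vector_derivative z') (at t within T)"
  shows "((\<lambda>t. mat_exp (h t *\<^sub>R A) *v z t) has_vector_derivative
    h' *\<^sub>R (A *v (mat_exp (h t *\<^sub>R A) *v z t)) + mat_exp (h t *\<^sub>R A) *v z') (at t within T)"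
proof -
  have zc: "((\<lambda>t. z t $ j) has_real_derivative z' $ j) (at t within T)" for j
    using bounded_linear.has_vector_derivative[OF bounded_linear_vec_nth z]
    by (simp add: has_real_derivative_iff_has_vector_derivative)
  have ec: "((\<lambda>t. mat_exp (h t *\<^sub>R A) $ i $ j) has_real_derivative (A ** mat_exp (h t *\<^sub>R A)) $ i $ j * h') (at t within T)" for i j
    using DERIV_chain2[OF mat_exp_entry_derivative h] .
  have "((\<lambda>t. (mat_exp (h t *\<^sub>R A) *v z t) $ i) has_real_derivative
     (h' *\<^sub>R ((A ** mat_exp (h t *\<^sub>R A)) *v z t) + mat_exp (h t *\<^sub>R A) *v z') $ i) (at t within T)" for i
  proof -
    have "((\<lambda>t. \<Sum>j\<in>UNIV. mat_exp (h t *\<^sub>R A) $ i $ j * z t $ j) has_real_derivative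
      (\<Sum>j\<in>UNIV. (A ** mat_exp (h t *\<^sub>R A)) $ i $ j * h' * z t $ j + mat_exp (h t *\<^sub>R A) $ i $ j * z' $ j)) (at t within T)"
      by (intro DERIV_sum) (auto intro!: derivative_eq_intros ec zc)
    then show ?thesis
      unfolding matrix_vector_mult_def[of "mat_exp _"] matrix_vector_mult_def[of "_ ** _"]
      by (simp add: sum.distrib sum_distrib_left mult.assoc mult.left_commute)
  qed
  then show ?thesis
    unfolding has_real_derivative_iff_has_vector_derivative has_vector_derivative_def
      has_derivative_componentwise_within[of "\<lambda>t. mat_exp (h t *\<^sub>R A) *v z t"]
    by (auto simp: Basis_vec_def inner_axis matrix_vector_mul_assoc)
qed

text \<open>Time reversal supplies the case s < r. The two-sided bound controls both a fundamental
  matrix and its inverse.\<close>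

lemma linear_ode_growth:
  fixes w :: "real \<Rightarrow> 'a::euclidean_space"
  assumes w: "\<And>s. (w has_vector_derivative B s (w s)) (at s)"
    and B: "\<And>s v. norm (B s v) \<le> L * norm v" and L: "L \<ge> 0"
  shows "norm (w s) \<le> norm (w r) * exp (L * \<bar>s - r\<bar>)"
proof (cases "r \<le> s")
  case True
  have "norm (w (r + (s - r))) \<le> (norm (w (r + 0)) + 0 * (s - r)) * exp (L * (s - r))"
  proof (rule gronwall_norm[of "s - r" "\<lambda>t. w (r + t)" "\<lambda>t. B (r + t) (w (r + t))" L 0 "s - r"])
    fix t
    have "((\<lambda>t. r + t) has_vector_derivative 1) (at t within {0..s - r})" by (auto intro!: derivative_eq_intros)
    from vector_diff_chain_within[OF this has_vector_derivative_at_within[OF w]]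
    show "((\<lambda>t. w (r + t)) has_vector_derivative B (r + t) (w (r + t))) (at t within {0..s - r})" by (simp add: o_def)
  qed (use True L B in auto)
  then show ?thesis using True by simp
next
  case False
  have "norm (w (r - (r - s))) \<le> (norm (w (r - 0)) + 0 * (r - s)) * exp (L * (r - s))"
  proof (rule gronwall_norm[of "r - s" "\<lambda>t. w (r - t)" "\<lambda>t. - B (r - t) (w (r - t))" L 0 "r - s"])
    fix t
    have "((\<lambda>t. r - t) has_vector_derivative -1) (at t within {0..r - s})" by (auto intro!: derivative_eq_intros)
    from vector_diff_chain_within[OF this has_vector_derivative_at_within[OF w]]
    show "((\<lambda>t. w (r - t)) has_vector_derivative - B (r - t) (w (r - t))) (at t within {0..r - s})" by (simp add: o_def)
  qed (use False L B in auto)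
  then show ?thesis using False by simp
qed

locale perturbed_torus =
  fixes f :: "real^'n \<Rightarrow> real^'n" and g u :: "real^'n \<Rightarrow> real \<Rightarrow> real \<Rightarrow> real^'n"
    and A :: "real^'n^'n" and x0 p1 p2 :: "real \<Rightarrow> real^'n" and \<alpha>0 \<beta>0 :: real
  assumes f_smooth: "C_k 2 f"
    and g_smooth: "C_k 2 (\<lambda>(x, \<psi>, \<phi>). g x \<psi> \<phi>)"
    and A_skew: "transpose A = - A"
    and f_equivariant: "\<And>x \<xi>. f (mat_exp (\<xi> *\<^sub>R A) *v x) = mat_exp (\<xi> *\<^sub>R A) *v f x"
    and g_periodic: "\<And>x \<psi> \<phi>. g x (\<psi> + 2 * pi) \<phi> = g x \<psi> \<phi>"
                    "\<And>x \<psi> \<phi>. g x \<psi> (\<phi> + 2 * pi) = g x \<psi> \<phi>"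
    and g_equivariant:
      "\<And>x \<psi> \<phi> \<xi>. g (mat_exp (\<xi> *\<^sub>R A) *v x) \<psi> (\<phi> + \<xi>) = mat_exp (\<xi> *\<^sub>R A) *v g x \<psi> \<phi>"
    and \<beta>0: "\<beta>0 > 0"
    and x0_periodic: "\<And>\<psi>. x0 (\<psi> + 2 * pi) = x0 \<psi>"
    and unperturbed_solution:
      "solves_ode_on (\<lambda>t. f) UNIV (\<lambda>t. mat_exp ((\<alpha>0 * t) *\<^sub>R A) *v x0 (\<beta>0 * t))"
    and exp_orbitally_stable:
      "multiplier_one_double_others_stable
         (\<lambda>\<psi>. (1 / \<beta>0) *\<^sub>R (jacobian f (at (x0 \<psi>)) - \<alpha>0 *\<^sub>R A)) (2 * pi)"
    and p_adjoint:
      "\<And>p. p \<in> {p1, p2} \<Longrightarrow>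
         solves_ode_on
           (\<lambda>\<psi> z. (1 / \<beta>0) *\<^sub>R (- ((transpose (jacobian f (at (x0 \<psi>))) + \<alpha>0 *\<^sub>R A) *v z))) UNIV p"
    and p_periodic: "\<And>p \<psi>. p \<in> {p1, p2} \<Longrightarrow> p (\<psi> + 2 * pi) = p \<psi>"
    and p_q_dual:
      "\<And>\<psi>. p1 \<psi> \<bullet> vector_derivative x0 (at \<psi>) = 1" "\<And>\<psi>. p1 \<psi> \<bullet> (A *v x0 \<psi>) = 0"
      "\<And>\<psi>. p2 \<psi> \<bullet> vector_derivative x0 (at \<psi>) = 0" "\<And>\<psi>. p2 \<psi> \<bullet> (A *v x0 \<psi>) = 1"
    and u_antiderivative:
      "\<And>x \<psi> \<phi>. ((\<lambda>s. u x \<psi> s) has_vector_derivative g x \<psi> \<phi>) (at \<phi>)"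
    and u_mean: "\<And>x \<psi>. integral {0..2 * pi} (\<lambda>\<phi>. u x \<psi> \<phi>) = 0"
    and g_mean: "\<And>x \<psi>. (1 / (2 * pi)) *\<^sub>R integral {0..2 * pi} (\<lambda>\<phi>. g x \<psi> \<phi>) = 0"
begin

definition E :: "real \<Rightarrow> real^'n \<Rightarrow> real^'n" where "E \<xi> x = mat_exp (\<xi> *\<^sub>R A) *v x"
text \<open>In the rotating frame the quasiperiodic solution becomes the periodic orbit x0(\<beta>0
  t) of this field.\<close>

definition F :: "real^'n \<Rightarrow> real^'n" where "F x = f x - \<alpha>0 *\<^sub>R (A *v x)"
definition DF :: "real^'n \<Rightarrow> real^'n \<Rightarrow> real^'n" where "DF x v = frechet_derivative f (at x) v - \<alpha>0 *\<^sub>R (A *v v)"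
definition G :: "(real^'n) \<times> real \<times> real \<Rightarrow> real^'n" where "G = (\<lambda>(x, \<psi>, \<phi>). g x \<psi> \<phi>)"
definition U :: "(real^'n) \<times> real \<times> real \<Rightarrow> real^'n" where "U = (\<lambda>(x, \<psi>, \<phi>). u x \<psi> \<phi>)"
text \<open>Written through the field rather than as a derivative, which makes its own
  differentiability visible; \<open>x0_deriv\<close> identifies it with the derivative of
  x0.\<close>

definition q1 :: "real \<Rightarrow> real^'n" where "q1 \<psi> = (1 / \<beta>0) *\<^sub>R F (x0 \<psi>)"
definition q2 :: "real \<Rightarrow> real^'n" where "q2 \<psi> = A *v x0 \<psi>"

lemma E_0 [simp]: "E 0 x = x" using mat_exp_zero[of A] by (simp add: E_def)
lemma E_add: "E (\<xi> + \<eta>) x = E \<xi> (E \<eta> x)" by (simp add: E_def mat_exp_add[OF A_skew])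
lemma E_norm [simp]: "norm (E \<xi> x) = norm x" by (simp add: E_def mat_exp_norm[OF A_skew])
lemma E_inverse [simp]: "E (- \<xi>) (E \<xi> x) = x" "E \<xi> (E (- \<xi>) x) = x" by (simp_all flip: E_add)
lemma E_linear: "linear (E \<xi>)" unfolding E_def by (rule matrix_vector_mul_linear)
lemma E_diff: "E \<xi> (x - y) = E \<xi> x - E \<xi> y" by (rule linear_diff[OF E_linear])
lemma E_deriv: "((\<lambda>\<xi>. E \<xi> x) has_vector_derivative A *v E \<xi> x) (at \<xi>)"
  unfolding E_def by (rule mat_exp_has_vector_derivative)

lemma E_product:
  assumes "(h has_real_derivative h') (at t within T)" "(z has_vector_derivative z') (at t within T)"
  shows "((\<lambda>t. E (h t) (z t)) has_vector_derivative h' *\<^sub>R (A *v E (h t) (z t)) + E (h t) z') (at t within T)"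
  using mat_exp_product_derivative[OF assms] by (simp add: E_def)

lemma f_E: "f (E \<xi> x) = E \<xi> (f x)" by (simp add: E_def f_equivariant)
lemma g_E: "g (E \<xi> x) \<psi> (\<phi> + \<xi>) = E \<xi> (g x \<psi> \<phi>)" by (simp add: E_def g_equivariant)

lemma f_C1: "C_k (Suc 0) f" by (rule C_k_antimono[OF f_smooth]) simp
lemma G_C2: "C_k 2 G" using g_smooth by (simp add: G_def)
lemma G_C1: "C_k (Suc 0) G" by (rule C_k_antimono[OF G_C2]) simp

lemma G_cont: "continuous_on T G" by (rule C1_imp_continuous[OF G_C1])

lemma f_deriv: "(f has_derivative frechet_derivative f (at x)) (at x)" by (rule C1_has_derivative[OF f_C1])

lemma jacobian_f: "jacobian f (at x) *v v = frechet_derivative f (at x) v"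
  using frechet_derivative_eq[of f "\<lambda>h. jacobian f (at x) *v h" x] jacobian_works[of f "at x"] f_C1 by simp

text \<open>x0 is recovered from the unperturbed solution z by rotating back, x0(\<psi>) =
  exp(-(\<alpha>0 / \<beta>0) \<psi> A) z(\<psi> / \<beta>0), so its differentiability follows from
  the differential equation.\<close>

lemma x0_deriv: "(x0 has_vector_derivative q1 \<psi>) (at \<psi>)"
proof -
  define z where "z = (\<lambda>t. E (\<alpha>0 * t) (x0 (\<beta>0 * t)))"
  have z: "(z has_vector_derivative f (z t)) (at t)" for t
    using unperturbed_solution by (simp add: solves_ode_on_def z_def E_def)
  have eq: "x0 \<psi> = E (- \<alpha>0 / \<beta>0 * \<psi>) (z (\<psi> / \<beta>0))" for \<psi>
    using \<beta>0 by (simp add: z_def flip: E_add)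
  have "((\<lambda>\<psi>. \<psi> / \<beta>0) has_vector_derivative 1 / \<beta>0) (at \<psi>)"
    using \<beta>0 by (auto intro!: derivative_eq_intros simp: has_vector_derivative_def)
  from vector_diff_chain_at[OF this z] have dz: "((\<lambda>\<psi>. z (\<psi> / \<beta>0)) has_vector_derivative (1 / \<beta>0) *\<^sub>R f (z (\<psi> / \<beta>0))) (at \<psi>)"
    by (simp add: o_def)
  have dh: "((\<lambda>\<psi>. - \<alpha>0 / \<beta>0 * \<psi>) has_real_derivative - \<alpha>0 / \<beta>0) (at \<psi>)"
    using \<beta>0 by (auto intro!: derivative_eq_intros)
  have "((\<lambda>\<psi>. E (- \<alpha>0 / \<beta>0 * \<psi>) (z (\<psi> / \<beta>0))) has_vector_derivative
      (- \<alpha>0 / \<beta>0) *\<^sub>R (A *v E (- \<alpha>0 / \<beta>0 * \<psi>) (z (\<psi> / \<beta>0))) + E (- \<alpha>0 / \<beta>0 * \<psi>) ((1 / \<beta>0) *\<^sub>R f (z (\<psi> / \<beta>0)))) (at \<psi>)"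
    by (rule E_product[OF dh dz])
  moreover have "E (- \<alpha>0 / \<beta>0 * \<psi>) ((1 / \<beta>0) *\<^sub>R f (z (\<psi> / \<beta>0))) = (1 / \<beta>0) *\<^sub>R f (x0 \<psi>)"
    by (simp only: linear_cmul[OF E_linear] eq[of \<psi>] f_E)
  ultimately show ?thesis
    unfolding eq[symmetric] by (simp add: q1_def F_def scaleR_diff_right)
qed

lemma vector_derivative_x0: "vector_derivative x0 (at \<psi>) = q1 \<psi>"
  by (rule vector_derivative_at[OF x0_deriv])

lemma pq: "p1 \<psi> \<bullet> q1 \<psi> = 1" "p1 \<psi> \<bullet> q2 \<psi> = 0" "p2 \<psi> \<bullet> q1 \<psi> = 0" "p2 \<psi> \<bullet> q2 \<psi> = 1"
  using p_q_dual[of \<psi>] by (simp_all add: vector_derivative_x0 q2_def)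

lemma x0_cont: "continuous_on T x0"
  by (rule vector_derivative_imp_continuous_on[OF x0_deriv])

lemma continuous_periodic_bounded:
  fixes h :: "real \<Rightarrow> 'b::euclidean_space"
  assumes "continuous_on UNIV h" "\<And>s. h (s + 2 * pi) = h s"
  shows "\<exists>B. \<forall>s. norm (h s) \<le> B"
proof -
  have "\<exists>B. \<forall>z\<in>UNIV. norm (h z) \<le> B"
  proof (rule bounded_by_periodicity[OF assms(1), of "{0..2 * pi}" "range (\<lambda>n. of_int n * (2 * pi))"])
    fix c w assume "c \<in> range (\<lambda>n. of_int n * (2 * pi))"
    then show "h (w + c) = h w" using periodic_add_of_int[of h "2 * pi", OF assms(2)] by auto
  next
    fix z :: real
    have "0 < 2 * pi" by simp
    then have "z + of_int (- \<lfloor>z / (2 * pi)\<rfloor>) * (2 * pi) \<in> {0..2 * pi}"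
      using floor_divide_lower[of "2 * pi" z] floor_divide_upper[of "2 * pi" z] by (simp add: algebra_simps)
    then show "\<exists>c\<in>range (\<lambda>n. of_int n * (2 * pi)). z + c \<in> {0..2 * pi}" by blast
  qed simp
  then show ?thesis by simp
qed

lemma DF_linear: "linear (DF x)"
  unfolding DF_def
  by (intro linear_compose_sub C1_linear[OF f_C1] linear_compose_scale_right matrix_vector_mul_linear)

lemma F_deriv: "(F has_derivative DF x) (at x)"
  unfolding F_def[abs_def] DF_def[abs_def]
  by (intro has_derivative_diff f_deriv has_derivative_scaleR_right bounded_linear_imp_has_derivative matrix_vector_mul_bounded_linear)

lemma DF_cont:
  assumes "continuous_on T p" "continuous_on T q"
  shows "continuous_on T (\<lambda>s. DF (p s) (q s))"
  unfolding DF_def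
  by (intro continuous_on_diff continuous_on_scaleR continuous_on_const continuous_on_C1_derivative[OF f_C1 assms]
      bounded_linear.continuous_on[OF matrix_vector_mul_bounded_linear assms(2)])

lemma F_cont: "continuous_on T F"
  by (rule continuous_at_imp_continuous_on, rule ballI, rule has_derivative_continuous[OF F_deriv])

text \<open>Derivative at \<xi> = 0 of the equivariance of f. It makes A x0 a solution of the
  variational equation.\<close>

lemma DF_A: "DF x (A *v x) = A *v F x"
proof -
  have "((\<lambda>\<xi>. f (E \<xi> x)) has_derivative (\<lambda>h. frechet_derivative f (at (E 0 x)) (h *\<^sub>R (A *v E 0 x)))) (at 0)"
    by (rule has_derivative_compose[OF E_deriv[unfolded has_vector_derivative_def] f_deriv])
  then have "((\<lambda>\<xi>. f (E \<xi> x)) has_vector_derivative frechet_derivative f (at x) (A *v x)) (at 0)"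
    by (simp add: has_vector_derivative_def linear_cmul[OF C1_linear[OF f_C1]])
  moreover have "((\<lambda>\<xi>. f (E \<xi> x)) has_vector_derivative A *v f x) (at 0)"
    unfolding f_E using E_deriv[of "f x" 0] by simp
  ultimately have "frechet_derivative f (at x) (A *v x) = A *v f x"
    by (rule vector_derivative_unique_at)
  then show ?thesis by (simp add: DF_def F_def matrix_vector_mult_diff_distrib matrix_vector_mult_scaleR)
qed

definition var_sol :: "(real \<Rightarrow> real^'n) \<Rightarrow> bool" where
  "var_sol w \<longleftrightarrow> (\<forall>s. (w has_vector_derivative (1 / \<beta>0) *\<^sub>R DF (x0 s) (w s)) (at s))"

lemma var_sol_q1: "var_sol q1"
  unfolding var_sol_def
proof
  fix s
  have "((\<lambda>s. F (x0 s)) has_derivative (\<lambda>h. DF (x0 s) (h *\<^sub>R q1 s))) (at s)"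
    by (rule has_derivative_compose[OF x0_deriv[unfolded has_vector_derivative_def] F_deriv])
  then have "((\<lambda>s. F (x0 s)) has_vector_derivative DF (x0 s) (q1 s)) (at s)"
    by (simp add: has_vector_derivative_def linear_cmul[OF DF_linear])
  then show "(q1 has_vector_derivative (1 / \<beta>0) *\<^sub>R DF (x0 s) (q1 s)) (at s)"
    unfolding q1_def[abs_def] by (rule bounded_linear.has_vector_derivative[OF bounded_linear_scaleR_right])
qed

lemma var_sol_q2: "var_sol q2"
  unfolding var_sol_def
proof
  fix s
  have "((\<lambda>s. A *v x0 s) has_vector_derivative A *v q1 s) (at s)"
    by (rule bounded_linear.has_vector_derivative[OF matrix_vector_mul_bounded_linear x0_deriv])
  then show "(q2 has_vector_derivative (1 / \<beta>0) *\<^sub>R DF (x0 s) (q2 s)) (at s)"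
    unfolding q2_def[abs_def] DF_A by (simp add: q1_def matrix_vector_mult_scaleR)
qed

lemma q_periodic: "q1 (s + 2 * pi) = q1 s" "q2 (s + 2 * pi) = q2 s"
  by (simp_all add: q1_def q2_def x0_periodic)

text \<open>Weak form of the adjoint equation, with skewness turning the given +\<alpha>0 A into the
  transpose of -\<alpha>0 A. Tested against basis vectors it also gives continuity of p'.\<close>

lemma p_deriv:
  assumes "p \<in> {p1, p2}"
  obtains p' where "\<And>s. (p has_vector_derivative p' s) (at s)" "\<And>s w. p' s \<bullet> w = - (1 / \<beta>0) * (p s \<bullet> DF (x0 s) w)"
    "continuous_on UNIV p'"
proof
  let ?p' = "\<lambda>s. (1 / \<beta>0) *\<^sub>R (- ((transpose (jacobian f (at (x0 s))) + \<alpha>0 *\<^sub>R A) *v p s))"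
  show der: "(p has_vector_derivative ?p' s) (at s)" for s using p_adjoint[OF assms] by (simp add: solves_ode_on_def)
  have tr: "(transpose M *v v) \<bullet> w = v \<bullet> (M *v w)" for M :: "real^'n^'n" and v w
    by (metis dot_lmul_matrix transpose_matrix_vector)
  have sk: "(A *v v) \<bullet> w = - (v \<bullet> (A *v w))" for v w
  proof -
    have "(A *v v) \<bullet> w = (transpose (- A) *v v) \<bullet> w" using A_skew by (metis transpose_transpose)
    also have "\<dots> = - (v \<bullet> (A *v w))"
      unfolding tr by (simp add: matrix_vector_mult_def inner_vec_def sum_negf)
    finally show ?thesis .
  qed
  show adj: "?p' s \<bullet> w = - (1 / \<beta>0) * (p s \<bullet> DF (x0 s) w)" for s w
  proof -
    have e: "(transpose (jacobian f (at (x0 s))) + \<alpha>0 *\<^sub>R A) *v p s = transpose (jacobian f (at (x0 s))) *v p s + \<alpha>0 *\<^sub>R (A *v p s)"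
      by (simp only: matrix_vector_mult_add_rdistrib scaleR_matrix_vector_assoc)
    have "((transpose (jacobian f (at (x0 s))) + \<alpha>0 *\<^sub>R A) *v p s) \<bullet> w = p s \<bullet> DF (x0 s) w"
      by (simp add: e inner_add_left tr sk DF_def inner_diff_right jacobian_f del: transpose_matrix_vector)
    then show ?thesis by (simp only: inner_scaleR_left inner_minus_left)
  qed
  have "continuous_on UNIV p" by (rule vector_derivative_imp_continuous_on[OF der])
  then have "continuous_on UNIV (\<lambda>s. ?p' s \<bullet> i)" for i
    unfolding adj by (intro continuous_intros DF_cont x0_cont)
  then show "continuous_on UNIV ?p'" by (rule continuous_on_componentwise[THEN iffD2, rule_format])
qed

lemma p_dual_const:
  assumes w: "var_sol w" and p: "p \<in> {p1, p2}"
  shows "p s \<bullet> w s = p 0 \<bullet> w 0"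
proof -
  obtain p' where p': "\<And>s. (p has_vector_derivative p' s) (at s)" "\<And>s w. p' s \<bullet> w = - (1 / \<beta>0) * (p s \<bullet> DF (x0 s) w)"
    using p_deriv[OF p] by metis
  have "((\<lambda>s. p s \<bullet> w s) has_real_derivative 0) (at s)" for s
  proof -
    have "((\<lambda>s. p s \<bullet> w s) has_vector_derivative p s \<bullet> ((1 / \<beta>0) *\<^sub>R DF (x0 s) (w s)) + p' s \<bullet> w s) (at s)"
      using has_derivative_inner[OF p'(1)[unfolded has_vector_derivative_def] w[unfolded var_sol_def, rule_format, unfolded has_vector_derivative_def], of s]
      by (simp add: has_vector_derivative_def algebra_simps)
    then show ?thesis unfolding p'(2) by (simp add: has_real_derivative_iff_has_vector_derivative)
  qed
  then show ?thesis by (rule DERIV_isconst_all[rule_format, of "\<lambda>s. p s \<bullet> w s"])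
qed

lemma DF_x0_bound: "\<exists>L\<ge>0. \<forall>s v. norm ((1 / \<beta>0) *\<^sub>R DF (x0 s) v) \<le> L * norm v"
proof -
  have "\<exists>B. \<forall>s. norm (DF (x0 s) i) \<le> B" for i
    by (rule continuous_periodic_bounded) (auto intro!: DF_cont x0_cont continuous_intros simp: x0_periodic)
  then obtain B where B: "\<And>i s. norm (DF (x0 s) i) \<le> B i" by metis
  have "norm (DF (x0 s) v) \<le> (\<Sum>i\<in>Basis. B i) * norm v" for s v
  proof -
    have "DF (x0 s) v = (\<Sum>i\<in>Basis. (v \<bullet> i) *\<^sub>R DF (x0 s) i)"
      using linear_sum[OF DF_linear, of "x0 s" "\<lambda>i. (v \<bullet> i) *\<^sub>R i" Basis] linear_cmul[OF DF_linear]
      by (simp add: euclidean_representation)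
    also have "norm \<dots> \<le> (\<Sum>i\<in>Basis. norm v * B i)"
      by (intro sum_norm_le) (auto intro!: mult_mono Basis_le_norm B)
    finally show ?thesis by (simp add: sum_distrib_left mult.commute)
  qed
  then have "norm ((1 / \<beta>0) *\<^sub>R DF (x0 s) v) \<le> ((1 / \<beta>0) * (\<Sum>i\<in>Basis. B i)) * norm v" for s v
    using \<beta>0 by (simp add: divide_right_mono)
  moreover have "(1 / \<beta>0) * (\<Sum>i\<in>(Basis::(real^'n) set). B i) \<ge> 0"
    using \<beta>0 order_trans[OF norm_ge_zero B] by (intro mult_nonneg_nonneg sum_nonneg) auto
  ultimately show ?thesis by blast
qed

lemma var_sol_diff: "var_sol w \<Longrightarrow> var_sol z \<Longrightarrow> var_sol (\<lambda>s. w s - z s)"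
  unfolding var_sol_def linear_diff[OF DF_linear] scaleR_diff_right
  by (auto intro: has_vector_derivative_diff)

lemma var_sol_unique:
  assumes "var_sol w" "var_sol z" "w r = z r"
  shows "w s = z s"
proof -
  obtain L where L: "L \<ge> 0" "\<And>s v. norm ((1 / \<beta>0) *\<^sub>R DF (x0 s) v) \<le> L * norm v" using DF_x0_bound by blast
  have "norm (w s - z s) \<le> norm (w r - z r) * exp (L * \<bar>s - r\<bar>)"
    by (rule linear_ode_growth[where B = "\<lambda>s v. (1 / \<beta>0) *\<^sub>R DF (x0 s) v"])
      (use var_sol_diff[OF assms(1,2)] L in \<open>auto simp: var_sol_def\<close>)
  then show ?thesis using assms(3) by simp
qed

lemma var_sol_shift:
  assumes "var_sol w"
  shows "var_sol (\<lambda>s. w (s + 2 * pi))"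
  unfolding var_sol_def
proof
  fix s
  have "((\<lambda>s. s + 2 * pi) has_vector_derivative 1) (at s)" by (auto intro!: derivative_eq_intros)
  from vector_diff_chain_at[OF this assms[unfolded var_sol_def, rule_format]]
  show "((\<lambda>s. w (s + 2 * pi)) has_vector_derivative (1 / \<beta>0) *\<^sub>R DF (x0 s) (w (s + 2 * pi))) (at s)"
    by (simp add: o_def x0_periodic)
qed

definition proj :: "real \<Rightarrow> real^'n \<Rightarrow> real^'n" where
  "proj \<psi> = deflate (q1 \<psi>) (q2 \<psi>) (p1 \<psi>) (p2 \<psi>)"

lemma periodic_int: "x0 (\<psi> + of_int n * (2 * pi)) = x0 \<psi>" "q1 (\<psi> + of_int n * (2 * pi)) = q1 \<psi>" "q2 (\<psi> + of_int n * (2 * pi)) = q2 \<psi>"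
  "p1 (\<psi> + of_int n * (2 * pi)) = p1 \<psi>" "p2 (\<psi> + of_int n * (2 * pi)) = p2 \<psi>"
  using periodic_add_of_int[of x0 "2 * pi", OF x0_periodic] periodic_add_of_int[of q1 "2 * pi", OF q_periodic(1)]
    periodic_add_of_int[of q2 "2 * pi", OF q_periodic(2)] periodic_add_of_int[of p1 "2 * pi", OF p_periodic]
    periodic_add_of_int[of p2 "2 * pi", OF p_periodic]
  by auto

text \<open>The number of periods is chosen so that the deflated monodromy matrix contracts by one half,
  uniformly in the initial phase.\<close>

lemma transversal_contraction:
  "\<exists>N>0. \<forall>\<psi> h. \<exists>m. m 0 = h \<and> (\<forall>s. (m has_vector_derivative DF (x0 (\<psi> + \<beta>0 * s)) (m s)) (at s)) \<and>
     norm (proj \<psi> (m (2 * pi * real N / \<beta>0))) \<le> 1 / 2 * norm h"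
proof -
  obtain Y where Y0: "Y 0 = mat 1"
    and Y: "solves_ode_on (\<lambda>s Z. ((1 / \<beta>0) *\<^sub>R (jacobian f (at (x0 s)) - \<alpha>0 *\<^sub>R A)) ** Z) UNIV Y"
    and ord: "order 1 (cmplx_charpoly (Y (2 * pi))) = 2"
    and roots: "\<And>\<mu>. poly (cmplx_charpoly (Y (2 * pi))) \<mu> = 0 \<Longrightarrow> \<mu> = 1 \<or> cmod \<mu> < 1"
    using exp_orbitally_stable unfolding multiplier_one_double_others_stable_def by blast
  have Yv: "var_sol (\<lambda>s. Y s *v v)" for v
    unfolding var_sol_def
  proof
    fix s
    have bl: "bounded_linear (\<lambda>M::real^'n^'n. M *v v)"
      by (intro linear_conv_bounded_linear[THEN iffD1] linearI)
        (auto simp: matrix_vector_mult_add_rdistrib scaleR_matrix_vector_assoc)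
    have "((\<lambda>s. Y s *v v) has_vector_derivative (((1 / \<beta>0) *\<^sub>R (jacobian f (at (x0 s)) - \<alpha>0 *\<^sub>R A)) ** Y s) *v v) (at s)"
      by (rule bounded_linear.has_vector_derivative[OF bl]) (use Y in \<open>simp add: solves_ode_on_def\<close>)
    moreover have "(((1 / \<beta>0) *\<^sub>R (jacobian f (at (x0 s)) - \<alpha>0 *\<^sub>R A)) ** Y s) *v v = (1 / \<beta>0) *\<^sub>R DF (x0 s) (Y s *v v)"
      by (simp add: DF_def matrix_vector_mul_assoc[symmetric] scaleR_matrix_vector_assoc[symmetric] matrix_vector_mult_diff_rdistrib jacobian_f)
    ultimately show "((\<lambda>s. Y s *v v) has_vector_derivative (1 / \<beta>0) *\<^sub>R DF (x0 s) (Y s *v v)) (at s)" by simp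
  qed
  let ?M = "Y (2 * pi)"
  have Yq: "Y s *v q1 0 = q1 s" "Y s *v q2 0 = q2 s" for s
    by (rule var_sol_unique[OF Yv var_sol_q1, where r = 0] var_sol_unique[OF Yv var_sol_q2, where r = 0], simp add: Y0)+
  have pY: "p1 s \<bullet> (Y s *v v) = p1 0 \<bullet> v" "p2 s \<bullet> (Y s *v v) = p2 0 \<bullet> v" for s v
    using p_dual_const[OF Yv[of v], of p1 s] p_dual_const[OF Yv[of v], of p2 s] by (simp_all add: Y0)
  have shift: "Y (s + 2 * pi) *v v = Y s *v (?M *v v)" for s v
    by (rule var_sol_unique[OF var_sol_shift[OF Yv[of v]] Yv[of "?M *v v"], where r = 0]) (simp add: Y0)
  have shiftN: "Y (s + 2 * pi * real N) *v v = Y s *v ((((*v) ?M) ^^ N) v)" for s v N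
  proof (induction N arbitrary: v)
    case (Suc N)
    have "Y (s + 2 * pi * real (Suc N)) *v v = Y ((s + 2 * pi * real N) + 2 * pi) *v v" by (simp add: algebra_simps)
    also have "\<dots> = Y s *v ((((*v) ?M) ^^ N) (?M *v v))" unfolding shift Suc ..
    finally show ?case by (simp add: funpow_swap1)
  qed simp
  obtain L where L: "L \<ge> 0" "\<And>s v. norm ((1 / \<beta>0) *\<^sub>R DF (x0 s) v) \<le> L * norm v" using DF_x0_bound by blast
  have gr: "norm (Y s *v v) \<le> norm (Y r *v v) * exp (L * \<bar>s - r\<bar>)" for s r v
    by (rule linear_ode_growth[where B = "\<lambda>s v. (1 / \<beta>0) *\<^sub>R DF (x0 s) v" and w = "\<lambda>s. Y s *v v"])
      (use Yv L in \<open>auto simp: var_sol_def\<close>)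
  \<comment> \<open>\<open>?e\<close> bounds the growth of the fundamental matrix and of its inverse
    between phase 0 and any phase of one period. Pulling h back to phase 0 and pushing the result
    forward costs one such factor each, whence the square in the contraction demanded at phase
    0.\<close>
  let ?e = "exp (L * (2 * pi))"
  have "\<exists>N>0. \<forall>v. norm (deflate (q1 0) (q2 0) (p1 0) (p2 0) ((((*v) ?M) ^^ N) v)) \<le> (1 / (2 * ?e * ?e)) * norm v"
  proof (rule deflated_monodromy_contracts[OF _ _ _ _ pq ord roots])
    show "?M *v q1 0 = q1 0" "?M *v q2 0 = q2 0" using Yq[of "2 * pi"] q_periodic[of 0] by simp_all
    show "p1 0 \<bullet> (?M *v v) = p1 0 \<bullet> v" "p2 0 \<bullet> (?M *v v) = p2 0 \<bullet> v" for v
      using pY[of "2 * pi" v] p_periodic[of p1 0] p_periodic[of p2 0] by simp_all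
  qed simp_all
  then obtain N where N: "N > 0" "\<And>v. norm (deflate (q1 0) (q2 0) (p1 0) (p2 0) ((((*v) ?M) ^^ N) v)) \<le> (1 / (2 * ?e * ?e)) * norm v"
    by auto
  have "\<exists>m. m 0 = h \<and> (\<forall>s. (m has_vector_derivative DF (x0 (\<psi> + \<beta>0 * s)) (m s)) (at s)) \<and>
     norm (proj \<psi> (m (2 * pi * real N / \<beta>0))) \<le> 1 / 2 * norm h" for \<psi> h
  proof -
    define n where "n = - \<lfloor>\<psi> / (2 * pi)\<rfloor>"
    define \<psi>' where "\<psi>' = \<psi> + of_int n * (2 * pi)"
    have "0 < 2 * pi" by simp
    then have \<psi>': "\<psi>' \<in> {0..2 * pi}"
      using floor_divide_lower[of "2 * pi" \<psi>] floor_divide_upper[of "2 * pi" \<psi>] by (simp add: \<psi>'_def n_def algebra_simps)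
    have inv: "norm v \<le> ?e * norm (Y \<psi>' *v v)" for v
    proof -
      have "norm v \<le> norm (Y \<psi>' *v v) * exp (L * \<bar>\<psi>'\<bar>)" using gr[of 0 v \<psi>'] by (simp add: Y0)
      also have "\<dots> \<le> norm (Y \<psi>' *v v) * ?e" using \<psi>' L by (intro mult_left_mono) (auto intro: mult_left_mono)
      finally show ?thesis by (simp add: mult.commute)
    qed
    have "inj ((*v) (Y \<psi>'))"
    proof (rule injI)
      fix v w assume "Y \<psi>' *v v = Y \<psi>' *v w"
      then have "Y \<psi>' *v (v - w) = 0" by (simp add: matrix_vector_mult_diff_distrib)
      then show "v = w" using inv[of "v - w"] by simp
    qed
    then have "surj ((*v) (Y \<psi>'))" using linear_injective_imp_surjective[OF matrix_vector_mul_linear] by blast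
    \<comment> \<open>The vector at phase 0 that the linear flow carries to h at phase \<psi>'.
      Since Y maps the q's at 0 to those at \<psi>' and preserves the pairings with p1 and p2, it
      also carries the deflation at 0 to \<open>proj\<close> at \<psi>'.\<close>
    then obtain v where v: "Y \<psi>' *v v = h" by (metis surjD)
    define m where "m = (\<lambda>s. Y (\<psi>' + \<beta>0 * s) *v v)"
    have "(m has_vector_derivative DF (x0 (\<psi> + \<beta>0 * s)) (m s)) (at s)" for s
    proof -
      have "((\<lambda>s. \<psi>' + \<beta>0 * s) has_vector_derivative \<beta>0) (at s)"
        by (auto intro!: derivative_eq_intros simp: has_vector_derivative_def)
      from vector_diff_chain_at[OF this Yv[unfolded var_sol_def, rule_format]]
      have "(m has_vector_derivative DF (x0 (\<psi>' + \<beta>0 * s)) (m s)) (at s)"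
        using \<beta>0 by (simp add: o_def m_def)
      moreover have "x0 (\<psi>' + \<beta>0 * s) = x0 (\<psi> + \<beta>0 * s)"
        using periodic_int(1)[of "\<psi> + \<beta>0 * s" n] by (simp add: \<psi>'_def algebra_simps)
      ultimately show ?thesis by simp
    qed
    moreover have "m 0 = h" by (simp add: m_def v)
    moreover have "norm (proj \<psi> (m (2 * pi * real N / \<beta>0))) \<le> 1 / 2 * norm h"
    proof -
      let ?w = "(((*v) ?M) ^^ N) v"
      have "m (2 * pi * real N / \<beta>0) = Y \<psi>' *v ?w" using \<beta>0 by (simp add: m_def shiftN)
      moreover have "proj \<psi> = proj \<psi>'" by (simp add: proj_def \<psi>'_def periodic_int)
      moreover have "proj \<psi>' (Y \<psi>' *v ?w) = Y \<psi>' *v deflate (q1 0) (q2 0) (p1 0) (p2 0) ?w"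
        by (simp add: proj_def deflate_def matrix_vector_mult_diff_distrib matrix_vector_mult_scaleR Yq pY)
      ultimately have "norm (proj \<psi> (m (2 * pi * real N / \<beta>0))) \<le> norm (deflate (q1 0) (q2 0) (p1 0) (p2 0) ?w) * exp (L * \<bar>\<psi>'\<bar>)"
        using gr[of \<psi>' _ 0] by (simp add: Y0)
      also have "\<dots> \<le> (1 / (2 * ?e * ?e) * norm v) * ?e"
        using N(2) \<psi>' L by (intro mult_mono) (auto intro: mult_left_mono)
      also have "\<dots> \<le> (1 / (2 * ?e * ?e) * (?e * norm h)) * ?e"
        using inv[of v] v by (intro mult_right_mono mult_left_mono) auto
      also have "\<dots> = 1 / 2 * norm h" by simp
      finally show ?thesis .
    qed
    ultimately show ?thesis by blast
  qed
  then show ?thesis using N(1) by blast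
qed

end

lemma vector_derivative_lipschitz:
  fixes z :: "real \<Rightarrow> 'a::euclidean_space"
  assumes "\<And>s. (z has_vector_derivative z' s) (at s)" "\<And>s. norm (z' s) \<le> B"
  shows "norm (z s - z t) \<le> B * \<bar>s - t\<bar>"
proof -
  have "norm (z s - z t) \<le> B * norm (s - t)"
  proof (rule differentiable_bound[of UNIV z "\<lambda>s h. h *\<^sub>R z' s"])
    show "(z has_derivative (\<lambda>h. h *\<^sub>R z' s)) (at s within UNIV)" for s
      using assms(1) by (simp add: has_vector_derivative_def)
    show "onorm (\<lambda>h. h *\<^sub>R z' s) \<le> B" for s
      using assms(2)[of s] by (intro onorm_le) (simp add: mult.commute[of B] mult_left_mono)
  qed auto
  then show ?thesis by simp
qed

lemma vector_derivative_taylor: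
  fixes z :: "real \<Rightarrow> 'a::euclidean_space"
  assumes d: "\<And>s. (z has_vector_derivative z' s) (at s)" and L: "\<And>s t. norm (z' s - z' t) \<le> L * \<bar>s - t\<bar>" "L \<ge> 0"
  shows "norm (z s - z t - (s - t) *\<^sub>R z' t) \<le> L * (s - t)\<^sup>2"
proof -
  let ?f = "\<lambda>r. z r - r *\<^sub>R z' t"
  have "norm (?f s - ?f t) \<le> (L * \<bar>s - t\<bar>) * norm (s - t)"
  proof (rule differentiable_bound[of "closed_segment t s" ?f "\<lambda>r h. h *\<^sub>R z' r - h *\<^sub>R z' t"])
    fix r assume r: "r \<in> closed_segment t s"
    show "(?f has_derivative (\<lambda>h. h *\<^sub>R z' r - h *\<^sub>R z' t)) (at r within closed_segment t s)"
    proof (rule has_derivative_diff)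
      show "(z has_derivative (\<lambda>h. h *\<^sub>R z' r)) (at r within closed_segment t s)"
        by (rule has_derivative_at_withinI[OF d[unfolded has_vector_derivative_def]])
      show "((\<lambda>r. r *\<^sub>R z' t) has_derivative (\<lambda>h. h *\<^sub>R z' t)) (at r within closed_segment t s)"
        by (intro has_derivative_scaleR_left has_derivative_ident)
    qed
    have "\<bar>r - t\<bar> \<le> \<bar>s - t\<bar>" using segment_bound1[OF r] by simp
    then have "L * \<bar>r - t\<bar> \<le> L * \<bar>s - t\<bar>" using L(2) by (rule mult_left_mono)
    then have zz: "norm (z' r - z' t) \<le> L * \<bar>s - t\<bar>" using L(1)[of r t] by linarith
    then show "onorm (\<lambda>h. h *\<^sub>R z' r - h *\<^sub>R z' t) \<le> L * \<bar>s - t\<bar>"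
    proof (intro onorm_le)
      fix h :: real
      have "h *\<^sub>R z' r - h *\<^sub>R z' t = h *\<^sub>R (z' r - z' t)" by (simp only: scaleR_diff_right)
      then have "norm (h *\<^sub>R z' r - h *\<^sub>R z' t) = norm (z' r - z' t) * norm h" by simp
      also have "\<dots> \<le> L * \<bar>s - t\<bar> * norm h" by (rule mult_right_mono[OF zz]) simp
      finally show "norm (h *\<^sub>R z' r - h *\<^sub>R z' t) \<le> L * \<bar>s - t\<bar> * norm h" .
    qed
  qed auto
  moreover have "?f s - ?f t = z s - z t - (s - t) *\<^sub>R z' t" by (simp add: scaleR_left_diff_distrib)
  moreover have "(L * \<bar>s - t\<bar>) * norm (s - t) = L * (s - t)\<^sup>2"
    by (simp add: power2_eq_square mult.assoc)
  ultimately show ?thesis by (simp only:)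
qed

lemma C2_bounds_compact:
  fixes h :: "'a::euclidean_space \<Rightarrow> 'b::euclidean_space"
  assumes h: "C_k 2 h" and K: "compact K" "convex K"
  shows "\<exists>C\<ge>0. (\<forall>z\<in>K. norm (h z) \<le> C) \<and>
    (\<forall>z\<in>K. \<forall>v. norm (frechet_derivative h (at z) v) \<le> C * norm v) \<and>
    (\<forall>z\<in>K. \<forall>w\<in>K. norm (h z - h w) \<le> C * norm (z - w)) \<and>
    (\<forall>z\<in>K. \<forall>w\<in>K. \<forall>v. norm (frechet_derivative h (at z) v - frechet_derivative h (at w) v) \<le> C * norm (z - w) * norm v) \<and>
    (\<forall>z\<in>K. \<forall>w\<in>K. norm (h w - h z - frechet_derivative h (at z) (w - z)) \<le> C * (norm (w - z))\<^sup>2)"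
  by (rule C2_bounds[OF h K, of "{0}"]) auto

section \<open>The antiderivative in the fast phase: periodicity, smoothness, equivariance\<close>

context perturbed_torus
begin

definition DU :: "(real^'n) \<times> real \<times> real \<Rightarrow> (real^'n) \<times> real \<times> real \<Rightarrow> real^'n" where
  "DU z v = frechet_derivative U (at z) v"

abbreviation e3 :: "(real^'n) \<times> real \<times> real" where "e3 \<equiv> (0, 0, 1)"

lemma g_cont: "continuous_on T r \<Longrightarrow> continuous_on T (\<lambda>s. g x \<psi> (r s))"
  using continuous_on_compose2[OF G_cont[of UNIV], of T "\<lambda>s. (x, \<psi>, r s)"]
  by (simp add: G_def continuous_on_Pair)

text \<open>The increment over a period is the integral of g over the fast phase, zero by the mean
  assumption; this keeps the averaging transformation bounded in time.\<close>

lemma u_periodic: "u x \<psi> (\<phi> + 2 * pi) = u x \<psi> \<phi>"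
proof -
  have "((\<lambda>s. g x \<psi> s) has_integral (u x \<psi> (\<phi> + 2 * pi) - u x \<psi> \<phi>)) {\<phi>..\<phi> + 2 * pi}"
    by (rule fundamental_theorem_of_calculus) (auto intro: has_vector_derivative_at_within u_antiderivative)
  moreover have "integral {\<phi>..\<phi> + 2 * pi} (g x \<psi>) = integral {0..2 * pi} (g x \<psi>)"
    by (rule integral_shift_periodic) (auto intro: g_cont simp: g_periodic)
  ultimately show ?thesis using g_mean[of x \<psi>] by (simp add: integral_unique)
qed

lemma u_cont: "continuous_on T (u x \<psi>)"
  by (rule vector_derivative_imp_continuous_on[OF u_antiderivative])

lemma integral_u_shift: "integral {0..2 * pi} (\<lambda>s. u x \<psi> (\<phi> + s)) = 0"
proof -
  have "integral {0..2 * pi} (\<lambda>s. u x \<psi> (\<phi> + s)) = integral {0 + \<phi>..2 * pi + \<phi>} (u x \<psi>)"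
    using integral_shift_Icc_real[of 0 "2 * pi" "u x \<psi>" \<phi>] by (simp add: o_def)
  also have "\<dots> = integral {0..2 * pi} (u x \<psi>)"
    using integral_shift_periodic[of "u x \<psi>" "2 * pi" \<phi>] by (simp add: u_cont u_periodic add.commute)
  finally show ?thesis by (simp add: u_mean)
qed

text \<open>Integration by parts writes the antiderivative of mean zero as an average of \<open>g\<close>, which
  makes it as smooth as \<open>g\<close> in all variables.\<close>

lemma u_formula: "u x \<psi> \<phi> = integral {0..2 * pi} (\<lambda>s. (s / (2 * pi)) *\<^sub>R g x \<psi> (\<phi> + s))"
proof -
  let ?v = "\<lambda>s. u x \<psi> (\<phi> + s)"
  have vc: "continuous_on T ?v" for T
    by (rule continuous_on_compose2[OF u_cont[of UNIV]]) (auto intro!: continuous_intros)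
  have dv: "(?v has_vector_derivative g x \<psi> (\<phi> + s)) (at s within T)" for s T
  proof -
    have "((\<lambda>s. \<phi> + s) has_vector_derivative 1) (at s within T)" by (auto intro!: derivative_eq_intros)
    from vector_diff_chain_within[OF this has_vector_derivative_at_within[OF u_antiderivative]]
    show ?thesis by (simp add: o_def)
  qed
  \<comment> \<open>Primitive of s g(\<phi> + s) by parts. At s = 2 pi the integral drops out
    because u has mean zero, and 2 pi u(\<phi>) remains by periodicity.\<close>
  let ?w = "\<lambda>s. s *\<^sub>R ?v s - integral {0..s} ?v"
  have "((\<lambda>s. s *\<^sub>R g x \<psi> (\<phi> + s)) has_integral (?w (2 * pi) - ?w 0)) {0..2 * pi}"
  proof (rule fundamental_theorem_of_calculus)
    fix s :: real assume s: "s \<in> {0..2 * pi}"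
    have "((\<lambda>s. s *\<^sub>R ?v s) has_vector_derivative s *\<^sub>R g x \<psi> (\<phi> + s) + 1 *\<^sub>R ?v s) (at s within {0..2 * pi})"
      by (intro has_vector_derivative_scaleR dv) (auto intro!: derivative_eq_intros)
    from has_vector_derivative_diff[OF this integral_has_vector_derivative[OF vc s]]
    show "(?w has_vector_derivative s *\<^sub>R g x \<psi> (\<phi> + s)) (at s within {0..2 * pi})" by simp
  qed simp
  then have "((\<lambda>s. s *\<^sub>R g x \<psi> (\<phi> + s)) has_integral (2 * pi) *\<^sub>R u x \<psi> \<phi>) {0..2 * pi}"
    by (simp add: integral_u_shift u_periodic)
  from has_integral_cmul[OF this, of "1 / (2 * pi)"]
  have "((\<lambda>s. (s / (2 * pi)) *\<^sub>R g x \<psi> (\<phi> + s)) has_integral u x \<psi> \<phi>) {0..2 * pi}" by simp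
  then show ?thesis by (simp add: integral_unique)
qed

lemma U_line_avg: "U = line_avg (\<lambda>s. s / (2 * pi)) e3 G"
  by (rule ext) (auto simp: U_def line_avg_def G_def u_formula)

lemma U_C2: "C_k 2 U"
  unfolding U_line_avg by (rule C_k_line_avg[OF G_C2]) (intro continuous_intros, simp)

lemma U_C1: "C_k (Suc 0) U" by (rule C_k_antimono[OF U_C2]) simp

lemma U_deriv: "(U has_derivative DU z) (at z)"
  using C1_has_derivative[OF U_C1, of z] by (simp add: DU_def[abs_def])

lemma DU_linear: "linear (DU z)" using U_deriv has_derivative_linear by blast

lemma DU_cont: "continuous_on T p \<Longrightarrow> continuous_on T q \<Longrightarrow> continuous_on T (\<lambda>s. DU (p s) (q s))"
  unfolding DU_def by (rule continuous_on_C1_derivative[OF U_C1])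

lemma DU_fast: "DU z e3 = G z"
proof -
  obtain x \<psi> \<phi> where z: "z = (x, \<psi>, \<phi>)" by (cases z) auto
  have "((\<lambda>s. (x, \<psi>, s)) has_derivative (\<lambda>h. (0, 0, h))) (at \<phi>)"
    by (auto intro!: derivative_eq_intros)
  then have "((\<lambda>s. U (x, \<psi>, s)) has_derivative (\<lambda>h. DU (x, \<psi>, \<phi>) (0, 0, h))) (at \<phi>)"
    by (rule has_derivative_compose) (rule U_deriv)
  moreover have "(\<lambda>h. DU (x, \<psi>, \<phi>) (0, 0, h)) = (\<lambda>h. h *\<^sub>R DU (x, \<psi>, \<phi>) e3)"
  proof (rule ext)
    fix h :: real
    have "(0, 0, h) = h *\<^sub>R e3" by simp
    then show "DU (x, \<psi>, \<phi>) (0, 0, h) = h *\<^sub>R DU (x, \<psi>, \<phi>) e3"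
      by (simp only: linear_cmul[OF DU_linear])
  qed
  ultimately have "((\<lambda>s. U (x, \<psi>, s)) has_vector_derivative DU (x, \<psi>, \<phi>) e3) (at \<phi>)"
    by (simp only: has_vector_derivative_def)
  moreover have "((\<lambda>s. U (x, \<psi>, s)) has_vector_derivative G (x, \<psi>, \<phi>)) (at \<phi>)"
    using u_antiderivative[of x \<psi> \<phi>] by (simp add: U_def G_def)
  ultimately show ?thesis unfolding z by (rule vector_derivative_unique_at)
qed

lemma U_per: "U (x, \<theta>, \<phi> + 2 * pi) = U (x, \<theta>, \<phi>)" by (simp add: U_def u_periodic)

lemma U_per_slow: "U (x, \<theta> + 2 * pi, \<phi>) = U (x, \<theta>, \<phi>)" by (simp add: U_def u_formula g_periodic)

lemma DU_per: "DU (x, \<theta>, \<phi> + 2 * pi) = DU (x, \<theta>, \<phi>)" "DU (x, \<theta> + 2 * pi, \<phi>) = DU (x, \<theta>, \<phi>)"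
proof -
  have d: "U differentiable (at z)" for z using U_deriv differentiableI by blast
  have "frechet_derivative U (at ((x, \<theta>, \<phi>) + (0, 0, 2 * pi))) = frechet_derivative U (at (x, \<theta>, \<phi>))"
    by (rule frechet_derivative_translate[OF _ d]) (auto simp: U_per)
  then show "DU (x, \<theta>, \<phi> + 2 * pi) = DU (x, \<theta>, \<phi>)" by (simp add: DU_def[abs_def])
  have "frechet_derivative U (at ((x, \<theta>, \<phi>) + (0, 2 * pi, 0))) = frechet_derivative U (at (x, \<theta>, \<phi>))"
    by (rule frechet_derivative_translate[OF _ d]) (auto simp: U_per_slow)
  then show "DU (x, \<theta> + 2 * pi, \<phi>) = DU (x, \<theta>, \<phi>)" by (simp add: DU_def[abs_def])
qed

lemma U_mean: "integral {0..2 * pi} (\<lambda>\<phi>. U (x, \<theta>, \<phi>)) = 0" by (simp add: U_def u_mean)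

text \<open>The fast average of U vanishes identically in all its arguments, so its derivative,
  which is the fast average of DU, vanishes too.\<close>

lemma DU_mean: "integral {0..2 * pi} (\<lambda>\<phi>. DU (x, \<theta>, \<phi>) v) = 0"
proof -
  have z: "line_avg (\<lambda>_. 1) e3 U z = 0" for z
    by (cases z) (simp add: line_avg_def U_def integral_u_shift)
  have "(line_avg (\<lambda>_. 1) e3 U has_derivative (\<lambda>v. line_avg (\<lambda>_. 1) e3 (\<lambda>x. frechet_derivative U (at x) v) (x, \<theta>, 0))) (at (x, \<theta>, 0))"
    by (rule line_avg_has_derivative[OF U_C1]) simp
  moreover have "(line_avg (\<lambda>_. 1) e3 U has_derivative (\<lambda>v. 0)) (at (x, \<theta>, 0))"
    unfolding z[abs_def] by simp
  ultimately have "line_avg (\<lambda>_. 1) e3 (\<lambda>x. frechet_derivative U (at x) v) (x, \<theta>, 0) = 0"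
    using has_derivative_unique by metis
  then show ?thesis by (simp add: line_avg_def DU_def)
qed

text \<open>Equivariance of g passes to u through \<open>u_formula\<close>. Because of it the
  transformed deviation keeps its form when the frame is rotated at a sample.\<close>

lemma U_E: "U (E \<xi> x, \<theta>, \<phi> + \<xi>) = E \<xi> (U (x, \<theta>, \<phi>))"
proof -
  have "(\<lambda>s. (s / (2 * pi)) *\<^sub>R g x \<theta> (\<phi> + s)) integrable_on {0..2 * pi}"
    by (intro integrable_continuous_real continuous_intros g_cont) simp
  from integral_linear[OF this linear_conv_bounded_linear[THEN iffD1, OF E_linear[of \<xi>]]]
  have "E \<xi> (u x \<theta> \<phi>) = integral {0..2 * pi} (\<lambda>s. E \<xi> ((s / (2 * pi)) *\<^sub>R g x \<theta> (\<phi> + s)))"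
    by (simp add: o_def u_formula)
  also have "\<dots> = u (E \<xi> x) \<theta> (\<phi> + \<xi>)"
    unfolding u_formula linear_cmul[OF E_linear] g_E[symmetric] by (simp add: ac_simps)
  finally show ?thesis by (simp add: U_def)
qed

text \<open>Given for all large C, because C must later dominate bounds for \<beta>, |\<beta> -
  \<beta>0| / \<rho> and p1 as well.\<close>

lemma averaging_exists:
  assumes "\<tau> > 0"
  shows "\<exists>R C0. \<forall>C\<ge>C0. averaging_step F DF G U DU x0 \<beta>0 R C \<tau>"
proof -
  obtain B where B: "\<And>s. norm (x0 s) \<le> B" using continuous_periodic_bounded[OF x0_cont x0_periodic] by blast
  define R where "R = B + 1"
  define K where "K = {z :: (real^'n) \<times> real \<times> real. norm (fst z) \<le> R}"
  define K0 where "K0 = cball (0::real^'n) R \<times> ({0..2 * pi} \<times> {0..2 * pi})"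
  define \<Gamma> where "\<Gamma> = range (\<lambda>(i, j). (0::real^'n, of_int i * (2 * pi), of_int j * (2 * pi)))"
  have "K = cball 0 R \<times> UNIV" by (auto simp: K_def)
  then have K: "convex K" by (simp add: convex_Times)
  have K0: "compact K0" unfolding K0_def by (intro compact_Times) auto
  have red: "\<exists>n::int. s + of_int n * (2 * pi) \<in> {0..2 * pi}" for s :: real
  proof -
    have "0 < 2 * pi" by simp
    then show ?thesis
      using floor_divide_lower[of "2 * pi" s] floor_divide_upper[of "2 * pi" s]
      by (intro exI[of _ "- \<lfloor>s / (2 * pi)\<rfloor>"]) (simp add: algebra_simps)
  qed
  have cov: "\<exists>c\<in>\<Gamma>. z + c \<in> K0" if z: "z \<in> K" for z
  proof -
    obtain x s t where zz: "z = (x, s, t)" by (cases z) auto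
    obtain i j :: int where "s + of_int i * (2 * pi) \<in> {0..2 * pi}" "t + of_int j * (2 * pi) \<in> {0..2 * pi}" using red by blast
    then have "z + (0, of_int i * (2 * pi), of_int j * (2 * pi)) \<in> K0" using z by (simp add: zz K_def K0_def)
    then show ?thesis unfolding \<Gamma>_def by auto
  qed
  have per: "h (w + c) = h w" if h: "\<And>x s t. h (x, s + 2 * pi, t) = h (x, s, t)" "\<And>x s t. h (x, s, t + 2 * pi) = h (x, s, t)" and c: "c \<in> \<Gamma>"
    for h :: "(real^'n) \<times> real \<times> real \<Rightarrow> real^'n" and c w
  proof -
    obtain x s t where w: "w = (x, s, t)" by (cases w) auto
    obtain i j :: int where cc: "c = (0, of_int i * (2 * pi), of_int j * (2 * pi))" using c by (auto simp: \<Gamma>_def)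
    have "h (x, s + of_int i * (2 * pi), t + of_int j * (2 * pi)) = h (x, s, t + of_int j * (2 * pi))"
      using periodic_add_of_int[of "\<lambda>s. h (x, s, t + of_int j * (2 * pi))" "2 * pi"] h(1) by simp
    also have "\<dots> = h (x, s, t)" using periodic_add_of_int[of "\<lambda>t. h (x, s, t)" "2 * pi"] h(2) by simp
    finally show ?thesis by (simp add: w cc)
  qed
  have perG: "\<And>c w. c \<in> \<Gamma> \<Longrightarrow> G (w + c) = G w" by (rule per) (auto simp: G_def g_periodic)
  have perU: "\<And>c w. c \<in> \<Gamma> \<Longrightarrow> U (w + c) = U w" by (rule per) (auto simp: U_per U_per_slow)
  obtain Cg where Cg: "Cg \<ge> 0" "\<And>z. z \<in> K \<Longrightarrow> norm (G z) \<le> Cg" "\<And>z w. z \<in> K \<Longrightarrow> w \<in> K \<Longrightarrow> norm (G z - G w) \<le> Cg * norm (z - w)"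
    using C2_bounds[OF G_C2 K0 K perG cov] by metis
  obtain Cu where Cu: "Cu \<ge> 0" "\<And>z. z \<in> K \<Longrightarrow> norm (U z) \<le> Cu" "\<And>z w. z \<in> K \<Longrightarrow> w \<in> K \<Longrightarrow> norm (U z - U w) \<le> Cu * norm (z - w)"
    "\<And>z v. z \<in> K \<Longrightarrow> norm (DU z v) \<le> Cu * norm v"
    "\<And>z w v. z \<in> K \<Longrightarrow> w \<in> K \<Longrightarrow> norm (DU z v - DU w v) \<le> Cu * norm (z - w) * norm v"
    using C2_bounds[OF U_C2 K0 K perU cov] unfolding DU_def by metis
  have b0: "compact (cball (0::real^'n) R)" "convex (cball (0::real^'n) R)" by auto
  obtain Cf where Cf0: "Cf \<ge> 0" "\<And>x. x \<in> cball 0 R \<Longrightarrow> norm (f x) \<le> Cf"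
    "\<And>x v. x \<in> cball 0 R \<Longrightarrow> norm (frechet_derivative f (at x) v) \<le> Cf * norm v"
    "\<And>x y. x \<in> cball 0 R \<Longrightarrow> y \<in> cball 0 R \<Longrightarrow> norm (f x - f y) \<le> Cf * norm (x - y)"
    "\<And>x y v. x \<in> cball 0 R \<Longrightarrow> y \<in> cball 0 R \<Longrightarrow> norm (frechet_derivative f (at x) v - frechet_derivative f (at y) v) \<le> Cf * norm (x - y) * norm v"
    "\<And>x y. x \<in> cball 0 R \<Longrightarrow> y \<in> cball 0 R \<Longrightarrow> norm (f y - f x - frechet_derivative f (at x) (y - x)) \<le> Cf * (norm (y - x))\<^sup>2"
    using C2_bounds_compact[OF f_smooth b0] by (elim exE conjE) (rule that; blast)
  note Cf = Cf0[unfolded mem_cball_0]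
  define Ka where "Ka = \<bar>\<alpha>0\<bar> * onorm (\<lambda>x. A *v x)"
  have Ka: "Ka \<ge> 0" unfolding Ka_def by (intro mult_nonneg_nonneg onorm_pos_le matrix_vector_mul_bounded_linear) auto
  have KA: "norm (\<alpha>0 *\<^sub>R (A *v x)) \<le> Ka * norm x" for x
    using onorm[OF matrix_vector_mul_bounded_linear[of A], of x] by (simp add: Ka_def mult.assoc mult_left_mono)
  have R0: "R \<ge> 0" using B[of 0] norm_ge_zero[of "x0 0"] unfolding R_def by linarith
  define C0 where "C0 = 1 + Cg + Cu + Cf + Ka + Ka * R"
  have C0: "Cg \<le> C0" "Cu \<le> C0" "Cf \<le> C0" "Cf + Ka \<le> C0" "Cf + Ka * R \<le> C0" "1 \<le> C0"
    using Cg(1) Cu(1) Cf(1) Ka R0 by (simp_all add: C0_def)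
  have "averaging_step F DF G U DU x0 \<beta>0 R C \<tau>" if C: "C \<ge> C0" for C
  proof (rule averaging_step.intro)
    show "1 \<le> C" "0 < \<tau>" "0 < \<beta>0" using C C0 assms \<beta>0 by auto
    show "norm (x0 \<psi>) + 1 \<le> R" for \<psi> using B[of \<psi>] by (simp add: R_def)
    show "(x0 has_vector_derivative (1 / \<beta>0) *\<^sub>R F (x0 \<psi>)) (at \<psi>)" for \<psi> using x0_deriv[of \<psi>] by (simp add: q1_def)
    have m: "a * b \<le> C * b" if "a \<le> C0" "b \<ge> 0" for a b using that C by (intro mult_right_mono) auto
    show "norm (F x) \<le> C" if "norm x \<le> R" for x
    proof -
      have "Ka * norm x \<le> Ka * R" using that Ka by (rule mult_left_mono)
      then have "norm (f x) + norm (\<alpha>0 *\<^sub>R (A *v x)) \<le> C" using Cf(2)[OF that] KA[of x] C0(5) C by linarith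
      then show ?thesis unfolding F_def by (rule norm_triangle_le_diff)
    qed
    show "norm (F y - F x - DF x (y - x)) \<le> C * (norm (y - x))\<^sup>2" if "norm x \<le> R" "norm y \<le> R" for x y
    proof -
      have "F y - F x - DF x (y - x) = f y - f x - frechet_derivative f (at x) (y - x)"
        by (simp add: F_def DF_def matrix_vector_mult_diff_distrib algebra_simps)
      then show ?thesis using Cf(6)[OF that] m[OF C0(3), of "(norm (y - x))\<^sup>2"] by simp
    qed
    show "norm (F x - F y) \<le> C * norm (x - y)" if "norm x \<le> R" "norm y \<le> R" for x y
    proof -
      have "F x - F y = (f x - f y) - \<alpha>0 *\<^sub>R (A *v (x - y))"
        by (simp add: F_def matrix_vector_mult_diff_distrib algebra_simps)
      also have "norm \<dots> \<le> (Cf + Ka) * norm (x - y)"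
        using Cf(4)[OF that] KA[of "x - y"] by (intro norm_triangle_le_diff) (simp add: algebra_simps)
      finally show ?thesis using m[OF C0(4), of "norm (x - y)"] by simp
    qed
    show "linear (DF x)" for x by (rule DF_linear)
    show "norm (DF x v) \<le> C * norm v" if "norm x \<le> R" for x v
    proof -
      have "norm (DF x v) \<le> (Cf + Ka) * norm v"
        unfolding DF_def using Cf(3)[OF that, of v] KA[of v] by (intro norm_triangle_le_diff) (simp add: distrib_right)
      then show ?thesis using m[OF C0(4), of "norm v"] by simp
    qed
    show "norm (DF x v - DF y v) \<le> C * norm (x - y) * norm v" if "norm x \<le> R" "norm y \<le> R" for x y v
      using Cf(5)[OF that, of v] m[OF C0(3), of "norm (x - y) * norm v"] by (simp add: DF_def mult.assoc)
    have zK: "z \<in> K" if "norm (fst z) \<le> R" for z using that by (simp add: K_def)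
    show "(U has_derivative DU z) (at z)" for z by (rule U_deriv)
    show "norm (U z) \<le> C" if "norm (fst z) \<le> R" for z using Cu(2)[OF zK[OF that]] C0 C by simp
    show "norm (U z - U w) \<le> C * norm (z - w)" if "norm (fst z) \<le> R" "norm (fst w) \<le> R" for z w
      using Cu(3)[OF zK[OF that(1)] zK[OF that(2)]] m[OF C0(2), of "norm (z - w)"] by simp
    show "norm (DU z v) \<le> C * norm v" if "norm (fst z) \<le> R" for z v
      using Cu(4)[OF zK[OF that], of v] m[OF C0(2), of "norm v"] by simp
    show "norm (DU z v - DU w v) \<le> C * norm (z - w) * norm v" if "norm (fst z) \<le> R" "norm (fst w) \<le> R" for z w v
      using Cu(5)[OF zK[OF that(1)] zK[OF that(2)], of v] m[OF C0(2), of "norm (z - w) * norm v"] by (simp add: mult.assoc)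
    show "norm (G z) \<le> C" if "norm (fst z) \<le> R" for z using Cg(2)[OF zK[OF that]] C0 C by simp
    show "norm (G z - G w) \<le> C * norm (z - w)" if "norm (fst z) \<le> R" "norm (fst w) \<le> R" for z w
      using Cg(3)[OF zK[OF that(1)] zK[OF that(2)]] m[OF C0(1), of "norm (z - w)"] by simp
    show "DU z e3 = G z" for z by (rule DU_fast)
    show "U (x, \<theta>, \<phi> + 2 * pi) = U (x, \<theta>, \<phi>)" "DU (x, \<theta>, \<phi> + 2 * pi) = DU (x, \<theta>, \<phi>)" for x \<theta> \<phi>
      by (rule U_per DU_per)+
    show "integral {0..2 * pi} (\<lambda>\<phi>. U (x, \<theta>, \<phi>)) = 0" "integral {0..2 * pi} (\<lambda>\<phi>. DU (x, \<theta>, \<phi>) v) = 0" for x \<theta> v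
      by (rule U_mean DU_mean)+
    show "continuous_on UNIV F" "continuous_on UNIV G" by (rule F_cont G_cont)+
    show "continuous_on UNIV (\<lambda>(x, v). DF x v)" unfolding split_beta by (intro DF_cont continuous_intros)
    show "continuous_on UNIV (\<lambda>(z, v). DU z v)" unfolding split_beta by (intro DU_cont continuous_intros)
  qed
  then show ?thesis by blast
qed

lemma q1_cont: "continuous_on T q1"
  unfolding q1_def[abs_def] by (intro continuous_intros continuous_on_compose2[OF F_cont[of UNIV] x0_cont]) auto

text \<open>Absorbs the components of a deviation along the torus, to first order, into a change of the two phases.\<close>

lemma newton_step:
  "\<exists>Cn\<ge>0. \<forall>\<psi> \<kappa>. norm \<kappa> \<le> 1 \<longrightarrow>
     norm (E (- (p2 \<psi> \<bullet> \<kappa>)) (x0 \<psi> + \<kappa>) - x0 (\<psi> + p1 \<psi> \<bullet> \<kappa>) - proj \<psi> \<kappa>) \<le> Cn * (norm \<kappa>)\<^sup>2 \<and>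
     \<bar>p1 (\<psi> + p1 \<psi> \<bullet> \<kappa>) \<bullet> (E (- (p2 \<psi> \<bullet> \<kappa>)) (x0 \<psi> + \<kappa>) - x0 (\<psi> + p1 \<psi> \<bullet> \<kappa>))\<bar> \<le> Cn * (norm \<kappa>)\<^sup>2"
proof -
  obtain B where B: "\<And>s. norm (x0 s) \<le> B" using continuous_periodic_bounded[OF x0_cont x0_periodic] by blast
  have B0: "B \<ge> 0" using order_trans[OF norm_ge_zero B] .
  obtain p1' where p1': "\<And>s. (p1 has_vector_derivative p1' s) (at s)" "\<And>s w. p1' s \<bullet> w = - (1 / \<beta>0) * (p1 s \<bullet> DF (x0 s) w)" "continuous_on UNIV p1'"
    using p_deriv[of p1] by (metis insertCI)
  obtain p2' where p2': "\<And>s. (p2 has_vector_derivative p2' s) (at s)" using p_deriv[of p2] by (metis insertCI)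
  have pc: "continuous_on UNIV p1" "continuous_on UNIV p2"
    by (rule vector_derivative_imp_continuous_on[OF p1'(1)] vector_derivative_imp_continuous_on[OF p2'])+
  obtain P1 where P1: "\<And>s. norm (p1 s) \<le> P1" using continuous_periodic_bounded[OF pc(1)] p_periodic by blast
  obtain P2 where P2: "\<And>s. norm (p2 s) \<le> P2" using continuous_periodic_bounded[OF pc(2)] p_periodic by blast
  have P0: "P1 \<ge> 0" "P2 \<ge> 0" using order_trans[OF norm_ge_zero P1] order_trans[OF norm_ge_zero P2] .
  have "p1' (s + 2 * pi) = p1' s" for s
  proof -
    have "p1' (s + 2 * pi) \<bullet> w = p1' s \<bullet> w" for w unfolding p1'(2) by (simp add: x0_periodic p_periodic)
    then show ?thesis by (rule vector_eq_rdot[THEN iffD1, OF allI])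
  qed
  then obtain P1' where P1': "\<And>s. norm (p1' s) \<le> P1'" using continuous_periodic_bounded[OF p1'(3)] by blast
  have P1'0: "P1' \<ge> 0" using order_trans[OF norm_ge_zero P1'] .
  have p1_lip: "norm (p1 s - p1 t) \<le> P1' * \<bar>s - t\<bar>" for s t
    by (rule vector_derivative_lipschitz[OF p1'(1) P1'])
  obtain Q1 where Q1: "\<And>s. norm (q1 s) \<le> Q1" using continuous_periodic_bounded[OF q1_cont] q_periodic by blast
  have Q10: "Q1 \<ge> 0" using order_trans[OF norm_ge_zero Q1] .
  obtain L where L: "L \<ge> 0" "\<And>s v. norm ((1 / \<beta>0) *\<^sub>R DF (x0 s) v) \<le> L * norm v" using DF_x0_bound by blast
  have "norm ((1 / \<beta>0) *\<^sub>R DF (x0 s) (q1 s)) \<le> L * Q1" for s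
    by (rule order_trans[OF L(2)]) (intro mult_left_mono Q1 L)
  then have q1_lip: "norm (q1 s - q1 t) \<le> (L * Q1) * \<bar>s - t\<bar>" for s t
    by (intro vector_derivative_lipschitz) (use var_sol_q1 in \<open>auto simp: var_sol_def\<close>)
  have x0_taylor: "norm (x0 (\<psi> + d) - x0 \<psi> - d *\<^sub>R q1 \<psi>) \<le> (L * Q1) * d\<^sup>2" for \<psi> d
    using vector_derivative_taylor[OF x0_deriv q1_lip, of "\<psi> + d" \<psi>] L Q10 by simp
  define KA where "KA = onorm (\<lambda>x. A *v x)"
  have KA0: "KA \<ge> 0" unfolding KA_def by (intro onorm_pos_le matrix_vector_mul_bounded_linear)
  have KA: "norm (A *v x) \<le> KA * norm x" for x
    unfolding KA_def by (rule onorm[OF matrix_vector_mul_bounded_linear])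
  have AE: "norm (A *v E s x - A *v E t x) \<le> (KA * (KA * norm x)) * \<bar>s - t\<bar>" for s t x
  proof -
    have "norm (E s x - E t x) \<le> (KA * norm x) * \<bar>s - t\<bar>"
      by (rule vector_derivative_lipschitz[OF E_deriv]) (rule order_trans[OF KA], simp)
    then have "KA * norm (E s x - E t x) \<le> KA * ((KA * norm x) * \<bar>s - t\<bar>)" using KA0 by (rule mult_left_mono)
    then show ?thesis using KA[of "E s x - E t x"] by (simp add: matrix_vector_mult_diff_distrib mult.assoc)
  qed
  have E_taylor: "norm (E \<xi> x - x - \<xi> *\<^sub>R (A *v x)) \<le> (KA * (KA * norm x)) * \<xi>\<^sup>2" for \<xi> x
    using vector_derivative_taylor[OF E_deriv AE, of x \<xi> 0] KA0 by simp
  define K1 where "K1 = KA * (KA * (B + 1)) * P2\<^sup>2 + P2 * KA + (L * Q1) * P1\<^sup>2"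
  have K10: "K1 \<ge> 0" unfolding K1_def using KA0 B0 P0 L Q10 by simp
  define Kp where "Kp = 1 + P1 * Q1 + P2 * (KA * B)"
  have Kp: "norm (proj \<psi> \<kappa>) \<le> Kp * norm \<kappa>" for \<psi> \<kappa>
  proof -
    have a1: "\<bar>p1 \<psi> \<bullet> \<kappa>\<bar> \<le> P1 * norm \<kappa>" "\<bar>p2 \<psi> \<bullet> \<kappa>\<bar> \<le> P2 * norm \<kappa>"
      by (rule order_trans[OF Cauchy_Schwarz_ineq2], rule mult_right_mono, rule P1 P2, simp)+
    have "norm (q2 \<psi>) \<le> KA * B" unfolding q2_def by (rule order_trans[OF KA]) (intro mult_left_mono B KA0)
    then have "\<bar>p1 \<psi> \<bullet> \<kappa>\<bar> * norm (q1 \<psi>) \<le> (P1 * norm \<kappa>) * Q1" "\<bar>p2 \<psi> \<bullet> \<kappa>\<bar> * norm (q2 \<psi>) \<le> (P2 * norm \<kappa>) * (KA * B)"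
      using a1 Q1 P0 by (auto intro!: mult_mono)
    moreover have "norm (\<kappa> - (p1 \<psi> \<bullet> \<kappa>) *\<^sub>R q1 \<psi> - (p2 \<psi> \<bullet> \<kappa>) *\<^sub>R q2 \<psi>)
      \<le> norm \<kappa> + \<bar>p1 \<psi> \<bullet> \<kappa>\<bar> * norm (q1 \<psi>) + \<bar>p2 \<psi> \<bullet> \<kappa>\<bar> * norm (q2 \<psi>)"
      using norm_triangle_ineq4[of "\<kappa> - (p1 \<psi> \<bullet> \<kappa>) *\<^sub>R q1 \<psi>" "(p2 \<psi> \<bullet> \<kappa>) *\<^sub>R q2 \<psi>"]
        norm_triangle_ineq4[of \<kappa> "(p1 \<psi> \<bullet> \<kappa>) *\<^sub>R q1 \<psi>"] by simp
    ultimately show ?thesis unfolding proj_def deflate_def by (simp add: Kp_def algebra_simps)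
  qed
  have main: "norm (E (- (p2 \<psi> \<bullet> \<kappa>)) (x0 \<psi> + \<kappa>) - x0 (\<psi> + p1 \<psi> \<bullet> \<kappa>) - proj \<psi> \<kappa>) \<le> K1 * (norm \<kappa>)\<^sup>2"
    and second: "\<bar>p1 (\<psi> + p1 \<psi> \<bullet> \<kappa>) \<bullet> (E (- (p2 \<psi> \<bullet> \<kappa>)) (x0 \<psi> + \<kappa>) - x0 (\<psi> + p1 \<psi> \<bullet> \<kappa>))\<bar> \<le> (P1' * P1 * Kp + P1 * K1) * (norm \<kappa>)\<^sup>2"
    if k1: "norm \<kappa> \<le> 1" for \<psi> \<kappa>
  proof -
    define \<xi> where "\<xi> = p2 \<psi> \<bullet> \<kappa>"
    define d where "d = p1 \<psi> \<bullet> \<kappa>"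
    have d: "\<bar>d\<bar> \<le> P1 * norm \<kappa>" and \<xi>: "\<bar>\<xi>\<bar> \<le> P2 * norm \<kappa>"
      unfolding d_def \<xi>_def by (rule order_trans[OF Cauchy_Schwarz_ineq2], rule mult_right_mono, rule P1 P2, simp)+
    have d2: "d\<^sup>2 \<le> P1\<^sup>2 * (norm \<kappa>)\<^sup>2" and \<xi>2: "\<xi>\<^sup>2 \<le> P2\<^sup>2 * (norm \<kappa>)\<^sup>2"
      using power_mono[OF d, of 2] power_mono[OF \<xi>, of 2] by (simp_all add: power_mult_distrib)
    let ?x = "x0 \<psi> + \<kappa>"
    \<comment> \<open>To first order the rotation removes \<xi> q2 and the phase shift removes d q1,
      which is what \<open>proj\<close> takes away from \<kappa>. Three quadratic remainders are
      left: \<xi> A \<kappa> and the Taylor terms of the rotation and of x0.\<close>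
    have "E (- \<xi>) ?x - x0 (\<psi> + d) - proj \<psi> \<kappa>
      = (E (- \<xi>) ?x - ?x - (- \<xi>) *\<^sub>R (A *v ?x)) - \<xi> *\<^sub>R (A *v \<kappa>) - (x0 (\<psi> + d) - x0 \<psi> - d *\<^sub>R q1 \<psi>)"
      by (simp add: proj_def deflate_def q2_def matrix_vector_right_distrib scaleR_add_right algebra_simps flip: d_def \<xi>_def)
    also have "norm \<dots> \<le> (KA * (KA * (B + 1))) * (P2\<^sup>2 * (norm \<kappa>)\<^sup>2) + (P2 * KA) * (norm \<kappa>)\<^sup>2 + (L * Q1) * (P1\<^sup>2 * (norm \<kappa>)\<^sup>2)"
    proof -
      have "norm ?x \<le> B + 1" using norm_triangle_ineq[of "x0 \<psi>" \<kappa>] B[of \<psi>] k1 by linarith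
      then have "(KA * (KA * norm ?x)) * (- \<xi>)\<^sup>2 \<le> (KA * (KA * (B + 1))) * (P2\<^sup>2 * (norm \<kappa>)\<^sup>2)"
        using \<xi>2 KA0 B0 by (intro mult_mono mult_left_mono) auto
      then have 1: "norm (E (- \<xi>) ?x - ?x - (- \<xi>) *\<^sub>R (A *v ?x)) \<le> (KA * (KA * (B + 1))) * (P2\<^sup>2 * (norm \<kappa>)\<^sup>2)"
        using E_taylor[of "- \<xi>" ?x] by linarith
      have "\<bar>\<xi>\<bar> * norm (A *v \<kappa>) \<le> (P2 * norm \<kappa>) * (KA * norm \<kappa>)" using \<xi> KA P0 by (intro mult_mono) auto
      then have 2: "norm (\<xi> *\<^sub>R (A *v \<kappa>)) \<le> (P2 * KA) * (norm \<kappa>)\<^sup>2" by (simp add: power2_eq_square algebra_simps)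
      have "(L * Q1) * d\<^sup>2 \<le> (L * Q1) * (P1\<^sup>2 * (norm \<kappa>)\<^sup>2)" using d2 L Q10 by (intro mult_left_mono) auto
      then have 3: "norm (x0 (\<psi> + d) - x0 \<psi> - d *\<^sub>R q1 \<psi>) \<le> (L * Q1) * (P1\<^sup>2 * (norm \<kappa>)\<^sup>2)"
        using x0_taylor[of \<psi> d] by linarith
      show ?thesis
        by (rule order_trans[OF norm_triangle_ineq4], rule add_mono[OF _ 3], rule order_trans[OF norm_triangle_ineq4], rule add_mono[OF 1 2])
    qed
    also have "\<dots> = K1 * (norm \<kappa>)\<^sup>2" by (simp add: K1_def algebra_simps)
    finally have m: "norm (E (- \<xi>) ?x - x0 (\<psi> + d) - proj \<psi> \<kappa>) \<le> K1 * (norm \<kappa>)\<^sup>2" .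
    then show "norm (E (- (p2 \<psi> \<bullet> \<kappa>)) (x0 \<psi> + \<kappa>) - x0 (\<psi> + p1 \<psi> \<bullet> \<kappa>) - proj \<psi> \<kappa>) \<le> K1 * (norm \<kappa>)\<^sup>2"
      by (simp add: \<xi>_def d_def)
    let ?h = "E (- \<xi>) ?x - x0 (\<psi> + d)"
    \<comment> \<open>The projected vector is orthogonal to p1 at the old phase; at the new phase p1
      differs by O(|\<kappa>|), which keeps the pairing quadratic.\<close>
    have pz: "p1 \<psi> \<bullet> proj \<psi> \<kappa> = 0" by (simp add: proj_def deflate_def inner_diff_right pq)
    have "p1 (\<psi> + d) \<bullet> ?h = (p1 (\<psi> + d) - p1 \<psi>) \<bullet> proj \<psi> \<kappa> + p1 (\<psi> + d) \<bullet> (?h - proj \<psi> \<kappa>)"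
      by (simp add: inner_diff_left inner_diff_right pz)
    also have "\<bar>\<dots>\<bar> \<le> norm (p1 (\<psi> + d) - p1 \<psi>) * norm (proj \<psi> \<kappa>) + norm (p1 (\<psi> + d)) * norm (?h - proj \<psi> \<kappa>)"
      by (rule order_trans[OF abs_triangle_ineq]) (intro add_mono Cauchy_Schwarz_ineq2)
    also have "\<dots> \<le> (P1' * (P1 * norm \<kappa>)) * (Kp * norm \<kappa>) + P1 * (K1 * (norm \<kappa>)\<^sup>2)"
    proof (intro add_mono mult_mono Kp P1 m)
      have "P1' * \<bar>d\<bar> \<le> P1' * (P1 * norm \<kappa>)" using d P1'0 by (rule mult_left_mono)
      then show "norm (p1 (\<psi> + d) - p1 \<psi>) \<le> P1' * (P1 * norm \<kappa>)" using p1_lip[of "\<psi> + d" \<psi>] by simp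
    qed (use P0 P1'0 in auto)
    also have "\<dots> = (P1' * P1 * Kp + P1 * K1) * (norm \<kappa>)\<^sup>2" by (simp add: power2_eq_square algebra_simps)
    finally show "\<bar>p1 (\<psi> + p1 \<psi> \<bullet> \<kappa>) \<bullet> (E (- (p2 \<psi> \<bullet> \<kappa>)) (x0 \<psi> + \<kappa>) - x0 (\<psi> + p1 \<psi> \<bullet> \<kappa>))\<bar> \<le> (P1' * P1 * Kp + P1 * K1) * (norm \<kappa>)\<^sup>2"
      by (simp add: \<xi>_def d_def)
  qed
  let ?C = "max K1 (P1' * P1 * Kp + P1 * K1)"
  show ?thesis
  proof (intro exI[of _ ?C] conjI allI impI)
    show "0 \<le> ?C" using K10 by simp
    fix \<psi> :: real and \<kappa> :: "real^'n" assume k: "norm \<kappa> \<le> 1"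
    have *: "K1 * (norm \<kappa>)\<^sup>2 \<le> ?C * (norm \<kappa>)\<^sup>2" "(P1' * P1 * Kp + P1 * K1) * (norm \<kappa>)\<^sup>2 \<le> ?C * (norm \<kappa>)\<^sup>2"
      by (intro mult_right_mono; simp)+
    show "norm (E (- (p2 \<psi> \<bullet> \<kappa>)) (x0 \<psi> + \<kappa>) - x0 (\<psi> + p1 \<psi> \<bullet> \<kappa>) - proj \<psi> \<kappa>) \<le> ?C * (norm \<kappa>)\<^sup>2"
      by (rule order_trans[OF main[OF k] *(1)])
    show "\<bar>p1 (\<psi> + p1 \<psi> \<bullet> \<kappa>) \<bullet> (E (- (p2 \<psi> \<bullet> \<kappa>)) (x0 \<psi> + \<kappa>) - x0 (\<psi> + p1 \<psi> \<bullet> \<kappa>))\<bar> \<le> ?C * (norm \<kappa>)\<^sup>2"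
      by (rule order_trans[OF second[OF k] *(2)])
  qed
qed

end

section \<open>The averaged phase function and one sampling step\<close>

lemma integral_stretch_periodic:
  fixes h :: "real \<Rightarrow> real"
  assumes cont: "continuous_on UNIV h" and per: "\<And>s. h (s + 2 * pi) = h s" and b: "b > 0"
  shows "integral {0..2 * pi * real N / b} (\<lambda>s. h (\<theta> + b * s)) = real N / b * integral {0..2 * pi} h"
proof -
  have int: "h integrable_on {c..d}" for c d by (intro integrable_continuous_real continuous_on_subset[OF cont]) auto
  have many: "integral {\<theta>..\<theta> + 2 * pi * real N} h = real N * integral {0..2 * pi} h"
  proof (induction N)
    case (Suc N)
    have "integral {\<theta>..\<theta> + 2 * pi * real (Suc N)} h
      = integral {\<theta>..\<theta> + 2 * pi * real N} h + integral {\<theta> + 2 * pi * real N..(\<theta> + 2 * pi * real N) + 2 * pi} h"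
      using Henstock_Kurzweil_Integration.integral_combine[of \<theta> "\<theta> + 2 * pi * real N" "(\<theta> + 2 * pi * real N) + 2 * pi" h] int
      by (simp add: algebra_simps)
    then show ?case using Suc integral_shift_periodic[OF cont per, of "\<theta> + 2 * pi * real N"] by (simp add: algebra_simps)
  qed simp
  have "(h has_integral real N * integral {0..2 * pi} h) (cbox \<theta> (\<theta> + 2 * pi * real N))"
    using integrable_integral[OF int] many by (metis cbox_interval)
  from has_integral_affinity[OF this, of b \<theta>]
  have "((\<lambda>s. h (b *\<^sub>R s + \<theta>)) has_integral (1 / b) *\<^sub>R (real N * integral {0..2 * pi} h))
     ((\<lambda>x. (1 / b) *\<^sub>R x + - ((1 / b) *\<^sub>R \<theta>)) ` cbox \<theta> (\<theta> + 2 * pi * real N))"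
    using b by simp
  moreover have "(\<lambda>x. (1 / b) *\<^sub>R x + - ((1 / b) *\<^sub>R \<theta>)) ` cbox \<theta> (\<theta> + 2 * pi * real N) = {0..2 * pi * real N / b}"
    using b by (subst image_affinity_cbox) (auto simp: field_simps)
  ultimately show ?thesis by (simp add: integral_unique add.commute)
qed

context perturbed_torus
begin

definition G2 :: "real \<Rightarrow> real" where "G2 = G2_of p1 x0 (g2_of u g)"

definition drift :: "(real^'n) \<times> real \<times> real \<Rightarrow> real^'n" where "drift z = DU z (G z, 0, 0)"

text \<open>At fast phase 0 this is -2 pi times \<open>g2_of\<close>, written as a line average on
  the full phase space so that its smoothness follows from \<open>C_k_line_avg\<close>.\<close>

definition slow :: "(real^'n) \<times> real \<times> real \<Rightarrow> real^'n" where "slow = line_avg (\<lambda>_. 1) e3 drift"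

text \<open>DU is applied to a vector that varies with z; expanding this vector in the basis leaves
  a finite sum of products of C^1 functions.\<close>

lemma drift_C1: "C_k (Suc 0) drift"
proof -
  have "drift z = (\<Sum>i\<in>Basis. (G z \<bullet> i) *\<^sub>R frechet_derivative U (at z) (i, 0, 0))" for z
  proof -
    have "(G z, 0::real, 0::real) = (\<Sum>i\<in>Basis. (G z \<bullet> i) *\<^sub>R (i, 0, 0))"
      by (simp add: prod_eq_iff fst_sum snd_sum euclidean_representation)
    then have "DU z (G z, 0, 0) = (\<Sum>i\<in>Basis. (G z \<bullet> i) *\<^sub>R DU z (i, 0, 0))"
      by (simp only: linear_sum[OF DU_linear] linear_cmul[OF DU_linear])
    then show ?thesis by (simp add: drift_def DU_def)
  qed
  then have "drift = (\<lambda>z. \<Sum>i\<in>Basis. (G z \<bullet> i) *\<^sub>R frechet_derivative U (at z) (i, 0, 0))" by (rule ext)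
  moreover have "C_k (Suc 0) (\<lambda>z. frechet_derivative U (at z) v)" for v
    using U_C2 unfolding numeral_2_eq_2 C_k.simps(2)[of "Suc 0"] by blast
  ultimately show ?thesis by (simp only:) (intro C1_sum C1_scaleR C1_inner_right G_C1)
qed

lemma slow_C1: "C_k (Suc 0) slow" unfolding slow_def by (rule C_k_line_avg[OF drift_C1]) simp

lemma jacobian_u: "jacobian (\<lambda>y. u y \<theta> \<phi>) (at x) *v w = DU (x, \<theta>, \<phi>) (w, 0, 0)"
proof -
  have "((\<lambda>y. (y, \<theta>, \<phi>)) has_derivative (\<lambda>w. (w, 0, 0))) (at x)"
    by (auto intro!: derivative_eq_intros simp: zero_prod_def)
  then have "((\<lambda>y. U (y, \<theta>, \<phi>)) has_derivative (\<lambda>w. DU (x, \<theta>, \<phi>) (w, 0, 0))) (at x)"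
    by (rule has_derivative_compose) (rule U_deriv)
  then have d: "((\<lambda>y. u y \<theta> \<phi>) has_derivative (\<lambda>w. DU (x, \<theta>, \<phi>) (w, 0, 0))) (at x)" by (simp add: U_def)
  then have "((\<lambda>y. u y \<theta> \<phi>) has_derivative (\<lambda>h. jacobian (\<lambda>y. u y \<theta> \<phi>) (at x) *v h)) (at x)"
    using jacobian_works differentiableI by metis
  from has_derivative_unique[OF this d] show ?thesis by metis
qed

lemma G_apply: "G (x, \<psi>, \<phi>) = g x \<psi> \<phi>" by (simp add: G_def)

lemma g2_slow: "g2_of u g x \<theta> = - (1 / (2 * pi)) *\<^sub>R slow (x, \<theta>, 0)"
  by (simp add: g2_of_def slow_def line_avg_def drift_def jacobian_u G_def)

lemma g2_per: "g2_of u g x (\<theta> + 2 * pi) = g2_of u g x \<theta>"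
  unfolding g2_of_def jacobian_u by (simp add: DU_per g_periodic)

lemma G2_slow: "G2 \<psi> = - (1 / (2 * pi))\<^sup>2 * integral {0..2 * pi} (\<lambda>\<theta>. p1 (\<psi> + \<theta>) \<bullet> slow (x0 (\<psi> + \<theta>), \<theta>, 0))"
  by (simp add: G2_def G2_of_def g2_slow power2_eq_square)

lemma p1_cont: "continuous_on T r \<Longrightarrow> continuous_on T (\<lambda>s. p1 (r s))"
proof -
  obtain p1' where "\<And>s. (p1 has_vector_derivative p1' s) (at s)" using p_deriv[of p1] by (metis insertCI)
  then have "continuous_on UNIV p1" by (rule vector_derivative_imp_continuous_on)
  then show "continuous_on T r \<Longrightarrow> continuous_on T (\<lambda>s. p1 (r s))" by (rule continuous_on_compose2) auto
qed

lemma x0_cont': "continuous_on T r \<Longrightarrow> continuous_on T (\<lambda>s. x0 (r s))"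
  by (rule continuous_on_compose2[OF x0_cont[of UNIV]]) auto

lemma slow_cont: "continuous_on T r \<Longrightarrow> continuous_on T (\<lambda>s. slow (r s))"
  by (rule continuous_on_compose2[OF C1_imp_continuous[OF slow_C1, of UNIV]]) auto

text \<open>Differentiation under the integral, possible since p1 and x0 satisfy differential
  equations and \<open>slow\<close> is C^1. It serves to recognize the extrema of G2 as critical
  points.\<close>

lemma G2_differentiable: "\<exists>D. (G2 has_real_derivative D) (at \<psi>)"
proof -
  obtain p1' where p1': "\<And>s. (p1 has_vector_derivative p1' s) (at s)" "continuous_on UNIV p1'"
    using p_deriv[of p1] by (metis insertCI)
  let ?z = "\<lambda>\<psi> \<theta>. (x0 (\<psi> + \<theta>), \<theta>, 0::real)"
  let ?D = "\<lambda>\<psi> \<theta>. p1 (\<psi> + \<theta>) \<bullet> frechet_derivative slow (at (?z \<psi> \<theta>)) (q1 (\<psi> + \<theta>), 0, 0) + p1' (\<psi> + \<theta>) \<bullet> slow (?z \<psi> \<theta>)"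
  have d: "((\<lambda>\<psi>. p1 (\<psi> + \<theta>) \<bullet> slow (?z \<psi> \<theta>)) has_vector_derivative ?D \<psi> \<theta>) (at \<psi> within UNIV)" for \<psi> \<theta>
  proof -
    have sh: "((\<lambda>\<psi>. \<psi> + \<theta>) has_vector_derivative 1) (at \<psi>)" by (auto intro!: derivative_eq_intros)
    have dp: "((\<lambda>\<psi>. p1 (\<psi> + \<theta>)) has_vector_derivative p1' (\<psi> + \<theta>)) (at \<psi>)"
      using vector_diff_chain_at[OF sh p1'(1)] by (simp add: o_def)
    have dx: "((\<lambda>\<psi>. x0 (\<psi> + \<theta>)) has_vector_derivative q1 (\<psi> + \<theta>)) (at \<psi>)"
      using vector_diff_chain_at[OF sh x0_deriv] by (simp add: o_def)
    have "((\<lambda>\<psi>. ?z \<psi> \<theta>) has_derivative (\<lambda>h. (h *\<^sub>R q1 (\<psi> + \<theta>), 0, 0))) (at \<psi>)"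
      using dx unfolding has_vector_derivative_def by (intro has_derivative_Pair has_derivative_const)
    then have "((\<lambda>\<psi>. slow (?z \<psi> \<theta>)) has_derivative (\<lambda>h. frechet_derivative slow (at (?z \<psi> \<theta>)) (h *\<^sub>R q1 (\<psi> + \<theta>), 0, 0))) (at \<psi>)"
      by (rule has_derivative_compose) (rule C1_has_derivative[OF slow_C1])
    moreover have "frechet_derivative slow (at (?z \<psi> \<theta>)) (h *\<^sub>R q1 (\<psi> + \<theta>), 0, 0) = h *\<^sub>R frechet_derivative slow (at (?z \<psi> \<theta>)) (q1 (\<psi> + \<theta>), 0, 0)" for h
      using linear_cmul[OF C1_linear[OF slow_C1], of "?z \<psi> \<theta>" h "(q1 (\<psi> + \<theta>), 0, 0)"] by simp
    ultimately have ds: "((\<lambda>\<psi>. slow (?z \<psi> \<theta>)) has_derivative (\<lambda>h. h *\<^sub>R frechet_derivative slow (at (?z \<psi> \<theta>)) (q1 (\<psi> + \<theta>), 0, 0))) (at \<psi>)"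
      by (simp only:)
    show ?thesis
      using has_derivative_inner[OF dp[unfolded has_vector_derivative_def] ds] by (simp add: has_vector_derivative_def algebra_simps)
  qed
  have "((\<lambda>\<psi>. integral (cbox 0 (2 * pi)) (\<lambda>\<theta>. p1 (\<psi> + \<theta>) \<bullet> slow (?z \<psi> \<theta>))) has_vector_derivative integral (cbox 0 (2 * pi)) (?D \<psi>)) (at \<psi> within UNIV)"
  proof (rule leibniz_rule_vector_derivative[OF d])
    show "continuous_on (UNIV \<times> cbox 0 (2 * pi)) (\<lambda>(\<psi>, \<theta>). ?D \<psi> \<theta>)"
      unfolding split_beta
      by (intro continuous_intros p1_cont x0_cont' slow_cont continuous_on_C1_derivative[OF slow_C1]
          continuous_on_compose2[OF q1_cont[of UNIV]] continuous_on_compose2[OF p1'(2)]) auto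
  qed (auto intro!: integrable_continuous_real continuous_intros p1_cont x0_cont' slow_cont)
  then have "((\<lambda>\<psi>. integral {0..2 * pi} (\<lambda>\<theta>. p1 (\<psi> + \<theta>) \<bullet> slow (?z \<psi> \<theta>))) has_real_derivative integral {0..2 * pi} (?D \<psi>)) (at \<psi>)"
    by (simp add: has_real_derivative_iff_has_vector_derivative)
  then have "(G2 has_real_derivative - (1 / (2 * pi))\<^sup>2 * integral {0..2 * pi} (?D \<psi>)) (at \<psi>)"
    unfolding G2_slow[abs_def] by (rule DERIV_cmult)
  then show ?thesis by blast
qed

lemma G2_cont: "continuous_on T G2"
  using G2_differentiable DERIV_isCont continuous_at_imp_continuous_on by metis

lemma G2_per: "G2 (\<psi> + 2 * pi) = G2 \<psi>"
proof -
  have "p1 (\<psi> + 2 * pi + \<theta>) = p1 (\<psi> + \<theta>)" "x0 (\<psi> + 2 * pi + \<theta>) = x0 (\<psi> + \<theta>)" for \<theta>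
    using p_periodic[of p1 "\<psi> + \<theta>"] x0_periodic[of "\<psi> + \<theta>"] by (simp_all add: ac_simps)
  then show ?thesis by (simp add: G2_slow)
qed

text \<open>Along the orbit both phases advance with speed \<beta>0, so integration over N full
  periods retains only their difference. This is how G2 at the slow phase arises.\<close>

lemma phase_integral:
  "integral {0..2 * pi * real N / \<beta>0} (\<lambda>s. p1 (\<psi> + \<beta>0 * s) \<bullet> g2_of u g (x0 (\<psi> + \<beta>0 * s)) (\<theta> + \<beta>0 * s))
    = 2 * pi * real N / \<beta>0 * G2 (\<psi> - \<theta>)"
proof -
  let ?h = "\<lambda>r. p1 (\<psi> - \<theta> + r) \<bullet> g2_of u g (x0 (\<psi> - \<theta> + r)) r"
  have "continuous_on UNIV ?h"
    unfolding g2_slow by (intro continuous_intros p1_cont x0_cont' slow_cont)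
  moreover have "?h (r + 2 * pi) = ?h r" for r
    using p_periodic[of p1 "\<psi> - \<theta> + r"] x0_periodic[of "\<psi> - \<theta> + r"] g2_per by (simp add: add.assoc[symmetric])
  ultimately have "integral {0..2 * pi * real N / \<beta>0} (\<lambda>s. ?h (\<theta> + \<beta>0 * s)) = real N / \<beta>0 * integral {0..2 * pi} ?h"
    using \<beta>0 by (rule integral_stretch_periodic)
  also have "integral {0..2 * pi} ?h = 2 * pi * G2 (\<psi> - \<theta>)" by (simp add: G2_def G2_of_def)
  finally show ?thesis by (simp add: algebra_simps)
qed

lemma proj_bound: "\<exists>K\<ge>0. \<forall>\<psi> v. norm (proj \<psi> v) \<le> K * norm v"
proof -
  have pc: "continuous_on UNIV p" if pp: "p \<in> {p1, p2}" for p
  proof -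
    obtain p' where "\<And>s. (p has_vector_derivative p' s) (at s)" using p_deriv[OF pp] by metis
    then show ?thesis by (rule vector_derivative_imp_continuous_on)
  qed
  obtain P1 where P1: "\<And>s. norm (p1 s) \<le> P1" using continuous_periodic_bounded[OF pc] p_periodic by (metis insertCI)
  obtain P2 where P2: "\<And>s. norm (p2 s) \<le> P2" using continuous_periodic_bounded[OF pc] p_periodic by (metis insertCI)
  obtain Q1 where Q1: "\<And>s. norm (q1 s) \<le> Q1" using continuous_periodic_bounded[OF q1_cont] q_periodic by metis
  have "continuous_on UNIV q2" unfolding q2_def[abs_def]
    by (rule bounded_linear.continuous_on[OF matrix_vector_mul_bounded_linear x0_cont])
  then obtain Q2 where Q2: "\<And>s. norm (q2 s) \<le> Q2" using continuous_periodic_bounded q_periodic by metis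
  have nn: "P1 \<ge> 0" "P2 \<ge> 0" "Q1 \<ge> 0" "Q2 \<ge> 0"
    using order_trans[OF norm_ge_zero P1] order_trans[OF norm_ge_zero P2] order_trans[OF norm_ge_zero Q1] order_trans[OF norm_ge_zero Q2] by auto
  have "norm (proj \<psi> v) \<le> (1 + P1 * Q1 + P2 * Q2) * norm v" for \<psi> v
  proof -
    have "\<bar>p1 \<psi> \<bullet> v\<bar> \<le> P1 * norm v" "\<bar>p2 \<psi> \<bullet> v\<bar> \<le> P2 * norm v"
      by (rule order_trans[OF Cauchy_Schwarz_ineq2], rule mult_right_mono, rule P1 P2, simp)+
    then have "\<bar>p1 \<psi> \<bullet> v\<bar> * norm (q1 \<psi>) \<le> (P1 * norm v) * Q1" "\<bar>p2 \<psi> \<bullet> v\<bar> * norm (q2 \<psi>) \<le> (P2 * norm v) * Q2"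
      using Q1 Q2 nn by (auto intro!: mult_mono)
    moreover have "norm (v - (p1 \<psi> \<bullet> v) *\<^sub>R q1 \<psi> - (p2 \<psi> \<bullet> v) *\<^sub>R q2 \<psi>)
      \<le> norm v + \<bar>p1 \<psi> \<bullet> v\<bar> * norm (q1 \<psi>) + \<bar>p2 \<psi> \<bullet> v\<bar> * norm (q2 \<psi>)"
      using norm_triangle_ineq4[of "v - (p1 \<psi> \<bullet> v) *\<^sub>R q1 \<psi>" "(p2 \<psi> \<bullet> v) *\<^sub>R q2 \<psi>"]
        norm_triangle_ineq4[of v "(p1 \<psi> \<bullet> v) *\<^sub>R q1 \<psi>"] by simp
    ultimately show ?thesis unfolding proj_def deflate_def by (simp add: algebra_simps)
  qed
  then show ?thesis using nn by (intro exI[of _ "1 + P1 * Q1 + P2 * Q2"]) auto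
qed

lemma proj_diff: "proj \<psi> (v - w) = proj \<psi> v - proj \<psi> w"
  by (simp add: proj_def deflate_def inner_diff_right scaleR_diff_left)

definition near_solution :: "real \<Rightarrow> real \<Rightarrow> real \<Rightarrow> real \<Rightarrow> real \<Rightarrow> real \<Rightarrow> real \<Rightarrow> (real \<Rightarrow> real^'n) \<Rightarrow> bool" where
  "near_solution \<gamma> \<omega> \<beta> \<theta> \<chi>0 \<psi> S y \<longleftrightarrow> 0 \<le> S \<and> norm (y 0 - x0 \<psi>) \<le> 1 \<and>
     (\<forall>s\<in>{0..S}. (y has_vector_derivative F (y s) + \<gamma> *\<^sub>R G (y s, \<theta> + \<beta> * s, \<chi>0 + \<omega> * s)) (at s within {0..S}))"

definition small_params :: "real \<Rightarrow> real \<Rightarrow> real \<Rightarrow> real \<Rightarrow> real \<Rightarrow> bool" where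
  "small_params B \<nu> \<gamma> \<omega> \<beta> \<longleftrightarrow> 0 < \<nu> \<and> \<omega> > 0 \<and> \<gamma> > 0 \<and> \<gamma> / \<omega> \<le> \<nu> \<and> \<gamma>\<^sup>2 / \<omega> \<le> \<nu> \<and> 1 / \<omega> \<le> \<nu> \<and> 1 / (\<gamma> * \<omega>) \<le> \<nu> \<and>
     0 \<le> \<beta> \<and> \<bar>\<beta> - \<beta>0\<bar> \<le> B * (\<gamma>\<^sup>2 / \<omega>)"

text \<open>In the conclusion \<open>\<xi>\<close> and \<open>\<psi>'\<close> are the phases chosen anew at time \<open>\<tau>\<close>: the deviation has shrunk up to
  \<open>O(\<gamma>\<^sup>2 / \<omega>)\<close>, and \<open>\<psi>' - \<theta>\<close> has advanced by \<open>\<gamma>\<^sup>2 / \<omega> * \<tau> * G2 (\<psi> - \<theta>)\<close> on top of \<open>\<beta>0 * \<tau>\<close>, up to higher order.\<close>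

lemma one_step:
  assumes B: "B \<ge> 0"
  shows "\<exists>\<tau>>0. \<exists>C\<ge>1.
    (\<forall>x \<psi> \<theta> \<phi>. norm (x - x0 \<psi>) \<le> 1 \<longrightarrow> norm (U (x, \<theta>, \<phi>)) \<le> C) \<and>
    (\<forall>\<nu> \<gamma> \<omega> \<beta> \<theta> \<chi>0 \<psi> S y h.
      \<nu> \<le> 1 / C \<longrightarrow> small_params B \<nu> \<gamma> \<omega> \<beta> \<longrightarrow> S \<le> \<tau> \<longrightarrow> near_solution \<gamma> \<omega> \<beta> \<theta> \<chi>0 \<psi> S y \<longrightarrow>
      h = y 0 - (\<gamma> / \<omega>) *\<^sub>R U (y 0, \<theta>, \<chi>0) - x0 \<psi> \<longrightarrow> norm h \<le> \<nu> \<longrightarrow>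
      (\<forall>s\<in>{0..S}. norm (y s - x0 (\<psi> + \<beta>0 * s)) \<le> C * (norm h + \<gamma>\<^sup>2 / \<omega> + \<gamma> / \<omega>) \<and> norm (y s - x0 (\<psi> + \<beta>0 * s)) \<le> 1 / 2) \<and>
      (S = \<tau> \<longrightarrow> (\<exists>\<xi> \<psi>' h'. h' = E (- \<xi>) (y \<tau> - (\<gamma> / \<omega>) *\<^sub>R U (y \<tau>, \<theta> + \<beta> * \<tau>, \<chi>0 + \<omega> * \<tau>)) - x0 \<psi>' \<and>
         norm (E (- \<xi>) (y \<tau>) - x0 \<psi>') \<le> 1 \<and>
         norm h' \<le> 3 / 4 * norm h + C * (\<gamma>\<^sup>2 / \<omega>) \<and>
         \<bar>p1 \<psi>' \<bullet> h'\<bar> \<le> C * (norm h + \<gamma>\<^sup>2 / \<omega>)\<^sup>2 \<and>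
         \<bar>\<psi>' - \<psi> - \<beta>0 * \<tau> - p1 \<psi> \<bullet> h - \<gamma>\<^sup>2 / \<omega> * \<tau> * G2 (\<psi> - \<theta>)\<bar>
           \<le> C * (\<nu> * (\<gamma>\<^sup>2 / \<omega>) + (norm h + \<gamma>\<^sup>2 / \<omega>) * (norm h + \<gamma>\<^sup>2 / \<omega> + \<nu>)))))"
proof -
  obtain N where N: "N > 0" "\<And>\<psi> h. \<exists>m. m 0 = h \<and> (\<forall>s. (m has_vector_derivative DF (x0 (\<psi> + \<beta>0 * s)) (m s)) (at s)) \<and>
     norm (proj \<psi> (m (2 * pi * real N / \<beta>0))) \<le> 1 / 2 * norm h"
    using transversal_contraction by metis
  \<comment> \<open>N periods of the unperturbed orbit, so that x0 and p1 take the same values at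
    both ends of the window.\<close>
  define \<tau> where "\<tau> = 2 * pi * real N / \<beta>0"
  have \<tau>: "\<tau> > 0" using N \<beta>0 by (simp add: \<tau>_def)
  have b\<tau>: "\<beta>0 * \<tau> = 2 * pi * real N" using \<beta>0 by (simp add: \<tau>_def)
  obtain R C0 where RC: "\<And>C. C \<ge> C0 \<Longrightarrow> averaging_step F DF G U DU x0 \<beta>0 R C \<tau>" using averaging_exists[OF \<tau>] by metis
  obtain Cn where Cn: "Cn \<ge> 0" "\<And>\<psi> \<kappa>. norm \<kappa> \<le> 1 \<Longrightarrow>
     norm (E (- (p2 \<psi> \<bullet> \<kappa>)) (x0 \<psi> + \<kappa>) - x0 (\<psi> + p1 \<psi> \<bullet> \<kappa>) - proj \<psi> \<kappa>) \<le> Cn * (norm \<kappa>)\<^sup>2"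
     "\<And>\<psi> \<kappa>. norm \<kappa> \<le> 1 \<Longrightarrow> \<bar>p1 (\<psi> + p1 \<psi> \<bullet> \<kappa>) \<bullet> (E (- (p2 \<psi> \<bullet> \<kappa>)) (x0 \<psi> + \<kappa>) - x0 (\<psi> + p1 \<psi> \<bullet> \<kappa>))\<bar> \<le> Cn * (norm \<kappa>)\<^sup>2"
    using newton_step by metis
  obtain Kp where Kp: "Kp \<ge> 0" "\<And>\<psi> v. norm (proj \<psi> v) \<le> Kp * norm v" using proj_bound by metis
  obtain p1' where p1': "\<And>s. (p1 has_vector_derivative p1' s) (at s)" "\<And>s w. p1' s \<bullet> w = - (1 / \<beta>0) * (p1 s \<bullet> DF (x0 s) w)" "continuous_on UNIV p1'"
    using p_deriv[of p1] by (metis insertCI)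
  have pc: "continuous_on UNIV p1" by (rule vector_derivative_imp_continuous_on[OF p1'(1)])
  obtain P1 where P1: "\<And>s. norm (p1 s) \<le> P1" using continuous_periodic_bounded[OF pc] p_periodic by (metis insertCI)
  have "p1' (s + 2 * pi) = p1' s" for s
  proof -
    have "p1' (s + 2 * pi) \<bullet> w = p1' s \<bullet> w" for w unfolding p1'(2) by (simp add: x0_periodic p_periodic)
    then show ?thesis by (rule vector_eq_rdot[THEN iffD1, OF allI])
  qed
  then obtain P1' where P1': "\<And>s. norm (p1' s) \<le> P1'" using continuous_periodic_bounded[OF p1'(3)] by metis
  \<comment> \<open>Besides the threshold C0, this dominates \<beta> (as \<rho> <= 1), |\<beta> -
    \<beta>0| / \<rho>, and the size of p1 and its Lipschitz constant along the orbit.\<close>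
  define C where "C = Max {1, C0, \<beta>0 + B, B, P1, P1' * \<beta>0}"
  have Cge: "C \<ge> 1" "C \<ge> C0" "C \<ge> \<beta>0 + B" "C \<ge> B" "C \<ge> P1" "C \<ge> P1' * \<beta>0" unfolding C_def by (rule Max_ge; simp)+
  interpret av: averaging_step F DF G U DU x0 \<beta>0 R C \<tau> by (rule RC[OF Cge(2)])
  let ?cr = av.crude_const and ?li = av.lin_const and ?ph = av.phase_const
  have cr1: "?cr \<ge> 1" by (rule av.crude_const_ge_1)
  have li0: "?li \<ge> 0" using av.drift_const_nonneg av.err_const_nonneg Cge(1) \<tau> by (simp add: av.lin_const_def)
  define K3 where "K3 = 3 * Kp * ?li + 2 * Cn * ?cr\<^sup>2"
  have K30: "K3 \<ge> 0" using Kp Cn li0 by (simp add: K3_def)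
  \<comment> \<open>The entries secure in turn: distance at most 1/2 from the orbit, errors
    proportional to |h| below |h| / 4, the coefficient of \<rho> in the new deviation, the bound on
    its p1 component, and the phase equation. The first two become effective through \<nu> Cf <=
    1.\<close>
  define Cf where "Cf = Max {4 * ?cr + 2 * C + 2, 4 * K3 + 1, 4 * (Kp * ?li + K3), Cn * ?cr\<^sup>2, ?ph}"
  have Cf: "Cf \<ge> 4 * ?cr + 2 * C + 2" "Cf \<ge> 4 * K3 + 1" "Cf \<ge> 4 * (Kp * ?li + K3)" "Cf \<ge> Cn * ?cr\<^sup>2" "Cf \<ge> ?ph"
    unfolding Cf_def by (rule Max_ge; simp)+
  have Cf1: "Cf \<ge> 1" "Cf \<ge> C" "Cf \<ge> ?cr" using Cf(1) cr1 Cge(1) by auto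
  have Ub: "norm (U (x, \<theta>, \<phi>)) \<le> C" if "norm (x - x0 \<psi>) \<le> 1" for x \<psi> \<theta> \<phi>
  proof (rule av.u_bound)
    show "norm (fst (x, \<theta>, \<phi>)) \<le> R" using that av.X_bound[of \<psi>] norm_triangle_sub[of x "x0 \<psi>"] by simp
  qed
  have main: "(\<forall>s\<in>{0..S}. norm (y s - x0 (\<psi> + \<beta>0 * s)) \<le> Cf * (norm h + \<gamma>\<^sup>2 / \<omega> + \<gamma> / \<omega>) \<and> norm (y s - x0 (\<psi> + \<beta>0 * s)) \<le> 1 / 2) \<and>
      (S = \<tau> \<longrightarrow> (\<exists>\<xi> \<psi>' h'. h' = E (- \<xi>) (y \<tau> - (\<gamma> / \<omega>) *\<^sub>R U (y \<tau>, \<theta> + \<beta> * \<tau>, \<chi>0 + \<omega> * \<tau>)) - x0 \<psi>' \<and>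
         norm (E (- \<xi>) (y \<tau>) - x0 \<psi>') \<le> 1 \<and>
         norm h' \<le> 3 / 4 * norm h + Cf * (\<gamma>\<^sup>2 / \<omega>) \<and>
         \<bar>p1 \<psi>' \<bullet> h'\<bar> \<le> Cf * (norm h + \<gamma>\<^sup>2 / \<omega>)\<^sup>2 \<and>
         \<bar>\<psi>' - \<psi> - \<beta>0 * \<tau> - p1 \<psi> \<bullet> h - \<gamma>\<^sup>2 / \<omega> * \<tau> * G2 (\<psi> - \<theta>)\<bar>
           \<le> Cf * (\<nu> * (\<gamma>\<^sup>2 / \<omega>) + (norm h + \<gamma>\<^sup>2 / \<omega>) * (norm h + \<gamma>\<^sup>2 / \<omega> + \<nu>))))"
    if \<nu>: "\<nu> \<le> 1 / Cf" and sp: "small_params B \<nu> \<gamma> \<omega> \<beta>" and S: "S \<le> \<tau>" and ns: "near_solution \<gamma> \<omega> \<beta> \<theta> \<chi>0 \<psi> S y"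
      and h: "h = y 0 - (\<gamma> / \<omega>) *\<^sub>R U (y 0, \<theta>, \<chi>0) - x0 \<psi>" and h\<nu>: "norm h \<le> \<nu>"
    for \<nu> \<gamma> \<omega> \<beta> \<theta> \<chi>0 \<psi> S y h
  proof -
    define a where "a = \<gamma> / \<omega>"
    define \<rho> where "\<rho> = \<gamma>\<^sup>2 / \<omega>"
    define q where "q = norm h + \<rho>"
    have p: "0 < \<nu>" "\<omega> > 0" "\<gamma> > 0" "\<gamma> / \<omega> \<le> \<nu>" "\<gamma>\<^sup>2 / \<omega> \<le> \<nu>" "1 / \<omega> \<le> \<nu>" "1 / (\<gamma> * \<omega>) \<le> \<nu>" "0 \<le> \<beta>" "\<bar>\<beta> - \<beta>0\<bar> \<le> B * (\<gamma>\<^sup>2 / \<omega>)"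
      using sp by (simp_all add: small_params_def)
    have S0: "0 \<le> S" and n0: "norm (y 0 - x0 \<psi>) \<le> 1"
      and yd: "\<And>s. s \<in> {0..S} \<Longrightarrow> (y has_vector_derivative F (y s) + \<gamma> *\<^sub>R G (y s, \<theta> + \<beta> * s, \<chi>0 + \<omega> * s)) (at s within {0..S})"
      using ns by (auto simp: near_solution_def)
    have \<nu>C: "\<nu> * Cf \<le> 1" using \<nu> Cf1 by (simp add: pos_le_divide_eq)
    have \<nu>1: "\<nu> \<le> 1" 
    proof -
      have "\<nu> * 1 \<le> \<nu> * Cf" using Cf1(1) p(1) by (intro mult_left_mono) auto
      then show ?thesis using \<nu>C by linarith
    qed
    have a0: "a > 0" "\<rho> > 0" "a \<le> \<nu>" "\<rho> \<le> \<nu>" using p by (simp_all add: a_def \<rho>_def)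
    have q: "q \<ge> 0" "q \<le> 2 * \<nu>" using a0 h\<nu> by (simp_all add: q_def)
    have \<beta>C: "\<beta> \<le> C" "\<bar>\<beta> - \<beta>0\<bar> \<le> C * (\<gamma>\<^sup>2 / \<omega>)"
    proof -
      have "B * \<rho> \<le> B * 1" using B a0 \<nu>1 by (intro mult_left_mono) auto
      then show "\<beta> \<le> C" using p(9) Cge(3) unfolding \<rho>_def by linarith
      have "B * \<rho> \<le> C * \<rho>" using Cge(4) a0 by (intro mult_right_mono) auto
      then show "\<bar>\<beta> - \<beta>0\<bar> \<le> C * (\<gamma>\<^sup>2 / \<omega>)" using p(9) unfolding \<rho>_def by linarith
    qed
    have run: "averaging_run F DF G U DU x0 \<beta>0 R C \<tau> \<nu> \<gamma> \<omega> \<beta> \<theta> \<chi>0 \<psi> s y"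
      if s: "s \<in> {0..S}" and near: "\<And>r. r \<in> {0..s} \<Longrightarrow> norm (y r - x0 (\<psi> + \<beta>0 * r)) \<le> 1" for s
    proof (intro averaging_run.intro averaging_run_axioms.intro av.averaging_step_axioms)
      show "(y has_vector_derivative F (y r) + \<gamma> *\<^sub>R G (y r, \<theta> + \<beta> * r, \<chi>0 + \<omega> * r)) (at r within {0..s})" if "r \<in> {0..s}" for r
        by (rule has_vector_derivative_within_subset[OF yd]) (use s that in auto)
    qed (use p \<nu>1 \<beta>C s S near in auto)
    have bd: "norm (y s - x0 (\<psi> + \<beta>0 * s)) \<le> ?cr * q + a * C"
      if s: "s \<in> {0..S}" and near: "\<And>r. r \<in> {0..s} \<Longrightarrow> norm (y r - x0 (\<psi> + \<beta>0 * r)) \<le> 1" for s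
    proof -
      interpret rn: averaging_run F DF G U DU x0 \<beta>0 R C \<tau> \<nu> \<gamma> \<omega> \<beta> \<theta> \<chi>0 \<psi> s y by (rule run[OF s near])
      have "s \<in> {0..s}" using s by simp
      moreover have "rn.k 0 = h" "rn.a = a" "rn.\<rho> = \<rho>" by (simp_all add: rn.k_def rn.a_def h a_def rn.\<rho>_def \<rho>_def)
      ultimately show ?thesis using rn.y_near_k[of s] rn.crude_bound[of s] by (simp add: q_def)
    qed
    have half: "?cr * q + a * C \<le> 1 / 2"
    proof -
      have "?cr * q \<le> ?cr * (2 * \<nu>)" using q cr1 by (intro mult_left_mono) auto
      moreover have "a * C \<le> \<nu> * C" using a0 Cge(1) by (intro mult_right_mono) auto
      moreover have "\<nu> * (4 * ?cr + 2 * C) \<le> \<nu> * Cf" using Cf(1) p(1) by (intro mult_left_mono) auto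
      ultimately show ?thesis using \<nu>C by (simp add: algebra_simps)
    qed
    have yc: "continuous_on {0..S} y"
      unfolding continuous_on_eq_continuous_within using yd has_vector_derivative_continuous by blast
    \<comment> \<open>A run presupposes distance at most 1 and delivers distance at most 1/2 by
      \<open>half\<close>, so bootstrapping makes the bound unconditional on the window.\<close>
    have near: "norm (y s - x0 (\<psi> + \<beta>0 * s)) \<le> 1 / 2" if s: "s \<in> {0..S}" for s
    proof (rule bootstrap_bound[of S "\<lambda>s. norm (y s - x0 (\<psi> + \<beta>0 * s))" 1 "1 / 2"])
      show "continuous_on {0..S} (\<lambda>s. norm (y s - x0 (\<psi> + \<beta>0 * s)))"
        by (intro continuous_intros yc x0_cont')
      show "norm (y s - x0 (\<psi> + \<beta>0 * s)) \<le> 1 / 2" if "s \<in> {0..S}" "\<And>r. r \<in> {0..s} \<Longrightarrow> norm (y r - x0 (\<psi> + \<beta>0 * r)) \<le> 1" for s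
        using bd[OF that] half by simp
      show "norm (y 0 - x0 (\<psi> + \<beta>0 * 0)) \<le> 1 / 2" using bd[of 0] half n0 S0 by simp
    qed (use s in auto)
    then have near1: "norm (y s - x0 (\<psi> + \<beta>0 * s)) \<le> 1" if "s \<in> {0..S}" for s using that by fastforce
    have partA: "norm (y s - x0 (\<psi> + \<beta>0 * s)) \<le> Cf * (norm h + \<gamma>\<^sup>2 / \<omega> + \<gamma> / \<omega>)" if s: "s \<in> {0..S}" for s
    proof -
      have "norm (y s - x0 (\<psi> + \<beta>0 * s)) \<le> ?cr * q + a * C"
        by (rule bd[OF s]) (use s near1 in auto)
      also have "\<dots> \<le> Cf * q + a * Cf" using Cf1 q a0 by (intro add_mono mult_right_mono mult_left_mono) auto
      finally show ?thesis by (simp add: q_def a_def \<rho>_def algebra_simps)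
    qed
    have partB: "\<exists>\<xi> \<psi>' h'. h' = E (- \<xi>) (y \<tau> - (\<gamma> / \<omega>) *\<^sub>R U (y \<tau>, \<theta> + \<beta> * \<tau>, \<chi>0 + \<omega> * \<tau>)) - x0 \<psi>' \<and>
         norm (E (- \<xi>) (y \<tau>) - x0 \<psi>') \<le> 1 \<and>
         norm h' \<le> 3 / 4 * norm h + Cf * (\<gamma>\<^sup>2 / \<omega>) \<and>
         \<bar>p1 \<psi>' \<bullet> h'\<bar> \<le> Cf * (norm h + \<gamma>\<^sup>2 / \<omega>)\<^sup>2 \<and>
         \<bar>\<psi>' - \<psi> - \<beta>0 * \<tau> - p1 \<psi> \<bullet> h - \<gamma>\<^sup>2 / \<omega> * \<tau> * G2 (\<psi> - \<theta>)\<bar>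
           \<le> Cf * (\<nu> * (\<gamma>\<^sup>2 / \<omega>) + (norm h + \<gamma>\<^sup>2 / \<omega>) * (norm h + \<gamma>\<^sup>2 / \<omega> + \<nu>))" if S\<tau>: "S = \<tau>"
    proof -
      have \<tau>S: "\<tau> \<in> {0..S}" using S\<tau> S0 by simp
      have r: "averaging_run F DF G U DU x0 \<beta>0 R C \<tau> \<nu> \<gamma> \<omega> \<beta> \<theta> \<chi>0 \<psi> \<tau> y"
        by (rule run[OF \<tau>S]) (use near1 S\<tau> in auto)
      interpret rn: averaging_run F DF G U DU x0 \<beta>0 R C \<tau> \<nu> \<gamma> \<omega> \<beta> \<theta> \<chi>0 \<psi> \<tau> y by (rule r)
      have k0': "rn.k 0 = h" by (simp add: rn.k_def rn.a_def h)
      have rq: "rn.q = q" "rn.\<rho> = \<rho>" "rn.a = a" by (simp_all add: rn.q_def rn.\<rho>_def rn.a_def k0' q_def \<rho>_def a_def)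
      define \<kappa> where "\<kappa> = rn.k \<tau>"
      have per: "x0 (\<psi> + \<beta>0 * \<tau>) = x0 \<psi>" "p1 (\<psi> + \<beta>0 * \<tau>) = p1 \<psi>"
        using periodic_int(1,4)[of \<psi> "int N"] by (simp_all add: b\<tau> mult.commute)
      have \<kappa>q: "norm \<kappa> \<le> ?cr * q" using rn.crude_bound[of \<tau>] \<tau> unfolding k0' rq by (simp add: \<kappa>_def q_def)
      have \<kappa>1: "norm \<kappa> \<le> 1" using \<kappa>q half a0 Cge(1) mult_nonneg_nonneg[of a C] by linarith
      have \<kappa>2: "(norm \<kappa>)\<^sup>2 \<le> ?cr\<^sup>2 * q\<^sup>2" using power_mono[OF \<kappa>q, of 2] by (simp add: power_mult_distrib)
      define \<xi> where "\<xi> = p2 \<psi> \<bullet> \<kappa>"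
      define \<psi>1 where "\<psi>1 = \<psi> + p1 \<psi> \<bullet> \<kappa>"
      \<comment> \<open>Adding \<beta>0 \<tau>, a multiple of 2 pi, changes neither x0 nor p1, but
        lets \<psi>' record the whole advance of the phase.\<close>
      define \<psi>' where "\<psi>' = \<psi>1 + \<beta>0 * \<tau>"
      define h' where "h' = E (- \<xi>) (x0 \<psi> + \<kappa>) - x0 \<psi>1"
      have per': "x0 \<psi>' = x0 \<psi>1" "p1 \<psi>' = p1 \<psi>1"
        using periodic_int(1,4)[of \<psi>1 "int N"] by (simp_all add: \<psi>'_def b\<tau> mult.commute)
      have W: "y \<tau> - (\<gamma> / \<omega>) *\<^sub>R U (y \<tau>, \<theta> + \<beta> * \<tau>, \<chi>0 + \<omega> * \<tau>) = x0 \<psi> + \<kappa>"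
        by (simp add: \<kappa>_def rn.k_def rn.a_def per)
      have h'eq: "h' = E (- \<xi>) (y \<tau> - (\<gamma> / \<omega>) *\<^sub>R U (y \<tau>, \<theta> + \<beta> * \<tau>, \<chi>0 + \<omega> * \<tau>)) - x0 \<psi>'"
        unfolding W per' h'_def ..
      have n1: "norm (h' - proj \<psi> \<kappa>) \<le> Cn * (norm \<kappa>)\<^sup>2" and n2: "\<bar>p1 \<psi>1 \<bullet> h'\<bar> \<le> Cn * (norm \<kappa>)\<^sup>2"
        using Cn(2,3)[OF \<kappa>1, of \<psi>] by (simp_all add: h'_def \<xi>_def \<psi>1_def)
      have \<kappa>C: "Cn * (norm \<kappa>)\<^sup>2 \<le> Cn * ?cr\<^sup>2 * q\<^sup>2" using mult_left_mono[OF \<kappa>2 Cn(1)] by (simp add: mult.assoc)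
      obtain m where m: "m 0 = h" "\<And>s. (m has_vector_derivative DF (x0 (\<psi> + \<beta>0 * s)) (m s)) (at s)"
        "norm (proj \<psi> (m \<tau>)) \<le> 1 / 2 * norm h"
        using N(2)[of h \<psi>] unfolding \<tau>_def[symmetric] by metis
      have lin: "norm (\<kappa> - m \<tau>) \<le> ?li * (\<rho> + q * (q + \<nu>))"
        using rn.linearization_bound[of m] m(1) has_vector_derivative_at_within[OF m(2)] unfolding k0' rq \<kappa>_def by simp
      have q2: "q\<^sup>2 \<le> 2 * \<nu> * q" "q * (q + \<nu>) \<le> 3 * \<nu> * q"
        using q mult_left_mono[OF q(2) q(1)] by (simp_all add: power2_eq_square algebra_simps)
      have hb: "norm h' \<le> 3 / 4 * norm h + Cf / 4 * \<rho>"
      proof -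
        \<comment> \<open>Newton error, projected linear flow, projected linearization error. The
          linear flow contributes |h| / 2, the errors of order \<nu> |h| raise this to 3/4 |h|, and
          the rest is O(\<rho>).\<close>
        have "h' = (h' - proj \<psi> \<kappa>) + proj \<psi> (m \<tau>) + proj \<psi> (\<kappa> - m \<tau>)" by (simp add: proj_diff)
        then have "norm h' \<le> norm (h' - proj \<psi> \<kappa>) + norm (proj \<psi> (m \<tau>)) + norm (proj \<psi> (\<kappa> - m \<tau>))"
          by (metis norm_triangle_ineq norm_triangle_mono order_refl)
        also have "\<dots> \<le> Cn * ?cr\<^sup>2 * q\<^sup>2 + 1 / 2 * norm h + Kp * (?li * (\<rho> + q * (q + \<nu>)))"
        proof (intro add_mono m(3))
          show "norm (h' - proj \<psi> \<kappa>) \<le> Cn * ?cr\<^sup>2 * q\<^sup>2" using n1 \<kappa>C by linarith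
          show "norm (proj \<psi> (\<kappa> - m \<tau>)) \<le> Kp * (?li * (\<rho> + q * (q + \<nu>)))"
            by (rule order_trans[OF Kp(2) mult_left_mono[OF lin Kp(1)]])
        qed
        also have "\<dots> \<le> Cn * ?cr\<^sup>2 * (2 * \<nu> * q) + 1 / 2 * norm h + Kp * (?li * (\<rho> + 3 * \<nu> * q))"
          using q2 Cn(1) Kp(1) li0 by (intro add_mono mult_left_mono) auto
        also have "\<dots> = K3 * \<nu> * norm h + 1 / 2 * norm h + (K3 * \<nu> + Kp * ?li) * \<rho>"
          by (simp add: K3_def q_def algebra_simps)
        also have "\<dots> \<le> 1 / 4 * norm h + 1 / 2 * norm h + Cf / 4 * \<rho>"
        proof (intro add_mono mult_right_mono)
          have "\<nu> * (4 * K3 + 1) \<le> \<nu> * Cf" using Cf(2) p(1) by (intro mult_left_mono) auto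
          then have "4 * (K3 * \<nu>) \<le> 1" using \<nu>C p(1) by (simp add: algebra_simps)
          then show "K3 * \<nu> \<le> 1 / 4" by simp
          have "K3 * \<nu> \<le> K3 * 1" using \<nu>1 K30 by (rule mult_left_mono)
          then show "K3 * \<nu> + Kp * ?li \<le> Cf / 4" using Cf(3) by simp
        qed (use a0 in auto)
        finally show ?thesis by simp
      qed
      have yE: "norm (E (- \<xi>) (y \<tau>) - x0 \<psi>') \<le> 1"
      proof -
        have "E (- \<xi>) (y \<tau>) - x0 \<psi>' = h' + a *\<^sub>R E (- \<xi>) (U (y \<tau>, \<theta> + \<beta> * \<tau>, \<chi>0 + \<omega> * \<tau>))"
          unfolding h'eq by (simp add: E_diff linear_cmul[OF E_linear] a_def)
        also have "norm \<dots> \<le> norm h' + a * C"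
          using Ub[OF near1[OF \<tau>S], of "\<theta> + \<beta> * \<tau>" "\<chi>0 + \<omega> * \<tau>"] a0
          by (intro norm_triangle_le add_left_mono) simp
        also have "\<dots> \<le> (3 / 4 * \<nu> + 1 / 4) + 1 / 2"
        proof (intro add_mono)
          have "Cf * \<rho> \<le> Cf * \<nu>" using a0 Cf1 by (intro mult_left_mono) auto
          then show "norm h' \<le> 3 / 4 * \<nu> + 1 / 4" using hb h\<nu> \<nu>C by (simp add: mult.commute)
          have "a * (2 * C) \<le> \<nu> * Cf" using a0 Cf(1) Cge(1) cr1 p(1) by (intro mult_mono) auto
          then show "a * C \<le> 1 / 2" using \<nu>C by simp
        qed
        also have "\<dots> \<le> 1"
        proof -
          have "\<nu> * 8 \<le> \<nu> * Cf" using p(1) Cf(1) cr1 Cge(1) by (intro mult_left_mono) auto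
          then show ?thesis using \<nu>C by simp
        qed
        finally show ?thesis .
      qed
      have second: "\<bar>p1 \<psi>' \<bullet> h'\<bar> \<le> Cf * (norm h + \<gamma>\<^sup>2 / \<omega>)\<^sup>2"
      proof -
        have "\<bar>p1 \<psi>' \<bullet> h'\<bar> \<le> Cn * ?cr\<^sup>2 * q\<^sup>2" using n2 \<kappa>C unfolding per' by linarith
        also have "\<dots> \<le> Cf * q\<^sup>2" using Cf(4) by (intro mult_right_mono) auto
        finally show ?thesis by (simp add: q_def \<rho>_def)
      qed
      have third: "\<bar>\<psi>' - \<psi> - \<beta>0 * \<tau> - p1 \<psi> \<bullet> h - \<rho> * \<tau> * G2 (\<psi> - \<theta>)\<bar> \<le> Cf * (\<nu> * \<rho> + q * (q + \<nu>))"
      proof -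
        have mm: "averaging_step.mmean G DU x0 \<psi> \<theta> = g2_of u g (x0 \<psi>) \<theta>" for \<psi> \<theta>
          by (simp add: av.mmean_def av.mdrift_def[abs_def] g2_of_def jacobian_u G_apply)
        have ps: "\<bar>p1 (\<psi> + \<beta>0 * \<tau>) \<bullet> rn.k \<tau> - p1 \<psi> \<bullet> rn.k 0 - rn.\<rho> * integral {0..\<tau>} (\<lambda>s. p1 (\<psi> + \<beta>0 * s) \<bullet> av.mmean (\<psi> + \<beta>0 * s) (\<theta> + \<beta>0 * s))\<bar>
          \<le> ?ph * (\<nu> * rn.\<rho> + rn.q * (rn.q + \<nu>))"
        proof (rule rn.phase_bound[OF pc, of "\<lambda>s. \<beta>0 *\<^sub>R p1' (\<psi> + \<beta>0 * s)"])
          show "norm (p1 \<psi>) \<le> C" for \<psi> using P1[of \<psi>] Cge(5) by linarith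
          have dp: "((\<lambda>s. p1 (\<psi> + \<beta>0 * s)) has_vector_derivative \<beta>0 *\<^sub>R p1' (\<psi> + \<beta>0 * s)) (at s)" for s
          proof -
            have "((\<lambda>s. \<psi> + \<beta>0 * s) has_vector_derivative \<beta>0) (at s)"
              by (auto intro!: derivative_eq_intros simp: has_vector_derivative_def)
            from vector_diff_chain_at[OF this p1'(1)] show ?thesis by (simp add: o_def)
          qed
          then show "((\<lambda>s. p1 (\<psi> + \<beta>0 * s)) has_vector_derivative \<beta>0 *\<^sub>R p1' (\<psi> + \<beta>0 * s)) (at s)" for s .
          show "norm (p1 (\<psi> + \<beta>0 * s) - p1 (\<psi> + \<beta>0 * r)) \<le> C * \<bar>s - r\<bar>" for s r
          proof (rule vector_derivative_lipschitz[OF dp])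
            fix s
            have "\<beta>0 * norm (p1' (\<psi> + \<beta>0 * s)) \<le> \<beta>0 * P1'" using P1' \<beta>0 by (intro mult_left_mono) auto
            also have "\<dots> \<le> C" using Cge(6) by (simp add: mult.commute)
            finally show "norm (\<beta>0 *\<^sub>R p1' (\<psi> + \<beta>0 * s)) \<le> C" using \<beta>0 by simp
          qed
          show "(\<beta>0 *\<^sub>R p1' (\<psi> + \<beta>0 * s)) \<bullet> w = - (p1 (\<psi> + \<beta>0 * s) \<bullet> DF (x0 (\<psi> + \<beta>0 * s)) w)" for s w
            using \<beta>0 by (simp add: p1'(2))
        qed
        have "\<bar>p1 \<psi> \<bullet> \<kappa> - p1 \<psi> \<bullet> h - \<rho> * (\<tau> * G2 (\<psi> - \<theta>))\<bar> \<le> ?ph * (\<nu> * \<rho> + q * (q + \<nu>))"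
          using ps phase_integral[of N \<psi> \<theta>] unfolding mm per k0' rq \<tau>_def[symmetric] \<kappa>_def by simp
        also have "\<dots> \<le> Cf * (\<nu> * \<rho> + q * (q + \<nu>))" using Cf(5) q a0 p(1) by (intro mult_right_mono) auto
        finally show ?thesis by (simp add: \<psi>'_def \<psi>1_def mult.assoc)
      qed
      have "Cf / 4 * \<rho> \<le> Cf * \<rho>" using a0 Cf1 by (intro mult_right_mono) auto
      then have hb': "norm h' \<le> 3 / 4 * norm h + Cf * \<rho>" using hb by linarith
      show ?thesis
        by (intro exI[of _ \<xi>] exI[of _ \<psi>'] exI[of _ h'] conjI h'eq yE second)
          (use hb' third in \<open>simp_all add: q_def \<rho>_def\<close>)
    qed
    show ?thesis using partA near partB by blast
  qed
  show ?thesis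
  proof (rule exI[of _ \<tau>], rule conjI[OF \<tau>], rule exI[of _ Cf], rule conjI[OF Cf1(1)], rule conjI)
    show "\<forall>x \<psi> \<theta> \<phi>. norm (x - x0 \<psi>) \<le> 1 \<longrightarrow> norm (U (x, \<theta>, \<phi>)) \<le> Cf"
      using order_trans[OF Ub Cf1(2)] by simp
  qed (intro allI impI, rule main, assumption+)
qed

end

subsection \<open>Attraction to a rotating orbit\<close>

text \<open>The map t -> 3 t / 4 + b has the fixed point 4 b, so 5 b is undercut after finitely many
  steps.\<close>

lemma contracting_recursion_eventually:
  fixes a :: "nat \<Rightarrow> real"
  assumes step: "\<And>k. a (Suc k) \<le> 3 / 4 * a k + b" and b: "b > 0" and a: "\<And>k. a k \<ge> 0"
  shows "\<exists>K. \<forall>k\<ge>K. a k \<le> 5 * b"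
proof -
  have bd: "a k \<le> (3 / 4) ^ k * a 0 + 4 * b" for k
  proof (induction k)
    case (Suc k)
    have "3 / 4 * a k \<le> 3 / 4 * ((3 / 4) ^ k * a 0 + 4 * b)" using Suc by (rule mult_left_mono) simp
    also have "\<dots> = (3 / 4) ^ Suc k * a 0 + 3 * b" by (simp add: algebra_simps)
    finally show ?case using step[of k] by linarith
  qed (use b in simp)
  have "(\<lambda>k. (3 / 4) ^ k * a 0) \<longlonglongrightarrow> 0"
    using LIMSEQ_realpow_zero[of "3 / 4"] tendsto_mult_left_zero by fastforce
  then obtain K where K: "\<And>k. k \<ge> K \<Longrightarrow> norm ((3 / 4) ^ k * a 0 - 0) < b" using LIMSEQ_D[OF _ b] by blast
  have "a k \<le> 5 * b" if "k \<ge> K" for k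
    using K[OF that] bd[of k] a[of 0] by simp
  then show ?thesis by blast
qed

context perturbed_torus
begin

lemma vector_field_continuous: "continuous_on UNIV (\<lambda>(t, y). f y + \<gamma> *\<^sub>R g y (\<beta> * t) (\<alpha> * t))"
proof -
  have "continuous_on UNIV (\<lambda>z. f (snd z) + \<gamma> *\<^sub>R G (snd z, \<beta> * fst z, \<alpha> * fst z))"
    by (intro continuous_intros continuous_on_compose2[OF C1_imp_continuous[OF f_C1, of UNIV]] continuous_on_compose2[OF G_cont[of UNIV]]) auto
  then show ?thesis by (simp add: split_beta G_apply)
qed

lemma vector_field_lipschitz:
  "\<exists>L. \<forall>t\<in>{-r..r}. \<forall>y\<in>cball 0 r. \<forall>z\<in>cball 0 r.
     norm ((f y + \<gamma> *\<^sub>R g y (\<beta> * t) (\<alpha> * t)) - (f z + \<gamma> *\<^sub>R g z (\<beta> * t) (\<alpha> * t))) \<le> L * norm (y - z)"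
proof -
  define M where "M = max \<bar>\<beta>\<bar> \<bar>\<alpha>\<bar> * \<bar>r\<bar>"
  define K where "K = cball (0::real^'n) r \<times> ({-M..M} \<times> {-M..M})"
  have K: "compact K" "convex K" unfolding K_def by (intro compact_Times convex_Times; simp)+
  have c: "compact (cball (0::real^'n) r)" "convex (cball (0::real^'n) r)" by auto
  obtain Cg where Cg: "\<forall>z\<in>K. \<forall>w\<in>K. norm (G z - G w) \<le> Cg * norm (z - w)"
    using C2_bounds_compact[OF G_C2 K] by (elim exE conjE) (rule that)
  obtain Cf where Cf: "\<forall>z\<in>cball 0 r. \<forall>w\<in>cball 0 r. norm (f z - f w) \<le> Cf * norm (z - w)"
    using C2_bounds_compact[OF f_smooth c] by (elim exE conjE) (rule that)
  have "norm ((f y + \<gamma> *\<^sub>R g y (\<beta> * t) (\<alpha> * t)) - (f z + \<gamma> *\<^sub>R g z (\<beta> * t) (\<alpha> * t))) \<le> (Cf + \<bar>\<gamma>\<bar> * Cg) * norm (y - z)"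
    if t: "t \<in> {-r..r}" and yz: "y \<in> cball 0 r" "z \<in> cball 0 r" for t y z
  proof -
    have "\<bar>\<beta> * t\<bar> \<le> M" "\<bar>\<alpha> * t\<bar> \<le> M"
      using t unfolding M_def abs_mult by (auto intro!: mult_mono)
    then have "(y, \<beta> * t, \<alpha> * t) \<in> K" "(z, \<beta> * t, \<alpha> * t) \<in> K" using yz by (auto simp: K_def abs_le_iff)
    then have "norm (G (y, \<beta> * t, \<alpha> * t) - G (z, \<beta> * t, \<alpha> * t)) \<le> Cg * norm ((y, \<beta> * t, \<alpha> * t) - (z, \<beta> * t, \<alpha> * t))"
      using Cg by blast
    then have "norm (g y (\<beta> * t) (\<alpha> * t) - g z (\<beta> * t) (\<alpha> * t)) \<le> Cg * norm (y - z)"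
      unfolding norm_triple_diff G_apply .
    then have "norm (\<gamma> *\<^sub>R (g y (\<beta> * t) (\<alpha> * t) - g z (\<beta> * t) (\<alpha> * t))) \<le> \<bar>\<gamma>\<bar> * (Cg * norm (y - z))"
      by (simp add: mult_left_mono)
    moreover have "norm (f y - f z) \<le> Cf * norm (y - z)" using Cf yz by blast
    moreover have "(f y + \<gamma> *\<^sub>R g y (\<beta> * t) (\<alpha> * t)) - (f z + \<gamma> *\<^sub>R g z (\<beta> * t) (\<alpha> * t))
      = (f y - f z) + \<gamma> *\<^sub>R (g y (\<beta> * t) (\<alpha> * t) - g z (\<beta> * t) (\<alpha> * t))" by (simp add: algebra_simps)
    ultimately show ?thesis
      using norm_triangle_ineq[of "f y - f z" "\<gamma> *\<^sub>R (g y (\<beta> * t) (\<alpha> * t) - g z (\<beta> * t) (\<alpha> * t))"]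
      by (simp add: algebra_simps)
  qed
  then show ?thesis by blast
qed

text \<open>Equivariance turns a rotation of the state into a shift of the fast phase, and rotating
  back by \<alpha>0 t lowers the fast frequency to \<alpha> - \<alpha>0. The angle \<phi> is the
  rotational phase that is adjusted at the samples.\<close>

lemma rotating_frame:
  assumes "(x has_vector_derivative f (x (t0 + s)) + \<gamma> *\<^sub>R g (x (t0 + s)) (\<beta> * (t0 + s)) (\<alpha> * (t0 + s))) (at (t0 + s))"
    and y: "y = (\<lambda>s. E (- \<phi> - \<alpha>0 * (t0 + s)) (x (t0 + s)))"
  shows "(y has_vector_derivative F (y s) + \<gamma> *\<^sub>R G (y s, \<beta> * t0 + \<beta> * s, ((\<alpha> - \<alpha>0) * t0 - \<phi>) + (\<alpha> - \<alpha>0) * s)) (at s within T)"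
proof -
  have "((\<lambda>s. t0 + s) has_vector_derivative 1) (at s within T)" by (auto intro!: derivative_eq_intros)
  from vector_diff_chain_within[OF this has_vector_derivative_at_within[OF assms(1)]]
  have dx: "((\<lambda>s. x (t0 + s)) has_vector_derivative f (x (t0 + s)) + \<gamma> *\<^sub>R g (x (t0 + s)) (\<beta> * (t0 + s)) (\<alpha> * (t0 + s))) (at s within T)"
    by (simp add: o_def)
  have dh: "((\<lambda>s. - \<phi> - \<alpha>0 * (t0 + s)) has_real_derivative - \<alpha>0) (at s within T)"
    by (auto intro!: derivative_eq_intros)
  let ?\<xi> = "- \<phi> - \<alpha>0 * (t0 + s)"
  have "E ?\<xi> (f (x (t0 + s)) + \<gamma> *\<^sub>R g (x (t0 + s)) (\<beta> * (t0 + s)) (\<alpha> * (t0 + s)))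
    = f (y s) + \<gamma> *\<^sub>R g (y s) (\<beta> * (t0 + s)) (\<alpha> * (t0 + s) + ?\<xi>)"
    by (simp only: linear_add[OF E_linear] linear_cmul[OF E_linear] y f_E g_E)
  moreover have "\<alpha> * (t0 + s) + ?\<xi> = ((\<alpha> - \<alpha>0) * t0 - \<phi>) + (\<alpha> - \<alpha>0) * s" "\<beta> * (t0 + s) = \<beta> * t0 + \<beta> * s"
    by (simp_all add: algebra_simps)
  moreover have "(y has_vector_derivative - \<alpha>0 *\<^sub>R (A *v E ?\<xi> (x (t0 + s)))
      + E ?\<xi> (f (x (t0 + s)) + \<gamma> *\<^sub>R g (x (t0 + s)) (\<beta> * (t0 + s)) (\<alpha> * (t0 + s)))) (at s within T)"
    using E_product[OF dh dx] by (simp add: y)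
  ultimately show ?thesis by (simp add: F_def G_apply y diff_add_eq)
qed

text \<open>Form in which non-degeneracy is used: on an interval where G2 is constant, its first two
  derivatives would both vanish.\<close>

lemma G2_not_constant:
  assumes nd: "\<And>\<psi>. deriv G2 \<psi> = 0 \<Longrightarrow> deriv (deriv G2) \<psi> \<noteq> 0" and ab: "a < b"
  shows "\<not> G2 constant_on {a..b}"
proof
  assume "G2 constant_on {a..b}"
  then obtain c where c: "\<And>s. s \<in> {a..b} \<Longrightarrow> G2 s = c" by (auto simp: constant_on_def)
  have 0: "deriv G2 s = 0" if s: "s \<in> {a<..<b}" for s
  proof -
    have "((\<lambda>_. c) has_real_derivative 0) (at s)" by simp
    then have "(G2 has_real_derivative 0) (at s)"
      by (rule DERIV_cong_ev[THEN iffD1, rotated 3])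
        (use s c in \<open>auto intro!: eventually_nhds_in_open[THEN eventually_mono, of "{a<..<b}"]\<close>)
    then show ?thesis by (rule DERIV_imp_deriv)
  qed
  define s where "s = (a + b) / 2"
  have s: "s \<in> {a<..<b}" using ab by (simp add: s_def)
  have "((\<lambda>_. 0) has_real_derivative 0) (at s)" by simp
  then have "(deriv G2 has_real_derivative 0) (at s)"
    by (rule DERIV_cong_ev[THEN iffD1, rotated 3])
      (use s 0 in \<open>auto intro!: eventually_nhds_in_open[THEN eventually_mono, of "{a<..<b}"]\<close>)
  then have "deriv (deriv G2) s = 0" by (rule DERIV_imp_deriv)
  then show False using nd 0[OF s] by blast
qed

text \<open>A global extremum is a critical point, and a period shift brings it to the fundamental
  interval. Distance from the singular values therefore implies distance from the maximum and the
  minimum.\<close>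

lemma G2_extreme_in_singular_values:
  assumes ext: "(\<forall>s. G2 s \<le> G2 b) \<or> (\<forall>s. G2 b \<le> G2 s)"
  shows "G2 b \<in> singular_values G2"
proof -
  define n where "n = - \<lfloor>b / (2 * pi)\<rfloor>"
  define b' where "b' = b + of_int n * (2 * pi)"
  have "0 < 2 * pi" by simp
  then have b': "b' \<in> {0..<2 * pi}"
    using floor_divide_lower[of "2 * pi" b] floor_divide_upper[of "2 * pi" b] by (simp add: b'_def n_def algebra_simps)
  have eq: "G2 b' = G2 b" unfolding b'_def by (rule periodic_add_of_int[of G2 "2 * pi", OF G2_per])
  obtain D where D: "(G2 has_real_derivative D) (at b')" using G2_differentiable by blast
  have "D = 0"
  proof (cases "\<forall>s. G2 s \<le> G2 b")
    case True
    then show ?thesis by (intro DERIV_local_max[OF D, of 1]) (auto simp: eq)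
  next
    case False
    then have "\<forall>s. G2 b \<le> G2 s" using ext by blast
    then show ?thesis by (intro DERIV_local_min[OF D, of 1]) (auto simp: eq)
  qed
  then have "deriv G2 b' = 0" using D by (auto intro: DERIV_imp_deriv)
  then show ?thesis using b' eq unfolding singular_values_def by (intro CollectI exI[of _ b']) auto
qed

lemma G2_extrema:
  obtains b b' where "\<And>s. G2 s \<le> G2 b" "\<And>s. G2 b' \<le> G2 s"
    "(SUP \<psi>\<in>{0..2 * pi}. G2 \<psi>) = G2 b" "(INF \<psi>\<in>{0..2 * pi}. G2 \<psi>) = G2 b'"
proof -
  have red: "\<exists>r\<in>{0..2 * pi}. G2 s = G2 r" for s
  proof -
    have "0 < 2 * pi" by simp
    then have "s + of_int (- \<lfloor>s / (2 * pi)\<rfloor>) * (2 * pi) \<in> {0..2 * pi}"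
      using floor_divide_lower[of "2 * pi" s] floor_divide_upper[of "2 * pi" s] by (simp add: algebra_simps)
    then show ?thesis using periodic_add_of_int[of G2 "2 * pi", OF G2_per] by metis
  qed
  have ne: "{0..2 * pi} \<noteq> {}" by simp
  obtain b where b: "b \<in> {0..2 * pi}" "\<forall>s\<in>{0..2 * pi}. G2 s \<le> G2 b"
    using continuous_attains_sup[OF compact_Icc ne G2_cont] by blast
  obtain b' where b': "b' \<in> {0..2 * pi}" "\<forall>s\<in>{0..2 * pi}. G2 b' \<le> G2 s"
    using continuous_attains_inf[OF compact_Icc ne G2_cont] by blast
  have "(SUP \<psi>\<in>{0..2 * pi}. G2 \<psi>) = G2 b" by (rule cSup_eq_maximum) (use b in auto)
  moreover have "(INF \<psi>\<in>{0..2 * pi}. G2 \<psi>) = G2 b'" by (rule cInf_eq_minimum) (use b' in auto)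
  moreover have "G2 s \<le> G2 b" "G2 b' \<le> G2 s" for s using red[of s] b(2) b'(2) by auto
  ultimately show ?thesis using that by blast
qed

text \<open>For \<alpha> >= 2 \<alpha>0 one has \<omega> >= \<alpha> / 2, so a ratio over \<omega>
  is at most twice the one over \<alpha>. The lower bound on \<gamma> controls 1 / (\<gamma>
  \<omega>), the upper one controls \<gamma> / \<omega> and \<gamma>^2 / \<omega>.\<close>

lemma parameter_choice:
  assumes s: "s > 0" and \<alpha>0: "\<alpha>0 > 0" and \<alpha>: "\<alpha> \<ge> 1 + 2 * \<alpha>0 + 2 / s"
    and \<gamma>: "(2 / s) / \<alpha> \<le> \<gamma>" "\<gamma> \<le> min 1 (s / 2) * sqrt \<alpha>"
  shows "\<alpha> - \<alpha>0 > 0" "\<gamma> > 0" "\<gamma> / (\<alpha> - \<alpha>0) \<le> s" "\<gamma>\<^sup>2 / (\<alpha> - \<alpha>0) \<le> s" "1 / (\<alpha> - \<alpha>0) \<le> s" "1 / (\<gamma> * (\<alpha> - \<alpha>0)) \<le> s"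
proof -
  have s2: "2 / s > 0" using s by simp
  have \<alpha>1: "\<alpha> \<ge> 1" "\<alpha> > 0" using \<alpha> \<alpha>0 s2 by linarith+
  have w: "\<alpha> - \<alpha>0 \<ge> \<alpha> / 2" using \<alpha> \<alpha>0 s2 by linarith
  then show w0: "\<alpha> - \<alpha>0 > 0" using \<alpha>1 by linarith
  have "(2 / s) / \<alpha> > 0" using s2 \<alpha>1 by simp
  then show g0: "\<gamma> > 0" using \<gamma>(1) by linarith
  define c where "c = min 1 (s / 2)"
  have c: "c > 0" "c \<le> 1" "2 * c \<le> s" using s by (auto simp: c_def)
  have \<gamma>c: "\<gamma> \<le> c * sqrt \<alpha>" using \<gamma>(2) by (simp only: c_def)
  have le: "r / (\<alpha> - \<alpha>0) \<le> 2 * (r / \<alpha>)" if "r \<ge> 0" for r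
  proof -
    have "r / (\<alpha> - \<alpha>0) \<le> r / (\<alpha> / 2)" using that w \<alpha>1 by (intro divide_left_mono) auto
    also have "\<dots> = 2 * (r / \<alpha>)" by simp
    finally show ?thesis .
  qed
  have sq: "sqrt \<alpha> \<ge> 1" "sqrt \<alpha> > 0" using \<alpha>1 by auto
  have "\<gamma> / \<alpha> \<le> c * sqrt \<alpha> / \<alpha>" using \<gamma>c \<alpha>1 by (intro divide_right_mono) auto
  also have "\<dots> = c / sqrt \<alpha>" using \<alpha>1 by (simp add: real_div_sqrt field_simps)
  also have "\<dots> \<le> c / 1" using c sq by (intro divide_left_mono) auto
  finally show "\<gamma> / (\<alpha> - \<alpha>0) \<le> s" using le[of \<gamma>] g0 c by linarith
  have "\<gamma>\<^sup>2 \<le> (c * sqrt \<alpha>)\<^sup>2" using \<gamma>c g0 by (intro power_mono) auto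
  also have "\<dots> = c * (c * \<alpha>)" using \<alpha>1 by (simp add: power_mult_distrib power2_eq_square)
  also have "\<dots> \<le> 1 * (c * \<alpha>)" using c \<alpha>1 by (intro mult_right_mono) auto
  finally have "\<gamma>\<^sup>2 / \<alpha> \<le> c" using \<alpha>1 by (simp add: pos_divide_le_eq)
  then show "\<gamma>\<^sup>2 / (\<alpha> - \<alpha>0) \<le> s" using le[OF zero_le_power2, of \<gamma>] c by linarith
  have "2 / s \<le> \<alpha>" using \<alpha> \<alpha>0 by linarith
  then have "1 / \<alpha> \<le> s / 2" using s \<alpha>1 by (simp add: field_simps)
  then show "1 / (\<alpha> - \<alpha>0) \<le> s" using le[of 1] by simp
  have "2 / s \<le> \<gamma> * \<alpha>" using pos_divide_le_eq[OF \<alpha>1(2), THEN iffD1, OF \<gamma>(1)] .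
  then have "1 / (\<gamma> * \<alpha>) \<le> s / 2" using s g0 \<alpha>1 by (simp add: field_simps)
  moreover have "(1 / \<gamma>) / (\<alpha> - \<alpha>0) \<le> 2 * ((1 / \<gamma>) / \<alpha>)" using g0 by (intro le) simp
  ultimately show "1 / (\<gamma> * (\<alpha> - \<alpha>0)) \<le> s" by simp
qed

lemma kappa_bounds:
  assumes ext: "\<And>s. G2 s \<le> G2 b" "\<And>s. G2 b' \<le> G2 s"
    and r: "r > 0" "r * G2 b' < d" "d < r * G2 b" and dist: "infdist (1 / r * d) (singular_values G2) \<ge> \<epsilon>"
  shows "G2 b' + \<epsilon> \<le> d / r" "d / r + \<epsilon> \<le> G2 b"
proof -
  have "G2 b \<in> singular_values G2" "G2 b' \<in> singular_values G2"
    using ext by (auto intro: G2_extreme_in_singular_values)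
  then have "\<epsilon> \<le> dist (d / r) (G2 b)" "\<epsilon> \<le> dist (d / r) (G2 b')"
    using dist infdist_le[of _ "singular_values G2" "1 / r * d"] by (auto intro: order_trans)
  moreover have "G2 b' < d / r" "d / r < G2 b" using r by (simp_all add: field_simps)
  ultimately show "G2 b' + \<epsilon> \<le> d / r" "d / r + \<epsilon> \<le> G2 b" by (simp_all add: dist_real_def)
qed

lemma attracted_to_torus_orbit:
  assumes \<alpha>0: "\<alpha>0 > 0" and nd: "\<And>\<psi>. deriv G2 \<psi> = 0 \<Longrightarrow> deriv (deriv G2) \<psi> \<noteq> 0"
    and \<epsilon>: "\<epsilon> > 0" and \<epsilon>1: "\<epsilon>1 > 0"
  shows "\<exists>\<alpha>1>0. \<exists>c1>0. \<exists>c2>0. \<exists>\<delta>>0.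
    \<forall>\<alpha> \<beta> \<gamma>. \<alpha> > 0 \<and> \<beta> > 0 \<and> \<gamma> \<ge> 0 \<and>
      \<alpha> \<ge> \<alpha>1 \<and> c1 / \<alpha> \<le> \<gamma> \<and> \<gamma> \<le> c2 * sqrt \<alpha> \<and>
      \<gamma>\<^sup>2 / \<alpha> * (INF \<psi>\<in>{0..2 * pi}. G2 \<psi>) < \<beta> - \<beta>0 \<and>
      \<beta> - \<beta>0 < \<gamma>\<^sup>2 / \<alpha> * (SUP \<psi>\<in>{0..2 * pi}. G2 \<psi>) \<and>
      infdist (\<alpha> / \<gamma>\<^sup>2 * (\<beta> - \<beta>0)) (singular_values G2) \<ge> \<epsilon> \<longrightarrow>
      (\<forall>J x. maximal_solution (\<lambda>t y. f y + \<gamma> *\<^sub>R g y (\<beta> * t) (\<alpha> * t)) J x \<and>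
             (\<exists>t0\<in>J. infdist (x t0) (torus_of A x0) < \<delta>) \<longrightarrow>
        (\<exists>\<sigma> T. \<forall>t>T. t \<in> J \<and>
           (INF \<phi>. norm (x t - mat_exp (\<phi> *\<^sub>R A) *v x0 (\<beta> * t + \<sigma>))) < \<epsilon>1))"
proof -
  obtain b b' where ext: "\<And>s. G2 s \<le> G2 b" "\<And>s. G2 b' \<le> G2 s"
    and SI: "(SUP \<psi>\<in>{0..2 * pi}. G2 \<psi>) = G2 b" "(INF \<psi>\<in>{0..2 * pi}. G2 \<psi>) = G2 b'"
    using G2_extrema by metis
  define B where "B = max \<bar>G2 b\<bar> \<bar>G2 b'\<bar>"
  have B0: "B \<ge> 0" by (simp add: B_def)
  obtain \<tau> C where \<tau>: "\<tau> > 0" and C: "C \<ge> 1"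
    and Ub: "\<And>x \<psi> \<theta> \<phi>. norm (x - x0 \<psi>) \<le> 1 \<Longrightarrow> norm (U (x, \<theta>, \<phi>)) \<le> C"
    and step: "\<forall>\<nu> \<gamma> \<omega> \<beta> \<theta> \<chi>0 \<psi> S y h.
      \<nu> \<le> 1 / C \<longrightarrow> small_params B \<nu> \<gamma> \<omega> \<beta> \<longrightarrow> S \<le> \<tau> \<longrightarrow> near_solution \<gamma> \<omega> \<beta> \<theta> \<chi>0 \<psi> S y \<longrightarrow>
      h = y 0 - (\<gamma> / \<omega>) *\<^sub>R U (y 0, \<theta>, \<chi>0) - x0 \<psi> \<longrightarrow> norm h \<le> \<nu> \<longrightarrow>
      (\<forall>s\<in>{0..S}. norm (y s - x0 (\<psi> + \<beta>0 * s)) \<le> C * (norm h + \<gamma>\<^sup>2 / \<omega> + \<gamma> / \<omega>) \<and> norm (y s - x0 (\<psi> + \<beta>0 * s)) \<le> 1 / 2) \<and>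
      (S = \<tau> \<longrightarrow> (\<exists>\<xi> \<psi>' h'. h' = E (- \<xi>) (y \<tau> - (\<gamma> / \<omega>) *\<^sub>R U (y \<tau>, \<theta> + \<beta> * \<tau>, \<chi>0 + \<omega> * \<tau>)) - x0 \<psi>' \<and>
         norm (E (- \<xi>) (y \<tau>) - x0 \<psi>') \<le> 1 \<and>
         norm h' \<le> 3 / 4 * norm h + C * (\<gamma>\<^sup>2 / \<omega>) \<and>
         \<bar>p1 \<psi>' \<bullet> h'\<bar> \<le> C * (norm h + \<gamma>\<^sup>2 / \<omega>)\<^sup>2 \<and>
         \<bar>\<psi>' - \<psi> - \<beta>0 * \<tau> - p1 \<psi> \<bullet> h - \<gamma>\<^sup>2 / \<omega> * \<tau> * G2 (\<psi> - \<theta>)\<bar>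
           \<le> C * (\<nu> * (\<gamma>\<^sup>2 / \<omega>) + (norm h + \<gamma>\<^sup>2 / \<omega>) * (norm h + \<gamma>\<^sup>2 / \<omega> + \<nu>))))"
    using one_step[OF B0] by (elim exE conjE) (rule that; blast)
  obtain Lx where Lx: "\<And>s. norm (q1 s) \<le> Lx" using continuous_periodic_bounded[OF q1_cont] q_periodic by metis
  have Lx0: "Lx \<ge> 0" using order_trans[OF norm_ge_zero Lx] .
  have x0_lip: "norm (x0 s - x0 t) \<le> Lx * \<bar>s - t\<bar>" for s t by (rule vector_derivative_lipschitz[OF x0_deriv Lx])
  obtain Bx where Bx: "\<And>s. norm (x0 s) \<le> Bx" using continuous_periodic_bounded[OF x0_cont x0_periodic] by metis
  \<comment> \<open>Final uncertainty allowed for the slow phase; it moves x0 by at most \<epsilon>1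
    / 4.\<close>
  define \<epsilon>' where "\<epsilon>' = \<epsilon>1 / (4 * (Lx + 1))"
  have \<epsilon>': "\<epsilon>' > 0" "Lx * \<epsilon>' \<le> \<epsilon>1 / 4" using \<epsilon>1 Lx0 by (simp_all add: \<epsilon>'_def field_simps)
  have "\<exists>\<eta>>0. \<exists>\<zeta>>0. \<forall>\<kappa> \<mu> \<sigma>.
    (\<exists>b. G2 b \<ge> \<kappa> + \<epsilon> / 2) \<and> (\<exists>b. G2 b \<le> \<kappa> - \<epsilon> / 2) \<and> 0 < \<mu> \<and> \<mu> \<le> \<zeta> \<and>
    (\<forall>k\<ge>0. \<bar>\<sigma> (Suc k) - \<sigma> k - \<mu> * (G2 (\<sigma> k) - \<kappa>)\<bar> \<le> \<mu> * \<eta>) \<longrightarrow>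
    (\<exists>c. \<exists>K::nat. \<forall>k\<ge>K. \<bar>\<sigma> k - c\<bar> \<le> \<epsilon>')"
    by (rule slow_drift_converges[OF G2_cont G2_per _ G2_not_constant[OF nd] _ \<epsilon>'(1)]) (use \<epsilon> in auto)
  then obtain \<eta> \<zeta> where \<eta>: "\<eta> > 0" "\<zeta> > 0" and conv: "\<And>\<kappa> \<mu> \<sigma>.
    (\<exists>b. G2 b \<ge> \<kappa> + \<epsilon> / 2) \<and> (\<exists>b. G2 b \<le> \<kappa> - \<epsilon> / 2) \<and> 0 < \<mu> \<and> \<mu> \<le> \<zeta> \<and>
    (\<forall>k\<ge>0. \<bar>\<sigma> (Suc k) - \<sigma> k - \<mu> * (G2 (\<sigma> k) - \<kappa>)\<bar> \<le> \<mu> * \<eta>) \<Longrightarrow>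
    (\<exists>c. \<exists>K::nat. \<forall>k\<ge>K. \<bar>\<sigma> k - c\<bar> \<le> \<epsilon>')"
    by (elim exE conjE) metis
  \<comment> \<open>Eventually |h| <= 5 C \<rho>, hence |h| + \<rho> <= K \<rho>. Q then collects
    the coefficients of \<nu> \<rho> in the drift error: C K^2 from p1 . h, the rest from the phase
    equation.\<close>
  define K where "K = 5 * C + 1"
  define Q where "Q = C * K\<^sup>2 + C * (1 + K * (K + 1))"
  have K0: "K \<ge> 1" and Q0: "Q > 0" using C by (simp_all add: K_def Q_def add_pos_pos)
  \<comment> \<open>With \<nu> = 1 / M the summands secure in turn: the hypothesis of
    \<open>one_step\<close>, a drift error of at most \<eta> \<tau> \<rho>, two contributions of at
    most \<epsilon>1 / 4 to the final distance, and \<nu> <= 1.\<close>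
  define M where "M = C + Q / (\<tau> * \<eta>) + 4 * C * (K + 1) / \<epsilon>1 + 4 * Lx * B * \<tau> / \<epsilon>1 + 1"
  have Mt: "C \<ge> 0" "Q / (\<tau> * \<eta>) \<ge> 0" "4 * C * (K + 1) / \<epsilon>1 \<ge> 0" "4 * Lx * B * \<tau> / \<epsilon>1 \<ge> 0"
    using C Q0 \<tau> \<eta> K0 \<epsilon>1 Lx0 B0 by auto
  have M: "M \<ge> C" "M \<ge> Q / (\<tau> * \<eta>)" "M \<ge> 4 * C * (K + 1) / \<epsilon>1" "M \<ge> 4 * Lx * B * \<tau> / \<epsilon>1" "M \<ge> 1"
    using Mt by (simp_all add: M_def)
  define \<nu> where "\<nu> = 1 / M"
  have \<nu>: "\<nu> > 0" "\<nu> \<le> 1" "\<nu> \<le> 1 / C" using M C by (simp_all add: \<nu>_def field_simps)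
  have \<nu>M: "\<nu> * r \<le> 1" if "r \<le> M" for r using that M by (simp add: \<nu>_def)
  have \<nu>Q: "\<nu> * Q \<le> \<tau> * \<eta>"
  proof -
    have "(\<nu> * Q) / (\<tau> * \<eta>) \<le> 1" using \<nu>M[OF M(2)] by simp
    then show ?thesis using \<tau> \<eta> by (simp add: pos_divide_le_eq)
  qed
  have \<nu>1: "C * (K + 1) * \<nu> \<le> \<epsilon>1 / 4"
  proof -
    have "(4 * C * (K + 1) * \<nu>) / \<epsilon>1 \<le> 1" using \<nu>M[OF M(3)] by (simp add: mult.commute)
    then show ?thesis using \<epsilon>1 by (simp add: pos_divide_le_eq)
  qed
  have \<nu>2: "Lx * (B * \<nu> * \<tau>) \<le> \<epsilon>1 / 4"
  proof -
    have "(4 * Lx * B * \<tau> * \<nu>) / \<epsilon>1 \<le> 1" using \<nu>M[OF M(4)] by (simp add: mult.commute)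
    then show ?thesis using \<epsilon>1 by (simp add: pos_divide_le_eq mult.commute mult.left_commute)
  qed
  \<comment> \<open>Common bound for the four small ratios. The first entry preserves |h| <= \<nu>,
    as 3/4 \<nu> + C \<rho> <= \<nu>; the second makes the step size \<rho> \<tau> of the slow phase
    at most \<zeta>.\<close>
  define s0 where "s0 = min (\<nu> / (4 * C)) (\<zeta> / \<tau>)"
  have s0: "s0 > 0" "s0 \<le> \<nu> / (4 * C)" "s0 \<le> \<zeta> / \<tau>" using \<nu> C \<eta> \<tau> by (simp_all add: s0_def)
  have s0C: "4 * C * s0 \<le> \<nu>" using s0(2) C by (simp add: pos_le_divide_eq mult.commute)
  have s0\<nu>: "s0 \<le> \<nu>"
  proof -
    have "1 * s0 \<le> 4 * C * s0" using C s0(1) by (intro mult_right_mono) auto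
    then show ?thesis using s0C by linarith
  qed
  \<comment> \<open>The last summand is for the passage from \<gamma>^2 / \<alpha>, the
    normalization in the hypotheses, to \<rho> = \<gamma>^2 / (\<alpha> - \<alpha>0), produced by
    the estimates; it limits the resulting change of \<kappa> to \<epsilon> / 2.\<close>
  define \<alpha>1 where "\<alpha>1 = 1 + 2 * \<alpha>0 + 2 / s0 + 2 * B * \<alpha>0 / \<epsilon>"
  define c1 where "c1 = 2 / s0"
  define c2 where "c2 = min 1 (s0 / 2)"
  have \<alpha>1: "\<alpha>1 > 0" "1 + 2 * \<alpha>0 + 2 / s0 \<le> \<alpha>1" "2 * B * \<alpha>0 / \<epsilon> \<le> \<alpha>1"
    using \<alpha>0 s0 B0 \<epsilon> by (simp_all add: \<alpha>1_def add_pos_nonneg)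
  have c12: "c1 > 0" "c2 > 0" using s0 by (simp_all add: c1_def c2_def)
  have main: "\<exists>\<sigma> T. \<forall>t>T. t \<in> J \<and> (INF \<phi>. norm (x t - mat_exp (\<phi> *\<^sub>R A) *v x0 (\<beta> * t + \<sigma>))) < \<epsilon>1"
    if par: "\<alpha> > 0" "\<beta> > 0" "\<alpha> \<ge> \<alpha>1" "c1 / \<alpha> \<le> \<gamma>" "\<gamma> \<le> c2 * sqrt \<alpha>"
      and lo: "\<gamma>\<^sup>2 / \<alpha> * G2 b' < \<beta> - \<beta>0" and hi: "\<beta> - \<beta>0 < \<gamma>\<^sup>2 / \<alpha> * G2 b"
      and dist: "infdist (\<alpha> / \<gamma>\<^sup>2 * (\<beta> - \<beta>0)) (singular_values G2) \<ge> \<epsilon>"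
      and max: "maximal_solution (\<lambda>t y. f y + \<gamma> *\<^sub>R g y (\<beta> * t) (\<alpha> * t)) J x"
      and t0: "t0 \<in> J" "infdist (x t0) (torus_of A x0) < \<nu> / 2" for \<alpha> \<beta> \<gamma> J x t0
  proof -
    define \<omega> where "\<omega> = \<alpha> - \<alpha>0"
    define a where "a = \<gamma> / \<omega>"
    define \<rho> where "\<rho> = \<gamma>\<^sup>2 / \<omega>"
    have pc: "\<omega> > 0" "\<gamma> > 0" "a \<le> s0" "\<rho> \<le> s0" "1 / \<omega> \<le> s0" "1 / (\<gamma> * \<omega>) \<le> s0"
      unfolding \<omega>_def a_def \<rho>_def
      by (rule parameter_choice[OF s0(1) \<alpha>0]; use par \<alpha>1 in \<open>simp add: c1_def c2_def\<close>)+
    have a0: "a > 0" "\<rho> > 0" using pc by (simp_all add: a_def \<rho>_def)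
    define \<kappa> where "\<kappa> = (\<beta> - \<beta>0) / (\<gamma>\<^sup>2 / \<alpha>)"
    define \<kappa>' where "\<kappa>' = (\<beta> - \<beta>0) / \<rho>"
    have r0: "\<gamma>\<^sup>2 / \<alpha> > 0" using pc par by simp
    have \<kappa>: "G2 b' + \<epsilon> \<le> \<kappa>" "\<kappa> + \<epsilon> \<le> G2 b"
      using kappa_bounds[OF ext r0 lo hi] dist by (simp_all add: \<kappa>_def)
    have \<kappa>B: "\<bar>\<kappa>\<bar> \<le> B" using \<kappa> \<epsilon> unfolding B_def by linarith
    have \<kappa>'eq: "\<kappa>' = \<kappa> - \<kappa> * (\<alpha>0 / \<alpha>)"
      using pc par by (simp add: \<kappa>'_def \<kappa>_def \<rho>_def \<omega>_def field_simps)
    have \<alpha>0\<alpha>: "0 \<le> \<alpha>0 / \<alpha>" "\<alpha>0 / \<alpha> \<le> 1" using \<alpha>0 par pc by (simp_all add: \<omega>_def)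
    have \<kappa>'B: "\<bar>\<kappa>'\<bar> \<le> B"
    proof -
      have "\<kappa>' = \<kappa> * (1 - \<alpha>0 / \<alpha>)" by (simp add: \<kappa>'eq algebra_simps)
      then have "\<bar>\<kappa>'\<bar> \<le> \<bar>\<kappa>\<bar> * 1" unfolding abs_mult using \<alpha>0\<alpha> by (simp only: abs_mult) (intro mult_left_mono, auto)
      then show ?thesis using \<kappa>B by simp
    qed
    have \<kappa>'\<kappa>: "\<bar>\<kappa>' - \<kappa>\<bar> \<le> \<epsilon> / 2"
    proof -
      have "2 * B * \<alpha>0 / \<epsilon> \<le> \<alpha>" using \<alpha>1(3) par(3) by linarith
      then have "B * (\<alpha>0 / \<alpha>) \<le> \<epsilon> / 2" using \<epsilon> par(1) by (simp add: field_simps)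
      moreover have "\<bar>\<kappa>' - \<kappa>\<bar> = \<bar>\<kappa>\<bar> * (\<alpha>0 / \<alpha>)"
        using abs_mult[of \<kappa> "\<alpha>0 / \<alpha>"] abs_of_nonneg[OF \<alpha>0\<alpha>(1)] unfolding \<kappa>'eq by (metis abs_minus_commute diff_diff_eq2 add_diff_cancel_left')
      moreover have "\<bar>\<kappa>\<bar> * (\<alpha>0 / \<alpha>) \<le> B * (\<alpha>0 / \<alpha>)" using \<kappa>B \<alpha>0\<alpha> by (intro mult_right_mono) auto
      ultimately show ?thesis by linarith
    qed
    have \<beta>\<rho>: "\<beta> - \<beta>0 = \<rho> * \<kappa>'" using a0 by (simp add: \<kappa>'_def)
    have \<beta>B: "\<bar>\<beta> - \<beta>0\<bar> \<le> B * \<rho>" using \<kappa>'B a0 by (simp add: \<beta>\<rho> abs_mult mult.commute mult_left_mono)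
    have sp: "small_params B \<nu> \<gamma> \<omega> \<beta>"
      unfolding small_params_def using \<nu> pc s0\<nu> par \<beta>B by (simp add: a_def \<rho>_def)
    have cf: "continuous_on UNIV (\<lambda>(t, y). f y + \<gamma> *\<^sub>R g y (\<beta> * t) (\<alpha> * t))"
      by (rule vector_field_continuous)
    have sol: "(x has_vector_derivative f (x t) + \<gamma> *\<^sub>R g (x t) (\<beta> * t) (\<alpha> * t)) (at t)" if "t \<in> J" for t
      using max that by (simp add: maximal_solution_def solves_ode_on_def)
    have Jint: "s \<in> J" if "r \<in> J" "r' \<in> J" "r \<le> s" "s \<le> r'" for r r' s
    proof -
      have "is_interval J" using max by (simp add: maximal_solution_def)
      then show ?thesis using that unfolding is_interval_1 by blast
    qed
    define T where "T = (\<lambda>k. t0 + real k * \<tau>)"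
    \<comment> \<open>\<open>Y\<close> is the state at sample k seen in the frame with rotational
      phase \<phi>, \<open>H\<close> its transformed deviation from x0(\<psi>). The pairs of phases
      are chosen recursively, with \<open>P\<close> as invariant and \<open>R\<close> as the
      relation between consecutive choices.\<close>
    define Y where "Y = (\<lambda>k \<phi>. E (- \<phi> - \<alpha>0 * T k) (x (T k)))"
    define H where "H = (\<lambda>k \<phi> \<psi>. Y k \<phi> - a *\<^sub>R U (Y k \<phi>, \<beta> * T k, \<omega> * T k - \<phi>) - x0 \<psi>)"
    define P where "P = (\<lambda>k (\<phi>, \<psi>). T k \<in> J \<and> norm (Y k \<phi> - x0 \<psi>) \<le> 1 \<and> norm (H k \<phi> \<psi>) \<le> \<nu>)"
    define R where "R = (\<lambda>k (\<phi>, \<psi>) (\<phi>', \<psi>').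
      norm (H (Suc k) \<phi>' \<psi>') \<le> 3 / 4 * norm (H k \<phi> \<psi>) + C * \<rho> \<and>
      \<bar>p1 \<psi>' \<bullet> H (Suc k) \<phi>' \<psi>'\<bar> \<le> C * (norm (H k \<phi> \<psi>) + \<rho>)\<^sup>2 \<and>
      \<bar>\<psi>' - \<psi> - \<beta>0 * \<tau> - p1 \<psi> \<bullet> H k \<phi> \<psi> - \<rho> * \<tau> * G2 (\<psi> - \<beta> * T k)\<bar>
        \<le> C * (\<nu> * \<rho> + (norm (H k \<phi> \<psi>) + \<rho>) * (norm (H k \<phi> \<psi>) + \<rho> + \<nu>)) \<and>
      (\<forall>s\<in>{0..\<tau>}. T k + s \<in> J \<and>
        norm (E (- \<phi> - \<alpha>0 * (T k + s)) (x (T k + s)) - x0 (\<psi> + \<beta>0 * s)) \<le> C * (norm (H k \<phi> \<psi>) + \<rho> + a)))"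
    \<comment> \<open>With \<delta> = \<nu> / 2, half of \<nu> pays for the initial distance from
      the torus and half for the term a u.\<close>
    have base: "\<exists>z. P 0 z"
    proof -
      have ne: "torus_of A x0 \<noteq> {}" by (auto simp: torus_of_def)
      have "\<exists>p\<in>torus_of A x0. dist (x t0) p < \<nu> / 2"
      proof -
        have "(INF p\<in>torus_of A x0. dist (x t0) p) < \<nu> / 2" using t0(2) ne by (simp add: infdist_def)
        then show ?thesis using ne by (subst (asm) cInf_less_iff) auto
      qed
      then obtain \<phi> \<psi> where d: "norm (x t0 - E \<phi> (x0 \<psi>)) < \<nu> / 2" by (auto simp: torus_of_def E_def dist_norm)
      have Y0: "Y 0 (\<phi> - \<alpha>0 * t0) = E (- \<phi>) (x t0)" by (simp add: Y_def T_def)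
      have "Y 0 (\<phi> - \<alpha>0 * t0) - x0 \<psi> = E (- \<phi>) (x t0 - E \<phi> (x0 \<psi>))" by (simp add: Y0 E_diff)
      then have n: "norm (Y 0 (\<phi> - \<alpha>0 * t0) - x0 \<psi>) < \<nu> / 2" using d by simp
      then have n1: "norm (Y 0 (\<phi> - \<alpha>0 * t0) - x0 \<psi>) \<le> 1" using \<nu> by linarith
      have "a * C \<le> \<nu> / 2"
      proof -
        have "a * C \<le> s0 * C" using pc C by (intro mult_right_mono) auto
        moreover have "0 \<le> C * s0" using C s0(1) by simp
        ultimately show ?thesis using s0C by (simp add: mult.commute mult.left_commute)
      qed
      moreover have "norm (a *\<^sub>R U (Y 0 (\<phi> - \<alpha>0 * t0), \<beta> * T 0, \<omega> * T 0 - (\<phi> - \<alpha>0 * t0))) \<le> a * C"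
        using Ub[OF n1] a0 by (simp add: mult_left_mono)
      moreover have "norm (H 0 (\<phi> - \<alpha>0 * t0) \<psi>) \<le> norm (Y 0 (\<phi> - \<alpha>0 * t0) - x0 \<psi>) + norm (a *\<^sub>R U (Y 0 (\<phi> - \<alpha>0 * t0), \<beta> * T 0, \<omega> * T 0 - (\<phi> - \<alpha>0 * t0)))"
        using norm_triangle_ineq4[of "Y 0 (\<phi> - \<alpha>0 * t0) - x0 \<psi>" "a *\<^sub>R U (Y 0 (\<phi> - \<alpha>0 * t0), \<beta> * T 0, \<omega> * T 0 - (\<phi> - \<alpha>0 * t0))"]
        by (simp add: H_def algebra_simps)
      ultimately have "norm (H 0 (\<phi> - \<alpha>0 * t0) \<psi>) \<le> \<nu>" using n by linarith
      then have "P 0 (\<phi> - \<alpha>0 * t0, \<psi>)" using n1 t0(1) by (simp add: P_def T_def)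
      then show ?thesis by blast
    qed
    have ind: "\<exists>z'. P (Suc k) z' \<and> R k z z'" if Pz: "P k z" for k z
    proof -
      obtain \<phi> \<psi> where z: "z = (\<phi>, \<psi>)" by (cases z)
      have Tk: "T k \<in> J" and Y1: "norm (Y k \<phi> - x0 \<psi>) \<le> 1" and h\<nu>: "norm (H k \<phi> \<psi>) \<le> \<nu>"
        using Pz by (simp_all add: P_def z)
      define y where "y = (\<lambda>s. E (- \<phi> - \<alpha>0 * (T k + s)) (x (T k + s)))"
      have y0: "y 0 = Y k \<phi>" by (simp add: y_def Y_def)
      have h: "H k \<phi> \<psi> = y 0 - (\<gamma> / \<omega>) *\<^sub>R U (y 0, \<beta> * T k, \<omega> * T k - \<phi>) - x0 \<psi>"
        by (simp add: H_def y0 a_def)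
      have ns: "near_solution \<gamma> \<omega> \<beta> (\<beta> * T k) (\<omega> * T k - \<phi>) \<psi> S y" if S: "S \<ge> 0" "T k + S \<in> J" for S
      proof -
        have "(y has_vector_derivative F (y s) + \<gamma> *\<^sub>R G (y s, \<beta> * T k + \<beta> * s, (\<omega> * T k - \<phi>) + \<omega> * s)) (at s within {0..S})"
          if s: "s \<in> {0..S}" for s
        proof -
          have "T k + s \<in> J" using Jint[OF Tk S(2)] s by simp
          from rotating_frame[OF sol[OF this] y_def, of "{0..S}"] show ?thesis by (simp add: \<omega>_def)
        qed
        then show ?thesis using S Y1 y0 by (simp add: near_solution_def)
      qed
      note st = step[rule_format, OF \<nu>(3) sp _ ns h h\<nu>]
      \<comment> \<open>\<open>one_step\<close> on the shorter windows on which the solution already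
        exists bounds it there, so it cannot end before T k + \<tau>.\<close>
      have "T k + \<tau> \<in> J"
      proof (rule maximal_solution_continues[OF max cf vector_field_lipschitz Tk, of _ "Bx + 1 / 2"])
        show "T k \<le> T k + \<tau>" using \<tau> by simp
        fix t assume t: "t \<in> J" "T k \<le> t" "t \<le> T k + \<tau>"
        have "norm (y (t - T k) - x0 (\<psi> + \<beta>0 * (t - T k))) \<le> 1 / 2"
          using st[of "t - T k"] t by auto
        moreover have "norm (y (t - T k)) = norm (x t)" by (simp add: y_def)
        ultimately show "norm (x t) \<le> Bx + 1 / 2"
          using Bx[of "\<psi> + \<beta>0 * (t - T k)"] norm_triangle_sub[of "y (t - T k)" "x0 (\<psi> + \<beta>0 * (t - T k))"] by linarith
      qed
      then have T\<tau>: "T (Suc k) \<in> J" and TJ: "T k + \<tau> \<in> J" by (simp_all add: T_def algebra_simps)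
      have TS: "T (Suc k) = T k + \<tau>" by (simp add: T_def algebra_simps)
      from st[OF order_refl less_imp_le[OF \<tau>] TJ] obtain \<xi> \<psi>' h' where
        bd: "\<forall>s\<in>{0..\<tau>}. norm (y s - x0 (\<psi> + \<beta>0 * s)) \<le> C * (norm (H k \<phi> \<psi>) + \<gamma>\<^sup>2 / \<omega> + \<gamma> / \<omega>)"
        and h': "h' = E (- \<xi>) (y \<tau> - (\<gamma> / \<omega>) *\<^sub>R U (y \<tau>, \<beta> * T k + \<beta> * \<tau>, \<omega> * T k - \<phi> + \<omega> * \<tau>)) - x0 \<psi>'"
        and n1: "norm (E (- \<xi>) (y \<tau>) - x0 \<psi>') \<le> 1"
        and nh: "norm h' \<le> 3 / 4 * norm (H k \<phi> \<psi>) + C * (\<gamma>\<^sup>2 / \<omega>)"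
        and ph: "\<bar>p1 \<psi>' \<bullet> h'\<bar> \<le> C * (norm (H k \<phi> \<psi>) + \<gamma>\<^sup>2 / \<omega>)\<^sup>2"
        and dr: "\<bar>\<psi>' - \<psi> - \<beta>0 * \<tau> - p1 \<psi> \<bullet> H k \<phi> \<psi> - \<gamma>\<^sup>2 / \<omega> * \<tau> * G2 (\<psi> - \<beta> * T k)\<bar>
           \<le> C * (\<nu> * (\<gamma>\<^sup>2 / \<omega>) + (norm (H k \<phi> \<psi>) + \<gamma>\<^sup>2 / \<omega>) * (norm (H k \<phi> \<psi>) + \<gamma>\<^sup>2 / \<omega> + \<nu>))"
        by auto
      have YS: "Y (Suc k) (\<phi> + \<xi>) = E (- \<xi>) (y \<tau>)"
        by (simp add: Y_def y_def TS flip: E_add) (simp add: algebra_simps)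
      \<comment> \<open>By \<open>U_E\<close> the correction a U rotates together with the state, so
        h' is the deviation for the new phases.\<close>
      have HS: "H (Suc k) (\<phi> + \<xi>) \<psi>' = h'"
      proof -
        have "U (E (- \<xi>) (y \<tau>), \<beta> * T (Suc k), \<omega> * T (Suc k) - (\<phi> + \<xi>)) = E (- \<xi>) (U (y \<tau>, \<beta> * T k + \<beta> * \<tau>, \<omega> * T k - \<phi> + \<omega> * \<tau>))"
          using U_E[of "- \<xi>" "y \<tau>" "\<beta> * T k + \<beta> * \<tau>" "\<omega> * T k - \<phi> + \<omega> * \<tau>"] by (simp add: TS algebra_simps)
        then show ?thesis by (simp add: H_def YS h' a_def E_diff linear_cmul[OF E_linear])
      qed
      have "norm h' \<le> \<nu>"
      proof -
        have "C * \<rho> \<le> C * s0" using pc C by (intro mult_left_mono) auto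
        then show ?thesis using nh h\<nu> s0C unfolding \<rho>_def by linarith
      qed
      then have "P (Suc k) (\<phi> + \<xi>, \<psi>')" using T\<tau> n1 by (simp add: P_def YS HS)
      moreover have "R k z (\<phi> + \<xi>, \<psi>')"
      proof -
        have "T k + s \<in> J" if "s \<in> {0..\<tau>}" for s using Jint[OF Tk TJ] that by simp
        then show ?thesis using bd nh ph dr by (simp add: R_def z HS \<rho>_def a_def y_def)
      qed
      ultimately show ?thesis by blast
    qed
    obtain S where S: "\<And>k. P k (S k)" "\<And>k. R k (S k) (S (Suc k))"
      using dependent_nat_choice[of P R] base ind by metis
    define \<phi> where "\<phi> = (\<lambda>k. fst (S k))"
    define \<psi> where "\<psi> = (\<lambda>k. snd (S k))"
    define n where "n = (\<lambda>k. norm (H k (\<phi> k) (\<psi> k)))"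
    have Rk: "n (Suc k) \<le> 3 / 4 * n k + C * \<rho>" "\<bar>p1 (\<psi> (Suc k)) \<bullet> H (Suc k) (\<phi> (Suc k)) (\<psi> (Suc k))\<bar> \<le> C * (n k + \<rho>)\<^sup>2"
      "\<bar>\<psi> (Suc k) - \<psi> k - \<beta>0 * \<tau> - p1 (\<psi> k) \<bullet> H k (\<phi> k) (\<psi> k) - \<rho> * \<tau> * G2 (\<psi> k - \<beta> * T k)\<bar>
        \<le> C * (\<nu> * \<rho> + (n k + \<rho>) * (n k + \<rho> + \<nu>))"
      "\<And>s. s \<in> {0..\<tau>} \<Longrightarrow> T k + s \<in> J \<and>
        norm (E (- \<phi> k - \<alpha>0 * (T k + s)) (x (T k + s)) - x0 (\<psi> k + \<beta>0 * s)) \<le> C * (n k + \<rho> + a)" for k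
      using S(2)[of k] by (simp_all add: R_def n_def \<phi>_def \<psi>_def split_beta)
    obtain K1 where K1: "\<And>k. k \<ge> K1 \<Longrightarrow> n k \<le> 5 * (C * \<rho>)"
      using contracting_recursion_eventually[of n "C * \<rho>", OF Rk(1)] C a0 by (auto simp: n_def)
    define \<sigma> where "\<sigma> = (\<lambda>k. \<psi> k - \<beta> * T k)"
    \<comment> \<open>The index starts at Suc K1: the p1 component at sample k was made quadratic by
      the step from k - 1, and this is of order \<rho> squared only if the deviation at k - 1 is
      already O(\<rho>).\<close>
    have drift: "\<bar>\<sigma> (Suc k) - \<sigma> k - (\<rho> * \<tau>) * (G2 (\<sigma> k) - \<kappa>')\<bar> \<le> (\<rho> * \<tau>) * \<eta>" if k: "k \<ge> Suc K1" for k
    proof -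
      obtain j where j: "k = Suc j" "j \<ge> K1" using k by (metis Suc_le_D Suc_le_mono)
      have nK: "n i + \<rho> \<le> K * \<rho>" "n i + \<rho> \<ge> 0" if "i \<ge> K1" for i
        using K1[OF that] a0 by (simp_all add: K_def algebra_simps n_def)
      have \<rho>\<nu>: "\<rho> \<le> \<nu>" using pc s0\<nu> by linarith
      have "(n j + \<rho>)\<^sup>2 \<le> (K * \<rho>)\<^sup>2" using nK[OF j(2)] by (intro power_mono)
      also have "\<dots> = K\<^sup>2 * (\<rho> * \<rho>)" by (simp add: power_mult_distrib power2_eq_square)
      also have "\<dots> \<le> K\<^sup>2 * (\<nu> * \<rho>)" using \<rho>\<nu> a0 by (intro mult_left_mono mult_right_mono) auto
      finally have "C * (n j + \<rho>)\<^sup>2 \<le> C * (K\<^sup>2 * (\<nu> * \<rho>))" using C by (intro mult_left_mono) auto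
      then have 1: "\<bar>p1 (\<psi> k) \<bullet> H k (\<phi> k) (\<psi> k)\<bar> \<le> C * K\<^sup>2 * (\<nu> * \<rho>)" using Rk(2)[of j] j by simp
      have "(n k + \<rho>) * (n k + \<rho> + \<nu>) \<le> (K * \<rho>) * (K * \<nu> + \<nu>)"
      proof (rule mult_mono)
        have "K * \<rho> \<le> K * \<nu>" using K0 \<rho>\<nu> by (intro mult_left_mono) auto
        then show "n k + \<rho> + \<nu> \<le> K * \<nu> + \<nu>" using nK[of k] k by simp
      qed (use nK[of k] k K0 a0 \<nu> in auto)
      also have "\<dots> = K * (K + 1) * (\<nu> * \<rho>)" by (simp add: algebra_simps)
      finally have "C * (\<nu> * \<rho> + (n k + \<rho>) * (n k + \<rho> + \<nu>)) \<le> C * (\<nu> * \<rho> + K * (K + 1) * (\<nu> * \<rho>))"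
        using C by (intro mult_left_mono) auto
      then have 2: "\<bar>\<psi> (Suc k) - \<psi> k - \<beta>0 * \<tau> - p1 (\<psi> k) \<bullet> H k (\<phi> k) (\<psi> k) - \<rho> * \<tau> * G2 (\<sigma> k)\<bar> \<le> C * (1 + K * (K + 1)) * (\<nu> * \<rho>)"
        using Rk(3)[of k] by (simp add: \<sigma>_def algebra_simps)
      have TS: "T (Suc k) = T k + \<tau>" by (simp add: T_def algebra_simps)
      have eq: "\<sigma> (Suc k) - \<sigma> k - (\<rho> * \<tau>) * (G2 (\<sigma> k) - \<kappa>')
        = (\<psi> (Suc k) - \<psi> k - \<beta>0 * \<tau> - p1 (\<psi> k) \<bullet> H k (\<phi> k) (\<psi> k) - \<rho> * \<tau> * G2 (\<sigma> k)) + p1 (\<psi> k) \<bullet> H k (\<phi> k) (\<psi> k)"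
      proof -
        have "\<rho> * \<tau> * \<kappa>' = (\<beta> - \<beta>0) * \<tau>" unfolding \<beta>\<rho> by simp
        moreover have "\<sigma> (Suc k) - \<sigma> k = \<psi> (Suc k) - \<psi> k - \<beta> * \<tau>" by (simp add: \<sigma>_def TS algebra_simps)
        ultimately show ?thesis by (simp add: algebra_simps)
      qed
      have "\<bar>\<sigma> (Suc k) - \<sigma> k - (\<rho> * \<tau>) * (G2 (\<sigma> k) - \<kappa>')\<bar> \<le> C * (1 + K * (K + 1)) * (\<nu> * \<rho>) + C * K\<^sup>2 * (\<nu> * \<rho>)"
        unfolding eq using 1 2 by linarith
      also have "\<dots> = (\<nu> * Q) * \<rho>" by (simp add: Q_def algebra_simps)
      also have "\<dots> \<le> (\<tau> * \<eta>) * \<rho>" using \<nu>Q a0 by (intro mult_right_mono) auto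
      finally show ?thesis by (simp add: mult.commute mult.left_commute)
    qed
    have "\<exists>c. \<exists>K::nat. \<forall>k\<ge>K. \<bar>\<sigma> (k + Suc K1) - c\<bar> \<le> \<epsilon>'"
    proof (rule conv[of \<kappa>' "\<rho> * \<tau>" "\<lambda>k. \<sigma> (k + Suc K1)"], intro conjI allI impI)
      show "\<exists>b. \<kappa>' + \<epsilon> / 2 \<le> G2 b" using \<kappa> \<kappa>'\<kappa> by (intro exI[of _ b]) linarith
      show "\<exists>b. G2 b \<le> \<kappa>' - \<epsilon> / 2" using \<kappa> \<kappa>'\<kappa> by (intro exI[of _ b']) linarith
      show "0 < \<rho> * \<tau>" using a0 \<tau> by simp
      have "\<rho> \<le> \<zeta> / \<tau>" using pc s0 by linarith
      then show "\<rho> * \<tau> \<le> \<zeta>" using \<tau> by (simp add: pos_le_divide_eq)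
      show "\<bar>\<sigma> (Suc k + Suc K1) - \<sigma> (k + Suc K1) - \<rho> * \<tau> * (G2 (\<sigma> (k + Suc K1)) - \<kappa>')\<bar> \<le> \<rho> * \<tau> * \<eta>" for k
        using drift[of "k + Suc K1"] by simp
    qed
    then obtain c K2 where K2: "\<And>k. k \<ge> K2 \<Longrightarrow> \<bar>\<sigma> (k + Suc K1) - c\<bar> \<le> \<epsilon>'" by metis
    define K3 where "K3 = K2 + Suc K1"
    have near: "t \<in> J \<and> (INF \<phi>. norm (x t - mat_exp (\<phi> *\<^sub>R A) *v x0 (\<beta> * t + c))) < \<epsilon>1" if t: "t > T K3" for t
    proof -
      define k where "k = nat \<lfloor>(t - t0) / \<tau>\<rfloor>"
      have tt: "(t - t0) / \<tau> \<ge> real K3" using t \<tau> by (simp add: T_def pos_le_divide_eq)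
      then have kK: "k \<ge> K3" by (simp add: k_def le_nat_floor)
      have kr: "real k = of_int \<lfloor>(t - t0) / \<tau>\<rfloor>" using tt by (simp add: k_def)
      define s where "s = t - T k"
      have s: "s \<in> {0..\<tau>}"
        using floor_divide_lower[OF \<tau>, of "t - t0"] floor_divide_upper[OF \<tau>, of "t - t0"]
        by (simp add: s_def T_def kr algebra_simps)
      have ts: "T k + s = t" by (simp add: s_def)
      have tJ: "t \<in> J" and d: "norm (E (- \<phi> k - \<alpha>0 * t) (x t) - x0 (\<psi> k + \<beta>0 * s)) \<le> C * (n k + \<rho> + a)"
        using Rk(4)[OF s, of k] unfolding ts by auto
      have "\<bar>\<sigma> k - c\<bar> \<le> \<epsilon>'" using K2[of "k - Suc K1"] kK by (simp add: K3_def)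
      have "n k + \<rho> + a \<le> (K + 1) * \<nu>"
      proof -
        have "n k + \<rho> \<le> K * \<rho>" using K1[of k] kK by (simp add: K_def K3_def algebra_simps)
        also have "\<dots> \<le> K * \<nu>" using pc s0\<nu> K0 by (intro mult_left_mono) auto
        finally show ?thesis using pc s0\<nu> by (simp add: distrib_right)
      qed
      then have "C * (n k + \<rho> + a) \<le> C * ((K + 1) * \<nu>)" using C by (intro mult_left_mono) auto
      then have d1: "norm (E (- \<phi> k - \<alpha>0 * t) (x t) - x0 (\<psi> k + \<beta>0 * s)) \<le> \<epsilon>1 / 4" using d \<nu>1 by (simp add: mult.assoc)
      have "norm (x0 (\<psi> k + \<beta>0 * s) - x0 (\<beta> * t + c)) \<le> Lx * \<bar>(\<psi> k + \<beta>0 * s) - (\<beta> * t + c)\<bar>" by (rule x0_lip)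
      \<comment> \<open>The phase error at time t splits into the uncertainty of the slow phase and
        the detuning accumulated since the last sample.\<close>
      also have "(\<psi> k + \<beta>0 * s) - (\<beta> * t + c) = (\<sigma> k - c) - (\<beta> - \<beta>0) * s"
        by (simp add: \<sigma>_def s_def algebra_simps)
      also have "Lx * \<bar>(\<sigma> k - c) - (\<beta> - \<beta>0) * s\<bar> \<le> Lx * (\<epsilon>' + B * \<nu> * \<tau>)"
      proof (rule mult_left_mono[OF _ Lx0])
        have "B * \<rho> \<le> B * \<nu>" using pc s0\<nu> B0 by (intro mult_left_mono) auto
        then have "\<bar>\<beta> - \<beta>0\<bar> * s \<le> (B * \<nu>) * \<tau>" using \<beta>B s B0 \<nu> by (intro mult_mono) auto
        then have "\<bar>(\<beta> - \<beta>0) * s\<bar> \<le> B * \<nu> * \<tau>" using s by (simp add: abs_mult)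
        then show "\<bar>(\<sigma> k - c) - (\<beta> - \<beta>0) * s\<bar> \<le> \<epsilon>' + B * \<nu> * \<tau>" using \<open>\<bar>\<sigma> k - c\<bar> \<le> \<epsilon>'\<close> by linarith
      qed
      also have "\<dots> \<le> \<epsilon>1 / 4 + \<epsilon>1 / 4" using \<epsilon>'(2) \<nu>2 by (simp add: distrib_left)
      finally have d2: "norm (x0 (\<psi> k + \<beta>0 * s) - x0 (\<beta> * t + c)) \<le> \<epsilon>1 / 4 + \<epsilon>1 / 4" .
      let ?\<xi> = "\<phi> k + \<alpha>0 * t"
      have "x t - E ?\<xi> (x0 (\<beta> * t + c)) = E ?\<xi> (E (- ?\<xi>) (x t) - x0 (\<beta> * t + c))" by (simp only: E_diff E_inverse)
      then have "norm (x t - E ?\<xi> (x0 (\<beta> * t + c))) = norm (E (- \<phi> k - \<alpha>0 * t) (x t) - x0 (\<beta> * t + c))" by simp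
      also have "\<dots> < \<epsilon>1"
        using d1 d2 \<epsilon>1 norm_triangle_ineq[of "E (- \<phi> k - \<alpha>0 * t) (x t) - x0 (\<psi> k + \<beta>0 * s)" "x0 (\<psi> k + \<beta>0 * s) - x0 (\<beta> * t + c)"]
        by simp
      finally have "norm (x t - mat_exp (?\<xi> *\<^sub>R A) *v x0 (\<beta> * t + c)) < \<epsilon>1" by (simp add: E_def)
      moreover have "(INF \<phi>. norm (x t - mat_exp (\<phi> *\<^sub>R A) *v x0 (\<beta> * t + c))) \<le> norm (x t - mat_exp (?\<xi> *\<^sub>R A) *v x0 (\<beta> * t + c))"
        by (rule cINF_lower) (auto intro: bdd_belowI[of _ 0])
      ultimately show ?thesis using tJ by linarith
    qed
    then show ?thesis by blast
  qed
  show ?thesis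
  proof (rule exI[of _ \<alpha>1], rule conjI[OF \<alpha>1(1)], rule exI[of _ c1], rule conjI[OF c12(1)], rule exI[of _ c2], rule conjI[OF c12(2)],
      rule exI[of _ "\<nu> / 2"], rule conjI)
    show "\<nu> / 2 > 0" using \<nu> by simp
  qed (unfold SI, intro allI impI, elim conjE bexE, rule main, assumption+)
qed

end

theorem theorem2p4:
  fixes f :: "real^'n \<Rightarrow> real^'n"
    and g u\<^sub>1 :: "real^'n \<Rightarrow> real \<Rightarrow> real \<Rightarrow> real^'n"
    and g\<^sub>2 :: "real^'n \<Rightarrow> real \<Rightarrow> real^'n"
    and G\<^sub>2 :: "real \<Rightarrow> real"
    and A :: "real^'n^'n"
    and x\<^sub>0 q\<^sub>1 q\<^sub>2 p\<^sub>1 p\<^sub>2 :: "real \<Rightarrow> real^'n"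
    and \<alpha>\<^sub>0 \<beta>\<^sub>0 :: real
    and l :: nat
    and \<T>\<^sub>2 :: "(real^'n) set"
  defines "q\<^sub>1 \<equiv> \<lambda>\<psi>. vector_derivative x\<^sub>0 (at \<psi>)"
    and "q\<^sub>2 \<equiv> \<lambda>\<psi>. A *v x\<^sub>0 \<psi>"
    and "\<T>\<^sub>2 \<equiv> torus_of A x\<^sub>0"
    and "g\<^sub>2 \<equiv> g2_of u\<^sub>1 g"
    and "G\<^sub>2 \<equiv> G2_of p\<^sub>1 x\<^sub>0 g\<^sub>2"
  assumes l: "l > 3"
    and f_smooth: "C_k l f"
    and g_smooth: "C_k l (\<lambda>(x, \<psi>, \<phi>). g x \<psi> \<phi>)"
    and A_nonzero: "A \<noteq> 0"
    and A_skew: "transpose A = - A"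
    and A_period: "mat_exp ((2 * pi) *\<^sub>R A) = mat 1"
    and f_equivariant: "\<And>x \<xi>. f (mat_exp (\<xi> *\<^sub>R A) *v x) = mat_exp (\<xi> *\<^sub>R A) *v f x"
    and g_periodic: "\<And>x \<psi> \<phi>. g x (\<psi> + 2 * pi) \<phi> = g x \<psi> \<phi>"
                    "\<And>x \<psi> \<phi>. g x \<psi> (\<phi> + 2 * pi) = g x \<psi> \<phi>"
    and g_equivariant:
      "\<And>x \<psi> \<phi> \<xi>. g (mat_exp (\<xi> *\<^sub>R A) *v x) \<psi> (\<phi> + \<xi>) = mat_exp (\<xi> *\<^sub>R A) *v g x \<psi> \<phi>"
    and frequencies: "\<alpha>\<^sub>0 > 0" "\<beta>\<^sub>0 > 0"
    and x0_periodic: "\<And>\<psi>. x\<^sub>0 (\<psi> + 2 * pi) = x\<^sub>0 \<psi>"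
    and unperturbed_solution:
      "solves_ode_on (\<lambda>t. f) UNIV (\<lambda>t. mat_exp ((\<alpha>\<^sub>0 * t) *\<^sub>R A) *v x\<^sub>0 (\<beta>\<^sub>0 * t))"
    and q_independent: "\<And>\<psi> a b. a *\<^sub>R q\<^sub>1 \<psi> + b *\<^sub>R q\<^sub>2 \<psi> = 0 \<Longrightarrow> a = 0 \<and> b = 0"
    and torus: "\<T>\<^sub>2 homeomorphic (sphere (0::complex) 1 \<times> sphere (0::complex) 1)"
    and torus_invariant:
      "\<And>y. solves_ode_on (\<lambda>t. f) UNIV y \<Longrightarrow> y 0 \<in> \<T>\<^sub>2 \<Longrightarrow> (\<forall>t. y t \<in> \<T>\<^sub>2)"
    and exp_orbitally_stable:
      "multiplier_one_double_others_stable
         (\<lambda>\<psi>. (1 / \<beta>\<^sub>0) *\<^sub>R (jacobian f (at (x\<^sub>0 \<psi>)) - \<alpha>\<^sub>0 *\<^sub>R A)) (2 * pi)"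
    and p_adjoint:
      "\<And>p. p \<in> {p\<^sub>1, p\<^sub>2} \<Longrightarrow>
         solves_ode_on
           (\<lambda>\<psi> z. (1 / \<beta>\<^sub>0) *\<^sub>R (- ((transpose (jacobian f (at (x\<^sub>0 \<psi>))) + \<alpha>\<^sub>0 *\<^sub>R A) *v z))) UNIV p"
    and p_periodic: "\<And>p \<psi>. p \<in> {p\<^sub>1, p\<^sub>2} \<Longrightarrow> p (\<psi> + 2 * pi) = p \<psi>"
    and p_q_dual:
      "\<And>\<psi>. p\<^sub>1 \<psi> \<bullet> q\<^sub>1 \<psi> = 1" "\<And>\<psi>. p\<^sub>1 \<psi> \<bullet> q\<^sub>2 \<psi> = 0"
      "\<And>\<psi>. p\<^sub>2 \<psi> \<bullet> q\<^sub>1 \<psi> = 0" "\<And>\<psi>. p\<^sub>2 \<psi> \<bullet> q\<^sub>2 \<psi> = 1"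
    and u1_antiderivative:
      "\<And>x \<psi> \<phi>. ((\<lambda>s. u\<^sub>1 x \<psi> s) has_vector_derivative g x \<psi> \<phi>) (at \<phi>)"
    and u1_mean: "\<And>x \<psi>. integral {0..2 * pi} (\<lambda>\<phi>. u\<^sub>1 x \<psi> \<phi>) = 0"
    and g_mean: "\<And>x \<psi>. (1 / (2 * pi)) *\<^sub>R integral {0..2 * pi} (\<lambda>\<phi>. g x \<psi> \<phi>) = 0"
    and nondegenerate: "\<And>\<psi>. deriv G\<^sub>2 \<psi> = 0 \<Longrightarrow> deriv (deriv G\<^sub>2) \<psi> \<noteq> 0"
  shows "\<forall>\<epsilon>>0. \<forall>\<epsilon>\<^sub>1>0. \<exists>\<alpha>\<^sub>1>0. \<exists>c\<^sub>1>0. \<exists>c\<^sub>2>0. \<exists>\<delta>>0.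
    \<forall>\<alpha> \<beta> \<gamma>. \<alpha> > 0 \<and> \<beta> > 0 \<and> \<gamma> \<ge> 0 \<and>
      \<alpha> \<ge> \<alpha>\<^sub>1 \<and> c\<^sub>1 / \<alpha> \<le> \<gamma> \<and> \<gamma> \<le> c\<^sub>2 * sqrt \<alpha> \<and>
      \<gamma>\<^sup>2 / \<alpha> * (INF \<psi>\<in>{0..2 * pi}. G\<^sub>2 \<psi>) < \<beta> - \<beta>\<^sub>0 \<and>
      \<beta> - \<beta>\<^sub>0 < \<gamma>\<^sup>2 / \<alpha> * (SUP \<psi>\<in>{0..2 * pi}. G\<^sub>2 \<psi>) \<and>
      infdist (\<alpha> / \<gamma>\<^sup>2 * (\<beta> - \<beta>\<^sub>0)) (singular_values G\<^sub>2) \<ge> \<epsilon> \<longrightarrow>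
      (\<forall>J x. maximal_solution (\<lambda>t y. f y + \<gamma> *\<^sub>R g y (\<beta> * t) (\<alpha> * t)) J x \<and>
             (\<exists>t\<^sub>0\<in>J. infdist (x t\<^sub>0) \<T>\<^sub>2 < \<delta>) \<longrightarrow>
        (\<exists>\<sigma> T. \<forall>t>T. t \<in> J \<and>
           (INF \<phi>. norm (x t - mat_exp (\<phi> *\<^sub>R A) *v x\<^sub>0 (\<beta> * t + \<sigma>))) < \<epsilon>\<^sub>1))"
proof -
  interpret perturbed_torus f g u\<^sub>1 A x\<^sub>0 p\<^sub>1 p\<^sub>2 \<alpha>\<^sub>0 \<beta>\<^sub>0
  proof (rule perturbed_torus.intro)
    have "2 \<le> l" using l by simp
    then show "C_k 2 f" "C_k 2 (\<lambda>(x, \<psi>, \<phi>). g x \<psi> \<phi>)"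
      using f_smooth g_smooth C_k_antimono by blast+
  qed (rule A_skew f_equivariant g_periodic g_equivariant frequencies x0_periodic unperturbed_solution exp_orbitally_stable
      p_adjoint p_periodic p_q_dual[unfolded q\<^sub>1_def q\<^sub>2_def] u1_antiderivative u1_mean g_mean; assumption?)+
  have G: "G\<^sub>2 = G2" unfolding G\<^sub>2_def g\<^sub>2_def G2_def ..
  show ?thesis unfolding \<T>\<^sub>2_def G
    by (intro allI impI) (rule attracted_to_torus_orbit[OF frequencies(1) nondegenerate[unfolded G]])
qed

end
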